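(* Let $q\in\mathbb{C}\setminus\{0\}$ be not a root of unity and let $\mathfrak g/\mathfrak p_S$ be irreducible. Then $(\underline C^S_{\ast,\ast},\underline h_{\ast,\ast},\underline{\overline h}_{\ast,\ast})$, as defined in the context, is a double complex, i.e. for any $n,m\in\mathbb N$ the relation $$\underline{\overline h}_{n-1,m}\circ\underline h_{n,m}+\underline h_{n,m-1}\circ\underline{\overline h}_{n,m}=0$$ holds.
   Context: $\mathbb N$ denotes the positive integers. $\mathfrak g$ is a finite-dimensional complex simple Lie algebra of rank $r$ with Cartan subalgebra $\mathfrak h$, root system $R$, simple roots $\pi=\{\alpha_1,\dots,\alpha_r\}$, positive/negative roots $R^\pm$, weight lattice $P$, Weyl group $W$ with length function $l$, half sum of positive roots $\rho$. $(\cdot,\cdot)$ is the form on $\mathfrak h^*$ induced by the Killing form, rescaled by a positive factor so that $(P,P)\subset\mathbb Z$; $\alpha_i^\vee=2\alpha_i/(\alpha_i,\alpha_i)$. For $S\subset\pi$: $R_S^\pm=\mathbb ZS\cap R^\pm$, $\mathfrak p_S=\mathfrak h\oplus\bigoplus_{\alpha\in R^+\cup R_S^-}\mathfrak g_\alpha$, $W^S=\{w\in W\mid R_S^+\subset wR^+\}$. $w.\mu=w(\mu+\rho)-\rho$. $w\to w'$ means $l(w)=l(w')+1$ and $w=s_\alpha w'$ for some $\alpha\in R^+$. $\mathfrak g/\mathfrak p_S$ is irreducible if the adjoint representation of $\mathfrak p_S$ on it is irreducible; equivalently $S=\pi\setminus\{\alpha_s\}$ where $\alpha_s$ occurs in every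 positive root with coefficient at most one. $U_q(\mathfrak g)$ is generated by $K_i^{\pm1},E_i,F_i$ ($1\le i\le r$), the $K_i$ commuting, with $K_iE_j=q^{(\alpha_i,\alpha_j)}E_jK_i$, $K_iF_j=q^{-(\alpha_i,\alpha_j)}F_jK_i$, $E_iF_j-F_jE_i=\delta_{ij}(K_i-K_i^{-1})/(q_i-q_i^{-1})$, $q_i=q^{(\alpha_i,\alpha_i)/2}$, and the quantum Serre relations. Coproduct: $\Delta K_i=K_i\otimes K_i$, $\Delta E_i=E_i\otimes K_i+1\otimes E_i$, $\Delta F_i=F_i\otimes1+K_i^{-1}\otimes F_i$; antipode $\kappa$. $\eta$ is the algebra automorphism with $\eta(E_i)=F_i$, $\eta(F_i)=E_i$, $\eta(K_i)=K_i^{-1}$. $U_q(\mathfrak n^-)$ is the subalgebra generated by all $F_i$; $U_q(\mathfrak l_S)$ is generated by $E_i,F_i$ ($\alpha_i\in S$) and all $K_j^{\pm1}$. For $\lambda\in P$ with $(\lambda,\alpha_i^\vee)$ a nonnegative integer for all $\alpha_i\in S$, $M(\lambda)$ is the finite-dimensional simple $U_q(\mathfrak l_S)$-module with highest weight vector $v_\lambda$, $K_jv_\lambda=q^{(\lambda,\alpha_j)}v_\lambda$; $M(\lambda)^*$ is its dual, $(uf)(v)=f(\kappa(u)v)$, with lowest weight vector $\xi_{-\lambda}$. Let $V^\lambda$ be the Verma module of $U_q(\mathfrak g)$ with highest weight vector $v_\lambda$. Fix embeddings $V^{w.0}\subset V^0$ for all $w\in W$; for $w\to w'$ they give an embedding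 $V^{w.0}\subset V^{w'.0}$ and a unique $y^0_{w,w'}\in U_q(\mathfrak n^-)$ such that it maps $v_{w.0}\mapsto y^0_{w,w'}v_{w'.0}$. Fix numbers $s(w,w')=\pm1$ for all $w\to w'$ in $W$ such that for all $w_1\to w_2\to w_4$, $w_1\to w_3\to w_4$ with $w_2\ne w_3$ the product $s(w_1,w_2)s(w_2,w_4)s(w_1,w_3)s(w_3,w_4)$ is $-1$. Put $y_{w,w'}=s(w,w')y^0_{w,w'}$ and $x_{w,w'}=\eta(y_{w,w'})$. $W(\mu,\nu)=U_q(\mathfrak g)\otimes_{U_q(\mathfrak l_S)}(M(\mu)\otimes M(\nu)^* )$ is generated by $1\otimes(v_\mu\otimes\xi_{-\nu})$. Set $\underline C^S_{n,m}=\bigoplus_{w_1,w_2\in W^S,\,l(w_1)=n,\,l(w_2)=m}W(w_1.0,w_2.0)$. For $w_1,w_1',w_2,w_2'\in W^S$ there are well defined $U_q(\mathfrak g)$-module maps: if $w_1\to w_1'$, $\underline h_{w_1,w_1';w_2}:W(w_1.0,w_2.0)\to W(w_1'.0,w_2.0)$, $u\otimes(v_{w_1.0}\otimes\xi_{-w_2.0})\mapsto uy_{w_1,w_1'}\otimes(v_{w_1'.0}\otimes\xi_{-w_2.0})$; if $w_2\to w_2'$, $\underline h_{w_1;w_2,w_2'}:W(w_1.0,w_2.0)\to W(w_1.0,w_2'.0)$, $u\otimes(v_{w_1.0}\otimes\xi_{-w_2.0})\mapsto ux_{w_2,w_2'}\otimes(v_{w_1.0}\otimes\xi_{-w_2'.0})$.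 $\underline h_{n,m}:\underline C^S_{n,m}\to\underline C^S_{n-1,m}$ is the sum of all $\underline h_{w_1,w_1';w_2}$ with $w_1\to w_1'$, $l(w_1)=n$, $l(w_2)=m$; $\underline{\overline h}_{n,m}:\underline C^S_{n,m}\to\underline C^S_{n,m-1}$ is $(-1)^n$ times the sum of all $\underline h_{w_1;w_2,w_2'}$ with $w_2\to w_2'$, $l(w_1)=n$, $l(w_2)=m$. It is already known that $\underline h_{n,m}\underline h_{n+1,m}=0$ and $\underline{\overline h}_{n,m}\underline{\overline h}_{n,m+1}=0$. *)

theory Defs
  imports Complex_Main "HOL-Library.Poly_Mapping" "HOL-Library.Product_Plus"
    "HOL-Algebra.Module" "HOL-Algebra.Bij" "HOL-Algebra.QuotRing" "HOL-Algebra.Generated_Rings"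
    "HOL-Algebra.Free_Abelian_Groups"
begin

section \<open>Simple Lie algebras and their root data\<close>

text \<open>The Lie algebra is the whole type \<open>'g\<close> with scalar multiplication \<^emph>\<open>sc\<close> and bracket
  \<^emph>\<open>br\<close>.\<close>

definition lie_algebra :: "(complex \<Rightarrow> 'g::ab_group_add \<Rightarrow> 'g) \<Rightarrow> ('g \<Rightarrow> 'g \<Rightarrow> 'g) \<Rightarrow> bool" where
  "lie_algebra sc br \<longleftrightarrow> vector_space sc \<and>
     (\<forall>x y z. br (x + y) z = br x z + br y z \<and> br x (y + z) = br x y + br x z) \<and>
     (\<forall>c x y. br (sc c x) y = sc c (br x y) \<and> br x (sc c y) = sc c (br x y)) \<and>
     (\<forall>x. br x x = 0) \<and>
     (\<forall>x y z. br x (br y z) + br y (br z x) + br z (br x y) = 0)"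

definition simple_lie_algebra ::
  "(complex \<Rightarrow> 'g::ab_group_add \<Rightarrow> 'g) \<Rightarrow> ('g \<Rightarrow> 'g \<Rightarrow> 'g) \<Rightarrow> bool" where
  "simple_lie_algebra sc br \<longleftrightarrow> lie_algebra sc br \<and>
     (\<exists>B. finite B \<and> module.span sc B = UNIV) \<and>
     (\<exists>x y. br x y \<noteq> 0) \<and>
     (\<forall>N. module.subspace sc N \<and> (\<forall>x. \<forall>y\<in>N. br x y \<in> N) \<longrightarrow> N = {0} \<or> N = UNIV)"

definition lin_trace :: "(complex \<Rightarrow> 'g::ab_group_add \<Rightarrow> 'g) \<Rightarrow> ('g \<Rightarrow> 'g) \<Rightarrow> complex" where
  "lin_trace sc f = (let B = vector_space.extend_basis sc {}
     in \<Sum>b\<in>B. module.representation sc B (f b) b)"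

definition killing ::
  "(complex \<Rightarrow> 'g::ab_group_add \<Rightarrow> 'g) \<Rightarrow> ('g \<Rightarrow> 'g \<Rightarrow> 'g) \<Rightarrow> 'g \<Rightarrow> 'g \<Rightarrow> complex" where
  "killing sc br x y = lin_trace sc (\<lambda>z. br x (br y z))"

definition cartan_subalgebra ::
  "(complex \<Rightarrow> 'g::ab_group_add \<Rightarrow> 'g) \<Rightarrow> ('g \<Rightarrow> 'g \<Rightarrow> 'g) \<Rightarrow> 'g set \<Rightarrow> bool" where
  \<comment> \<open>the usual definition for complex semisimple Lie algebras: abelian, self-centralizing and
    acting diagonalizably\<close>
  "cartan_subalgebra sc br H \<longleftrightarrow> module.subspace sc H \<and>
     (\<forall>x\<in>H. \<forall>y\<in>H. br x y = 0) \<and>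
     (\<forall>x. (\<forall>y\<in>H. br y x = 0) \<longrightarrow> x \<in> H) \<and>
     (\<forall>y\<in>H. module.span sc {x. \<exists>c. br y x = sc c x} = UNIV)"

text \<open>The field \<^emph>\<open>frm\<close> is the normalized form on the dual of the Cartan subalgebra. The simple roots
  are indexed by the finite type \<open>'i\<close>, so the rank is \<open>CARD('i)\<close>, and the subset \<open>S\<close> of the simple
  roots is given by the index set \<^emph>\<open>sub\<close>.\<close>

type_synonym 'g wt = "'g \<Rightarrow> complex"

record ('g, 'i) qflag =
  sc :: "complex \<Rightarrow> 'g \<Rightarrow> 'g"
  br :: "'g \<Rightarrow> 'g \<Rightarrow> 'g"
  csa :: "'g set"
  simp_root :: "'i \<Rightarrow> 'g wt"
  frm :: "'g wt \<Rightarrow> 'g wt \<Rightarrow> complex"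
  sub :: "'i set"
  qpar :: complex

definition hstar :: "('g::ab_group_add, 'i) qflag \<Rightarrow> 'g wt set" where
  \<comment> \<open>a functional on \<open>\<hh>\<close> is represented by its extension by zero to all of \<open>'g\<close>\<close>
  "hstar D = {\<mu>. (\<forall>x\<in>csa D. \<forall>y\<in>csa D. \<mu> (x + y) = \<mu> x + \<mu> y) \<and>
     (\<forall>c. \<forall>x\<in>csa D. \<mu> (sc D c x) = c * \<mu> x) \<and> (\<forall>x. x \<notin> csa D \<longrightarrow> \<mu> x = 0)}"

definition root_space :: "('g::ab_group_add, 'i) qflag \<Rightarrow> 'g wt \<Rightarrow> 'g set" where
  "root_space D \<beta> = {x. \<forall>y\<in>csa D. br D y x = sc D (\<beta> y) x}"

definition roots :: "('g::ab_group_add, 'i) qflag \<Rightarrow> 'g wt set" where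
  "roots D = {\<beta> \<in> hstar D. \<beta> \<noteq> (\<lambda>_. 0) \<and> root_space D \<beta> \<noteq> {0}}"

definition root_comb :: "('g::ab_group_add, 'i::finite) qflag \<Rightarrow> ('i \<Rightarrow> complex) \<Rightarrow> 'g wt" where
  "root_comb D c = (\<lambda>x. \<Sum>i\<in>UNIV. c i * simp_root D i x)"

definition pos_roots :: "('g::ab_group_add, 'i::finite) qflag \<Rightarrow> 'g wt set" where
  "pos_roots D = {\<beta> \<in> roots D. \<exists>c::'i \<Rightarrow> nat. \<beta> = root_comb D (\<lambda>i. of_nat (c i))}"

definition neg_roots :: "('g::ab_group_add, 'i::finite) qflag \<Rightarrow> 'g wt set" where
  "neg_roots D = {\<beta> \<in> roots D. \<exists>c::'i \<Rightarrow> nat. \<beta> = root_comb D (\<lambda>i. - of_nat (c i))}"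

definition simple_roots :: "('g::ab_group_add, 'i::finite) qflag \<Rightarrow> bool" where
  "simple_roots D \<longleftrightarrow> range (simp_root D) \<subseteq> roots D \<and>
     (\<forall>\<mu>\<in>hstar D. \<exists>!c. \<mu> = root_comb D c) \<and> roots D = pos_roots D \<union> neg_roots D"

definition sub_lattice :: "('g::ab_group_add, 'i::finite) qflag \<Rightarrow> 'g wt set" where
  "sub_lattice D = {root_comb D (\<lambda>i. of_int (c i)) | c. \<forall>i. i \<notin> sub D \<longrightarrow> c i = 0}"

definition coroot_pairing :: "('g, 'i) qflag \<Rightarrow> 'g wt \<Rightarrow> 'g wt \<Rightarrow> complex" where
  "coroot_pairing D \<mu> \<beta> = 2 * frm D \<mu> \<beta> / frm D \<beta> \<beta>"

definition weight_lattice :: "('g::ab_group_add, 'i::finite) qflag \<Rightarrow> 'g wt set" where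
  "weight_lattice D = {\<mu> \<in> hstar D. \<forall>i. coroot_pairing D \<mu> (simp_root D i) \<in> \<int>}"

definition dominant_wrt_sub :: "('g::ab_group_add, 'i::finite) qflag \<Rightarrow> 'g wt set" where
  "dominant_wrt_sub D =
     {\<mu> \<in> weight_lattice D. \<forall>i\<in>sub D. coroot_pairing D \<mu> (simp_root D i) \<in> \<nat>}"

definition normalized_form :: "('g::ab_group_add, 'i::finite) qflag \<Rightarrow> bool" where
  \<comment> \<open>\<open>t \<mu>\<close> is the element of \<open>\<hh>\<close> corresponding to \<open>\<mu>\<close> under the Killing form\<close>
  "normalized_form D \<longleftrightarrow>
     (\<exists>(k::real) t. k > 0 \<and>
        (\<forall>\<mu>\<in>hstar D. t \<mu> \<in> csa D \<and> (\<forall>x\<in>csa D. killing (sc D) (br D) (t \<mu>) x = \<mu> x)) \<and>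
        (\<forall>\<mu>\<in>hstar D. \<forall>\<nu>\<in>hstar D.
           frm D \<mu> \<nu> = complex_of_real k * killing (sc D) (br D) (t \<mu>) (t \<nu>))) \<and>
     (\<forall>\<mu>\<in>weight_lattice D. \<forall>\<nu>\<in>weight_lattice D. frm D \<mu> \<nu> \<in> \<int>)"

definition parabolic :: "('g::ab_group_add, 'i::finite) qflag \<Rightarrow> 'g set" where
  "parabolic D = module.span (sc D)
     (csa D \<union> (\<Union>\<beta> \<in> pos_roots D \<union> (sub_lattice D \<inter> neg_roots D). root_space D \<beta>))"

definition irreducible_flag :: "('g::ab_group_add, 'i::finite) qflag \<Rightarrow> bool" where
  \<comment> \<open>the adjoint representation of \<open>\<pp>\<^sub>S\<close> on \<open>\<gg>/\<pp>\<^sub>S\<close> is irreducible; elements of the quotient are the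
    cosets \<open>\<kappa> x\<close>, \<open>N\<close> ranges over the subrepresentations\<close>
  "irreducible_flag D \<longleftrightarrow> (let P = parabolic D; \<kappa> = (\<lambda>x. (+) x ` P) in
     range \<kappa> \<noteq> {\<kappa> 0} \<and>
     (\<forall>N. N \<subseteq> range \<kappa> \<and> \<kappa> 0 \<in> N \<and>
        (\<forall>x y. \<kappa> x \<in> N \<and> \<kappa> y \<in> N \<longrightarrow> \<kappa> (x + y) \<in> N) \<and>
        (\<forall>c x. \<kappa> x \<in> N \<longrightarrow> \<kappa> (sc D c x) \<in> N) \<and>
        (\<forall>p\<in>P. \<forall>x. \<kappa> x \<in> N \<longrightarrow> \<kappa> (br D p x) \<in> N)
      \<longrightarrow> N = {\<kappa> 0} \<or> N = range \<kappa>))"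


section \<open>The Weyl group\<close>

type_synonym 'g wgt = "'g wt \<Rightarrow> 'g wt"

definition reflection :: "('g::ab_group_add, 'i) qflag \<Rightarrow> 'g wt \<Rightarrow> 'g wgt" where
  "reflection D \<beta> = (\<lambda>\<mu>\<in>hstar D. (\<lambda>x. \<mu> x - coroot_pairing D \<mu> \<beta> * \<beta> x))"

definition weyl :: "('g::ab_group_add, 'i) qflag \<Rightarrow> 'g wgt set" where
  "weyl D = generate (BijGroup (hstar D)) (reflection D ` roots D)"

definition weyl_length :: "('g::ab_group_add, 'i) qflag \<Rightarrow> 'g wgt \<Rightarrow> nat" where
  "weyl_length D w = (LEAST n. \<exists>is. length is = n \<and>
     w = foldr (\<lambda>i u. reflection D (simp_root D i) \<otimes>\<^bsub>BijGroup (hstar D)\<^esub> u) is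
           \<one>\<^bsub>BijGroup (hstar D)\<^esub>)"

definition half_sum :: "('g::ab_group_add, 'i::finite) qflag \<Rightarrow> 'g wt" where
  "half_sum D = (\<lambda>x. (\<Sum>\<beta>\<in>pos_roots D. \<beta> x) / 2)"

definition dot :: "('g::ab_group_add, 'i::finite) qflag \<Rightarrow> 'g wgt \<Rightarrow> 'g wt \<Rightarrow> 'g wt" where
  "dot D w \<mu> = (\<lambda>x. w (\<lambda>z. \<mu> z + half_sum D z) x - half_sum D x)"

abbreviation dot0 :: "('g::ab_group_add, 'i::finite) qflag \<Rightarrow> 'g wgt \<Rightarrow> 'g wt" where
  "dot0 D w \<equiv> dot D w (\<lambda>_. 0)"

definition min_reps :: "('g::ab_group_add, 'i::finite) qflag \<Rightarrow> 'g wgt set" where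
  "min_reps D = {w \<in> weyl D. sub_lattice D \<inter> pos_roots D \<subseteq> w ` pos_roots D}"

definition arrow :: "('g::ab_group_add, 'i::finite) qflag \<Rightarrow> 'g wgt \<Rightarrow> 'g wgt \<Rightarrow> bool" where
  "arrow D w w' \<longleftrightarrow> w \<in> weyl D \<and> w' \<in> weyl D \<and> weyl_length D w = weyl_length D w' + 1 \<and>
     (\<exists>\<beta>\<in>pos_roots D. w = reflection D \<beta> \<otimes>\<^bsub>BijGroup (hstar D)\<^esub> w')"


section \<open>The quantized enveloping algebra\<close>

datatype 'a word = Word (letters: "'a list")

instantiation word :: (type) monoid_add
begin

definition zero_word :: "'a word" where "zero_word = Word []"

definition plus_word :: "'a word \<Rightarrow> 'a word \<Rightarrow> 'a word" where
  "plus_word u v = Word (letters u @ letters v)"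

instance
  by standard (simp_all add: zero_word_def plus_word_def)

end

text \<open>Words form the free monoid, written additively, so that \<open>'a word \<Rightarrow>\<^sub>0 complex\<close> with its
  convolution product is the free associative unital algebra on \<open>'a\<close>, and
  \<open>'a word \<times> 'a word \<Rightarrow>\<^sub>0 complex\<close> is its tensor square.\<close>

datatype 'i qgen = QK 'i | QKi 'i | QE 'i | QF 'i

type_synonym 'i falg = "'i qgen word \<Rightarrow>\<^sub>0 complex"

type_synonym 'i uq = "'i falg set"

definition const :: "complex \<Rightarrow> ('m::monoid_add \<Rightarrow>\<^sub>0 complex)" where
  "const c = Poly_Mapping.single 0 c"

definition gen :: "'i qgen \<Rightarrow> 'i falg" where
  "gen a = Poly_Mapping.single (Word [a]) 1"

definition qpow :: "('g, 'i) qflag \<Rightarrow> complex \<Rightarrow> complex" where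
  \<comment> \<open>only used with integer exponents \<open>z\<close>\<close>
  "qpow D z = qpar D powi \<lfloor>Re z\<rfloor>"

definition qi :: "('g, 'i) qflag \<Rightarrow> 'i \<Rightarrow> complex" where
  \<comment> \<open>\<open>(\<alpha>\<^sub>i,\<alpha>\<^sub>i)/2 = (\<omega>\<^sub>i,\<alpha>\<^sub>i)\<close> is an integer because \<open>(P,P) \<subseteq> \<int>\<close>\<close>
  "qi D i = qpow D (frm D (simp_root D i) (simp_root D i) / 2)"

definition qint :: "complex \<Rightarrow> nat \<Rightarrow> complex" where
  "qint t n = (t ^ n - inverse t ^ n) / (t - inverse t)"

definition qbinom :: "complex \<Rightarrow> nat \<Rightarrow> nat \<Rightarrow> complex" where
  "qbinom t n k =
     (\<Prod>j=1..n. qint t j) / ((\<Prod>j=1..k. qint t j) * (\<Prod>j=1..n - k. qint t j))"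

definition serre :: "('g, 'i) qflag \<Rightarrow> ('i \<Rightarrow> 'i qgen) \<Rightarrow> 'i \<Rightarrow> 'i \<Rightarrow> 'i falg" where
  \<comment> \<open>\<open>n = 1 - a\<^sub>i\<^sub>j\<close> with the Cartan integer \<open>a\<^sub>i\<^sub>j = (\<alpha>\<^sub>j,\<alpha>\<^sub>i\<^sup>\<or>)\<close>\<close>
  "serre D Z i j = (let n = nat (1 - \<lfloor>Re (coroot_pairing D (simp_root D j) (simp_root D i))\<rfloor>) in
     \<Sum>k\<le>n. const ((- 1) ^ k * qbinom (qi D i) n k) *
       gen (Z i) ^ (n - k) * gen (Z j) * gen (Z i) ^ k)"

definition uq_rels :: "('g, 'i) qflag \<Rightarrow> 'i falg set" where
  "uq_rels D =
     (\<Union>i. {gen (QK i) * gen (QKi i) - 1, gen (QKi i) * gen (QK i) - 1}) \<union>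
     (\<Union>i j. {gen (QK i) * gen (QK j) - gen (QK j) * gen (QK i),
        gen (QK i) * gen (QE j) -
          const (qpow D (frm D (simp_root D i) (simp_root D j))) * gen (QE j) * gen (QK i),
        gen (QK i) * gen (QF j) -
          const (qpow D (- frm D (simp_root D i) (simp_root D j))) * gen (QF j) * gen (QK i),
        gen (QE i) * gen (QF j) - gen (QF j) * gen (QE i) -
          (if i = j then const (1 / (qi D i - inverse (qi D i))) * (gen (QK i) - gen (QKi i))
           else 0)}) \<union>
     {serre D QE i j | i j. i \<noteq> j} \<union> {serre D QF i j | i j. i \<noteq> j}"

definition free_alg :: "'i falg ring" where
  "free_alg = \<lparr>carrier = UNIV, mult = (*), one = 1, ring.zero = 0, ring.add = (+)\<rparr>"

definition Uq :: "('g, 'i) qflag \<Rightarrow> 'i uq ring" where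
  "Uq D = free_alg Quot (Idl\<^bsub>free_alg\<^esub> (uq_rels D))"

definition ucl :: "('g, 'i) qflag \<Rightarrow> 'i falg \<Rightarrow> 'i uq" where
  "ucl D p = (Idl\<^bsub>free_alg\<^esub> (uq_rels D)) +>\<^bsub>free_alg\<^esub> p"

definition scal :: "('g, 'i) qflag \<Rightarrow> complex \<Rightarrow> 'i uq" where
  "scal D c = ucl D (const c)"

definition levi_letters :: "('g, 'i) qflag \<Rightarrow> 'i qgen set" where
  "levi_letters D = QE ` sub D \<union> QF ` sub D \<union> range QK \<union> range QKi"

definition Ul :: "('g, 'i) qflag \<Rightarrow> 'i uq ring" where
  "Ul D = (Uq D)\<lparr>carrier := generate_ring (Uq D)
     ((\<lambda>a. ucl D (gen a)) ` levi_letters D \<union> range (scal D))\<rparr>"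

definition Un_minus :: "('g, 'i) qflag \<Rightarrow> 'i uq set" where
  "Un_minus D = generate_ring (Uq D) (range (\<lambda>i. ucl D (gen (QF i))) \<union> range (scal D))"

definition free_hom ::
  "('i qgen \<Rightarrow> ('m::monoid_add \<Rightarrow>\<^sub>0 complex)) \<Rightarrow> 'i falg \<Rightarrow> ('m \<Rightarrow>\<^sub>0 complex)" where
  "free_hom \<phi> p = (\<Sum>w\<in>Poly_Mapping.keys p.
     const (Poly_Mapping.lookup p w) * prod_list (map \<phi> (letters w)))"

definition free_antihom ::
  "('i qgen \<Rightarrow> ('m::monoid_add \<Rightarrow>\<^sub>0 complex)) \<Rightarrow> 'i falg \<Rightarrow> ('m \<Rightarrow>\<^sub>0 complex)" where
  "free_antihom \<phi> p = (\<Sum>w\<in>Poly_Mapping.keys p.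
     const (Poly_Mapping.lookup p w) * prod_list (rev (map \<phi> (letters w))))"

primrec eta_gen :: "'i qgen \<Rightarrow> 'i falg" where
  "eta_gen (QK i) = gen (QKi i)"
| "eta_gen (QKi i) = gen (QK i)"
| "eta_gen (QE i) = gen (QF i)"
| "eta_gen (QF i) = gen (QE i)"

primrec coprod_gen :: "'i qgen \<Rightarrow> ('i qgen word \<times> 'i qgen word \<Rightarrow>\<^sub>0 complex)" where
  "coprod_gen (QK i) = Poly_Mapping.single (Word [QK i], Word [QK i]) 1"
| "coprod_gen (QKi i) = Poly_Mapping.single (Word [QKi i], Word [QKi i]) 1"
| "coprod_gen (QE i) =
     Poly_Mapping.single (Word [QE i], Word [QK i]) 1 + Poly_Mapping.single (0, Word [QE i]) 1"
| "coprod_gen (QF i) =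
     Poly_Mapping.single (Word [QF i], 0) 1 + Poly_Mapping.single (Word [QKi i], Word [QF i]) 1"

text \<open>The antipode is the antihomomorphism with the following values on generators. They are forced
  by the antipode axiom for this coproduct, e.g. \<open>\<kappa>(E\<^sub>i) K\<^sub>i + E\<^sub>i = \<epsilon>(E\<^sub>i) = 0\<close> and
  \<open>\<kappa>(F\<^sub>i) + K\<^sub>i F\<^sub>i = \<epsilon>(F\<^sub>i) = 0\<close>.\<close>

primrec antipode_gen :: "'i qgen \<Rightarrow> 'i falg" where
  "antipode_gen (QK i) = gen (QKi i)"
| "antipode_gen (QKi i) = gen (QK i)"
| "antipode_gen (QE i) = - (gen (QE i) * gen (QKi i))"
| "antipode_gen (QF i) = - (gen (QK i) * gen (QF i))"

text \<open>Here and below, maps out of a quotient are defined as \<^const>\<open>the_elem\<close> of the set of the values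
  on all representatives.\<close>

definition eta :: "('g, 'i) qflag \<Rightarrow> 'i uq \<Rightarrow> 'i uq" where
  "eta D u = the_elem ((\<lambda>p. ucl D (free_hom eta_gen p)) ` u)"

definition antipode :: "('g, 'i) qflag \<Rightarrow> 'i uq \<Rightarrow> 'i uq" where
  "antipode D u = the_elem ((\<lambda>p. ucl D (free_antihom antipode_gen p)) ` u)"


section \<open>Modules\<close>

text \<open>Left modules over a possibly noncommutative ring; the record
  \<^typ>\<open>('a, 'b) module\<close> is reused, its components \<^const>\<open>mult\<close> and \<^const>\<open>one\<close> are ignored. All
  complex scalars act through \<^const>\<open>scal\<close>.\<close>

definition left_module :: "('r, 'x) ring_scheme \<Rightarrow> ('r, 'm, 'y) module_scheme \<Rightarrow> bool" where
  "left_module R M \<longleftrightarrow> abelian_group M \<and>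
     (\<forall>a\<in>carrier R. \<forall>x\<in>carrier M. a \<odot>\<^bsub>M\<^esub> x \<in> carrier M) \<and>
     (\<forall>a\<in>carrier R. \<forall>b\<in>carrier R. \<forall>x\<in>carrier M.
        (a \<oplus>\<^bsub>R\<^esub> b) \<odot>\<^bsub>M\<^esub> x = (a \<odot>\<^bsub>M\<^esub> x) \<oplus>\<^bsub>M\<^esub> (b \<odot>\<^bsub>M\<^esub> x) \<and>
        (a \<otimes>\<^bsub>R\<^esub> b) \<odot>\<^bsub>M\<^esub> x = a \<odot>\<^bsub>M\<^esub> (b \<odot>\<^bsub>M\<^esub> x)) \<and>
     (\<forall>a\<in>carrier R. \<forall>x\<in>carrier M. \<forall>y\<in>carrier M.
        a \<odot>\<^bsub>M\<^esub> (x \<oplus>\<^bsub>M\<^esub> y) = (a \<odot>\<^bsub>M\<^esub> x) \<oplus>\<^bsub>M\<^esub> (a \<odot>\<^bsub>M\<^esub> y)) \<and>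
     (\<forall>x\<in>carrier M. \<one>\<^bsub>R\<^esub> \<odot>\<^bsub>M\<^esub> x = x)"

definition lmod_hom ::
  "('r, 'x) ring_scheme \<Rightarrow> ('r, 'm, 'y) module_scheme \<Rightarrow> ('r, 'n, 'z) module_scheme \<Rightarrow> ('m \<Rightarrow> 'n) set"
where
  "lmod_hom R M N = {f \<in> carrier M \<rightarrow> carrier N.
     (\<forall>x\<in>carrier M. \<forall>y\<in>carrier M. f (x \<oplus>\<^bsub>M\<^esub> y) = f x \<oplus>\<^bsub>N\<^esub> f y) \<and>
     (\<forall>a\<in>carrier R. \<forall>x\<in>carrier M. f (a \<odot>\<^bsub>M\<^esub> x) = a \<odot>\<^bsub>N\<^esub> f x)}"

definition simple_module :: "('r, 'x) ring_scheme \<Rightarrow> ('r, 'm, 'y) module_scheme \<Rightarrow> bool" where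
  "simple_module R M \<longleftrightarrow> left_module R M \<and> carrier M \<noteq> {\<zero>\<^bsub>M\<^esub>} \<and>
     (\<forall>N. submodule N R M \<longrightarrow> N = {\<zero>\<^bsub>M\<^esub>} \<or> N = carrier M)"

definition fin_dim :: "('g, 'i) qflag \<Rightarrow> ('i uq, 'm, 'y) module_scheme \<Rightarrow> bool" where
  "fin_dim D M \<longleftrightarrow> (\<exists>B. finite B \<and> B \<subseteq> carrier M \<and>
     (\<forall>x\<in>carrier M. \<exists>c. x = finsum M (\<lambda>b. scal D (c b) \<odot>\<^bsub>M\<^esub> b) B))"

definition weight_vector ::
  "('g, 'i) qflag \<Rightarrow> ('i uq, 'm, 'y) module_scheme \<Rightarrow> 'g wt \<Rightarrow> 'm \<Rightarrow> bool" where
  "weight_vector D M \<mu> v \<longleftrightarrow> v \<in> carrier M \<and> v \<noteq> \<zero>\<^bsub>M\<^esub> \<and>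
     (\<forall>j. ucl D (gen (QK j)) \<odot>\<^bsub>M\<^esub> v = scal D (qpow D (frm D \<mu> (simp_root D j))) \<odot>\<^bsub>M\<^esub> v)"

definition highest_weight_vector ::
  "('g, 'i) qflag \<Rightarrow> ('i uq, 'm, 'y) module_scheme \<Rightarrow> 'g wt \<Rightarrow> 'm \<Rightarrow> bool" where
  "highest_weight_vector D M \<mu> v \<longleftrightarrow> weight_vector D M \<mu> v \<and>
     (\<forall>i\<in>sub D. ucl D (gen (QE i)) \<odot>\<^bsub>M\<^esub> v = \<zero>\<^bsub>M\<^esub>)"

definition lowest_weight_vector ::
  "('g, 'i) qflag \<Rightarrow> ('i uq, 'm, 'y) module_scheme \<Rightarrow> 'g wt \<Rightarrow> 'm \<Rightarrow> bool" where
  "lowest_weight_vector D M \<mu> v \<longleftrightarrow> weight_vector D M \<mu> v \<and>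
     (\<forall>i\<in>sub D. ucl D (gen (QF i)) \<odot>\<^bsub>M\<^esub> v = \<zero>\<^bsub>M\<^esub>)"

definition levi_module ::
  "('g, 'i) qflag \<Rightarrow> ('i uq, 'm) module \<Rightarrow> 'g wt \<Rightarrow> 'm \<Rightarrow> bool" where
  "levi_module D M \<mu> v \<longleftrightarrow> simple_module (Ul D) M \<and> fin_dim D M \<and> highest_weight_vector D M \<mu> v"

definition dual_module ::
  "('g, 'i) qflag \<Rightarrow> ('i uq, 'm) module \<Rightarrow> ('i uq, 'm \<Rightarrow> complex) module" where
  "dual_module D M =
     \<lparr>carrier = {f \<in> extensional (carrier M).
        (\<forall>x\<in>carrier M. \<forall>y\<in>carrier M. f (x \<oplus>\<^bsub>M\<^esub> y) = f x + f y) \<and>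
        (\<forall>c. \<forall>x\<in>carrier M. f (scal D c \<odot>\<^bsub>M\<^esub> x) = c * f x)},
      mult = undefined, one = undefined, ring.zero = (\<lambda>x\<in>carrier M. 0),
      ring.add = (\<lambda>f g. \<lambda>x\<in>carrier M. f x + g x),
      smult = (\<lambda>u f. \<lambda>x\<in>carrier M. f (antipode D u \<odot>\<^bsub>M\<^esub> x))\<rparr>"


section \<open>Verma modules\<close>

definition left_ideal :: "'a set \<Rightarrow> ('a, 'x) ring_scheme \<Rightarrow> bool" where
  "left_ideal J R \<longleftrightarrow> additive_subgroup J R \<and> (\<forall>a\<in>carrier R. \<forall>x\<in>J. a \<otimes>\<^bsub>R\<^esub> x \<in> J)"

definition verma_ideal :: "('g, 'i) qflag \<Rightarrow> 'g wt \<Rightarrow> 'i uq set" where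
  "verma_ideal D \<mu> = \<Inter>{J. left_ideal J (Uq D) \<and> (\<forall>i. ucl D (gen (QE i)) \<in> J) \<and>
     (\<forall>j. ucl D (gen (QK j) - const (qpow D (frm D \<mu> (simp_root D j)))) \<in> J)}"

definition verma :: "('g, 'i) qflag \<Rightarrow> 'g wt \<Rightarrow> ('i uq, 'i uq set) module" where
  "verma D \<mu> = (let J = verma_ideal D \<mu> in
     \<lparr>carrier = a_rcosets\<^bsub>Uq D\<^esub> J, mult = undefined, one = undefined, ring.zero = J,
      ring.add = set_add (Uq D),
      smult = (\<lambda>u Z. the_elem ((\<lambda>a. J +>\<^bsub>Uq D\<^esub> (u \<otimes>\<^bsub>Uq D\<^esub> a)) ` Z))\<rparr>)"

definition verma_vec :: "('g, 'i) qflag \<Rightarrow> 'g wt \<Rightarrow> 'i uq set" where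
  "verma_vec D \<mu> = verma_ideal D \<mu> +>\<^bsub>Uq D\<^esub> \<one>\<^bsub>Uq D\<^esub>"

definition verma_embeddings ::
  "('g::ab_group_add, 'i::finite) qflag \<Rightarrow> ('g wgt \<Rightarrow> 'i uq set \<Rightarrow> 'i uq set) \<Rightarrow> bool" where
  "verma_embeddings D \<iota> \<longleftrightarrow> (\<forall>w\<in>weyl D.
     \<iota> w \<in> lmod_hom (Uq D) (verma D (dot0 D w)) (verma D (\<lambda>_. 0)) \<and>
     inj_on (\<iota> w) (carrier (verma D (dot0 D w))))"

definition embedding_elements ::
  "('g::ab_group_add, 'i::finite) qflag \<Rightarrow> ('g wgt \<Rightarrow> 'i uq set \<Rightarrow> 'i uq set) \<Rightarrow>
    ('g wgt \<Rightarrow> 'g wgt \<Rightarrow> 'i uq) \<Rightarrow> bool" where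
  \<comment> \<open>inside \<open>V\<^sup>0\<close>, the generator of \<open>V\<^bsup>w.0\<^esup>\<close> is \<open>y0 w w'\<close> times the one of \<open>V\<^bsup>w'.0\<^esup>\<close>\<close>
  "embedding_elements D \<iota> y0 \<longleftrightarrow> (\<forall>w w'. arrow D w w' \<longrightarrow> y0 w w' \<in> Un_minus D \<and>
     \<iota> w (verma_vec D (dot0 D w)) =
       \<iota> w' (y0 w w' \<odot>\<^bsub>verma D (dot0 D w')\<^esub> verma_vec D (dot0 D w')))"

definition sign_choice ::
  "('g::ab_group_add, 'i::finite) qflag \<Rightarrow> ('g wgt \<Rightarrow> 'g wgt \<Rightarrow> int) \<Rightarrow> bool" where
  "sign_choice D s \<longleftrightarrow> (\<forall>w w'. arrow D w w' \<longrightarrow> s w w' = 1 \<or> s w w' = - 1) \<and>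
     (\<forall>w1 w2 w3 w4. arrow D w1 w2 \<and> arrow D w2 w4 \<and> arrow D w1 w3 \<and> arrow D w3 w4 \<and> w2 \<noteq> w3
        \<longrightarrow> s w1 w2 * s w2 w4 * s w1 w3 * s w3 w4 = - 1)"

definition y_elt :: "('g, 'i) qflag \<Rightarrow> ('g wgt \<Rightarrow> 'g wgt \<Rightarrow> int) \<Rightarrow> ('g wgt \<Rightarrow> 'g wgt \<Rightarrow> 'i uq) \<Rightarrow>
    'g wgt \<Rightarrow> 'g wgt \<Rightarrow> 'i uq" where
  "y_elt D s y0 w w' = scal D (of_int (s w w')) \<otimes>\<^bsub>Uq D\<^esub> y0 w w'"

definition x_elt :: "('g, 'i) qflag \<Rightarrow> ('g wgt \<Rightarrow> 'g wgt \<Rightarrow> int) \<Rightarrow> ('g wgt \<Rightarrow> 'g wgt \<Rightarrow> 'i uq) \<Rightarrow>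
    'g wgt \<Rightarrow> 'g wgt \<Rightarrow> 'i uq" where
  "x_elt D s y0 w w' = eta D (y_elt D s y0 w w')"


section \<open>Tensor products\<close>

text \<open>The tensor product of a right module \<open>A\<close> and a left module \<open>B\<close> over scalars \<open>Rs\<close>, acting by
  \<open>ra\<close> and \<open>la\<close>, is the free abelian group on \<open>A \<times> B\<close> modulo the subgroup \<^emph>\<open>tensor_ker\<close>.\<close>

definition tensor_ker :: "('a, 'x) ring_scheme \<Rightarrow> ('b, 'y) ring_scheme \<Rightarrow> 'r set \<Rightarrow>
    ('a \<Rightarrow> 'r \<Rightarrow> 'a) \<Rightarrow> ('r \<Rightarrow> 'b \<Rightarrow> 'b) \<Rightarrow> ('a \<times> 'b \<Rightarrow>\<^sub>0 int) set" where
  "tensor_ker A B Rs ra la = generate (free_Abelian_group (carrier A \<times> carrier B))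
     ({frag_of (a \<oplus>\<^bsub>A\<^esub> a', b) - frag_of (a, b) - frag_of (a', b) | a a' b.
         a \<in> carrier A \<and> a' \<in> carrier A \<and> b \<in> carrier B} \<union>
      {frag_of (a, b \<oplus>\<^bsub>B\<^esub> b') - frag_of (a, b) - frag_of (a, b') | a b b'.
         a \<in> carrier A \<and> b \<in> carrier B \<and> b' \<in> carrier B} \<union>
      {frag_of (ra a r, b) - frag_of (a, la r b) | a r b.
         a \<in> carrier A \<and> r \<in> Rs \<and> b \<in> carrier B})"

definition tensor_cl :: "('a, 'x) ring_scheme \<Rightarrow> ('b, 'y) ring_scheme \<Rightarrow> ('a \<times> 'b \<Rightarrow>\<^sub>0 int) set \<Rightarrow>
    ('a \<times> 'b \<Rightarrow>\<^sub>0 int) \<Rightarrow> ('a \<times> 'b \<Rightarrow>\<^sub>0 int) set" where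
  "tensor_cl A B N z = N #>\<^bsub>free_Abelian_group (carrier A \<times> carrier B)\<^esub> z"

definition tensor_module :: "('a, 'x) ring_scheme \<Rightarrow> ('b, 'y) ring_scheme \<Rightarrow>
    ('a \<times> 'b \<Rightarrow>\<^sub>0 int) set \<Rightarrow> ('r \<Rightarrow> ('a \<times> 'b \<Rightarrow>\<^sub>0 int) set \<Rightarrow> ('a \<times> 'b \<Rightarrow>\<^sub>0 int) set) \<Rightarrow>
    ('r, ('a \<times> 'b \<Rightarrow>\<^sub>0 int) set) module" where
  "tensor_module A B N act = (let Q = free_Abelian_group (carrier A \<times> carrier B) Mod N in
     \<lparr>carrier = carrier Q, mult = undefined, one = undefined, ring.zero = \<one>\<^bsub>Q\<^esub>, ring.add = mult Q,
      smult = act\<rparr>)"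

type_synonym ('m, 'n) tens = "('m \<times> 'n \<Rightarrow>\<^sub>0 int) set"

definition ctens_ker :: "('g, 'i) qflag \<Rightarrow> ('i uq, 'm) module \<Rightarrow> ('i uq, 'n) module \<Rightarrow>
    ('m, 'n) tens" where
  "ctens_ker D M N =
     tensor_ker M N (UNIV :: complex set) (\<lambda>x c. scal D c \<odot>\<^bsub>M\<^esub> x) (\<lambda>c y. scal D c \<odot>\<^bsub>N\<^esub> y)"

definition ctens_act :: "('g, 'i) qflag \<Rightarrow> ('i uq, 'm) module \<Rightarrow> ('i uq, 'n) module \<Rightarrow>
    'i uq \<Rightarrow> ('m, 'n) tens \<Rightarrow> ('m, 'n) tens" where
  \<comment> \<open>\<open>u (x \<otimes> y) = \<Sum> u\<^sub>(\<^sub>1\<^sub>) x \<otimes> u\<^sub>(\<^sub>2\<^sub>) y\<close>; only representatives \<open>p\<close> of \<open>u\<close> in the letters of the Levi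
    part are used, since \<open>M\<close> and \<open>N\<close> are modules over \<^const>\<open>Ul\<close> only\<close>
  "ctens_act D M N u Z = the_elem
     {tensor_cl M N (ctens_ker D M N)
        (frag_extend (\<lambda>(x, y). \<Sum>(a, b)\<in>Poly_Mapping.keys (free_hom coprod_gen p).
           frag_of (ucl D (Poly_Mapping.single a (Poly_Mapping.lookup (free_hom coprod_gen p) (a, b)))
                      \<odot>\<^bsub>M\<^esub> x,
                    ucl D (Poly_Mapping.single b 1) \<odot>\<^bsub>N\<^esub> y)) z) | p z.
      p \<in> u \<and> (\<forall>w\<in>Poly_Mapping.keys p. set (letters w) \<subseteq> levi_letters D) \<and> z \<in> Z}"

definition ctens :: "('g, 'i) qflag \<Rightarrow> ('i uq, 'm) module \<Rightarrow> ('i uq, 'n) module \<Rightarrow>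
    ('i uq, ('m, 'n) tens) module" where
  "ctens D M N = tensor_module M N (ctens_ker D M N) (ctens_act D M N)"

definition induced_ker :: "('g, 'i) qflag \<Rightarrow> ('i uq, 't) module \<Rightarrow> ('i uq, 't) tens" where
  "induced_ker D T =
     tensor_ker (Uq D) T (carrier (Ul D)) (\<lambda>u r. u \<otimes>\<^bsub>Uq D\<^esub> r) (\<lambda>r t. r \<odot>\<^bsub>T\<^esub> t)"

definition induced_act :: "('g, 'i) qflag \<Rightarrow> ('i uq, 't) module \<Rightarrow> 'i uq \<Rightarrow>
    ('i uq, 't) tens \<Rightarrow> ('i uq, 't) tens" where
  "induced_act D T u Z = the_elem ((\<lambda>z. tensor_cl (Uq D) T (induced_ker D T)
     (frag_extend (\<lambda>(a, t). frag_of (u \<otimes>\<^bsub>Uq D\<^esub> a, t)) z)) ` Z)"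

definition induced :: "('g, 'i) qflag \<Rightarrow> ('i uq, 't) module \<Rightarrow>
    ('i uq, ('i uq, 't) tens) module" where
  "induced D T = tensor_module (Uq D) T (induced_ker D T) (induced_act D T)"


section \<open>The double complex\<close>

type_synonym ('i, 'm) wel = "('i uq, ('m, 'm \<Rightarrow> complex) tens) tens"

definition Wmod :: "('g, 'i) qflag \<Rightarrow> ('g wt \<Rightarrow> ('i uq, 'm) module) \<Rightarrow> 'g wt \<Rightarrow> 'g wt \<Rightarrow>
    ('i uq, ('i, 'm) wel) module" where
  "Wmod D M \<mu> \<nu> = induced D (ctens D (M \<mu>) (dual_module D (M \<nu>)))"

definition welt :: "('g, 'i) qflag \<Rightarrow> ('g wt \<Rightarrow> ('i uq, 'm) module) \<Rightarrow> ('g wt \<Rightarrow> 'm) \<Rightarrow>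
    ('g wt \<Rightarrow> 'm \<Rightarrow> complex) \<Rightarrow> 'g wt \<Rightarrow> 'g wt \<Rightarrow> 'i uq \<Rightarrow> ('i, 'm) wel" where
  \<comment> \<open>\<open>u \<otimes> (v\<^sub>\<mu> \<otimes> \<xi>\<^sub>-\<^sub>\<nu>)\<close>; the vector \<open>\<xi>\<^sub>-\<^sub>\<nu>\<close> is written \<open>\<xi> \<nu>\<close>\<close>
  "welt D M v \<xi> \<mu> \<nu> u = (let N = dual_module D (M \<nu>); T = ctens D (M \<mu>) N in
     tensor_cl (Uq D) T (induced_ker D T)
       (frag_of (u, tensor_cl (M \<mu>) N (ctens_ker D (M \<mu>) N) (frag_of (v \<mu>, \<xi> \<nu>)))))"

definition h_first :: "('g::ab_group_add, 'i::finite) qflag \<Rightarrow>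
    ('g wt \<Rightarrow> ('i uq, 'm) module) \<Rightarrow> ('g wt \<Rightarrow> 'm) \<Rightarrow> ('g wt \<Rightarrow> 'm \<Rightarrow> complex) \<Rightarrow>
    ('g wgt \<Rightarrow> 'g wgt \<Rightarrow> 'i uq) \<Rightarrow>
    ('g wgt \<Rightarrow> 'g wgt \<Rightarrow> 'g wgt \<Rightarrow> ('i, 'm) wel \<Rightarrow> ('i, 'm) wel) \<Rightarrow> bool" where
  \<comment> \<open>\<open>h w1 w1' w2\<close> is the module map \<open>W(w1.0, w2.0) \<rightarrow> W(w1'.0, w2.0)\<close> given by \<open>y w1 w1'\<close>\<close>
  "h_first D M v \<xi> y h \<longleftrightarrow>
     (\<forall>w1\<in>min_reps D. \<forall>w1'\<in>min_reps D. \<forall>w2\<in>min_reps D. arrow D w1 w1' \<longrightarrow>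
        h w1 w1' w2 \<in>
          lmod_hom (Uq D) (Wmod D M (dot0 D w1) (dot0 D w2)) (Wmod D M (dot0 D w1') (dot0 D w2)) \<and>
        (\<forall>u\<in>carrier (Uq D). h w1 w1' w2 (welt D M v \<xi> (dot0 D w1) (dot0 D w2) u) =
           welt D M v \<xi> (dot0 D w1') (dot0 D w2) (u \<otimes>\<^bsub>Uq D\<^esub> y w1 w1')))"

definition h_second :: "('g::ab_group_add, 'i::finite) qflag \<Rightarrow>
    ('g wt \<Rightarrow> ('i uq, 'm) module) \<Rightarrow> ('g wt \<Rightarrow> 'm) \<Rightarrow> ('g wt \<Rightarrow> 'm \<Rightarrow> complex) \<Rightarrow>
    ('g wgt \<Rightarrow> 'g wgt \<Rightarrow> 'i uq) \<Rightarrow>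
    ('g wgt \<Rightarrow> 'g wgt \<Rightarrow> 'g wgt \<Rightarrow> ('i, 'm) wel \<Rightarrow> ('i, 'm) wel) \<Rightarrow> bool" where
  \<comment> \<open>\<open>h w1 w2 w2'\<close> is the module map \<open>W(w1.0, w2.0) \<rightarrow> W(w1.0, w2'.0)\<close> given by \<open>x w2 w2'\<close>\<close>
  "h_second D M v \<xi> x h \<longleftrightarrow>
     (\<forall>w1\<in>min_reps D. \<forall>w2\<in>min_reps D. \<forall>w2'\<in>min_reps D. arrow D w2 w2' \<longrightarrow>
        h w1 w2 w2' \<in>
          lmod_hom (Uq D) (Wmod D M (dot0 D w1) (dot0 D w2)) (Wmod D M (dot0 D w1) (dot0 D w2')) \<and>
        (\<forall>u\<in>carrier (Uq D). h w1 w2 w2' (welt D M v \<xi> (dot0 D w1) (dot0 D w2) u) =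
           welt D M v \<xi> (dot0 D w1) (dot0 D w2') (u \<otimes>\<^bsub>Uq D\<^esub> x w2 w2')))"

definition direct_sum :: "'k set \<Rightarrow> ('k \<Rightarrow> ('r, 'm) module) \<Rightarrow> ('r, 'k \<Rightarrow> 'm) module" where
  "direct_sum I Z =
     \<lparr>carrier = {z \<in> \<Pi>\<^sub>E k\<in>I. carrier (Z k). finite {k \<in> I. z k \<noteq> \<zero>\<^bsub>Z k\<^esub>}},
      mult = undefined, one = undefined, ring.zero = (\<lambda>k\<in>I. \<zero>\<^bsub>Z k\<^esub>),
      ring.add = (\<lambda>z z'. \<lambda>k\<in>I. z k \<oplus>\<^bsub>Z k\<^esub> z' k),
      smult = (\<lambda>u z. \<lambda>k\<in>I. u \<odot>\<^bsub>Z k\<^esub> z k)\<rparr>"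

definition bidegree :: "('g::ab_group_add, 'i::finite) qflag \<Rightarrow> nat \<Rightarrow> nat \<Rightarrow> ('g wgt \<times> 'g wgt) set"
where
  "bidegree D n m = {(w1, w2). w1 \<in> min_reps D \<and> w2 \<in> min_reps D \<and>
     weyl_length D w1 = n \<and> weyl_length D w2 = m}"

definition Cmod :: "('g::ab_group_add, 'i::finite) qflag \<Rightarrow> ('g wt \<Rightarrow> ('i uq, 'm) module) \<Rightarrow>
    nat \<Rightarrow> nat \<Rightarrow> ('i uq, 'g wgt \<times> 'g wgt \<Rightarrow> ('i, 'm) wel) module" where
  "Cmod D M n m =
     direct_sum (bidegree D n m) (\<lambda>(w1, w2). Wmod D M (dot0 D w1) (dot0 D w2))"

definition d_first :: "('g::ab_group_add, 'i::finite) qflag \<Rightarrow> ('g wt \<Rightarrow> ('i uq, 'm) module) \<Rightarrow>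
    ('g wgt \<Rightarrow> 'g wgt \<Rightarrow> 'g wgt \<Rightarrow> ('i, 'm) wel \<Rightarrow> ('i, 'm) wel) \<Rightarrow> nat \<Rightarrow> nat \<Rightarrow>
    ('g wgt \<times> 'g wgt \<Rightarrow> ('i, 'm) wel) \<Rightarrow> ('g wgt \<times> 'g wgt \<Rightarrow> ('i, 'm) wel)" where
  "d_first D M h n m z = (\<lambda>(w1', w2)\<in>bidegree D (n - 1) m.
     finsum (Wmod D M (dot0 D w1') (dot0 D w2)) (\<lambda>w1. h w1 w1' w2 (z (w1, w2)))
       {w1 \<in> min_reps D. weyl_length D w1 = n \<and> arrow D w1 w1'})"

definition d_second :: "('g::ab_group_add, 'i::finite) qflag \<Rightarrow> ('g wt \<Rightarrow> ('i uq, 'm) module) \<Rightarrow>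
    ('g wgt \<Rightarrow> 'g wgt \<Rightarrow> 'g wgt \<Rightarrow> ('i, 'm) wel \<Rightarrow> ('i, 'm) wel) \<Rightarrow> nat \<Rightarrow> nat \<Rightarrow>
    ('g wgt \<times> 'g wgt \<Rightarrow> ('i, 'm) wel) \<Rightarrow> ('g wgt \<times> 'g wgt \<Rightarrow> ('i, 'm) wel)" where
  "d_second D M h n m z = (\<lambda>(w1, w2')\<in>bidegree D n (m - 1).
     scal D ((- 1) ^ n) \<odot>\<^bsub>Wmod D M (dot0 D w1) (dot0 D w2')\<^esub>
       finsum (Wmod D M (dot0 D w1) (dot0 D w2')) (\<lambda>w2. h w1 w2 w2' (z (w1, w2)))
         {w2 \<in> min_reps D. weyl_length D w2 = m \<and> arrow D w2 w2'})"

end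

theory Submission
  imports Defs
begin

text \<open>
  The sign \<open>(-1)\<^sup>n\<close> reduces the claim to the equality of the two ways of composing a map given by \<open>y\<close>
  with one given by \<open>x\<close>. As \<open>W(\<mu>, \<nu>)\<close> is generated by \<open>z = v\<^sub>\<mu> \<otimes> \<xi>\<^sub>-\<^sub>\<nu>\<close>, this means \<open>y x z = x y z\<close> for the
  targets \<open>\<mu> = w\<^sub>1'.0\<close> and \<open>\<nu> = w\<^sub>2'.0\<close>.

  Since \<open>y\<close> comes from an embedding of Verma modules, \<open>y v\<^sub>\<mu>\<close> is a singular vector of the Verma module:
  all \<open>E\<^sub>k\<close> kill it. Applying \<open>\<eta>\<close>, all \<open>F\<^sub>k\<close> kill \<open>x \<xi>\<^sub>-\<^sub>\<nu>\<close> in the lowest weight Verma module. In the tensor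
  product of the two Verma modules, \<open>E\<^sub>k\<close> therefore acts on \<open>y v\<^sub>\<mu> \<otimes> r \<xi>\<^sub>-\<^sub>\<nu>\<close> through the second factor only,
  whence \<open>x (y v\<^sub>\<mu> \<otimes> \<xi>\<^sub>-\<^sub>\<nu>) = y v\<^sub>\<mu> \<otimes> x \<xi>\<^sub>-\<^sub>\<nu>\<close>, and symmetrically \<open>y (v\<^sub>\<mu> \<otimes> x \<xi>\<^sub>-\<^sub>\<nu>) = y v\<^sub>\<mu> \<otimes> x \<xi>\<^sub>-\<^sub>\<nu>\<close>; up to
  the relations this computation takes place in \<open>U\<^sub>q(\<gg>)\<close> modulo the left ideal generated by the
  \<open>K\<^sub>j - q\<^bsup>(\<mu> - \<nu>, \<alpha>\<^sub>j)\<^esup>\<close>, which annihilates \<open>z\<close>.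

  That the weights \<open>w.0\<close> are integral and dominant for \<open>S\<close> follows from \<open>w\<rho> = \<rho> - \<Sum> \<gamma>\<close>, the sum over the
  positive roots \<open>\<gamma>\<close> with \<open>-\<gamma> \<in> w R\<^sup>+\<close>, which for reflections also gives \<open>(\<rho>, \<beta>\<^sup>\<or>) \<ge> 1\<close> for positive \<open>\<beta>\<close>.
\<close>

subsection \<open>Gaussian binomials and the quantum Serre polynomial\<close>

text \<open>The quantized algebra is only a quotient of a free algebra, with no basis to compute in.
  Each structure map (eta, antipode, coproduct, the action on a Verma module) therefore has to be
  checked on the relations, and the quantum Serre relations are the hard ones. Writing the Serre
  polynomial as an iterated q-commutator \<open>qcomm\<close> turns these checks into inductions on
  the number of factors. Singular vectors are treated in the free Verma module of polynomials in the
  F_i, where the E_i act by an explicit formula; singular then means killed modulo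
  \<open>serre_ideal\<close>. This ideal links the two halves: an embedding of Verma modules yields
  vectors that are singular in this sense, and \<open>ee p r\<close> falls into \<open>LL\<close>
  once p or r lies in \<open>serre_ideal\<close>. The other obstacle is W itself, which is built by
  two tensor products from abstractly given modules: the coproduct has to descend to an action on
  the first tensor product, and the obvious vector has to be shown to generate W. For the dual
  factor, generation is obtained from an annihilator in the simple module.\<close>

locale scalar_algebra =
  fixes \<sigma> :: "complex \<Rightarrow> 'a::ring_1"
  assumes sc_add: "\<sigma> (c + d) = \<sigma> c + \<sigma> d"
    and sc_mult: "\<sigma> (c * d) = \<sigma> c * \<sigma> d"
    and sc_one: "\<sigma> 1 = 1"
    and sc_comm: "x * \<sigma> c = \<sigma> c * x"
begin

lemma sc_zero [simp]: "\<sigma> 0 = 0"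
  using sc_add[of 0 0] by simp

lemma sc_minus: "\<sigma> (- c) = - \<sigma> c"
  using sc_add[of c "- c"] by (simp add: eq_neg_iff_add_eq_0 add.commute)

lemma sc_diff: "\<sigma> (c - d) = \<sigma> c - \<sigma> d"
  using sc_add[of c "- d"] by (simp add: sc_minus)

lemma sc_left: "x * (\<sigma> c * y) = \<sigma> c * (x * y)"
  by (metis mult.assoc sc_comm)

lemma sc_merge: "\<sigma> c * (\<sigma> d * x) = \<sigma> (c * d) * x"
  by (simp add: sc_mult mult.assoc)

text \<open>Scalars get their own operator because \<open>\<sigma> c * x\<close> is no stable normal
  form under associativity. With \<open>sm\<close> all coefficients collect in front, and long
  identities with central scalars can be left to \<open>algebra_simps\<close>.\<close>

definition sm :: "complex \<Rightarrow> 'a \<Rightarrow> 'a" where "sm c x = \<sigma> c * x"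

lemma sm_rules:
  "sm c x * y = sm c (x * y)" "x * sm c y = sm c (x * y)" "sm c (sm d x) = sm (c * d) x"
  "sm c (x + y) = sm c x + sm c y" "sm c (x - y) = sm c x - sm c y" "sm c (- x) = - sm c x"
  "sm (c + d) x = sm c x + sm d x" "sm (c - d) x = sm c x - sm d x" "sm (- c) x = - sm c x"
  "sm 0 x = 0" "sm 1 x = x" "sm c 0 = 0"
  by (simp_all add: sm_def mult.assoc sc_merge distrib_left distrib_right left_diff_distrib
      right_diff_distrib sc_add sc_diff sc_minus sc_one)
    (simp add: sc_left)

lemmas sm_simps = sm_def[symmetric] sm_rules mult.assoc

text \<open>Stated over an arbitrary ring with central scalars, because it is used in the free
  algebra, in its tensor square and in rings of operators.\<close>

definition qserre :: "complex \<Rightarrow> nat \<Rightarrow> 'a \<Rightarrow> 'a \<Rightarrow> 'a" where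
  "qserre t n f g = (\<Sum>k\<le>n. \<sigma> ((- 1) ^ k * qbinom t n k) * f ^ (n - k) * g * f ^ k)"

text \<open>The operators T -> f T - p T f commute for different scalars p; here p runs through b, b
  t^2, b t^4 and so on. With b t^(n-1) = 1 the n-fold product applied to g is the quantum Serre
  polynomial, and the recursion replaces its alternating sum by inductions on m.\<close>

primrec qcomm :: "complex \<Rightarrow> complex \<Rightarrow> 'a \<Rightarrow> 'a \<Rightarrow> nat \<Rightarrow> 'a" where
  "qcomm b t f g 0 = g"
| "qcomm b t f g (Suc m) = f * qcomm b t f g m - \<sigma> (b * t ^ (2 * m)) * qcomm b t f g m * f"

end

lemma qint_nonzero:
  assumes "t \<noteq> 0" "\<And>k. k > 0 \<Longrightarrow> t ^ k \<noteq> (1::complex)" "j > 0"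
  shows "qint t j \<noteq> 0"
proof -
  have "t * t \<noteq> 1" using assms(2)[of 2] by (simp add: power2_eq_square)
  moreover have "t ^ j * t ^ j \<noteq> 1" using assms(2)[of "j + j"] assms(3) by (simp add: power_add)
  ultimately show ?thesis using assms(1)
    by (auto simp: qint_def field_simps)
qed

lemma qint_split:
  assumes "t \<noteq> 0" "t * t \<noteq> 1"
  shows "qint t (a + c) = inverse t ^ c * qint t a + t ^ a * qint t c"
proof -
  have nz: "t - inverse t \<noteq> 0" using assms by (auto simp: field_simps)
  have q: "qint t j * (t - inverse t) = t ^ j - inverse t ^ j" for j
    using nz by (simp add: qint_def)
  have "(inverse t ^ c * qint t a + t ^ a * qint t c) * (t - inverse t)
      = inverse t ^ c * (t ^ a - inverse t ^ a) + t ^ a * (t ^ c - inverse t ^ c)"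
    by (simp only: distrib_right mult.assoc q)
  also have "\<dots> = qint t (a + c) * (t - inverse t)"
    unfolding q by (simp add: power_add algebra_simps)
  finally show ?thesis using nz by simp
qed

lemma qbinom_0 [simp]:
  assumes "t \<noteq> 0" "\<And>k. k > 0 \<Longrightarrow> t ^ k \<noteq> (1::complex)"
  shows "qbinom t m 0 = 1" "qbinom t m m = 1"
proof -
  have "(\<Prod>j=1..m. qint t j) \<noteq> 0" using qint_nonzero[OF assms] by auto
  then show "qbinom t m 0 = 1" "qbinom t m m = 1" by (simp_all add: qbinom_def)
qed

text \<open>Comes from [m+1] = t^(-k) [m+1-k] + t^(m+1-k) [k] for the symmetric quantum integers [j]
  = \<open>qint t j\<close>.\<close>

lemma qbinom_Pascal:
  assumes t: "t \<noteq> 0" "\<And>k. k > 0 \<Longrightarrow> t ^ k \<noteq> (1::complex)" and k: "1 \<le> k" "k \<le> m"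
  shows "qbinom t (Suc m) k = inverse t ^ k * qbinom t m k + t ^ (Suc m - k) * qbinom t m (k - 1)"
proof -
  define P where "P n = (\<Prod>j=1..n. qint t j)" for n
  have nz: "P n \<noteq> 0" for n using qint_nonzero[OF t] by (auto simp: P_def)
  have S: "P (Suc n) = P n * qint t (Suc n)" for n by (simp add: P_def)
  have bin: "qbinom t n k = P n / (P k * P (n - k))" for n k by (simp add: qbinom_def P_def)
  obtain l where l: "k = Suc l" using k by (cases k) auto
  define d where "d = m - k"
  have m: "m = d + Suc l" using k l d_def by auto
  have t2: "t * t \<noteq> 1" using t(2)[of 2] by (simp add: power2_eq_square)
  have sp: "qint t (Suc m) = inverse t ^ k * qint t (Suc d) + t ^ (Suc d) * qint t k"
    using qint_split[OF t(1) t2, of "Suc d" k] m l by simp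
  have q1: "qbinom t (Suc m) k = P m * qint t (Suc m) / (P l * qint t k * (P d * qint t (Suc d)))"
    using m l by (simp add: bin S)
  have q2: "qbinom t m k = P m / (P l * qint t k * P d)"
    using m l by (simp add: bin S)
  have q3: "qbinom t m (k - 1) = P m / (P l * (P d * qint t (Suc d)))"
    using m l by (simp add: bin S)
  have n1: "qint t k \<noteq> 0" "qint t (Suc d) \<noteq> 0" using qint_nonzero[OF t] l by auto
  have e: "Suc m - k = Suc d" using m l by simp
  have gen: "p * (x * y + z * w) / (c * w * (g * y)) = x * (p / (c * w * g)) + z * (p / (c * (g * y)))"
    if "y \<noteq> 0" "w \<noteq> 0" "c \<noteq> 0" "g \<noteq> 0" for p x y z w c g :: complex
    using that by (simp add: field_simps)
  show ?thesis unfolding q1 q2 q3 sp e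
    by (rule gen) (use nz n1 in auto)
qed

lemma qint_inverse: "qint (inverse t) j = qint t j"
proof -
  have "(a - b) / (c - d) = (b - a) / (d - c)" for a b c d :: complex
    by (metis minus_diff_eq minus_divide_divide)
  then show ?thesis unfolding qint_def inverse_inverse_eq by simp
qed

lemma qbinom_inverse: "qbinom (inverse t) n k = qbinom t n k"
  by (simp add: qbinom_def qint_inverse)

lemma qbinom_sym: "k \<le> n \<Longrightarrow> qbinom t n (n - k) = qbinom t n k"
  by (simp add: qbinom_def mult.commute)

context scalar_algebra
begin

text \<open>The q-binomial theorem for the product of the commuting operators T -> f T - b t^(2l) T
  f with l < m: the k-th coefficient is a Gaussian binomial times the k-th power of -b
  t^(m-1).\<close>

lemma qcomm_expand:
  assumes t: "t \<noteq> 0" "\<And>k. k > 0 \<Longrightarrow> t ^ k \<noteq> 1"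
  shows "qcomm b t f g m =
    (\<Sum>k\<le>m. \<sigma> ((- 1) ^ k * (b * t ^ m / t) ^ k * qbinom t m k) * f ^ (m - k) * g * f ^ k)"
proof (induction m)
  case 0
  show ?case using qbinom_0[OF t, of 0] by (simp add: sc_one)
next
  case (Suc m)
  define C where "C m k = (- 1) ^ k * (b * t ^ m / t) ^ k * qbinom t m k" for m k
  have IH: "qcomm b t f g m = (\<Sum>k\<le>m. \<sigma> (C m k) * f ^ (m - k) * g * f ^ k)"
    using Suc.IH by (simp add: C_def)
  have rec: "C (Suc m) k = C m k - b * t ^ (2 * m) * C m (k - 1)" if kk: "1 \<le> k" "k \<le> m" for k
  proof -
    obtain l where l: "k = Suc l" using kk by (cases k) auto
    define d where "d = m - k"
    have m: "m = d + Suc l" using kk l d_def by auto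
    have Q: "qbinom t (Suc m) k = inverse t ^ k * qbinom t m k + t ^ (Suc d) * qbinom t m l"
    proof -
      have e: "Suc m - k = Suc d" "k - 1 = l" using m l by auto
      show ?thesis by (rule qbinom_Pascal[OF t kk, unfolded e])
    qed
    have a: "(b * t ^ Suc m / t) ^ k * inverse t ^ k = (b * t ^ m / t) ^ k"
    proof -
      have "b * t ^ Suc m / t * inverse t = b * t ^ m / t" using t(1) by (simp add: divide_inverse)
      then show ?thesis by (metis power_mult_distrib)
    qed
    have b: "(b * t ^ Suc m / t) ^ k * t ^ (Suc d) = b * t ^ (2 * m) * (b * t ^ m / t) ^ l"
    proof -
      have p: "t ^ Suc m / t = t ^ m" "t ^ m / t = t ^ (d + l)" using t(1) m by (auto simp: field_simps)
      have "(b * t ^ Suc m / t) ^ k * t ^ Suc d = (b * t ^ m) ^ Suc l * t ^ Suc d"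
        by (simp only: l times_divide_eq_right[symmetric] p)
      also have "\<dots> = b * b ^ l * (t ^ m * (t ^ m) ^ l * t ^ Suc d)"
        by (simp add: power_mult_distrib)
      also have "t ^ m * (t ^ m) ^ l * t ^ Suc d = t ^ (2 * m) * (t ^ (d + l)) ^ l"
      proof -
        have "m + m * l + Suc d = 2 * m + (d + l) * l" by (simp add: m algebra_simps)
        then show ?thesis by (simp only: power_mult[symmetric] power_add[symmetric])
      qed
      also have "b * b ^ l * (t ^ (2 * m) * (t ^ (d + l)) ^ l) = b * t ^ (2 * m) * (b * t ^ m / t) ^ l"
        by (simp only: times_divide_eq_right[symmetric] p power_mult_distrib) (simp add: mult_ac)
      finally show ?thesis .
    qed
    have "C (Suc m) k = (- 1) ^ k * ((b * t ^ Suc m / t) ^ k * inverse t ^ k) * qbinom t m k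
        + (- 1) ^ k * ((b * t ^ Suc m / t) ^ k * t ^ (Suc d)) * qbinom t m l"
      by (simp only: C_def Q) (simp add: algebra_simps)
    also have "\<dots> = C m k - b * t ^ (2 * m) * C m (k - 1)"
      unfolding a b by (simp add: C_def l)
    finally show ?thesis .
  qed
  have C0: "C n 0 = 1" for n using qbinom_0[OF t] by (simp add: C_def)
  have Cl: "C (Suc m) (Suc m) = - b * t ^ (2 * m) * C m m"
  proof -
    have "(t ^ m) ^ m = t ^ m * (t ^ m / t) ^ m"
      using t(1) by (simp add: power_divide)
    moreover have "t ^ (2 * m) = t ^ m * t ^ m" by (simp add: mult_2 power_add)
    ultimately show ?thesis
      unfolding C_def using t(1) qbinom_0(2)[OF t, of m] qbinom_0(2)[OF t, of "Suc m"]
      by (simp add: power_mult_distrib power_divide)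
  qed
  define X where "X k = f ^ (Suc m - k) * g * f ^ k" for k
  have left: "f * qcomm b t f g m = (\<Sum>k\<le>m. \<sigma> (C m k) * X k)"
    unfolding IH sum_distrib_left
    by (rule sum.cong) (auto simp: X_def Suc_diff_le mult.assoc sc_left)
  have right: "\<sigma> (b * t ^ (2 * m)) * qcomm b t f g m * f =
      (\<Sum>k\<le>m. \<sigma> (b * t ^ (2 * m) * C m k) * X (Suc k))"
    unfolding IH sum_distrib_left sum_distrib_right
    by (rule sum.cong) (auto simp: X_def mult.assoc sc_mult power_commutes[symmetric])
  have "qcomm b t f g (Suc m) = (\<Sum>k\<le>m. \<sigma> (C m k) * X k)
      - (\<Sum>k\<le>m. \<sigma> (b * t ^ (2 * m) * C m k) * X (Suc k))"
    by (simp only: qcomm.simps left right)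
  also have "(\<Sum>k\<le>m. \<sigma> (C m k) * X k) = X 0 + (\<Sum>k=1..m. \<sigma> (C m k) * X k)"
    by (simp add: atMost_atLeast0 sum.atLeast_Suc_atMost C0 sc_one)
  also have "(\<Sum>k\<le>m. \<sigma> (b * t ^ (2 * m) * C m k) * X (Suc k))
      = (\<Sum>k=1..Suc m. \<sigma> (b * t ^ (2 * m) * C m (k - 1)) * X k)"
    unfolding atMost_atLeast0 One_nat_def
    by (subst sum.shift_bounds_cl_Suc_ivl) simp
  also have "\<dots> = (\<Sum>k=1..m. \<sigma> (b * t ^ (2 * m) * C m (k - 1)) * X k)
      + \<sigma> (b * t ^ (2 * m) * C m m) * X (Suc m)"
    by simp
  finally have "qcomm b t f g (Suc m) = X 0
      + (\<Sum>k=1..m. \<sigma> (C m k) * X k - \<sigma> (b * t ^ (2 * m) * C m (k - 1)) * X k)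
      - \<sigma> (b * t ^ (2 * m) * C m m) * X (Suc m)"
    by (simp add: sum_subtractf)
  also have "(\<Sum>k=1..m. \<sigma> (C m k) * X k - \<sigma> (b * t ^ (2 * m) * C m (k - 1)) * X k)
      = (\<Sum>k=1..m. \<sigma> (C (Suc m) k) * X k)"
    by (rule sum.cong) (auto simp: rec sc_diff left_diff_distrib)
  also have "X 0 + (\<Sum>k=1..m. \<sigma> (C (Suc m) k) * X k) - \<sigma> (b * t ^ (2 * m) * C m m) * X (Suc m)
      = (\<Sum>k\<le>Suc m. \<sigma> (C (Suc m) k) * X k)"
    by (simp add: atMost_atLeast0 sum.atLeast_Suc_atMost[of 0] C0 sc_one Cl sc_minus)
  finally show ?case by (simp add: C_def X_def mult.assoc)
qed

lemma qserre_eq_qcomm: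
  assumes t: "t \<noteq> 0" "\<And>k. k > 0 \<Longrightarrow> t ^ k \<noteq> 1" and b: "b * t ^ (n - 1) = 1" "n \<ge> 1"
  shows "qserre t n f g = qcomm b t f g n"
proof -
  have "b * t ^ n / t = 1" using b t(1) by (cases n) auto
  then show ?thesis by (simp add: qcomm_expand[OF t] qserre_def)
qed

text \<open>The scalars b t^(2l) with l < n are t^(1-n), t^(3-n), ..., t^(n-1), a set stable under
  inversion. So the same polynomial is also the iterated commutator with the factors in the opposite
  order; the proof uses that Gaussian binomials do not change under t -> 1/t.\<close>

lemma qserre_eq_qcomm':
  assumes t: "t \<noteq> 0" "\<And>k. k > 0 \<Longrightarrow> t ^ k \<noteq> 1" and b: "b * t ^ (n - 1) = 1" "n \<ge> 1"
  shows "qserre t n f g = qcomm (inverse b) (inverse t) f g n"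
proof -
  have t': "inverse t \<noteq> 0" "\<And>k. k > 0 \<Longrightarrow> inverse t ^ k \<noteq> 1" using t by (auto simp: field_simps)
  have b': "inverse b * inverse t ^ (n - 1) = 1"
    using b by (metis inverse_1 inverse_mult_distrib power_inverse)
  have "qserre t n f g = qserre (inverse t) n f g"
    by (simp add: qserre_def qbinom_inverse)
  also have "\<dots> = qcomm (inverse b) (inverse t) f g n"
    by (rule qserre_eq_qcomm[OF t' b' b(2)])
  finally show ?thesis .
qed

lemma qserre_add: "qserre t n f (g + h) = qserre t n f g + qserre t n f h"
  by (simp add: qserre_def algebra_simps sum.distrib)

end

text \<open>Ideals are plain sets and quotients are congruences \<open>x - y \<in> H\<close>; the
  same lemmas then serve the relation ideal and the ideal \<open>hopf\<close> of the tensor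
  square.\<close>

definition two_sided :: "'a::ring_1 set \<Rightarrow> bool" where
  "two_sided H \<longleftrightarrow> 0 \<in> H \<and> (\<forall>x\<in>H. \<forall>y\<in>H. x + y \<in> H) \<and> (\<forall>a. \<forall>x\<in>H. a * x \<in> H \<and> x * a \<in> H)"

lemma two_sidedD:
  assumes "two_sided H"
  shows "0 \<in> H" "x \<in> H \<Longrightarrow> y \<in> H \<Longrightarrow> x + y \<in> H" "x \<in> H \<Longrightarrow> a * x \<in> H" "x \<in> H \<Longrightarrow> x * a \<in> H"
    "x \<in> H \<Longrightarrow> - x \<in> H" "x \<in> H \<Longrightarrow> y \<in> H \<Longrightarrow> x - y \<in> H"
proof -
  show *: "x \<in> H \<Longrightarrow> - x \<in> H" for x
    using assms unfolding two_sided_def by (metis mult_minus1)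
  show "x \<in> H \<Longrightarrow> y \<in> H \<Longrightarrow> x - y \<in> H"
    using assms * unfolding two_sided_def by (metis diff_conv_add_uminus)
qed (use assms in \<open>auto simp: two_sided_def\<close>)

lemma two_sided_cong_mult:
  assumes "two_sided H" "x - x' \<in> H" "y - y' \<in> H"
  shows "x * y - x' * y' \<in> H"
proof -
  have "x * y - x' * y' = (x - x') * y + x' * (y - y')" by (simp add: algebra_simps)
  then show ?thesis using two_sidedD[OF assms(1)] assms(2,3) by metis
qed

lemma two_sided_cong_add:
  assumes "two_sided H" "x - x' \<in> H" "y - y' \<in> H"
  shows "(x + y) - (x' + y') \<in> H" "(x - y) - (x' - y') \<in> H"
proof -
  have "(x + y) - (x' + y') = (x - x') + (y - y')" "(x - y) - (x' - y') = (x - x') - (y - y')"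
    by (simp_all add: algebra_simps)
  then show "(x + y) - (x' + y') \<in> H" "(x - y) - (x' - y') \<in> H"
    using two_sidedD[OF assms(1)] assms(2,3) by metis+
qed

lemma two_sided_cong_trans:
  assumes "two_sided H" "x - y \<in> H" "y - z \<in> H"
  shows "x - z \<in> H"
  using two_sidedD(2)[OF assms] by simp

lemma two_sided_cong_sym: "two_sided H \<Longrightarrow> x - y \<in> H \<Longrightarrow> y - x \<in> H"
  using two_sidedD(5)[of H "x - y"] by simp

context scalar_algebra
begin

text \<open>By \<open>aux\<close>, g passes T_m = \<open>qcomm b t f f' m\<close> with exactly the
  factor b t^(2m) that the next commutator puts on T_m g, so the contributions of g cancel at every
  step.\<close>

lemma qcomm_skew:
  assumes H: "two_sided H"
    and gf: "g * f - \<sigma> (t ^ 2) * f * g \<in> H" and gf': "g * f' - \<sigma> b * f' * g \<in> H"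
  shows "qcomm b t (f + g) f' m - qcomm b t f f' m \<in> H"
proof -
  note D = two_sidedD[OF H]
  have aux: "g * qcomm b t f f' m - \<sigma> (b * t ^ (2 * m)) * qcomm b t f f' m * g \<in> H" for m
  proof (induction m)
    case 0 then show ?case using gf' by simp
  next
    case (Suc m)
    define T where "T = qcomm b t f f' m"
    define p where "p = b * t ^ (2 * m)"
    have p2: "b * t ^ (2 * Suc m) = t ^ 2 * p" by (simp add: p_def power2_eq_square)
    have IH: "g * T - \<sigma> p * T * g \<in> H" using Suc by (simp add: T_def p_def)
    have "g * (f * T - \<sigma> p * T * f) - \<sigma> (t ^ 2 * p) * (f * T - \<sigma> p * T * f) * g
      = (g * f - \<sigma> (t ^ 2) * f * g) * T + \<sigma> (t ^ 2) * f * (g * T - \<sigma> p * T * g)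
       - \<sigma> p * (g * T - \<sigma> p * T * g) * f - \<sigma> p * \<sigma> p * T * (g * f - \<sigma> (t ^ 2) * f * g)"
      by (simp add: sm_simps algebra_simps)
    also have "\<dots> \<in> H" by (intro D(2,6) D(3) D(4) IH gf)
    finally show ?case by (simp only: T_def[symmetric] p2 qcomm.simps p_def[symmetric])
  qed
  show ?thesis
  proof (induction m)
    case 0 then show ?case using D by simp
  next
    case (Suc m)
    define T where "T = qcomm b t f f' m"
    define T' where "T' = qcomm b t (f + g) f' m"
    define p where "p = b * t ^ (2 * m)"
    have IH: "T' - T \<in> H" using Suc by (simp add: T_def T'_def)
    have "(f + g) * T' - \<sigma> p * T' * (f + g) - (f * T - \<sigma> p * T * f)
      = (f + g) * (T' - T) - \<sigma> p * (T' - T) * (f + g) + (g * T - \<sigma> p * T * g)"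
      by (simp add: algebra_simps)
    also have "\<dots> \<in> H"
      by (intro D(2)[OF D(6)[OF D(3)[OF IH] D(4)[OF D(3)[OF IH]]]]) (use aux[of m] in \<open>simp add: T_def p_def\<close>)
    finally show ?case by (simp add: T_def p_def T'_def)
  qed
qed

text \<open>Since the factors \<open>T \<mapsto> f T - p\<^sub>m T f\<close> commute, they may be applied in either order; one order
  kills the mixed terms with \<open>f'\<close>, the other those with \<open>g'\<close>.\<close>

lemma qserre_skew_primitive:
  assumes t: "t \<noteq> 0" "\<And>k. k > 0 \<Longrightarrow> t ^ k \<noteq> 1" and b: "b * t ^ (n - 1) = 1" "n \<ge> 1"
    and H: "two_sided H"
    and gf: "g * f - \<sigma> (t ^ 2) * f * g \<in> H" and gf': "g * f' - \<sigma> b * f' * g \<in> H"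
    and g'f: "g' * f - \<sigma> b * f * g' \<in> H"
  shows "qserre t n (f + g) (f' + g') - (qserre t n f f' + qserre t n g g') \<in> H"
proof -
  have b0: "b \<noteq> 0" using b by auto
  \<comment> \<open>The relations in inverted form, as the factors in the opposite order require
    them.\<close>
  have i: "y * x - \<sigma> (inverse c) * x * y \<in> H" if "x * y - \<sigma> c * y * x \<in> H" "c \<noteq> 0" for x y c
  proof -
    have "y * x - \<sigma> (inverse c) * x * y = (- \<sigma> (inverse c)) * (x * y - \<sigma> c * y * x)"
      using that(2) by (simp add: sm_simps)
    then show ?thesis using two_sidedD(3)[OF H that(1)] by metis
  qed
  have 1: "qserre t n (f + g) f' - qserre t n f f' \<in> H"
    using qcomm_skew[OF H gf gf', of n] qserre_eq_qcomm[OF t b] by simp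
  have "qcomm (inverse b) (inverse t) (g + f) g' n - qcomm (inverse b) (inverse t) g g' n \<in> H"
    by (rule qcomm_skew[OF H])
      (use i[OF gf] i[OF g'f] t b0 in \<open>simp_all add: power_inverse\<close>)
  then have 2: "qserre t n (f + g) g' - qserre t n g g' \<in> H"
    using qserre_eq_qcomm'[OF t b] by (simp add: add.commute)
  show ?thesis unfolding qserre_add using two_sided_cong_add(1)[OF H 1 2] .
qed

text \<open>The case of e = E_i against the Serre polynomial of F_i and F_j. Inductively,
  [e, T_(m+1)] is the multiple \<open>\<gamma> (Suc m)\<close> of T_m K. The coefficient
  \<open>\<gamma> n\<close> vanishes: p_l p_(n-1-l) = (b t^(n-1))^2 = 1 makes the summands at l and
  n-1-l opposite.\<close>

lemma qserre_commutes_same: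
  assumes t: "t \<noteq> 0" "\<And>k. k > 0 \<Longrightarrow> t ^ k \<noteq> 1" and b: "b * t ^ (n - 1) = 1" "n \<ge> 1"
    and Ef: "e * f - f * e = \<sigma> c * (K - K')" and Ef': "e * f' = f' * e"
    and Kf: "K * f = \<sigma> (inverse t ^ 2) * f * K" "K' * f = \<sigma> (t ^ 2) * f * K'"
    and Kf': "K * f' = \<sigma> (inverse b) * f' * K" "K' * f' = \<sigma> b * f' * K'"
  shows "e * qserre t n f f' = qserre t n f f' * e"
proof -
  have b0: "b \<noteq> 0" using b by auto
  define T where "T = qcomm b t f f'"
  define p where "p m = b * t ^ (2 * m)" for m
  have p0: "p m \<noteq> 0" for m using b0 t by (simp add: p_def)
  have pS: "p (Suc m) = t ^ 2 * p m" for m by (simp add: p_def power2_eq_square)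
  have T: "T 0 = f'" "T (Suc m) = f * T m - \<sigma> (p m) * T m * f" for m by (simp_all add: T_def p_def)
  have KT: "K * T m = \<sigma> (inverse (p m)) * T m * K" for m
  proof (induction m)
    case (Suc m)
    have "K * T (Suc m) = K * f * T m - \<sigma> (p m) * (K * T m) * f"
      by (simp add: T sm_simps algebra_simps)
    also have "\<dots> = \<sigma> (inverse t ^ 2) * f * (K * T m) - \<sigma> (p m) * (\<sigma> (inverse (p m)) * T m * (K * f))"
      by (simp add: Kf Suc mult.assoc)
    also have "\<dots> = \<sigma> (inverse (p (Suc m))) * T (Suc m) * K"
      unfolding Suc Kf T pS by (simp add: sm_simps algebra_simps field_simps)
    finally show ?case .
  qed (simp add: T Kf' p_def)
  have K'T: "K' * T m = \<sigma> (p m) * T m * K'" for m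
  proof (induction m)
    case (Suc m)
    have "K' * T (Suc m) = K' * f * T m - \<sigma> (p m) * (K' * T m) * f"
      by (simp add: T sm_simps algebra_simps)
    also have "\<dots> = \<sigma> (t ^ 2) * f * (K' * T m) - \<sigma> (p m) * (\<sigma> (p m) * T m * (K' * f))"
      by (simp add: Kf Suc mult.assoc)
    also have "\<dots> = \<sigma> (p (Suc m)) * T (Suc m) * K'"
      unfolding Suc Kf T pS by (simp add: sm_simps algebra_simps)
    finally show ?case .
  qed (simp add: T Kf' p_def)
  define \<gamma> where "\<gamma> m = (\<Sum>l<m. (inverse (p l) - p l) * c)" for m
  have main: "e * T (Suc m) - T (Suc m) * e = \<sigma> (\<gamma> (Suc m)) * T m * K" for m
  proof -
    have step: "e * T (Suc m) - T (Suc m) * e = \<sigma> ((inverse (p m) - p m) * c) * T m * K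
        + (f * (e * T m - T m * e) - \<sigma> (p m) * (e * T m - T m * e) * f)" for m
    proof -
      have "e * T (Suc m) - T (Suc m) * e = (e * f - f * e) * T m - \<sigma> (p m) * T m * (e * f - f * e)
        + (f * (e * T m - T m * e) - \<sigma> (p m) * (e * T m - T m * e) * f)"
        by (simp add: T sm_simps algebra_simps)
      also have "(e * f - f * e) * T m - \<sigma> (p m) * T m * (e * f - f * e)
        = \<sigma> c * (K * T m - K' * T m) - \<sigma> (p m) * T m * (\<sigma> c * (K - K'))"
        by (simp add: Ef algebra_simps)
      also have "\<dots> = \<sigma> ((inverse (p m) - p m) * c) * T m * K"
        unfolding KT K'T by (simp add: sm_simps algebra_simps)
      finally show ?thesis .
    qed
    show ?thesis
    proof (induction m)
      case 0
      show ?case using step[of 0] by (simp add: T Ef' \<gamma>_def)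
    next
      case (Suc m)
      have "e * T (Suc (Suc m)) - T (Suc (Suc m)) * e = \<sigma> ((inverse (p (Suc m)) - p (Suc m)) * c) * T (Suc m) * K
        + (f * (\<sigma> (\<gamma> (Suc m)) * T m * K) - \<sigma> (p (Suc m)) * (\<sigma> (\<gamma> (Suc m)) * T m * K) * f)"
        using step[of "Suc m"] by (simp only: Suc)
      also have "f * (\<sigma> (\<gamma> (Suc m)) * T m * K) - \<sigma> (p (Suc m)) * (\<sigma> (\<gamma> (Suc m)) * T m * K) * f
        = \<sigma> (\<gamma> (Suc m)) * (f * T m * K - \<sigma> (p (Suc m)) * T m * (K * f))"
        by (simp add: sm_simps algebra_simps)
      also have "f * T m * K - \<sigma> (p (Suc m)) * T m * (K * f) = T (Suc m) * K"
        unfolding Kf pS using t(1) by (simp add: T sm_simps algebra_simps field_simps)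
      finally show ?case
        by (simp add: \<gamma>_def algebra_simps sc_add sc_diff mult.assoc)
    qed
  qed
  have "\<gamma> n = 0"
  proof -
    have pr: "p (n - 1 - l) = inverse (p l)" if "l < n" for l
    proof -
      have "p (n - 1 - l) * p l = b * b * t ^ (2 * (n - 1 - l) + 2 * l)" by (simp add: p_def power_add mult_ac)
      also have "2 * (n - 1 - l) + 2 * l = (n - 1) + (n - 1)" using that by simp
      also have "b * b * t ^ ((n - 1) + (n - 1)) = (b * t ^ (n - 1)) * (b * t ^ (n - 1))"
        by (simp only: power_add mult_ac)
      finally have "p (n - 1 - l) * p l = 1" using b by simp
      then show ?thesis using p0[of l] by (simp add: field_simps)
    qed
    have "\<gamma> n = (\<Sum>l<n. (inverse (p (n - 1 - l)) - p (n - 1 - l)) * c)"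
      unfolding \<gamma>_def by (subst sum.nat_diff_reindex[symmetric]) simp
    also have "\<dots> = (\<Sum>l<n. - ((inverse (p l) - p l) * c))"
      using pr by (intro sum.cong) (auto simp: algebra_simps)
    finally have "\<gamma> n = - \<gamma> n" by (simp add: \<gamma>_def sum_negf)
    then show ?thesis by simp
  qed
  moreover obtain m where "n = Suc m" using b(2) by (cases n) auto
  ultimately have "e * T n - T n * e = 0" using main[of m] by simp
  then show ?thesis by (simp add: qserre_eq_qcomm[OF t b] T_def)
qed

text \<open>The case of e = E_j, where only f' contributes. Then [e, T_m] = c (u_m f^m K - v_m f^m
  K'), and u_n contains the factor 1 - p_0 / b = 0, while v_n contains 1 - p_(n-1) b = 0.\<close>

lemma qserre_commutes_other:
  assumes t: "t \<noteq> 0" "\<And>k. k > 0 \<Longrightarrow> t ^ k \<noteq> 1" and b: "b * t ^ (n - 1) = 1" "n \<ge> 1"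
    and Ef': "e * f' - f' * e = \<sigma> c * (K - K')" and Ef: "e * f = f * e"
    and Kf: "K * f = \<sigma> (inverse b) * f * K" "K' * f = \<sigma> b * f * K'"
  shows "e * qserre t n f f' = qserre t n f f' * e"
proof -
  have b0: "b \<noteq> 0" using b by auto
  define T where "T = qcomm b t f f'"
  define p where "p m = b * t ^ (2 * m)" for m
  have T: "T 0 = f'" "T (Suc m) = f * T m - \<sigma> (p m) * T m * f" for m by (simp_all add: T_def p_def)
  define u v where "u m = (\<Prod>l<m. 1 - p l * inverse b)" and "v m = (\<Prod>l<m. 1 - p l * b)" for m
  have main: "e * T m - T m * e = \<sigma> (u m * c) * f ^ m * K - \<sigma> (v m * c) * f ^ m * K'" for m
  proof (induction m)
    case 0 show ?case by (simp add: T Ef' u_def v_def algebra_simps)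
  next
    case (Suc m)
    have "e * T (Suc m) - T (Suc m) * e
      = f * (e * T m - T m * e) - \<sigma> (p m) * (e * T m - T m * e) * f"
    proof -
      have c: "e * (f * x) = f * (e * x)" for x by (metis Ef mult.assoc)
      show ?thesis by (simp add: T sm_simps algebra_simps c Ef)
    qed
    also have "\<dots> = f * (\<sigma> (u m * c) * f ^ m * K - \<sigma> (v m * c) * f ^ m * K')
       - \<sigma> (p m) * (\<sigma> (u m * c) * f ^ m * (K * f) - \<sigma> (v m * c) * f ^ m * (K' * f))"
      by (simp only: Suc) (simp add: algebra_simps)
    also have "\<dots> = \<sigma> (u (Suc m) * c) * f ^ Suc m * K - \<sigma> (v (Suc m) * c) * f ^ Suc m * K'"
    proof -
      have ff: "f ^ m * (f * x) = f * (f ^ m * x)" for x by (metis mult.assoc power_commutes)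
      show ?thesis unfolding Kf u_def v_def
        by (simp add: sm_simps algebra_simps ff)
    qed
    finally show ?case .
  qed
  obtain m where n: "n = Suc m" using b(2) by (cases n) auto
  have "u n = 0" unfolding u_def n prod.lessThan_Suc_shift
    using b0 by (simp add: p_def)
  moreover have "p m * b = (b * t ^ m) * (b * t ^ m)"
    by (simp add: p_def mult_2 power_add)
  then have "p m * b = 1" using b(1) unfolding n by (metis diff_Suc_1 mult_1)
  then have "v n = 0" unfolding v_def n by simp
  ultimately have "e * T n - T n * e = 0" using main[of n] by simp
  then show ?thesis by (simp add: qserre_eq_qcomm[OF t b] T_def)
qed

lemma qserre_commutes:
  assumes "e * f = f * e" "e * f' = f' * e"
  shows "e * qserre t n f f' = qserre t n f f' * e"
proof -
  have "e * f ^ k = f ^ k * e" for k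
    by (induction k) (simp, metis assms(1) mult.assoc power_Suc)
  then have "e * (\<sigma> c * f ^ k * f' * f ^ l) = \<sigma> c * f ^ k * f' * f ^ l * e" for c k l
    by (metis assms(2) mult.assoc sc_comm)
  then show ?thesis by (simp add: qserre_def sum_distrib_left sum_distrib_right)
qed

end

subsection \<open>Linear extension from a monoid algebra\<close>

lemma pm_expand: "p = (\<Sum>w\<in>Poly_Mapping.keys p. Poly_Mapping.single w (Poly_Mapping.lookup p w))"
  for p :: "'m \<Rightarrow>\<^sub>0 'a::comm_monoid_add"
  by (rule poly_mapping_eqI)
    (auto simp: lookup_sum lookup_single when_def sum.delta in_keys_iff if_distrib cong: if_cong)

lemma pm_induct [case_names zero single add]:
  fixes p :: "'m \<Rightarrow>\<^sub>0 'a::comm_monoid_add"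
  assumes "P 0" "\<And>w c. P (Poly_Mapping.single w c)" "\<And>p q. P p \<Longrightarrow> P q \<Longrightarrow> P (p + q)"
  shows "P p"
proof -
  have "P (\<Sum>w\<in>S. Poly_Mapping.single w (Poly_Mapping.lookup p w))" if "finite S" for S
    using that by (induction S rule: finite_induct) (use assms in auto)
  then show ?thesis using pm_expand[of p] by (metis finite_keys)
qed

lemma const_mult_single: "const c * Poly_Mapping.single w d = Poly_Mapping.single w (c * d)"
  by (simp add: const_def mult_single)

lemma single_conv_const: "Poly_Mapping.single w c = const c * Poly_Mapping.single w 1"
  by (simp add: const_mult_single)

lemma const_comm: "p * const c = const c * p" for p :: "'m::monoid_add \<Rightarrow>\<^sub>0 complex"
  by (induction p rule: pm_induct) (simp_all add: const_def mult_single algebra_simps)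

interpretation cst: scalar_algebra "const :: complex \<Rightarrow> ('m::monoid_add \<Rightarrow>\<^sub>0 complex)"
proof
  fix c d and x :: "'m \<Rightarrow>\<^sub>0 complex"
  show "x * const c = const c * x" by (rule const_comm)
qed (simp_all add: const_def single_add mult_single)

context scalar_algebra
begin

definition lext :: "('m \<Rightarrow> 'a) \<Rightarrow> ('m \<Rightarrow>\<^sub>0 complex) \<Rightarrow> 'a" where
  "lext f p = (\<Sum>w\<in>Poly_Mapping.keys p. \<sigma> (Poly_Mapping.lookup p w) * f w)"

lemma lext_superset:
  "finite S \<Longrightarrow> Poly_Mapping.keys p \<subseteq> S \<Longrightarrow> lext f p = (\<Sum>w\<in>S. \<sigma> (Poly_Mapping.lookup p w) * f w)"
  unfolding lext_def by (rule sum.mono_neutral_left) (auto simp: in_keys_iff)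

lemma lext_zero [simp]: "lext f 0 = 0"
  by (simp add: lext_def)

lemma lext_add: "lext f (p + q) = lext f p + lext f q"
proof -
  let ?S = "Poly_Mapping.keys p \<union> Poly_Mapping.keys q"
  have "lext f x = (\<Sum>w\<in>?S. \<sigma> (Poly_Mapping.lookup x w) * f w)" if "x = p \<or> x = q \<or> x = p + q" for x
    using that keys_add[of p q] by (intro lext_superset) auto
  then show ?thesis by (simp add: lookup_add sc_add distrib_right sum.distrib)
qed

lemma lext_single: "lext f (Poly_Mapping.single w c) = \<sigma> c * f w"
  by (cases "c = 0") (simp_all add: lext_def)

lemma lext_const_mult: "lext f (const c * p) = \<sigma> c * lext f p" for p :: "'m::monoid_add \<Rightarrow>\<^sub>0 complex"
  by (induction p rule: pm_induct)
    (simp_all add: lext_add lext_single const_mult_single distrib_left sc_mult mult.assoc)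

lemma lext_minus: "lext f (- p) = - lext f p"
  using lext_add[of f p "- p"] by (simp add: eq_neg_iff_add_eq_0 add.commute)

lemma lext_diff: "lext f (p - q) = lext f p - lext f q"
  using lext_add[of f p "- q"] by (simp add: lext_minus)

lemma lext_sum: "lext f (\<Sum>i\<in>S. g i) = (\<Sum>i\<in>S. lext f (g i))"
  by (induction S rule: infinite_finite_induct) (simp_all add: lext_add)

lemma lext_unique:
  assumes "\<And>p q. g (p + q) = g p + g q" "\<And>w c. g (Poly_Mapping.single w c) = \<sigma> c * f w"
  shows "g p = lext f p"
proof (induction p rule: pm_induct)
  case zero
  have "g 0 + g 0 = g 0" using assms(1)[of 0 0] by simp
  then show ?case by simp
qed (simp_all add: assms lext_add lext_single)

lemma lext_mult:
  assumes "\<And>v w. f (v + w) = f v * f w"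
  shows "lext f (p * q) = lext f p * lext f q"
proof (induction p rule: pm_induct)
  case (single w c)
  show ?case
    by (induction q rule: pm_induct)
      (simp_all add: mult_single lext_single assms lext_add distrib_left distrib_right sm_simps mult.commute)
qed (simp_all add: distrib_right lext_add)

lemma lext_antimult:
  assumes "\<And>v w. f (v + w) = f w * f v"
  shows "lext f (p * q) = lext f q * lext f p"
proof (induction p rule: pm_induct)
  case (single w c)
  show ?case
    by (induction q rule: pm_induct)
      (simp_all add: mult_single lext_single assms lext_add distrib_left distrib_right sm_simps mult.commute)
qed (simp_all add: algebra_simps lext_add)

lemma lext_one: "f 0 = 1 \<Longrightarrow> lext f 1 = 1"
  using lext_single[of f 0 1] by (simp add: sc_one)

lemma lext_const: "f 0 = 1 \<Longrightarrow> lext f (const c) = \<sigma> c"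
  by (simp add: const_def lext_single)

definition ahom :: "('x \<Rightarrow> 'a) \<Rightarrow> ('x word \<Rightarrow>\<^sub>0 complex) \<Rightarrow> 'a" where
  "ahom \<phi> = lext (\<lambda>w. prod_list (map \<phi> (letters w)))"

lemma ahom_simps:
  "ahom \<phi> (p + q) = ahom \<phi> p + ahom \<phi> q" "ahom \<phi> (p * q) = ahom \<phi> p * ahom \<phi> q"
  "ahom \<phi> 0 = 0" "ahom \<phi> 1 = 1" "ahom \<phi> (const c) = \<sigma> c" "ahom \<phi> (- p) = - ahom \<phi> p"
  "ahom \<phi> (p - q) = ahom \<phi> p - ahom \<phi> q"
  "ahom \<phi> (Poly_Mapping.single (Word [a]) 1) = \<phi> a"
  unfolding ahom_def
  by (simp_all add: lext_add lext_mult lext_one lext_const lext_minus lext_diff lext_single sc_one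
      plus_word_def zero_word_def)

lemma ahom_power: "ahom \<phi> (p ^ k) = ahom \<phi> p ^ k"
  by (induction k) (simp_all add: ahom_simps)

lemma ahom_sum: "ahom \<phi> (\<Sum>i\<in>S. g i) = (\<Sum>i\<in>S. ahom \<phi> (g i))"
  unfolding ahom_def by (rule lext_sum)

lemma ahom_gen: "ahom \<phi> (gen a) = \<phi> a"
  by (simp add: gen_def ahom_simps)

lemma ahom_qserre: "ahom \<phi> (cst.qserre t n f g) = qserre t n (ahom \<phi> f) (ahom \<phi> g)"
  by (simp add: cst.qserre_def qserre_def ahom_sum ahom_simps ahom_power)

lemma ahom_unique:
  assumes "\<And>p q. F (p + q) = F p + F q" "\<And>p q. F (p * q) = F p * F q" "F 1 = 1"
    "\<And>c. F (const c) = \<sigma> c" "\<And>a. F (Poly_Mapping.single (Word [a]) 1) = \<phi> a"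
  shows "F p = ahom \<phi> p"
  unfolding ahom_def
proof (rule lext_unique)
  have m: "F (Poly_Mapping.single (Word u) 1) = prod_list (map \<phi> u)" for u
  proof (induction u)
    case Nil
    then show ?case using assms(3) by (simp add: zero_word_def[symmetric])
  next
    case (Cons a u)
    have "Poly_Mapping.single (Word (a # u)) 1 =
      Poly_Mapping.single (Word [a]) 1 * Poly_Mapping.single (Word u) (1::complex)"
      by (simp add: mult_single plus_word_def)
    then show ?case using Cons assms(2,5) by simp
  qed
  show "F (Poly_Mapping.single w c) = \<sigma> c * prod_list (map \<phi> (letters w))" for w c
    using m[of "letters w"] by (subst single_conv_const) (simp add: assms)
qed (rule assms)

lemma qserre_K:
  assumes "K * f = \<sigma> c * f * K" "K * g = \<sigma> d * g * K"
  shows "K * qserre t n f g = \<sigma> (c ^ n * d) * qserre t n f g * K"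
proof -
  have pw: "K * f ^ k = \<sigma> (c ^ k) * f ^ k * K" for k
  proof (induction k)
    case (Suc k)
    have "K * f ^ Suc k = (K * f) * f ^ k" by (simp add: mult.assoc)
    also have "\<dots> = \<sigma> c * f * (K * f ^ k)" by (simp add: assms mult.assoc)
    finally show ?case unfolding Suc by (simp add: sm_simps mult.commute[of c])
  qed (simp add: sc_one)
  have "K * (\<sigma> e * f ^ (n - k) * g * f ^ k) = \<sigma> (c ^ n * d) * (\<sigma> e * f ^ (n - k) * g * f ^ k) * K"
    if "k \<le> n" for e k
  proof -
    have "K * (\<sigma> e * f ^ (n - k) * g * f ^ k) = \<sigma> e * (K * f ^ (n - k)) * g * f ^ k"
      by (simp add: sc_left mult.assoc)
    also have "\<dots> = \<sigma> e * \<sigma> (c ^ (n - k)) * f ^ (n - k) * (K * g) * f ^ k"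
      by (simp add: pw mult.assoc)
    also have "\<dots> = \<sigma> e * \<sigma> (c ^ (n - k)) * f ^ (n - k) * \<sigma> d * g * (K * f ^ k)"
      by (simp add: assms mult.assoc)
    also have "\<dots> = \<sigma> (c ^ (n - k) * c ^ k * d) * (\<sigma> e * f ^ (n - k) * g * f ^ k) * K"
      by (simp add: pw sm_simps mult.commute mult.left_commute)
    also have "c ^ (n - k) * c ^ k = c ^ n" using that by (simp add: power_add[symmetric])
    finally show ?thesis .
  qed
  then show ?thesis by (simp add: qserre_def sum_distrib_left sum_distrib_right)
qed

end

lemma free_hom_eq_ahom: "free_hom \<phi> p = cst.ahom \<phi> p"
  by (simp add: free_hom_def cst.ahom_def cst.lext_def)

lemma free_antihom_eq_lext:
  "free_antihom \<phi> p = cst.lext (\<lambda>w. prod_list (rev (map \<phi> (letters w)))) p"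
  by (simp add: free_antihom_def cst.lext_def)

subsection \<open>The ring of linear operators on a monoid algebra\<close>

text \<open>Linear endomorphisms form a type of class \<open>ring_1\<close>, so that the Serre
  identities above apply verbatim to the operators by which the K_i, E_i and F_i act on a Verma
  module.\<close>

typedef (overloaded) ('m::monoid_add) lop =
  "{f :: ('m \<Rightarrow>\<^sub>0 complex) \<Rightarrow> ('m \<Rightarrow>\<^sub>0 complex).
     (\<forall>x y. f (x + y) = f x + f y) \<and> (\<forall>c x. f (const c * x) = const c * f x)}"
  morphisms app Abs_lop
  by (rule exI[of _ "\<lambda>x. x"]) auto

setup_lifting type_definition_lop

lemma app_add: "app f (x + y) = app f x + app f y" and app_const: "app f (const c * x) = const c * app f x"
  using app[of f] by auto

lemma app_sm: "app f (cst.sm c x) = cst.sm c (app f x)"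
  by (simp add: cst.sm_def app_const)

lemma app_zero [simp]: "app f 0 = 0"
  using app_add[of f 0 0] by simp

lemma app_minus: "app f (- x) = - app f x"
  using app_add[of f x "- x"] by (simp add: eq_neg_iff_add_eq_0 add.commute)

instantiation lop :: (monoid_add) ring_1
begin

lift_definition zero_lop :: "'a lop" is "\<lambda>x. 0" by simp
lift_definition one_lop :: "'a lop" is "\<lambda>x. x" by simp
lift_definition plus_lop :: "'a lop \<Rightarrow> 'a lop \<Rightarrow> 'a lop" is "\<lambda>f g x. f x + g x"
  by (simp add: algebra_simps)
lift_definition minus_lop :: "'a lop \<Rightarrow> 'a lop \<Rightarrow> 'a lop" is "\<lambda>f g x. f x - g x"
  by (simp add: algebra_simps)
lift_definition uminus_lop :: "'a lop \<Rightarrow> 'a lop" is "\<lambda>f x. - f x"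
  by (simp add: algebra_simps)
lift_definition times_lop :: "'a lop \<Rightarrow> 'a lop \<Rightarrow> 'a lop" is "\<lambda>f g x. f (g x)"
  by simp

instance
proof
  show "(0::'a lop) \<noteq> 1"
  proof
    assume "(0::'a lop) = 1"
    then have "app (0::'a lop) 1 = app 1 1" by simp
    then show False by (simp add: zero_lop.rep_eq one_lop.rep_eq)
  qed
qed (transfer; auto simp: algebra_simps fun_eq_iff)+

end

lemmas app_simps = zero_lop.rep_eq one_lop.rep_eq plus_lop.rep_eq minus_lop.rep_eq
  uminus_lop.rep_eq times_lop.rep_eq

definition lmul :: "('m::monoid_add \<Rightarrow>\<^sub>0 complex) \<Rightarrow> 'm lop" where
  "lmul p = Abs_lop (\<lambda>x. p * x)"

definition lscal :: "complex \<Rightarrow> 'm::monoid_add lop" where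
  "lscal c = Abs_lop (\<lambda>x. const c * x)"

definition lin_op :: "('m::monoid_add \<Rightarrow> ('m \<Rightarrow>\<^sub>0 complex)) \<Rightarrow> 'm lop" where
  "lin_op f = Abs_lop (cst.lext f)"

lemma app_lmul: "app (lmul p) x = p * x"
  unfolding lmul_def by (subst Abs_lop_inverse) (auto simp: algebra_simps cst.sc_left)

lemma app_lscal: "app (lscal c) x = const c * x"
  unfolding lscal_def
  by (subst Abs_lop_inverse) (auto simp: distrib_left cst.sc_merge mult.commute)

lemma app_lin_op: "app (lin_op f) x = cst.lext f x"
  unfolding lin_op_def by (subst Abs_lop_inverse) (auto simp: cst.lext_add cst.lext_const_mult)

lemma lop_eqI:
  assumes "\<And>w. app f (Poly_Mapping.single w 1) = app g (Poly_Mapping.single w 1)"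
  shows "f = g"
proof -
  have "app f p = app g p" for p
  proof (induction p rule: pm_induct)
    case (single w c)
    show ?case by (subst (1 2) single_conv_const) (simp add: app_const assms)
  qed (simp_all add: app_add)
  then show ?thesis by (simp add: app_inject[symmetric] fun_eq_iff)
qed

lemma lop_ext: "(\<And>x. app f x = app g x) \<Longrightarrow> f = g"
  by (rule lop_eqI)

interpretation lops: scalar_algebra "lscal :: complex \<Rightarrow> 'm::monoid_add lop"
proof
  fix c d and x :: "'m lop"
  show "lscal (c + d) = (lscal c + lscal d :: 'm lop)"
    by (rule lop_ext) (simp add: app_simps app_lscal cst.sc_add distrib_right)
  show "lscal (c * d) = (lscal c * lscal d :: 'm lop)"
    by (rule lop_ext) (simp add: app_simps app_lscal cst.sc_mult mult.assoc)
  show "lscal 1 = (1 :: 'm lop)"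
    by (rule lop_ext) (simp add: app_simps app_lscal cst.sc_one)
  show "x * lscal c = lscal c * x"
    by (rule lop_ext) (simp add: app_simps app_lscal app_const)
qed

lemma lmul_simps: "lmul (p + q) = lmul p + lmul q" "lmul (p * q) = lmul p * lmul q" "lmul 1 = 1"
  "lmul (const c) = lscal c"
  by (rule lop_ext, simp add: app_simps app_lmul app_lscal algebra_simps)+

lemma lmul_sum: "lmul (\<Sum>i\<in>S. g i) = (\<Sum>i\<in>S. lmul (g i))"
proof -
  have "lmul (0 :: 'a \<Rightarrow>\<^sub>0 complex) = 0" by (rule lop_ext) (simp add: app_lmul app_simps)
  then show ?thesis by (induction S rule: infinite_finite_induct) (simp_all add: lmul_simps)
qed

lemma lmul_qserre: "lmul (cst.qserre t n f g) = lops.qserre t n (lmul f) (lmul g)"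
proof -
  have "lmul (p ^ k) = lmul p ^ k" for p :: "'a \<Rightarrow>\<^sub>0 complex" and k
    by (induction k) (simp_all add: lmul_simps)
  then show ?thesis by (simp add: cst.qserre_def lops.qserre_def lmul_sum lmul_simps)
qed

subsection \<open>The quantized enveloping algebra as a quotient of a free algebra\<close>

lemma ring_free_alg: "ring free_alg"
  by (rule ringI, unfold_locales)
    (auto simp: free_alg_def algebra_simps Units_def intro: exI[of _ "- x" for x] eq_neg_iff_add_eq_0)

definition rel_ideal :: "('g, 'i) qflag \<Rightarrow> 'i falg set" where
  "rel_ideal D = Idl\<^bsub>free_alg\<^esub> (uq_rels D)"

lemma ideal_rel_ideal: "ideal (rel_ideal D) free_alg"
  unfolding rel_ideal_def
  by (rule ring.genideal_ideal[OF ring_free_alg]) (simp add: free_alg_def)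

lemma two_sided_rel_ideal: "two_sided (rel_ideal D)"
proof -
  interpret ideal "rel_ideal D" free_alg by (rule ideal_rel_ideal)
  show ?thesis unfolding two_sided_def
    using additive_subgroup.a_closed[OF is_additive_subgroup]
      additive_subgroup.zero_closed[OF is_additive_subgroup] I_l_closed I_r_closed
    by (auto simp: free_alg_def)
qed

lemma rels_in_rel_ideal: "uq_rels D \<subseteq> rel_ideal D"
  unfolding rel_ideal_def
  by (rule ring.genideal_self[OF ring_free_alg]) (simp add: free_alg_def)

lemma two_sided_ideal: "two_sided H \<Longrightarrow> ideal H free_alg"
  for H :: "'i falg set"
proof -
  assume H: "two_sided H"
  note d = two_sidedD[OF H]
  interpret ring "free_alg :: 'i falg ring" by (rule ring_free_alg)
  have inv: "inv\<^bsub>add_monoid free_alg\<^esub> x = - x" for x :: "'i falg"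
  proof -
    have "\<ominus>\<^bsub>free_alg\<^esub> x = - x"
      by (rule add.inv_equality[symmetric, unfolded a_inv_def[symmetric], THEN sym])
        (auto simp: free_alg_def)
    then show ?thesis by (simp add: a_inv_def)
  qed
  show ?thesis
  proof (rule idealI[OF ring_free_alg])
    show "subgroup H (add_monoid free_alg)"
      by (rule group.subgroupI[OF add.is_group])
        (use d inv in \<open>auto simp: free_alg_def\<close>)
  qed (use d in \<open>auto simp: free_alg_def\<close>)
qed

lemma rel_ideal_minimal:
  assumes "two_sided H" "uq_rels D \<subseteq> H"
  shows "rel_ideal D \<subseteq> H"
  unfolding rel_ideal_def
  by (rule ring.genideal_minimal[OF ring_free_alg two_sided_ideal[OF assms(1)] assms(2)])

lemma Uq_ring: "ring (Uq D)"
  using ideal.quotient_is_ring[OF ideal_rel_ideal] by (simp add: Uq_def rel_ideal_def)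

lemma ucl_alt: "ucl D p = {i + p | i. i \<in> rel_ideal D}"
  unfolding ucl_def rel_ideal_def[symmetric] a_r_coset_def r_coset_def by (auto simp: free_alg_def)

lemma ucl_iff: "p \<in> ucl D q \<longleftrightarrow> p - q \<in> rel_ideal D"
  by (auto simp: ucl_alt) (metis diff_add_cancel)

lemma ucl_self: "p \<in> ucl D p"
  using two_sidedD(1)[OF two_sided_rel_ideal] by (simp add: ucl_iff)

lemma ucl_eq: "ucl D p = ucl D q \<longleftrightarrow> p - q \<in> rel_ideal D"
proof
  assume "ucl D p = ucl D q" then show "p - q \<in> rel_ideal D" using ucl_self ucl_iff by metis
next
  assume a: "p - q \<in> rel_ideal D"
  note t = two_sided_cong_trans[OF two_sided_rel_ideal] two_sided_cong_sym[OF two_sided_rel_ideal]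
  show "ucl D p = ucl D q"
    by (auto simp: set_eq_iff ucl_iff intro: t(1)[OF _ a] t(1)[OF _ t(2)[OF a]])
qed

lemma carrier_Uq: "carrier (Uq D) = range (ucl D)"
  by (auto simp: Uq_def FactRing_def A_RCOSETS_def RCOSETS_def ucl_def a_r_coset_def free_alg_def)

lemma ucl_closed [simp]: "ucl D p \<in> carrier (Uq D)"
  by (simp add: carrier_Uq)

lemma ucl_hom: "ucl D \<in> ring_hom free_alg (Uq D)"
  using ideal.rcos_ring_hom[OF ideal_rel_ideal, of D]
  by (simp add: Uq_def rel_ideal_def ucl_def[abs_def])

lemma ucl_add: "ucl D (p + q) = ucl D p \<oplus>\<^bsub>Uq D\<^esub> ucl D q"
  and ucl_mult: "ucl D (p * q) = ucl D p \<otimes>\<^bsub>Uq D\<^esub> ucl D q"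
  and ucl_one: "ucl D 1 = \<one>\<^bsub>Uq D\<^esub>"
  using ring_hom_add[OF ucl_hom, of p q D] ring_hom_mult[OF ucl_hom, of p q D] ring_hom_one[OF ucl_hom, of D]
  by (simp_all add: free_alg_def)

lemma ucl_zero: "ucl D 0 = \<zero>\<^bsub>Uq D\<^esub>"
proof -
  interpret ring "Uq D" by (rule Uq_ring)
  show ?thesis using ucl_add[of D 0 0] add.l_cancel_one[of "ucl D 0" "ucl D 0"] by simp
qed

lemma ucl_minus: "ucl D (- p) = \<ominus>\<^bsub>Uq D\<^esub> ucl D p"
proof -
  interpret ring "Uq D" by (rule Uq_ring)
  show ?thesis using ucl_add[of D "- p" p] by (simp add: ucl_zero minus_equality)
qed

lemma ucl_eq_zero: "ucl D p = \<zero>\<^bsub>Uq D\<^esub> \<longleftrightarrow> p \<in> rel_ideal D"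
  using ucl_eq[of D p 0] by (simp add: ucl_zero)

lemma the_elem_image_eq:
  assumes "\<And>x. x \<in> A \<Longrightarrow> f x = y" "A \<noteq> {}"
  shows "the_elem (f ` A) = y"
proof -
  have "f ` A = {y}" using assms by auto
  then show ?thesis by simp
qed

text \<open>Descent to the quotient: once f preserves \<open>rel_ideal\<close>, all representatives
  give the same class, and \<open>the_elem\<close> picks it.\<close>

lemma the_elem_ucl:
  assumes "\<And>p. p \<in> rel_ideal D \<Longrightarrow> f p \<in> rel_ideal D" "\<And>p q. f (p - q) = f p - f q"
  shows "the_elem ((\<lambda>p. ucl D (f p)) ` ucl D q) = ucl D (f q)"
proof (rule the_elem_image_eq)
  show "ucl D (f p) = ucl D (f q)" if "p \<in> ucl D q" for p
    using assms(1)[of "p - q"] that by (simp add: ucl_iff ucl_eq assms(2))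
qed (use ucl_self in blast)

subsection \<open>Integral quantum data\<close>

definition bq :: "('g, 'i) qflag \<Rightarrow> 'i \<Rightarrow> 'i \<Rightarrow> complex" where
  "bq D i j = qpow D (frm D (simp_root D i) (simp_root D j))"

text \<open>For distinct i and j this is 1 - a_ij with a nonpositive Cartan integer a_ij, so
  \<open>nat\<close> truncates nothing.\<close>

definition nq :: "('g, 'i) qflag \<Rightarrow> 'i \<Rightarrow> 'i \<Rightarrow> nat" where
  "nq D i j = nat (1 - \<lfloor>Re (coroot_pairing D (simp_root D j) (simp_root D i))\<rfloor>)"

lemma qpow_of_int: "qpow D (of_int k) = qpar D powi k"
  by (simp add: qpow_def)

lemma qpow_minus: "z \<in> \<int> \<Longrightarrow> qpow D (- z) = inverse (qpow D z)"
  by (elim Ints_cases) (simp add: qpow_of_int power_int_minus flip: of_int_minus)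

text \<open>The arithmetic that the quantum group computations take from Lie theory;
  \<open>qdatum_lie\<close> derives it from the actual root system.\<close>

locale qdatum =
  fixes D :: "('g::ab_group_add, 'i::finite) qflag"
  assumes q0: "qpar D \<noteq> 0" and qru: "\<forall>k>0. qpar D ^ k \<noteq> 1"
    and frm_int: "frm D (simp_root D i) (simp_root D j) \<in> \<int>"
    and frm_sym: "frm D (simp_root D i) (simp_root D j) = frm D (simp_root D j) (simp_root D i)"
    and frm_half: "frm D (simp_root D i) (simp_root D i) / 2 \<in> \<int>"
    and frm_nz: "frm D (simp_root D i) (simp_root D i) \<noteq> 0"
    and cartan_int: "i \<noteq> j \<Longrightarrow> coroot_pairing D (simp_root D j) (simp_root D i) \<in> \<int>"
    and cartan_nonpos: "i \<noteq> j \<Longrightarrow> Re (coroot_pairing D (simp_root D j) (simp_root D i)) \<le> 0"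
begin

lemma powi_ne_one: assumes "z \<noteq> 0" shows "qpar D powi z \<noteq> 1"
proof
  assume a: "qpar D powi z = 1"
  have "qpar D ^ nat \<bar>z\<bar> = 1"
  proof (cases "z \<ge> 0")
    case True then show ?thesis using a by (simp add: power_int_def)
  next
    case False then show ?thesis using a by (simp add: power_int_def power_inverse)
  qed
  then show False using qru assms by auto
qed

lemma t_powi: obtains z where "z \<noteq> 0" "frm D (simp_root D i) (simp_root D i) = 2 * of_int z"
    "qi D i = qpar D powi z"
proof -
  obtain z where z: "frm D (simp_root D i) (simp_root D i) / 2 = of_int z"
    using frm_half[of i] by (elim Ints_cases)
  then show thesis using that[of z] frm_nz[of i] by (auto simp: qi_def qpow_of_int)
qed

lemma t0: "qi D i \<noteq> 0" and tru: "k > 0 \<Longrightarrow> qi D i ^ k \<noteq> 1"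
proof -
  obtain z where z: "z \<noteq> 0" "qi D i = qpar D powi z" by (rule t_powi)
  show "qi D i \<noteq> 0" using z q0 by simp
  have "qi D i ^ k = qpar D powi (z * int k)" by (simp add: z power_int_mult)
  then show "k > 0 \<Longrightarrow> qi D i ^ k \<noteq> 1" using powi_ne_one[of "z * int k"] z by simp
qed

lemma b0: "bq D i j \<noteq> 0"
  using q0 by (simp add: bq_def qpow_def)

lemma b_sym: "bq D i j = bq D j i"
  by (simp add: bq_def frm_sym)

lemma bii: "bq D i i = qi D i ^ 2"
proof -
  obtain z where z: "frm D (simp_root D i) (simp_root D i) = 2 * of_int z" "qi D i = qpar D powi z"
    by (rule t_powi)
  have "bq D i i = qpar D powi (z * 2)"
    using qpow_of_int[of D "z * 2"] by (simp add: bq_def z mult.commute)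
  then show ?thesis by (simp add: z(2) power_int_mult)
qed

lemma b_neg: "qpow D (- frm D (simp_root D i) (simp_root D j)) = inverse (bq D i j)"
  by (simp add: bq_def qpow_minus frm_int)

text \<open>Since a_ij (alpha_i, alpha_i)/2 = (alpha_i, alpha_j), one has q^(alpha_i, alpha_j) =
  q_i^(a_ij), and n - 1 = -a_ij. This is the condition b t^(n-1) = 1 of the Serre
  identities.\<close>

lemma nq1: "i \<noteq> j \<Longrightarrow> nq D i j \<ge> 1" and
  bn: "i \<noteq> j \<Longrightarrow> bq D i j * qi D i ^ (nq D i j - 1) = 1"
proof -
  assume ij: "i \<noteq> j"
  obtain m where m: "coroot_pairing D (simp_root D j) (simp_root D i) = of_int m"
    using cartan_int[OF ij] by (elim Ints_cases)
  then have m0: "m \<le> 0" using cartan_nonpos[OF ij] by simp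
  have n: "nq D i j = Suc (nat (- m))" using m0 by (simp add: nq_def m Suc_nat_eq_nat_zadd1)
  then show "nq D i j \<ge> 1" by simp
  obtain z where z: "z \<noteq> 0" "frm D (simp_root D i) (simp_root D i) = 2 * of_int z"
    "qi D i = qpar D powi z" by (rule t_powi)
  have "frm D (simp_root D j) (simp_root D i) = of_int (z * m)"
    using m z by (simp add: coroot_pairing_def field_simps)
  then have "bq D i j = qpar D powi (z * m)"
    by (simp add: bq_def frm_sym[of i j] qpow_of_int del: of_int_mult)
  moreover have "qi D i ^ nat (- m) = qpar D powi (z * - m)"
    using m0 by (simp add: z power_int_mult power_int_def[of _ "- m"] power_inverse del: mult_minus_right)
  ultimately show "bq D i j * qi D i ^ (nq D i j - 1) = 1"
    using q0 by (simp add: n power_int_minus)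
qed

lemma serre_eq: "serre D Z i j = cst.qserre (qi D i) (nq D i j) (gen (Z i)) (gen (Z j))"
  by (simp add: serre_def cst.qserre_def nq_def Let_def)

definition aq :: "'i \<Rightarrow> complex" where
  "aq i = 1 / (qi D i - inverse (qi D i))"

lemma uq_rels_eq: "uq_rels D =
     (\<Union>i. {gen (QK i) * gen (QKi i) - 1, gen (QKi i) * gen (QK i) - 1}) \<union>
     (\<Union>i j. {gen (QK i) * gen (QK j) - gen (QK j) * gen (QK i),
        gen (QK i) * gen (QE j) - const (bq D i j) * gen (QE j) * gen (QK i),
        gen (QK i) * gen (QF j) - const (inverse (bq D i j)) * gen (QF j) * gen (QK i),
        gen (QE i) * gen (QF j) - gen (QF j) * gen (QE i) -
          (if i = j then const (aq i) * (gen (QK i) - gen (QKi i)) else 0)}) \<union>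
     {serre D QE i j | i j. i \<noteq> j} \<union> {serre D QF i j | i j. i \<noteq> j}"
  unfolding uq_rels_def b_neg bq_def[symmetric] aq_def[symmetric] ..

text \<open>Induction principle for the relation ideal: applied to the set of polynomials with a
  desired property, it reduces every well-definedness claim below to the generating
  relations.\<close>

lemma two_sided_rels:
  assumes "two_sided H"
    and "\<And>i. gen (QK i) * gen (QKi i) - 1 \<in> H" "\<And>i. gen (QKi i) * gen (QK i) - 1 \<in> H"
    and "\<And>i j. gen (QK i) * gen (QK j) - gen (QK j) * gen (QK i) \<in> H"
    and "\<And>i j. gen (QK i) * gen (QE j) - const (bq D i j) * gen (QE j) * gen (QK i) \<in> H"
    and "\<And>i j. gen (QK i) * gen (QF j) - const (inverse (bq D i j)) * gen (QF j) * gen (QK i) \<in> H"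
    and "\<And>i j. gen (QE i) * gen (QF j) - gen (QF j) * gen (QE i) -
          (if i = j then const (aq i) * (gen (QK i) - gen (QKi i)) else 0) \<in> H"
    and "\<And>i j. i \<noteq> j \<Longrightarrow> serre D QE i j \<in> H" "\<And>i j. i \<noteq> j \<Longrightarrow> serre D QF i j \<in> H"
  shows "rel_ideal D \<subseteq> H"
  by (rule rel_ideal_minimal[OF assms(1)]) (use assms(2-) in \<open>auto simp: uq_rels_eq\<close>)

lemma rels:
  "gen (QK i) * gen (QKi i) - 1 \<in> rel_ideal D" "gen (QKi i) * gen (QK i) - 1 \<in> rel_ideal D"
  "gen (QK i) * gen (QK j) - gen (QK j) * gen (QK i) \<in> rel_ideal D"
  "gen (QK i) * gen (QE j) - const (bq D i j) * gen (QE j) * gen (QK i) \<in> rel_ideal D"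
  "gen (QK i) * gen (QF j) - const (inverse (bq D i j)) * gen (QF j) * gen (QK i) \<in> rel_ideal D"
  "gen (QE i) * gen (QF j) - gen (QF j) * gen (QE i) -
     (if i = j then const (aq i) * (gen (QK i) - gen (QKi i)) else 0) \<in> rel_ideal D"
  "i \<noteq> j \<Longrightarrow> serre D QE i j \<in> rel_ideal D" "i \<noteq> j \<Longrightarrow> serre D QF i j \<in> rel_ideal D"
proof -
  note r = subsetD[OF rels_in_rel_ideal[of D, unfolded uq_rels_eq]]
  show "gen (QK i) * gen (QKi i) - 1 \<in> rel_ideal D" "gen (QKi i) * gen (QK i) - 1 \<in> rel_ideal D"
    by (rule r, rule UnI1, rule UnI1, rule UnI1, rule UN_I[of i], simp, simp)+
  show "gen (QK i) * gen (QK j) - gen (QK j) * gen (QK i) \<in> rel_ideal D"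
    "gen (QK i) * gen (QE j) - const (bq D i j) * gen (QE j) * gen (QK i) \<in> rel_ideal D"
    "gen (QK i) * gen (QF j) - const (inverse (bq D i j)) * gen (QF j) * gen (QK i) \<in> rel_ideal D"
    "gen (QE i) * gen (QF j) - gen (QF j) * gen (QE i) -
     (if i = j then const (aq i) * (gen (QK i) - gen (QKi i)) else 0) \<in> rel_ideal D"
    by (rule r, rule UnI1, rule UnI1, rule UnI2, rule UN_I[of i], simp, rule UN_I[of j], simp, simp)+
  assume ij: "i \<noteq> j"
  show "serre D QE i j \<in> rel_ideal D"
    by (rule r, rule UnI1, rule UnI2) (use ij in blast)
  show "serre D QF i j \<in> rel_ideal D"
    by (rule r, rule UnI2) (use ij in blast)
qed

subsection \<open>The free Verma module\<close>

definition var :: "'i \<Rightarrow> ('i word \<Rightarrow>\<^sub>0 complex)" where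
  "var i = Poly_Mapping.single (Word [i]) 1"

definition mono :: "'i list \<Rightarrow> ('i word \<Rightarrow>\<^sub>0 complex)" where
  "mono u = Poly_Mapping.single (Word u) 1"

lemma mono_simps: "mono [] = 1" "mono (j # u) = var j * mono u"
  by (simp_all add: mono_def var_def mult_single plus_word_def zero_word_def[symmetric])

text \<open>If K_i has the eigenvalue \<open>\<chi> i\<close> on the highest weight vector v, then
  it has the eigenvalue \<open>\<chi> i * kap i u\<close> on F_u v.\<close>

definition kap :: "'i \<Rightarrow> 'i list \<Rightarrow> complex" where
  "kap i u = prod_list (map (\<lambda>j. inverse (bq D i j)) u)"

lemma kap_simps: "kap i [] = 1" "kap i (j # u) = inverse (bq D i j) * kap i u"
  by (simp_all add: kap_def)

lemma kap0: "kap i u \<noteq> 0"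
  by (induction u) (simp_all add: kap_simps b0)

definition LX :: "'i \<Rightarrow> 'i word lop" where "LX i = lmul (var i)"

definition LK :: "('i \<Rightarrow> complex) \<Rightarrow> 'i \<Rightarrow> 'i word lop" where
  "LK \<chi> i = lin_op (\<lambda>w. const (\<chi> i * kap i (letters w)) * mono (letters w))"

definition LKi :: "('i \<Rightarrow> complex) \<Rightarrow> 'i \<Rightarrow> 'i word lop" where
  "LKi \<chi> i = lin_op (\<lambda>w. const (inverse (\<chi> i * kap i (letters w))) * mono (letters w))"

text \<open>The value of E_i on F_u v, found by moving E_i to the right through [E_i, F_i] =
  \<open>aq i\<close> (K_i - K_i^-1) until it kills v. The words in the F_j are free: no Serre
  relation is imposed at this stage.\<close>

primrec dl :: "('i \<Rightarrow> complex) \<Rightarrow> 'i \<Rightarrow> 'i list \<Rightarrow> ('i word \<Rightarrow>\<^sub>0 complex)" where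
  "dl \<chi> i [] = 0"
| "dl \<chi> i (j # u) = var j * dl \<chi> i u +
     (if i = j then const (aq i * (\<chi> i * kap i u - inverse (\<chi> i * kap i u))) * mono u else 0)"

definition LD :: "('i \<Rightarrow> complex) \<Rightarrow> 'i \<Rightarrow> 'i word lop" where
  "LD \<chi> i = lin_op (\<lambda>w. dl \<chi> i (letters w))"

lemma app_mono:
  "app (LX j) p = var j * p"
  "app (LK \<chi> i) (mono u) = const (\<chi> i * kap i u) * mono u"
  "app (LKi \<chi> i) (mono u) = const (inverse (\<chi> i * kap i u)) * mono u"
  "app (LD \<chi> i) (mono u) = dl \<chi> i u"
  by (simp_all add: LX_def LK_def LKi_def LD_def app_lin_op app_lmul cst.lext_single mono_def cst.sc_one)

lemma lop_mono_eqI: "(\<And>u. app f (mono u) = app g (mono u)) \<Longrightarrow> f = g"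
  by (rule lop_eqI) (metis mono_def word.exhaust)

lemma A_induct [case_names one var add const]:
  assumes "P 1" "\<And>j p. P p \<Longrightarrow> P (var j * p)" "\<And>p q. P p \<Longrightarrow> P q \<Longrightarrow> P (p + q)"
    "\<And>c p. P p \<Longrightarrow> P (const c * p)"
  shows "P p"
proof (induction p rule: pm_induct)
  case zero show ?case using assms(4)[of 1 0] assms(1) by (simp add: const_def)
next
  case (single w c)
  have "P (mono u)" for u by (induction u) (simp_all add: mono_simps assms)
  then have "P (const c * mono (letters w))" by (rule assms)
  then show ?case by (simp add: mono_def single_conv_const[symmetric])
qed (rule assms)

lemma A_mono_induct [case_names mono add const]:
  assumes "\<And>u. P (mono u)" "\<And>p q. P p \<Longrightarrow> P q \<Longrightarrow> P (p + q)" "\<And>c p. P p \<Longrightarrow> P (const c * p)"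
  shows "P p"
proof (induction p rule: pm_induct)
  case zero show ?case using assms(3)[of "mono []" 0] assms(1) by (simp add: const_def)
next
  case (single w c)
  have "P (const c * mono (letters w))" by (intro assms)
  then show ?case by (simp add: mono_def single_conv_const[symmetric])
qed (rule assms)

definition SX :: "'i \<Rightarrow> 'i \<Rightarrow> ('i word \<Rightarrow>\<^sub>0 complex)" where
  "SX i j = cst.qserre (qi D i) (nq D i j) (var i) (var j)"

context
  fixes \<chi> :: "'i \<Rightarrow> complex"
  assumes \<chi>0: "\<And>i. \<chi> i \<noteq> 0"
begin

lemma LK_LKi: "LK \<chi> i * LKi \<chi> i = 1" "LKi \<chi> i * LK \<chi> i = 1"
  by (rule lop_mono_eqI, simp add: app_simps app_mono app_sm cst.sm_def[symmetric] cst.sm_rules \<chi>0 kap0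
      del: inverse_mult_distrib)+

lemma LK_comm: "LK \<chi> i * LK \<chi> j = LK \<chi> j * LK \<chi> i"
  by (rule lop_mono_eqI) (simp add: app_simps app_mono app_sm cst.sm_simps mult_ac)

lemma LK_LX: "LK \<chi> i * LX j = lscal (inverse (bq D i j)) * LX j * LK \<chi> i"
  by (rule lop_mono_eqI)
    (simp add: app_simps app_mono app_sm app_lscal cst.sm_simps mono_simps(2)[symmetric]
      kap_simps mult_ac)

lemma LKi_LX: "LKi \<chi> i * LX j = lscal (bq D i j) * LX j * LKi \<chi> i"
  by (rule lop_mono_eqI)
    (simp add: app_simps app_mono app_sm app_lscal cst.sm_simps mono_simps(2)[symmetric]
      kap_simps mult_ac)

lemma LD_LX: "LD \<chi> i * LX j - LX j * LD \<chi> i = (if i = j then lscal (aq i) * (LK \<chi> i - LKi \<chi> i) else 0)"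
  by (rule lop_mono_eqI)
    (auto simp: app_simps app_mono app_lscal mono_simps(2)[symmetric] cst.sm_simps right_diff_distrib)

lemma LK_LD: "LK \<chi> i * LD \<chi> j = lscal (bq D i j) * LD \<chi> j * LK \<chi> i"
proof (rule lop_mono_eqI)
  fix u
  have "app (LK \<chi> i) (dl \<chi> j u) = const (bq D i j * (\<chi> i * kap i u)) * dl \<chi> j u"
  proof (induction u)
    case (Cons k u)
    have "app (LK \<chi> i) (var k * dl \<chi> j u) = const (inverse (bq D i k)) * (var k * app (LK \<chi> i) (dl \<chi> j u))"
      using arg_cong[OF LK_LX[of i k], of "\<lambda>f. app f (dl \<chi> j u)"]
      by (simp add: app_simps app_mono app_lscal)
    also have "\<dots> = const (bq D i j * (\<chi> i * kap i (k # u))) * (var k * dl \<chi> j u)"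
      unfolding Cons by (simp add: cst.sm_simps kap_simps mult_ac)
    finally have 1: "app (LK \<chi> i) (var k * dl \<chi> j u) =
      const (bq D i j * (\<chi> i * kap i (k # u))) * (var k * dl \<chi> j u)" .
    have 2: "app (LK \<chi> i) (if j = k then const C * mono u else 0) =
      const (bq D i j * (\<chi> i * kap i (k # u))) * (if j = k then const C * mono u else 0)" for C
    proof -
      have "C * (\<chi> i * kap i u) = bq D i k * (\<chi> i * (inverse (bq D i k) * kap i u)) * C"
        using b0[of i k] by (simp add: field_simps)
      then show ?thesis by (simp only: app_const app_mono cst.sc_merge kap_simps if_True
        if_False app_zero mult_zero_right split: if_split) simp
    qed
    show ?case by (simp only: dl.simps app_add 1 2 distrib_left)
  qed simp
  then show "app (LK \<chi> i * LD \<chi> j) (mono u) = app (lscal (bq D i j) * LD \<chi> j * LK \<chi> i) (mono u)"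
    by (simp add: app_simps app_mono app_sm app_lscal cst.sm_simps)
qed

lemma LKi_LD: "LKi \<chi> i * LD \<chi> j = lscal (inverse (bq D i j)) * LD \<chi> j * LKi \<chi> i"
proof -
  have "LKi \<chi> i * (LK \<chi> i * LD \<chi> j) * LKi \<chi> i = LKi \<chi> i * (lscal (bq D i j) * LD \<chi> j * LK \<chi> i) * LKi \<chi> i"
    by (simp only: LK_LD)
  then have "(LKi \<chi> i * LK \<chi> i) * LD \<chi> j * LKi \<chi> i = lscal (bq D i j) * (LKi \<chi> i * LD \<chi> j * (LK \<chi> i * LKi \<chi> i))"
    by (simp add: mult.assoc lops.sc_left)
  then have "LD \<chi> j * LKi \<chi> i = lscal (bq D i j) * (LKi \<chi> i * LD \<chi> j)"
    by (simp add: LK_LKi)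
  then have "lscal (inverse (bq D i j)) * (LD \<chi> j * LKi \<chi> i) = LKi \<chi> i * LD \<chi> j"
    by (simp add: lops.sc_merge b0 lops.sc_one)
  then show ?thesis by (simp add: mult.assoc)
qed

text \<open>This makes the ideal of the Serre elements stable under the E_k. The cases k = i, k = j
  and k different from both call for the three commutation identities of
  \<open>scalar_algebra\<close>.\<close>

lemma LD_SX:
  assumes ij: "i \<noteq> j"
  shows "LD \<chi> k * lmul (SX i j) = lmul (SX i j) * LD \<chi> k"
proof -
  note T = t0[of i] tru[of _ i] bn[OF ij] nq1[OF ij]
  note C = lops.qserre_commutes_same[OF T] lops.qserre_commutes_other[OF T]
  have S: "lmul (SX i j) = lops.qserre (qi D i) (nq D i j) (LX i) (LX j)"
    by (simp add: SX_def lmul_qserre LX_def)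
  note R = LK_LX LKi_LX
  consider "k = i" | "k = j" | "k \<noteq> i" "k \<noteq> j" by blast
  then show ?thesis
  proof cases
    case 1
    show ?thesis unfolding S
      by (rule C(1)[where c = "aq i" and K = "LK \<chi> i" and K' = "LKi \<chi> i"])
        (use 1 ij LD_LX[of i i] LD_LX[of i j] R[of i] in \<open>simp_all add: bii power_inverse\<close>)
  next
    case 2
    show ?thesis unfolding S
      by (rule C(2)[where c = "aq j" and K = "LK \<chi> j" and K' = "LKi \<chi> j"])
        (use 2 ij LD_LX[of j i] LD_LX[of j j] R[of j i] in \<open>simp_all add: b_sym[of j i]\<close>)
  next
    case 3
    show ?thesis unfolding S
      by (rule lops.qserre_commutes) (use 3 LD_LX[of k i] LD_LX[of k j] in simp_all)
  qed
qed

text \<open>The same identities with the E's and F's exchanged; as [F_k, E_k] has the opposite sign,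
  K_k and K_k^-1 trade places.\<close>

lemma LX_serre_LD:
  assumes ij: "i \<noteq> j"
  shows "LX k * lops.qserre (qi D i) (nq D i j) (LD \<chi> i) (LD \<chi> j) =
    lops.qserre (qi D i) (nq D i j) (LD \<chi> i) (LD \<chi> j) * LX k"
proof -
  note T = t0[of i] tru[of _ i] bn[OF ij] nq1[OF ij]
  note C = lops.qserre_commutes_same[OF T] lops.qserre_commutes_other[OF T]
  have X: "LX k * LD \<chi> l - LD \<chi> l * LX k = (if k = l then lscal (aq k) * (LKi \<chi> k - LK \<chi> k) else 0)" for l
    using LD_LX[of l k] by (auto simp: algebra_simps split: if_splits)
  note R = LK_LD LKi_LD
  consider "k = i" | "k = j" | "k \<noteq> i" "k \<noteq> j" by blast
  then show ?thesis
  proof cases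
    case 1
    show ?thesis
      by (rule C(1)[where c = "aq i" and K = "LKi \<chi> i" and K' = "LK \<chi> i"])
        (use 1 ij X[of i] X[of j] R[of i] in \<open>simp_all add: bii power_inverse\<close>)
  next
    case 2
    show ?thesis
      by (rule C(2)[where c = "aq j" and K = "LKi \<chi> j" and K' = "LK \<chi> j"])
        (use 2 ij X[of i] X[of j] R[of j i] in \<open>simp_all add: b_sym[of j i]\<close>)
  next
    case 3
    show ?thesis
      by (rule lops.qserre_commutes) (use 3 X[of i] X[of j] in simp_all)
  qed
qed

text \<open>The Serre operator commutes with all multiplications by variables, and it kills 1
  because each of its summands applies some \<open>LD\<close> first. As 1 generates, it vanishes. So
  the Serre relations of the E_i hold already on the free module.\<close>

lemma serre_LD_zero:
  assumes ij: "i \<noteq> j"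
  shows "lops.qserre (qi D i) (nq D i j) (LD \<chi> i) (LD \<chi> j) = 0" (is "?S = 0")
proof (rule lop_ext)
  fix p
  have n: "nq D i j > 0" using nq1[OF ij] by simp
  have z: "app (LD \<chi> k) 1 = 0" for k using app_mono(4)[of \<chi> k "[]"] by (simp add: mono_simps)
  have pz: "app (LD \<chi> k ^ l) 1 = 0" if "l > 0" for k l
  proof -
    obtain l' where l: "l = Suc l'" using \<open>l > 0\<close> by (cases l) auto
    show ?thesis by (simp only: l power_Suc2 app_simps z app_zero)
  qed
  have s: "app (\<Sum>k\<in>S. g k) x = (\<Sum>k\<in>S. app (g k) x)" for S :: "nat set" and g x
    by (induction S rule: infinite_finite_induct) (simp_all add: app_simps)
  have "app (lscal c * LD \<chi> i ^ (nq D i j - k) * LD \<chi> j * LD \<chi> i ^ k) 1 = 0" for c k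
    by (cases "k = 0") (simp_all add: app_simps z pz)
  then have "app ?S 1 = 0" unfolding lops.qserre_def s by simp
  then have "app ?S p = 0"
  proof (induction p rule: A_induct)
    case (var j' p)
    then show ?case using arg_cong[OF LX_serre_LD[OF ij, of j'], of "\<lambda>f. app f p"]
      by (simp add: app_simps app_mono)
  qed (simp_all add: app_add app_const)
  then show "app ?S p = app 0 p" by (simp add: app_simps)
qed

end

end

subsection \<open>The Serre ideal in the free Verma module\<close>

context qdatum
begin

text \<open>The two-sided ideal generated by the Serre elements. Right multiples sit in
  \<open>serre_ideal_gen\<close> and left multiplication is by single variables, so that an
  induction has to treat only these two operations.\<close>

inductive_set serre_ideal :: "('i word \<Rightarrow>\<^sub>0 complex) set" where
  serre_ideal_zero: "0 \<in> serre_ideal"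
| serre_ideal_gen: "i \<noteq> j \<Longrightarrow> SX i j * p \<in> serre_ideal"
| serre_ideal_add: "x \<in> serre_ideal \<Longrightarrow> y \<in> serre_ideal \<Longrightarrow> x + y \<in> serre_ideal"
| serre_ideal_var: "x \<in> serre_ideal \<Longrightarrow> var k * x \<in> serre_ideal"

lemma serre_ideal_const: "x \<in> serre_ideal \<Longrightarrow> const c * x \<in> serre_ideal"
proof (induction rule: serre_ideal.induct)
  case (serre_ideal_gen i j p)
  then show ?case using serre_ideal.serre_ideal_gen[of i j "const c * p"] by (simp add: cst.sc_left)
next
  case (serre_ideal_var x k)
  then show ?case using serre_ideal.serre_ideal_var[of "const c * x" k] by (simp add: cst.sc_left)
qed (auto simp: distrib_left intro: serre_ideal.intros)

lemma serre_ideal_minus: "x \<in> serre_ideal \<Longrightarrow> - x \<in> serre_ideal"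
  using serre_ideal_const[of x "- 1"] by (simp add: cst.sc_minus cst.sc_one)

lemma serre_ideal_diff: "x \<in> serre_ideal \<Longrightarrow> y \<in> serre_ideal \<Longrightarrow> x - y \<in> serre_ideal"
  using serre_ideal_add[OF _ serre_ideal_minus, of x y] by simp

primrec vgen :: "('i \<Rightarrow> complex) \<Rightarrow> 'i qgen \<Rightarrow> 'i word lop" where
  "vgen \<chi> (QK i) = LK \<chi> i"
| "vgen \<chi> (QKi i) = LKi \<chi> i"
| "vgen \<chi> (QE i) = LD \<chi> i"
| "vgen \<chi> (QF i) = LX i"

definition vrep :: "('i \<Rightarrow> complex) \<Rightarrow> 'i falg \<Rightarrow> 'i word lop" where
  "vrep \<chi> = lops.ahom (vgen \<chi>)"

lemmas vrep_simps = lops.ahom_simps[of "vgen \<chi>" for \<chi>, folded vrep_def]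
  lops.ahom_gen[of "vgen \<chi>" for \<chi>, folded vrep_def]
  lops.ahom_qserre[of "vgen \<chi>" for \<chi>, folded vrep_def]

context
  fixes \<chi> :: "'i \<Rightarrow> complex"
  assumes \<chi>0: "\<And>i. \<chi> i \<noteq> 0"
begin

lemma serre_ideal_LK: "x \<in> serre_ideal \<Longrightarrow> app (LK \<chi> k) x \<in> serre_ideal \<and> app (LKi \<chi> k) x \<in> serre_ideal"
proof (induction rule: serre_ideal.induct)
  case (serre_ideal_gen i j p)
  have S: "lmul (SX i j) = lops.qserre (qi D i) (nq D i j) (LX i) (LX j)"
    by (simp add: SX_def lmul_qserre LX_def)
  obtain c where "LK \<chi> k * lmul (SX i j) = lscal c * lmul (SX i j) * LK \<chi> k"
    unfolding S using lops.qserre_K[OF LK_LX[of \<chi>, OF \<chi>0] LK_LX[of \<chi>, OF \<chi>0]] by blast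
  from arg_cong[OF this, of "\<lambda>f. app f p"] have 1: "app (LK \<chi> k) (SX i j * p) = const c * (SX i j * app (LK \<chi> k) p)"
    by (simp add: app_simps app_lmul app_lscal)
  obtain d where "LKi \<chi> k * lmul (SX i j) = lscal d * lmul (SX i j) * LKi \<chi> k"
    unfolding S using lops.qserre_K[OF LKi_LX[of \<chi>, OF \<chi>0] LKi_LX[of \<chi>, OF \<chi>0]] by blast
  from arg_cong[OF this, of "\<lambda>f. app f p"] have 2: "app (LKi \<chi> k) (SX i j * p) = const d * (SX i j * app (LKi \<chi> k) p)"
    by (simp add: app_simps app_lmul app_lscal)
  show ?case unfolding 1 2 using serre_ideal_gen by (auto intro: serre_ideal_const serre_ideal.intros)
next
  case (serre_ideal_var x j)
  have "app (LK \<chi> k) (var j * x) = const (inverse (bq D k j)) * (var j * app (LK \<chi> k) x)"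
    "app (LKi \<chi> k) (var j * x) = const (bq D k j) * (var j * app (LKi \<chi> k) x)"
    using arg_cong[OF LK_LX[of \<chi>, OF \<chi>0, of k j], of "\<lambda>f. app f x"] arg_cong[OF LKi_LX[of \<chi>, OF \<chi>0, of k j], of "\<lambda>f. app f x"]
    by (simp_all add: app_simps app_mono app_lscal)
  then show ?case using serre_ideal_var by (auto intro: serre_ideal_const serre_ideal.intros)
qed (auto simp: app_add intro: serre_ideal.intros)

lemma LD_var: "app (LD \<chi> k) (var j * x) = var j * app (LD \<chi> k) x +
    (if k = j then const (aq k) * (app (LK \<chi> k) x - app (LKi \<chi> k) x) else 0)"
  using arg_cong[OF LD_LX[of \<chi>, OF \<chi>0, of k j], of "\<lambda>f. app f x"]
  by (auto simp: app_simps app_mono app_lscal algebra_simps split: if_splits)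

lemma serre_ideal_LD: "x \<in> serre_ideal \<Longrightarrow> app (LD \<chi> k) x \<in> serre_ideal"
proof (induction rule: serre_ideal.induct)
  case (serre_ideal_gen i j p)
  have "app (LD \<chi> k) (SX i j * p) = SX i j * app (LD \<chi> k) p"
    using arg_cong[OF LD_SX[of \<chi>, OF \<chi>0 serre_ideal_gen, of k], of "\<lambda>f. app f p"] by (simp add: app_simps app_lmul)
  then show ?case using serre_ideal_gen by (auto intro: serre_ideal.intros)
next
  case (serre_ideal_var x j)
  then show ?case using serre_ideal_LK[OF serre_ideal_var(1), of k] unfolding LD_var
    by (auto intro!: serre_ideal_const serre_ideal_diff serre_ideal.intros)
qed (auto simp: app_add intro: serre_ideal.intros)

lemma serre_ideal_vgen: "x \<in> serre_ideal \<Longrightarrow> app (vgen \<chi> a) x \<in> serre_ideal"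
  by (cases a) (auto simp: serre_ideal_LK serre_ideal_LD app_mono intro: serre_ideal.intros)

lemma serre_ideal_vrep: "x \<in> serre_ideal \<Longrightarrow> app (vrep \<chi> p) x \<in> serre_ideal"
proof (induction p rule: pm_induct)
  case (single w c)
  have "app (vrep \<chi> (Poly_Mapping.single (Word l) 1)) x \<in> serre_ideal" for l
  proof (induction l)
    case Nil
    then show ?case using single by (simp add: zero_word_def[symmetric] vrep_simps app_simps)
  next
    case (Cons a l)
    have "Poly_Mapping.single (Word (a # l)) (1::complex) = gen a * Poly_Mapping.single (Word l) 1"
      by (simp add: gen_def mult_single plus_word_def)
    then show ?case using Cons serre_ideal_vgen by (simp add: vrep_simps app_simps)
  qed
  from this[of "letters w"] show ?case
    by (subst single_conv_const) (simp add: vrep_simps app_simps app_lscal serre_ideal_const)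
qed (auto simp: vrep_simps app_simps intro: serre_ideal.intros)

text \<open>All relations except the Serre relations of the F_i hold exactly on the free module, and
  those act as left multiplication by Serre elements. Asking for the property on all vectors x, and
  not just on 1, makes the set H two-sided.\<close>

lemma rel_ideal_vrep: "p \<in> rel_ideal D \<Longrightarrow> app (vrep \<chi> p) x \<in> serre_ideal"
proof -
  define H where "H = {p. \<forall>x. app (vrep \<chi> p) x \<in> serre_ideal}"
  have z: "vrep \<chi> p = 0 \<Longrightarrow> p \<in> H" for p by (simp add: H_def app_simps serre_ideal_zero)
  have "rel_ideal D \<subseteq> H"
  proof (rule two_sided_rels)
    show "two_sided H"
      by (auto simp: two_sided_def H_def vrep_simps app_simps intro: serre_ideal.intros serre_ideal_vrep)
  next
    fix i j
    show "gen (QK i) * gen (QKi i) - 1 \<in> H" "gen (QKi i) * gen (QK i) - 1 \<in> H"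
      by (rule z, simp add: vrep_simps LK_LKi[of \<chi>, OF \<chi>0])+
    show "gen (QK i) * gen (QK j) - gen (QK j) * gen (QK i) \<in> H"
      by (rule z, simp add: vrep_simps LK_comm[of \<chi>, OF \<chi>0, of i j])
    show "gen (QK i) * gen (QE j) - const (bq D i j) * gen (QE j) * gen (QK i) \<in> H"
      by (rule z, simp add: vrep_simps LK_LD[of \<chi>, OF \<chi>0])
    show "gen (QK i) * gen (QF j) - const (inverse (bq D i j)) * gen (QF j) * gen (QK i) \<in> H"
      by (rule z, simp add: vrep_simps LK_LX[of \<chi>, OF \<chi>0])
    show "gen (QE i) * gen (QF j) - gen (QF j) * gen (QE i) -
          (if i = j then const (aq i) * (gen (QK i) - gen (QKi i)) else 0) \<in> H"
      by (rule z, cases "i = j") (use LD_LX[of \<chi>, OF \<chi>0, of i j] in \<open>simp_all add: vrep_simps\<close>)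
    assume ij: "i \<noteq> j"
    show "serre D QE i j \<in> H"
      by (rule z) (simp add: serre_eq vrep_simps serre_LD_zero[of \<chi>, OF \<chi>0 ij])
    have "vrep \<chi> (serre D QF i j) = lmul (SX i j)"
      by (simp add: serre_eq vrep_simps SX_def lmul_qserre LX_def)
    then show "serre D QF i j \<in> H" by (simp add: H_def app_lmul serre_ideal_gen[OF ij])
  qed
  then show "p \<in> rel_ideal D \<Longrightarrow> app (vrep \<chi> p) x \<in> serre_ideal" by (auto simp: H_def)
qed

end

definition liftF :: "('i word \<Rightarrow>\<^sub>0 complex) \<Rightarrow> 'i falg" where
  "liftF = cst.ahom (\<lambda>i. gen (QF i))"

definition liftE :: "('i word \<Rightarrow>\<^sub>0 complex) \<Rightarrow> 'i falg" where
  "liftE = cst.ahom (\<lambda>i. gen (QE i))"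

lemma lift_simps:
  "liftF 0 = 0" "liftF 1 = 1" "liftF (p + q) = liftF p + liftF q" "liftF (p * q) = liftF p * liftF q"
  "liftF (const c) = const c" "liftF (var i) = gen (QF i)"
  "liftE 0 = 0" "liftE 1 = 1" "liftE (p + q) = liftE p + liftE q" "liftE (p * q) = liftE p * liftE q"
  "liftE (const c) = const c" "liftE (var i) = gen (QE i)"
  by (simp_all add: liftF_def liftE_def cst.ahom_simps var_def)

lemma vrep_liftF: "vrep \<chi> (liftF p) = lmul p"
proof (induction p rule: A_induct)
  case (var j p)
  then show ?case by (simp add: lift_simps vrep_simps lmul_simps LX_def)
qed (simp_all add: lift_simps vrep_simps lmul_simps)

text \<open>For \<open>\<chi> j\<close> = q^(mu, alpha_j) this says that p v is a singular vector of
  the Verma module, with the Serre relations of the F_i taken as a congruence.\<close>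

definition singular :: "('i \<Rightarrow> complex) \<Rightarrow> ('i word \<Rightarrow>\<^sub>0 complex) \<Rightarrow> bool" where
  "singular \<chi> p \<longleftrightarrow> (\<forall>k. app (LD \<chi> k) p \<in> serre_ideal)"

end

subsection \<open>Tensor products of a highest and a lowest weight Verma module\<close>

text \<open>The lowest weight module is treated as a highest weight one through eta: a polynomial r
  in the E_i is read as one in abstract variables, \<open>LD \<psi> i\<close> gives the action of
  F_i on it and \<open>LK \<psi> i\<close> that of K_i^-1. This is why K_i has the eigenvalue
  \<open>\<chi> i * inverse (\<psi> i)\<close> on the tensor product of the two extremal
  vectors.\<close>

locale qcore = qdatum D for D :: "('g::ab_group_add, 'i::finite) qflag" +
  fixes LL :: "'i falg set" and \<chi> \<psi> :: "'i \<Rightarrow> complex"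
  assumes \<chi>0: "\<And>i. \<chi> i \<noteq> 0" and \<psi>0: "\<And>i. \<psi> i \<noteq> 0"
    and LL_add: "x \<in> LL \<Longrightarrow> y \<in> LL \<Longrightarrow> x + y \<in> LL"
    and LL_mult: "x \<in> LL \<Longrightarrow> a * x \<in> LL"
    and LL_rel: "rel_ideal D \<subseteq> LL"
    and LL_K: "gen (QK i) - const (\<chi> i * inverse (\<psi> i)) \<in> LL"
begin

lemma LL_zero: "0 \<in> LL"
  using LL_rel two_sidedD(1)[OF two_sided_rel_ideal[of D]] by auto

lemma LL_minus: "x \<in> LL \<Longrightarrow> - x \<in> LL"
  using LL_mult[of x "- 1"] by simp

lemma LL_diff: "x \<in> LL \<Longrightarrow> y \<in> LL \<Longrightarrow> x - y \<in> LL"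
  using LL_add[OF _ LL_minus, of x y] by simp

text \<open>The left ideal \<open>LL\<close> annihilates a weight vector \<open>z\<close>, and \<open>ee p r\<close> represents the element
  of \<open>U z\<close> corresponding to \<open>p v \<otimes> r \<xi>\<close>, where \<open>p\<close> is a polynomial in the \<open>F\<^sub>i\<close> and \<open>r\<close> one in the
  \<open>E\<^sub>i\<close>. The recursion solves \<open>F\<^sub>j (p v \<otimes> r \<xi>) = F\<^sub>j p v \<otimes> r \<xi> + K\<^sub>j\<inverse> p v \<otimes> F\<^sub>j r \<xi>\<close> for the
  first summand.\<close>

definition cg :: "'i falg \<Rightarrow> 'i falg \<Rightarrow> bool" (infix \<open>\<doteq>\<close> 50) where
  "x \<doteq> y \<longleftrightarrow> x - y \<in> LL"

lemma cg_refl [simp]: "x \<doteq> x"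
  by (simp add: cg_def LL_zero)

lemma cg_sym: "x \<doteq> y \<Longrightarrow> y \<doteq> x"
  unfolding cg_def using LL_minus[of "x - y"] by simp

lemma cg_trans [trans]: "x \<doteq> y \<Longrightarrow> y \<doteq> z \<Longrightarrow> x \<doteq> z"
  unfolding cg_def using LL_add[of "x - y" "y - z"] by simp

lemma cg_eq_trans [trans]: "x = y \<Longrightarrow> y \<doteq> z \<Longrightarrow> x \<doteq> z" "x \<doteq> y \<Longrightarrow> y = z \<Longrightarrow> x \<doteq> z"
  by simp_all

lemma cg_add: "x \<doteq> y \<Longrightarrow> x' \<doteq> y' \<Longrightarrow> x + x' \<doteq> y + y'"
  unfolding cg_def using LL_add[of "x - y" "x' - y'"] by (simp add: algebra_simps)

lemma cg_diff: "x \<doteq> y \<Longrightarrow> x' \<doteq> y' \<Longrightarrow> x - x' \<doteq> y - y'"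
  unfolding cg_def using LL_diff[of "x - y" "x' - y'"] by (simp add: algebra_simps)

lemma cg_mult: "x \<doteq> y \<Longrightarrow> a * x \<doteq> a * y"
  unfolding cg_def using LL_mult[of "x - y" a] by (simp add: algebra_simps)

lemma cg_rel: "x - y \<in> rel_ideal D \<Longrightarrow> x * a \<doteq> y * a"
  unfolding cg_def using LL_rel two_sidedD(4)[OF two_sided_rel_ideal[of D], of "x - y" a]
  by (auto simp: algebra_simps)

primrec el :: "'i list \<Rightarrow> ('i word \<Rightarrow>\<^sub>0 complex) \<Rightarrow> 'i falg" where
  "el [] r = liftE r"
| "el (j # u) r = gen (QF j) * el u r - const (inverse (\<chi> j * kap j u)) * el u (app (LD \<psi> j) r)"

definition ee :: "('i word \<Rightarrow>\<^sub>0 complex) \<Rightarrow> ('i word \<Rightarrow>\<^sub>0 complex) \<Rightarrow> 'i falg" where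
  "ee p r = cst.lext (\<lambda>w. el (letters w) r) p"

lemma el_add: "el u (r + r') = el u r + el u r'"
  by (induction u arbitrary: r r') (simp_all add: lift_simps app_add algebra_simps)

lemma el_const: "el u (const c * r) = const c * el u r"
proof (induction u arbitrary: r)
  case (Cons j u)
  show ?case
    by (simp only: el.simps app_const Cons right_diff_distrib) (simp add: cst.sm_simps mult.commute)
qed (simp add: lift_simps)

lemma ee_add: "ee (p + q) r = ee p r + ee q r" "ee p (r + r') = ee p r + ee p r'"
proof -
  show "ee (p + q) r = ee p r + ee q r" by (simp add: ee_def cst.lext_add)
  show "ee p (r + r') = ee p r + ee p r'"
    by (simp add: ee_def cst.lext_def el_add distrib_left sum.distrib)
qed

lemma ee_const: "ee (const c * p) r = const c * ee p r" "ee p (const c * r) = const c * ee p r"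
proof -
  show "ee (const c * p) r = const c * ee p r" by (simp add: ee_def cst.lext_const_mult)
  show "ee p (const c * r) = const c * ee p r"
    by (simp add: ee_def cst.lext_def el_const sum_distrib_left)
      (rule sum.cong, simp, simp add: cst.sm_simps mult.commute)
qed

lemma ee_zero [simp]: "ee 0 r = 0" "ee p 0 = 0"
  using ee_add(1)[of 0 0 r] ee_add(2)[of p 0 0] by simp_all

lemma ee_minus: "ee (- p) r = - ee p r" "ee p (- r) = - ee p r"
  using ee_add(1)[of p "- p" r] ee_add(2)[of p r "- r"]
  by (simp_all add: eq_neg_iff_add_eq_0 add.commute)

lemma ee_diff: "ee (p - q) r = ee p r - ee q r" "ee p (r - r') = ee p r - ee p r'"
  using ee_add(1)[of p "- q" r] ee_add(2)[of p r "- r'"] by (simp_all add: ee_minus)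

lemma ee_mono: "ee (mono u) r = el u r"
  by (simp add: ee_def mono_def cst.lext_single cst.sc_one)

lemma ee_one: "ee 1 r = liftE r"
  using ee_mono[of "[]" r] by (simp add: mono_simps)

lemma ee_var: "ee (var j * p) r = gen (QF j) * ee p r - ee (app (LKi \<chi> j) p) (app (LD \<psi> j) r)"
proof (induction p rule: pm_induct)
  case (single w c)
  have *: "ee (var j * mono u) r = gen (QF j) * ee (mono u) r - ee (app (LKi \<chi> j) (mono u)) (app (LD \<psi> j) r)" for u
    by (simp add: mono_simps(2)[symmetric] ee_mono app_mono ee_const)
  have "ee (const c * (var j * mono u)) r = const c * (gen (QF j) * ee (mono u) r)
      - ee (const c * app (LKi \<chi> j) (mono u)) (app (LD \<psi> j) r)" for u
    by (simp only: ee_const * right_diff_distrib)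
  from this[of "letters w"] show ?case
    by (subst (1 2 3) single_conv_const)
      (simp add: mono_def app_const cst.sc_left ee_const)
qed (simp_all add: ee_add app_add algebra_simps)

lemma K_gen_comm: "gen (QK i) * (gen (QE j) * x) \<doteq> const (bq D i j) * (gen (QE j) * (gen (QK i) * x))"
  "gen (QK i) * (gen (QF j) * x) \<doteq> const (inverse (bq D i j)) * (gen (QF j) * (gen (QK i) * x))"
  using cg_rel[OF rels(4), of i j x] cg_rel[OF rels(5), of i j x] by (simp_all add: mult.assoc)

lemma LKi_var: "app (LKi \<psi> i) (var j * r) = const (bq D i j) * (var j * app (LKi \<psi> i) r)"
  using arg_cong[OF LKi_LX[of \<psi>, OF \<psi>0, of i j], of "\<lambda>f. app f r"]
  by (simp add: app_simps app_mono app_lscal)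

text \<open>The formula for the group-like K_i. It is proved for all r at once because the recursion
  of \<open>el\<close> changes r; the empty word in the first slot needs an induction on r of its
  own, starting from \<open>LL_K\<close>.\<close>

lemma K_ee: "gen (QK i) * ee p r \<doteq> ee (app (LK \<chi> i) p) (app (LKi \<psi> i) r)"
proof (induction p arbitrary: r rule: A_mono_induct)
  case (mono u)
  show ?case
  proof (induction u arbitrary: r)
  case Nil
  have o: "app (LK \<chi> i) 1 = const (\<chi> i)" "app (LKi \<psi> i) 1 = const (inverse (\<psi> i))"
    using app_mono(2)[of \<chi> i "[]"] app_mono(3)[of \<psi> i "[]"] by (simp_all add: mono_simps kap_simps)
  have "gen (QK i) * liftE r \<doteq> const (\<chi> i) * liftE (app (LKi \<psi> i) r)"
  proof (induction r rule: A_induct)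
    case one
    show ?case using LL_K[of i] by (simp add: o lift_simps cst.sc_mult cg_def)
  next
    case (var j r)
    have "gen (QK i) * liftE (var j * r) \<doteq> const (bq D i j) * (gen (QE j) * (gen (QK i) * liftE r))"
      using K_gen_comm(1)[of i j "liftE r"] by (simp add: lift_simps)
    also have "\<dots> \<doteq> const (bq D i j) * (gen (QE j) * (const (\<chi> i) * liftE (app (LKi \<psi> i) r)))"
      by (intro cg_mult var)
    also have "\<dots> = const (\<chi> i) * liftE (app (LKi \<psi> i) (var j * r))"
      unfolding LKi_var lift_simps by (simp add: cst.sm_simps mult.commute)
    finally show ?case .
  next
    case (add p q)
    then show ?case using cg_add[OF add.IH] by (simp add: app_add lift_simps distrib_left)
  next
    case (const c p)
    then show ?case using cg_mult[OF const.IH, of "const c"]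
      by (simp only: app_const lift_simps) (simp add: cst.sm_simps mult.commute)
  qed
  then show ?case using ee_const(1)[of "\<chi> i" 1] by (simp add: o ee_one mono_simps)
next
  case (Cons j u)
  define p where "p = mono u"
  obtain c where c: "app (LKi \<chi> j) p = const c * p" unfolding p_def using app_mono(3) by metis
  have l: "app (LK \<chi> i) (var j * p) = const (inverse (bq D i j)) * (var j * app (LK \<chi> i) p)"
    using arg_cong[OF LK_LX[of \<chi>, OF \<chi>0, of i j], of "\<lambda>f. app f p"]
    by (simp add: app_simps app_mono app_lscal)
  have kk: "app (LK \<chi> i) (app (LKi \<chi> j) p) = app (LKi \<chi> j) (app (LK \<chi> i) p)"
  proof -
    have "LK \<chi> i * LKi \<chi> j = LKi \<chi> j * LK \<chi> i"
      by (rule lop_mono_eqI) (simp add: app_simps app_mono app_const cst.sc_merge mult_ac)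
    from arg_cong[OF this, of "\<lambda>f. app f p"] show ?thesis by (simp add: app_simps)
  qed
  have kd: "app (LKi \<psi> i) (app (LD \<psi> j) r) = const (inverse (bq D i j)) * app (LD \<psi> j) (app (LKi \<psi> i) r)"
    using arg_cong[OF LKi_LD[of \<psi>, OF \<psi>0, of i j], of "\<lambda>f. app f r"] by (simp add: app_simps app_lscal)
  have "gen (QK i) * ee (var j * p) r = gen (QK i) * (gen (QF j) * ee p r)
      - gen (QK i) * ee (app (LKi \<chi> j) p) (app (LD \<psi> j) r)"
    by (simp add: ee_var right_diff_distrib)
  also have "\<dots> \<doteq> const (inverse (bq D i j)) * (gen (QF j) * ee (app (LK \<chi> i) p) (app (LKi \<psi> i) r))
      - ee (app (LK \<chi> i) (app (LKi \<chi> j) p)) (app (LKi \<psi> i) (app (LD \<psi> j) r))"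
  proof (rule cg_diff[OF cg_trans[OF K_gen_comm(2)]])
    show "gen (QK i) * ee (app (LKi \<chi> j) p) (app (LD \<psi> j) r)
      \<doteq> ee (app (LK \<chi> i) (app (LKi \<chi> j) p)) (app (LKi \<psi> i) (app (LD \<psi> j) r))"
      using cg_mult[OF Cons[of "app (LD \<psi> j) r"], of "const c"]
      unfolding c by (simp add: p_def app_const ee_const cst.sc_left)
  qed (use Cons in \<open>intro cg_mult, simp add: p_def\<close>)
  also have "\<dots> = ee (app (LK \<chi> i) (var j * p)) (app (LKi \<psi> i) r)"
    unfolding l kk kd by (simp add: ee_const ee_var right_diff_distrib)
  finally show ?case by (simp add: p_def mono_simps)
  qed
next
  case (add p q)
  show ?case using cg_add[OF add.IH] by (simp add: app_add ee_add distrib_left)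
next
  case (const c p)
  show ?case using cg_mult[OF const.IH, of "const c"] by (simp add: app_const ee_const cst.sc_left)
qed

lemma Ki_ee: "gen (QKi i) * ee p r \<doteq> ee (app (LKi \<chi> i) p) (app (LK \<psi> i) r)"
proof -
  let ?p = "app (LKi \<chi> i) p" and ?r = "app (LK \<psi> i) r"
  have "app (LK \<chi> i) ?p = p" "app (LKi \<psi> i) ?r = r"
    using arg_cong[OF LK_LKi(1)[of \<chi>, OF \<chi>0, of i], of "\<lambda>f. app f p"]
      arg_cong[OF LK_LKi(2)[of \<psi>, OF \<psi>0, of i], of "\<lambda>f. app f r"]
    by (simp_all add: app_simps)
  then have "gen (QK i) * ee ?p ?r \<doteq> ee p r" using K_ee[of i ?p ?r] by simp
  from cg_mult[OF cg_sym[OF this], of "gen (QKi i)"]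
  have "gen (QKi i) * ee p r \<doteq> gen (QKi i) * gen (QK i) * ee ?p ?r" by (simp add: mult.assoc)
  also have "\<dots> \<doteq> 1 * ee ?p ?r" by (rule cg_rel[OF rels(2)])
  finally show ?thesis by simp
qed

lemma EF_comm: "gen (QE i) * (gen (QF j) * x) \<doteq> gen (QF j) * (gen (QE i) * x) +
    (if i = j then const (aq i) * (gen (QK i) * x - gen (QKi i) * x) else 0)"
proof -
  have "gen (QE i) * gen (QF j) - (gen (QF j) * gen (QE i) +
     (if i = j then const (aq i) * (gen (QK i) - gen (QKi i)) else 0)) \<in> rel_ideal D"
    using rels(6)[of i j] by (simp add: algebra_simps)
  from cg_rel[OF this, of x] show ?thesis
    by (cases "i = j") (simp_all add: distrib_right left_diff_distrib right_diff_distrib mult.assoc)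
qed

lemma LX_LD: "app (LD \<psi> k) (var j * x) = var j * app (LD \<psi> k) x +
    (if k = j then const (aq k) * (app (LK \<psi> k) x - app (LKi \<psi> k) x) else 0)"
  by (rule LD_var[OF \<psi>0])

text \<open>This is the coproduct E_i \<otimes> K_i + 1 \<otimes> E_i. The action of the F_j is
  built into the recursion of \<open>el\<close>; for E_i the formula has to be proved, by induction
  on the first slot, moving E_i past F_j.\<close>

lemma E_ee: "gen (QE i) * ee p r \<doteq> ee (app (LD \<chi> i) p) (app (LKi \<psi> i) r) + ee p (var i * r)"
proof (induction p arbitrary: r rule: A_mono_induct)
  case (mono u)
  show ?case
  proof (induction u arbitrary: r)
    case Nil
    have "app (LD \<chi> i) 1 = 0" using app_mono(4)[of \<chi> i "[]"] by (simp add: mono_simps)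
    then show ?case by (simp add: mono_simps ee_one lift_simps)
  next
    case (Cons j u)
    define p where "p = mono u"
    let ?E = "gen (QE i)" and ?F = "gen (QF j)" and ?d = "app (LD \<chi> i)" and ?e = "app (LD \<psi> j)"
    let ?Kj = "app (LKi \<chi> j)" and ?K' = "app (LKi \<psi> i)"
    have IH: "?E * ee p r \<doteq> ee (?d p) (?K' r) + ee p (var i * r)" for r
      using Cons[of r] by (simp add: p_def)
    obtain c where c: "?Kj p = const c * p" unfolding p_def using app_mono(3) by metis
    have IH': "?E * ee (?Kj p) r \<doteq> ee (?d (?Kj p)) (?K' r) + ee (?Kj p) (var i * r)" for r
      using cg_mult[OF IH, of "const c" r] unfolding c
      by (simp add: ee_const app_const cst.sc_left distrib_left)
    have sw: "ee (?Kj (?d p)) (?e (?K' r)) = ee (?d (?Kj p)) (?K' (?e r))"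
    proof -
      have 1: "?Kj (?d p) = const (inverse (bq D i j)) * ?d (?Kj p)"
        using arg_cong[OF LKi_LD[of \<chi>, OF \<chi>0, of j i], of "\<lambda>f. app f p"] by (simp add: app_simps app_lscal b_sym[of j i])
      have 2: "?K' (?e r) = const (inverse (bq D i j)) * ?e (?K' r)"
        using arg_cong[OF LKi_LD[of \<psi>, OF \<psi>0, of i j], of "\<lambda>f. app f r"] by (simp add: app_simps app_lscal)
      show ?thesis unfolding 1 2 by (simp add: ee_const)
    qed
    have Fx: "?F * ee p r = ee (var j * p) r + ee (?Kj p) (?e r)" for p r
      by (simp add: ee_var)
    define \<delta> where "\<delta> = (if i = j then const (aq i) * (ee (app (LK \<chi> i) p) (?K' r) - ee (app (LKi \<chi> i) p) (app (LK \<psi> i) r)) else 0)"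
    have \<delta>: "(if i = j then const (aq i) * (gen (QK i) * ee p r - gen (QKi i) * ee p r) else 0) \<doteq> \<delta>"
      unfolding \<delta>_def by (auto intro: cg_mult cg_diff K_ee Ki_ee)
    have "?E * ee (var j * p) r = ?E * (?F * ee p r) - ?E * ee (?Kj p) (?e r)"
      by (simp add: ee_var right_diff_distrib)
    also have "\<dots> \<doteq> (?F * (?E * ee p r) +
        (if i = j then const (aq i) * (gen (QK i) * ee p r - gen (QKi i) * ee p r) else 0))
        - (ee (?d (?Kj p)) (?K' (?e r)) + ee (?Kj p) (var i * ?e r))"
      by (intro cg_diff EF_comm IH')
    also have "\<dots> \<doteq> (?F * (ee (?d p) (?K' r) + ee p (var i * r)) + \<delta>)
        - (ee (?d (?Kj p)) (?K' (?e r)) + ee (?Kj p) (var i * ?e r))"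
      by (intro cg_diff cg_add \<delta> cg_mult IH cg_refl)
    also have "\<dots> = ee (var j * ?d p) (?K' r) + ee (var j * p) (var i * r)
        + ee (?Kj p) (?e (var i * r)) - ee (?Kj p) (var i * ?e r) + \<delta>"
      unfolding distrib_left Fx sw by simp
    also have "\<dots> = ee (?d (var j * p)) (?K' r) + ee (var j * p) (var i * r)"
    proof (cases "i = j")
      case True
      \<comment> \<open>The two terms with \<open>LK \<psi> i\<close> cancel. What remains is the
        commutator term that \<open>LD \<chi> i\<close> produces on
        \<open>var j * p\<close>.\<close>
      have 1: "ee (?Kj p) (?e (var i * r)) - ee (?Kj p) (var i * ?e r) + \<delta>
        = const (aq i) * (ee (app (LK \<chi> i) p) (?K' r) - ee (app (LKi \<chi> i) p) (?K' r))"
        unfolding \<delta>_def LX_LD using True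
        by (simp add: ee_add ee_const ee_diff right_diff_distrib)
      have 2: "ee (?d (var j * p)) (?K' r) = ee (var j * ?d p) (?K' r) +
         const (aq i) * (ee (app (LK \<chi> i) p) (?K' r) - ee (app (LKi \<chi> i) p) (?K' r))"
        unfolding LD_var[OF \<chi>0] using True by (simp add: ee_add ee_const ee_diff)
      show ?thesis unfolding 2 1[symmetric] by simp
    next
      case False
      then show ?thesis unfolding \<delta>_def LX_LD LD_var[OF \<chi>0] by simp
    qed
    finally show ?case by (simp add: p_def mono_simps)
  qed
next
  case (add p q)
  show ?case using cg_add[OF add.IH] by (simp add: app_add ee_add distrib_left algebra_simps)
next
  case (const c p)
  show ?case using cg_mult[OF const.IH, of "const c"]
    by (simp add: app_const ee_const cst.sc_left distrib_left)
qed

lemma LD_one: "app (LD \<phi> k) 1 = 0"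
  using app_mono(4)[of \<phi> k "[]"] by (simp add: mono_simps)

text \<open>Each correction term of the recursion applies some \<open>LD \<psi> j\<close> to 1 and
  vanishes.\<close>

lemma ee_one_right: "ee p 1 = liftF p"
proof (induction p rule: A_induct)
  case (var j p)
  then show ?case by (simp add: ee_var LD_one lift_simps)
qed (simp_all add: ee_one lift_simps ee_add ee_const)

lemma lift_SX: "i \<noteq> j \<Longrightarrow> liftF (SX i j) \<in> rel_ideal D" "i \<noteq> j \<Longrightarrow> liftE (SX i j) \<in> rel_ideal D"
proof -
  have "liftF (SX i j) = serre D QF i j" "liftE (SX i j) = serre D QE i j"
    by (simp_all add: serre_eq SX_def liftF_def liftE_def cst.ahom_qserre)
      (simp_all add: var_def cst.ahom_simps)
  then show "i \<noteq> j \<Longrightarrow> liftF (SX i j) \<in> rel_ideal D" "i \<noteq> j \<Longrightarrow> liftE (SX i j) \<in> rel_ideal D"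
    using rels(7,8) by auto
qed

lemma cg_LL: "x \<doteq> y \<Longrightarrow> y \<in> LL \<Longrightarrow> x \<in> LL"
  unfolding cg_def using LL_add[of "x - y" y] by simp

lemma LL_const_add: "ee p r \<in> LL \<Longrightarrow> ee (const c * p) r \<in> LL" "ee p r \<in> LL \<Longrightarrow> ee p (const c * r) \<in> LL"
  by (simp_all add: ee_const LL_mult)

text \<open>Induction on r: \<open>E_ee\<close> removes a letter from the second slot and leaves a
  multiple of the same Serre element in the first, as \<open>LD\<close> commutes with it. For r = 1
  the Serre relation of the F_i applies.\<close>

lemma ee_SX_left:
  assumes ij: "i \<noteq> j"
  shows "ee (SX i j * p) r \<in> LL"
proof (induction r arbitrary: p rule: A_mono_induct)
  case (mono u)
  show ?case
  proof (induction u arbitrary: p)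
    case Nil
    have "liftF (SX i j * p) \<in> rel_ideal D"
      unfolding lift_simps using two_sidedD(4)[OF two_sided_rel_ideal lift_SX(1)[OF ij]] .
    then show ?case using LL_rel by (auto simp: mono_simps ee_one_right)
  next
    case (Cons k u)
    obtain c where c: "app (LKi \<psi> k) (mono u) = const c * mono u" using app_mono(3) by metis
    have d: "app (LD \<chi> k) (SX i j * p) = SX i j * app (LD \<chi> k) p"
      using arg_cong[OF LD_SX[of \<chi>, OF \<chi>0 ij, of k], of "\<lambda>f. app f p"] by (simp add: app_simps app_lmul)
    have "ee (SX i j * p) (mono (k # u)) \<doteq> gen (QE k) * ee (SX i j * p) (mono u)
      - ee (SX i j * app (LD \<chi> k) p) (const c * mono u)"
      using cg_diff[OF cg_sym[OF E_ee[of k "SX i j * p" "mono u"]] cg_refl[of "ee (SX i j * app (LD \<chi> k) p) (const c * mono u)"]]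
      by (simp add: mono_simps c d)
    then show ?case by (rule cg_LL) (intro LL_diff LL_mult LL_const_add Cons)
  qed
qed (auto simp: ee_add intro: LL_add LL_const_add)

text \<open>The mirror image: letters are now removed from the first slot by \<open>ee_var\<close>,
  and the empty word leads to the Serre relation of the E_i.\<close>

lemma ee_SX_right:
  assumes ij: "i \<noteq> j"
  shows "ee p (SX i j * r) \<in> LL"
proof (induction p arbitrary: r rule: A_mono_induct)
  case (mono u)
  show ?case
  proof (induction u arbitrary: r)
    case Nil
    have "liftE (SX i j * r) \<in> rel_ideal D"
      unfolding lift_simps using two_sidedD(4)[OF two_sided_rel_ideal lift_SX(2)[OF ij]] .
    then show ?case using LL_rel by (auto simp: mono_simps ee_one)
  next
    case (Cons k u)
    obtain c where c: "app (LKi \<chi> k) (mono u) = const c * mono u" using app_mono(3) by metis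
    have d: "app (LD \<psi> k) (SX i j * r) = SX i j * app (LD \<psi> k) r"
      using arg_cong[OF LD_SX[of \<psi>, OF \<psi>0 ij, of k], of "\<lambda>f. app f r"] by (simp add: app_simps app_lmul)
    show ?case unfolding mono_simps ee_var c d by (intro LL_diff LL_mult LL_const_add Cons)
  qed
qed (auto simp: ee_add intro: LL_add LL_const_add)

text \<open>\<open>ee_var\<close> also produces \<open>app (LKi \<chi> k) x\<close>, which the
  induction hypothesis does not cover; by \<open>Ki_ee\<close> its value is congruent to K_k^-1
  times a value at x.\<close>

lemma ee_serre_ideal_left: "x \<in> serre_ideal \<Longrightarrow> ee x r \<in> LL"
proof (induction x arbitrary: r rule: serre_ideal.induct)
  case (serre_ideal_var x k)
  have l: "app (LK \<psi> k) (app (LKi \<psi> k) r) = r" for r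
    using arg_cong[OF LK_LKi(1)[of \<psi>, OF \<psi>0, of k], of "\<lambda>f. app f r"] by (simp add: app_simps)
  have "ee (app (LKi \<chi> k) x) r \<in> LL" for r
    using cg_LL[OF cg_sym[OF Ki_ee[of k x "app (LKi \<psi> k) r"]]] serre_ideal_var by (simp add: l LL_mult)
  then show ?case unfolding ee_var using serre_ideal_var by (intro LL_diff LL_mult)
qed (auto simp: ee_add LL_zero ee_SX_left intro: LL_add)

lemma ee_serre_ideal_right: "x \<in> serre_ideal \<Longrightarrow> ee p x \<in> LL"
proof (induction x arbitrary: p rule: serre_ideal.induct)
  case (serre_ideal_var x k)
  have l: "app (LK \<chi> k) (app (LKi \<chi> k) p) = p" for p
    using arg_cong[OF LK_LKi(1)[of \<chi>, OF \<chi>0, of k], of "\<lambda>f. app f p"] by (simp add: app_simps)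
  have a: "ee p (app (LKi \<psi> k) x) \<in> LL" for p
    using cg_LL[OF cg_sym[OF K_ee[of k "app (LKi \<chi> k) p" x]]] serre_ideal_var by (simp add: l LL_mult)
  have "ee p (var k * x) \<doteq> gen (QE k) * ee p x - ee (app (LD \<chi> k) p) (app (LKi \<psi> k) x)"
    using cg_diff[OF cg_sym[OF E_ee[of k p x]] cg_refl[of "ee (app (LD \<chi> k) p) (app (LKi \<psi> k) x)"]] by simp
  then show ?case by (rule cg_LL) (intro LL_diff LL_mult serre_ideal_var a)
qed (auto simp: ee_add LL_zero ee_SX_right intro: LL_add)

text \<open>Both products are congruent to \<open>ee y x\<close>. \<open>L1\<close> and
  \<open>L2\<close> are stated for arbitrary r and p, so that the induction runs through the letters
  of one factor while the singular vector in the other slot stays fixed.\<close>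

theorem singular_commute:
  assumes y: "singular \<chi> y" and x: "singular \<psi> x"
  shows "liftF y * liftE x - liftE x * liftF y \<in> LL"
proof -
  have L1: "liftE r * ee y 1 \<doteq> ee y r" for r
  proof (induction r rule: A_induct)
    case (var k r)
    have "liftE (var k * r) * ee y 1 = gen (QE k) * (liftE r * ee y 1)"
      by (simp add: lift_simps mult.assoc)
    also have "\<dots> \<doteq> gen (QE k) * ee y r" by (intro cg_mult var)
    also have "\<dots> \<doteq> ee (app (LD \<chi> k) y) (app (LKi \<psi> k) r) + ee y (var k * r)" by (rule E_ee)
    also have "\<dots> \<doteq> 0 + ee y (var k * r)"
      using ee_serre_ideal_left y by (intro cg_add cg_refl) (simp add: cg_def singular_def)
    finally show ?case by simp
  next
    case (add p q)
    then show ?case using cg_add[OF add.IH] by (simp add: lift_simps ee_add distrib_right)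
  next
    case (const c p)
    then show ?case using cg_mult[OF const.IH, of "const c"] by (simp add: lift_simps ee_const mult.assoc)
  qed (simp add: lift_simps)
  have L2: "liftF p * ee 1 x \<doteq> ee p x" for p
  proof (induction p rule: A_induct)
    case (var k p)
    have "liftF (var k * p) * ee 1 x = gen (QF k) * (liftF p * ee 1 x)"
      by (simp add: lift_simps mult.assoc)
    also have "\<dots> \<doteq> gen (QF k) * ee p x" by (intro cg_mult var)
    also have "\<dots> = ee (var k * p) x + ee (app (LKi \<chi> k) p) (app (LD \<psi> k) x)" by (simp add: ee_var)
    also have "\<dots> \<doteq> ee (var k * p) x + 0"
      using ee_serre_ideal_right x by (intro cg_add cg_refl) (simp add: cg_def singular_def)
    finally show ?case by simp
  next
    case (add p q)
    then show ?case using cg_add[OF add.IH] by (simp add: lift_simps ee_add distrib_right)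
  next
    case (const c p)
    then show ?case using cg_mult[OF const.IH, of "const c"] by (simp add: lift_simps ee_const mult.assoc)
  qed (simp add: lift_simps)
  show ?thesis using cg_trans[OF L2 cg_sym[OF L1]] by (simp add: ee_one ee_one_right cg_def)
qed

end

subsection \<open>Automorphism, antipode and coproduct\<close>

context scalar_algebra
begin

text \<open>Moving every \<open>\<kappa>\<close> and \<open>\<mu>\<close> to the right collects
  powers of c and d. The two terms of each commutator collect the same power, because
  \<open>\<kappa>\<close> past y and \<open>\<mu>\<close> past x give the same d. So the twisted
  iterate is a scalar multiple of the original one, followed by the twists. Needed for the antipode
  and the coproduct.\<close>

lemma qcomm_twist:
  assumes H: "two_sided H"
    and kx: "\<kappa> * x - \<sigma> c * x * \<kappa> \<in> H" and ky: "\<kappa> * y - \<sigma> d * y * \<kappa> \<in> H"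
    and lx: "\<mu> * x - \<sigma> d * x * \<mu> \<in> H" and lk: "\<mu> * \<kappa> - \<kappa> * \<mu> \<in> H"
  shows "\<exists>C. qcomm b t (x * \<kappa>) (y * \<mu>) m - \<sigma> C * qcomm b t x y m * \<kappa> ^ m * \<mu> \<in> H"
proof (induction m)
  case 0
  have "qcomm b t (x * \<kappa>) (y * \<mu>) 0 - \<sigma> 1 * qcomm b t x y 0 * \<kappa> ^ 0 * \<mu> = 0" by (simp add: sc_one)
  then show ?case using two_sidedD(1)[OF H] by metis
next
  case (Suc m)
  note D = two_sidedD[OF H]
  define T where "T = qcomm b t x y"
  define p where "p = b * t ^ (2 * m)"
  obtain C where C: "qcomm b t (x * \<kappa>) (y * \<mu>) m - \<sigma> C * T m * \<kappa> ^ m * \<mu> \<in> H"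
    using Suc by (auto simp: T_def)
  have kT: "\<kappa> * T m - \<sigma> (c ^ m * d) * T m * \<kappa> \<in> H" for m
  proof (induction m)
    case (Suc m)
    define p where "p = b * t ^ (2 * m)"
    have "\<kappa> * (x * T m - \<sigma> p * T m * x) - \<sigma> (c ^ Suc m * d) * (x * T m - \<sigma> p * T m * x) * \<kappa>
      = (\<kappa> * x - \<sigma> c * x * \<kappa>) * T m + \<sigma> c * x * (\<kappa> * T m - \<sigma> (c ^ m * d) * T m * \<kappa>)
        - \<sigma> p * (\<kappa> * T m - \<sigma> (c ^ m * d) * T m * \<kappa>) * x
        - \<sigma> p * \<sigma> (c ^ m * d) * T m * (\<kappa> * x - \<sigma> c * x * \<kappa>)"
      by (simp add: sm_simps algebra_simps)
    also have "\<dots> \<in> H" by (intro D(2)[OF D(4)[OF kx]] D(2,6) D(3)[OF Suc] D(4)[OF D(3)[OF Suc]] D(4)[OF kx] D(3)[OF kx])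
    finally show ?case by (simp add: T_def p_def)
  qed (use ky in \<open>simp add: T_def\<close>)
  have kp: "\<kappa> ^ k * x - \<sigma> (c ^ k) * x * \<kappa> ^ k \<in> H" for k
  proof (induction k)
    case 0 show ?case using D(1) by (simp add: sc_one)
  next
    case (Suc k)
    have "\<kappa> ^ Suc k * x - \<sigma> (c ^ Suc k) * x * \<kappa> ^ Suc k
      = \<kappa> * (\<kappa> ^ k * x - \<sigma> (c ^ k) * x * \<kappa> ^ k) + \<sigma> (c ^ k) * (\<kappa> * x - \<sigma> c * x * \<kappa>) * \<kappa> ^ k"
      by (simp add: sm_simps algebra_simps)
    also have "\<dots> \<in> H" by (intro D(2) D(3)[OF Suc] D(4)[OF D(3)[OF kx]])
    finally show ?case .
  qed
  have kl: "\<kappa> ^ k * \<mu> * \<kappa> - \<kappa> ^ Suc k * \<mu> \<in> H" for k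
  proof -
    have "\<kappa> ^ k * \<mu> * \<kappa> - \<kappa> ^ Suc k * \<mu> = \<kappa> ^ k * (\<mu> * \<kappa> - \<kappa> * \<mu>)"
      by (simp add: right_diff_distrib mult.assoc power_commutes)
        (metis mult.assoc power_commutes)
    then show ?thesis using D(3)[OF lk] by metis
  qed
  define Q where "Q = qcomm b t (x * \<kappa>) (y * \<mu>) m"
  define e where "e = c ^ m * d"
  \<comment> \<open>The right-hand side lists six defects, each a multiple of an element of
    H.\<close>
  have "x * \<kappa> * Q - \<sigma> p * Q * (x * \<kappa>) - \<sigma> (C * e) * (x * T m - \<sigma> p * T m * x) * \<kappa> ^ Suc m * \<mu>
    = x * \<kappa> * (Q - \<sigma> C * T m * \<kappa> ^ m * \<mu>) - \<sigma> p * (Q - \<sigma> C * T m * \<kappa> ^ m * \<mu>) * (x * \<kappa>)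
      + \<sigma> C * x * (\<kappa> * T m - \<sigma> e * T m * \<kappa>) * \<kappa> ^ m * \<mu>
      - \<sigma> p * \<sigma> C * T m * \<kappa> ^ m * (\<mu> * x - \<sigma> d * x * \<mu>) * \<kappa>
      - \<sigma> p * \<sigma> C * \<sigma> d * T m * (\<kappa> ^ m * x - \<sigma> (c ^ m) * x * \<kappa> ^ m) * \<mu> * \<kappa>
      - \<sigma> p * \<sigma> C * \<sigma> e * T m * x * (\<kappa> ^ m * \<mu> * \<kappa> - \<kappa> ^ Suc m * \<mu>)"
    by (simp add: sm_simps e_def algebra_simps)
  also have "\<dots> \<in> H"
    by (rule D(6)[OF D(6)[OF D(6)[OF D(2)[OF D(6)]]]])
      (rule D(3)[OF kl] D(4)[OF D(4)[OF D(3)[OF kp]]] D(4)[OF D(3)[OF lx]] D(4)[OF D(4)[OF D(3)[OF kT[of m, folded e_def]]]]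
        D(3)[OF C[folded Q_def]] D(4)[OF D(3)[OF C[folded Q_def]]])+
  finally show ?case unfolding qcomm.simps Q_def[symmetric] p_def[symmetric] T_def by blast
qed

lemma qserre_twist:
  assumes t: "t \<noteq> 0" "\<And>k. k > 0 \<Longrightarrow> t ^ k \<noteq> 1" and b: "b * t ^ (n - 1) = 1" "n \<ge> 1"
    and H: "two_sided H"
    and kx: "\<kappa> * x - \<sigma> c * x * \<kappa> \<in> H" and ky: "\<kappa> * y - \<sigma> d * y * \<kappa> \<in> H"
    and lx: "\<mu> * x - \<sigma> d * x * \<mu> \<in> H" and lk: "\<mu> * \<kappa> - \<kappa> * \<mu> \<in> H"
    and S: "qserre t n x y \<in> H"
  shows "qserre t n (x * \<kappa>) (y * \<mu>) \<in> H"
proof -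
  obtain C where "qserre t n (x * \<kappa>) (y * \<mu>) - \<sigma> C * qserre t n x y * \<kappa> ^ n * \<mu> \<in> H"
    using qcomm_twist[OF H kx ky lx lk, of b t n] using qserre_eq_qcomm[OF t b, symmetric] by auto
  moreover have "\<sigma> C * qserre t n x y * \<kappa> ^ n * \<mu> \<in> H"
    using two_sidedD(4)[OF H two_sidedD(4)[OF H two_sidedD(3)[OF H S]]] .
  ultimately show ?thesis using two_sidedD(2)[OF H] by fastforce
qed

lemma qserre_scale: "qserre t n (\<sigma> c * f) (\<sigma> d * g) = \<sigma> (c ^ n * d) * qserre t n f g"
proof -
  have pw: "(\<sigma> c * f) ^ k = \<sigma> (c ^ k) * f ^ k" for k
    by (induction k) (simp_all add: sm_simps sc_one mult.commute)
  have "\<sigma> e * (\<sigma> c * f) ^ (n - k) * (\<sigma> d * g) * (\<sigma> c * f) ^ k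
      = \<sigma> (c ^ n * d) * (\<sigma> e * f ^ (n - k) * g * f ^ k)" if "k \<le> n" for e k
  proof -
    have "c ^ n = c ^ (n - k) * c ^ k" using that by (simp add: power_add[symmetric])
    then show ?thesis unfolding pw by (simp add: sm_simps mult.commute mult.left_commute)
  qed
  then show ?thesis by (simp add: qserre_def sum_distrib_left)
qed

lemma qserre_cong:
  assumes H: "two_sided H" and f: "f - f' \<in> H" and g: "g - g' \<in> H"
  shows "qserre t n f g - qserre t n f' g' \<in> H"
proof -
  note M = two_sided_cong_mult[OF H]
  have z: "x - x \<in> H" for x using two_sidedD(1)[OF H] by simp
  have pw: "f ^ k - f' ^ k \<in> H" for k
    by (induction k) (auto intro: M f z simp: two_sidedD(1)[OF H])
  have s: "finite S \<Longrightarrow> (\<And>k. k \<in> S \<Longrightarrow> h k \<in> H) \<Longrightarrow> sum h S \<in> H" for S :: "nat set" and h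
    by (induction S rule: finite_induct) (auto intro: two_sidedD[OF H])
  show ?thesis unfolding qserre_def sum_subtractf[symmetric]
    by (rule s) (auto intro!: M z pw g)
qed

text \<open>Reversing all products exchanges the k-th and the (n-k)-th summand up to the sign
  (-1)^n, since the Gaussian binomials are symmetric.\<close>

lemma lext_anti_qserre:
  assumes "\<And>p q. F (p + q) = F p + F q" "\<And>p q. F (p * q) = F q * F p" "F 1 = 1"
    "\<And>c. F (\<sigma> c) = \<sigma> c"
  shows "F (qserre t n f g) = \<sigma> ((- 1) ^ n) * qserre t n (F f) (F g)"
proof -
  have z: "F 0 = 0" using assms(1)[of 0 0] by simp
  have s: "F (sum h S) = (\<Sum>k\<in>S. F (h k))" for h and S :: "nat set"
    by (induction S rule: infinite_finite_induct) (simp_all add: z assms)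
  have pw: "F (x ^ k) = F x ^ k" for x k
    by (induction k) (simp_all add: assms power_commutes)
  define c where "c k = (- 1) ^ k * qbinom t n k" for k :: nat
  have "F (qserre t n f g) = (\<Sum>k\<le>n. \<sigma> (c k) * (F f ^ k * F g * F f ^ (n - k)))"
    unfolding qserre_def s c_def[symmetric] by (simp add: assms pw sc_comm mult.assoc)
  also have "\<dots> = (\<Sum>k\<le>n. \<sigma> (c (n - k)) * (F f ^ (n - k) * F g * F f ^ k))"
    by (rule sum.reindex_bij_witness[of _ "\<lambda>k. n - k" "\<lambda>k. n - k"]) auto
  also have "\<dots> = (\<Sum>k\<le>n. \<sigma> ((- 1) ^ n) * (\<sigma> (c k) * F f ^ (n - k) * F g * F f ^ k))"
  proof (rule sum.cong)
    fix k assume "k \<in> {..n}"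
    then have k: "k \<le> n" by simp
    have "(- 1) ^ (n - k) = (- 1) ^ n * ((- 1 :: complex) ^ k)"
    proof -
      have "(- 1) ^ n = (- 1) ^ (n - k) * ((- 1 :: complex) ^ k)" using k by (simp add: power_add[symmetric])
      then show ?thesis by (simp add: mult.assoc)
    qed
    then have "c (n - k) = (- 1) ^ n * c k" using k by (simp add: c_def qbinom_sym)
    then show "\<sigma> (c (n - k)) * (F f ^ (n - k) * F g * F f ^ k)
      = \<sigma> ((- 1) ^ n) * (\<sigma> (c k) * F f ^ (n - k) * F g * F f ^ k)"
      by (simp add: sm_simps mult.commute)
  qed simp
  finally show ?thesis by (simp add: qserre_def c_def sum_distrib_left)
qed

end

lemma eta_hom_simps: "free_hom \<phi> (p + q) = free_hom \<phi> p + free_hom \<phi> q"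
  "free_hom \<phi> (p * q) = free_hom \<phi> p * free_hom \<phi> q" "free_hom \<phi> 1 = 1"
  "free_hom \<phi> (const c) = const c" "free_hom \<phi> (- p) = - free_hom \<phi> p" "free_hom \<phi> 0 = 0"
  "free_hom \<phi> (p - q) = free_hom \<phi> p - free_hom \<phi> q" "free_hom \<phi> (gen a) = \<phi> a"
  by (simp_all add: free_hom_eq_ahom cst.ahom_simps cst.ahom_gen)

lemma antihom_simps: "free_antihom \<phi> (p + q) = free_antihom \<phi> p + free_antihom \<phi> q"
  "free_antihom \<phi> (p * q) = free_antihom \<phi> q * free_antihom \<phi> p" "free_antihom \<phi> 1 = 1"
  "free_antihom \<phi> (const c) = const c" "free_antihom \<phi> (- p) = - free_antihom \<phi> p"
  "free_antihom \<phi> 0 = 0" "free_antihom \<phi> (p - q) = free_antihom \<phi> p - free_antihom \<phi> q"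
  "free_antihom \<phi> (gen a) = \<phi> a"
  unfolding free_antihom_eq_lext
  by (simp_all add: cst.lext_add cst.lext_one cst.lext_const cst.lext_minus cst.lext_diff gen_def
      cst.lext_single cst.sc_one zero_word_def, subst cst.lext_antimult)
    (simp_all add: plus_word_def)

context qdatum
begin

lemma rel_mult: "x - x' \<in> rel_ideal D \<Longrightarrow> y - y' \<in> rel_ideal D \<Longrightarrow> x * y - x' * y' \<in> rel_ideal D"
  by (rule two_sided_cong_mult[OF two_sided_rel_ideal])

definition ueq :: "'i falg \<Rightarrow> 'i falg \<Rightarrow> bool" (infix \<open>\<triangleq>\<close> 50) where
  "x \<triangleq> y \<longleftrightarrow> x - y \<in> rel_ideal D"

lemma ueq_refl [simp]: "x \<triangleq> x" and ueq_sym: "x \<triangleq> y \<Longrightarrow> y \<triangleq> x"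
  and ueq_trans [trans]: "x \<triangleq> y \<Longrightarrow> y \<triangleq> z \<Longrightarrow> x \<triangleq> z"
  and ueq_mult: "x \<triangleq> x' \<Longrightarrow> y \<triangleq> y' \<Longrightarrow> x * y \<triangleq> x' * y'"
  and ueq_add: "x \<triangleq> x' \<Longrightarrow> y \<triangleq> y' \<Longrightarrow> x + y \<triangleq> x' + y'"
  and ueq_diff: "x \<triangleq> x' \<Longrightarrow> y \<triangleq> y' \<Longrightarrow> x - y \<triangleq> x' - y'"
proof -
  note H = two_sided_rel_ideal[of D]
  show "x \<triangleq> x" using two_sidedD(1)[OF H] by (simp add: ueq_def)
  show "x \<triangleq> y \<Longrightarrow> y \<triangleq> x" unfolding ueq_def by (rule two_sided_cong_sym[OF H])
  show "x \<triangleq> y \<Longrightarrow> y \<triangleq> z \<Longrightarrow> x \<triangleq> z" unfolding ueq_def by (rule two_sided_cong_trans[OF H])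
  show "x \<triangleq> x' \<Longrightarrow> y \<triangleq> y' \<Longrightarrow> x * y \<triangleq> x' * y'" unfolding ueq_def by (rule rel_mult)
  show "x \<triangleq> x' \<Longrightarrow> y \<triangleq> y' \<Longrightarrow> x + y \<triangleq> x' + y'" "x \<triangleq> x' \<Longrightarrow> y \<triangleq> y' \<Longrightarrow> x - y \<triangleq> x' - y'"
    unfolding ueq_def by (rule two_sided_cong_add[OF H]; assumption)+
qed

lemma ueq_eq_trans [trans]: "x = y \<Longrightarrow> y \<triangleq> z \<Longrightarrow> x \<triangleq> z" "x \<triangleq> y \<Longrightarrow> y = z \<Longrightarrow> x \<triangleq> z"
  by simp_all

lemma ueq_inverse:
  assumes "gen (QK i) * x \<triangleq> const c * x * gen (QK i)" "c \<noteq> 0"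
  shows "gen (QKi i) * x \<triangleq> const (inverse c) * x * gen (QKi i)"
proof -
  let ?K = "gen (QK i)" and ?L = "gen (QKi i)"
  have "?L * x \<triangleq> ?L * x * (?K * ?L)"
    using ueq_mult[OF ueq_refl ueq_sym, of "?K * ?L" 1 "?L * x"] rels(1)[of i] by (simp add: ueq_def)
  also have "\<dots> = const (inverse c) * (?L * (const c * x * ?K) * ?L)"
    using assms(2) by (simp add: cst.sm_simps)
  also have "\<dots> \<triangleq> const (inverse c) * (?L * (?K * x) * ?L)"
    by (intro ueq_mult ueq_refl ueq_sym[OF assms(1)])
  also have "\<dots> = const (inverse c) * ((?L * ?K) * (x * ?L))" by (simp add: mult.assoc)
  also have "\<dots> \<triangleq> const (inverse c) * (1 * (x * ?L))"
    by (intro ueq_mult ueq_refl) (use rels(2)[of i] in \<open>simp add: ueq_def\<close>)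
  finally show ?thesis by (simp add: mult.assoc)
qed

lemma K_rels:
  "gen (QK i) * gen (QKi i) \<triangleq> 1" "gen (QKi i) * gen (QK i) \<triangleq> 1"
  "gen (QK i) * gen (QK j) \<triangleq> gen (QK j) * gen (QK i)"
  "gen (QKi i) * gen (QK j) \<triangleq> gen (QK j) * gen (QKi i)"
  "gen (QKi i) * gen (QKi j) \<triangleq> gen (QKi j) * gen (QKi i)"
  "gen (QK i) * gen (QE j) \<triangleq> const (bq D i j) * gen (QE j) * gen (QK i)"
  "gen (QK i) * gen (QF j) \<triangleq> const (inverse (bq D i j)) * gen (QF j) * gen (QK i)"
  "gen (QKi i) * gen (QE j) \<triangleq> const (inverse (bq D i j)) * gen (QE j) * gen (QKi i)"
  "gen (QKi i) * gen (QF j) \<triangleq> const (bq D i j) * gen (QF j) * gen (QKi i)"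
  "gen (QE i) * gen (QF j) - gen (QF j) * gen (QE i) \<triangleq>
     (if i = j then const (aq i) * (gen (QK i) - gen (QKi i)) else 0)"
proof -
  show 1: "gen (QK i) * gen (QKi i) \<triangleq> 1" "gen (QKi i) * gen (QK i) \<triangleq> 1" for i
    using rels by (auto simp: ueq_def)
  show 2: "gen (QK i) * gen (QK j) \<triangleq> gen (QK j) * gen (QK i)" for i j
    using rels by (auto simp: ueq_def)
  show 3: "gen (QKi i) * gen (QK j) \<triangleq> gen (QK j) * gen (QKi i)" for i j
    using ueq_inverse[of i "gen (QK j)" 1] 2[of i j] by (simp add: cst.sc_one)
  show "gen (QKi i) * gen (QKi j) \<triangleq> gen (QKi j) * gen (QKi i)"
    using ueq_inverse[of i "gen (QKi j)" 1] ueq_sym[OF 3[of j i]] by (simp add: cst.sc_one)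
  show 4: "gen (QK i) * gen (QE j) \<triangleq> const (bq D i j) * gen (QE j) * gen (QK i)"
    "gen (QK i) * gen (QF j) \<triangleq> const (inverse (bq D i j)) * gen (QF j) * gen (QK i)"
    using rels by (auto simp: ueq_def)
  show "gen (QKi i) * gen (QE j) \<triangleq> const (inverse (bq D i j)) * gen (QE j) * gen (QKi i)"
    "gen (QKi i) * gen (QF j) \<triangleq> const (bq D i j) * gen (QF j) * gen (QKi i)"
    using ueq_inverse[OF 4(1)] ueq_inverse[OF 4(2)] b0 by simp_all
  show "gen (QE i) * gen (QF j) - gen (QF j) * gen (QE i) \<triangleq>
     (if i = j then const (aq i) * (gen (QK i) - gen (QKi i)) else 0)"
    using rels(6)[of i j] by (simp add: ueq_def)
qed

lemma rel_ideal_eta: "p \<in> rel_ideal D \<Longrightarrow> free_hom eta_gen p \<in> rel_ideal D"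
proof -
  let ?f = "free_hom eta_gen"
  note d = two_sidedD[OF two_sided_rel_ideal[of D]]
  have "rel_ideal D \<subseteq> {p. ?f p \<in> rel_ideal D}"
  proof (rule two_sided_rels)
    show "two_sided {p. ?f p \<in> rel_ideal D}"
      unfolding two_sided_def by (auto simp: eta_hom_simps d)
  next
    fix i j
    show "serre D QE i j \<in> {p. ?f p \<in> rel_ideal D}" "serre D QF i j \<in> {p. ?f p \<in> rel_ideal D}" if "i \<noteq> j"
      using rels(7,8)[OF that]
      by (simp_all add: serre_eq free_hom_eq_ahom cst.ahom_qserre cst.ahom_gen)
    have "- (gen (QE j) * gen (QF i) - gen (QF i) * gen (QE j) -
          (if j = i then const (aq j) * (gen (QK j) - gen (QKi j)) else 0)) \<in> rel_ideal D"
      by (intro d rels)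
    also have "- (gen (QE j) * gen (QF i) - gen (QF i) * gen (QE j) -
          (if j = i then const (aq j) * (gen (QK j) - gen (QKi j)) else 0)) =
      ?f (gen (QE i) * gen (QF j) - gen (QF j) * gen (QE i) -
          (if i = j then const (aq i) * (gen (QK i) - gen (QKi i)) else 0))"
      by (auto simp: eta_hom_simps algebra_simps)
    finally show "gen (QE i) * gen (QF j) - gen (QF j) * gen (QE i) -
          (if i = j then const (aq i) * (gen (QK i) - gen (QKi i)) else 0) \<in> {p. ?f p \<in> rel_ideal D}"
      by simp
  qed (use K_rels in \<open>auto simp: eta_hom_simps ueq_def\<close>)
  then show "p \<in> rel_ideal D \<Longrightarrow> ?f p \<in> rel_ideal D" by auto
qed

lemma eta_ucl: "eta D (ucl D p) = ucl D (free_hom eta_gen p)"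
  unfolding eta_def by (rule the_elem_ucl) (simp_all add: rel_ideal_eta eta_hom_simps)

lemma eta_liftF: "eta D (ucl D (liftF p)) = ucl D (liftE p)"
proof -
  have "free_hom eta_gen (liftF p) = liftE p"
    by (induction p rule: A_induct) (simp_all add: lift_simps eta_hom_simps)
  then show ?thesis by (simp add: eta_ucl)
qed

text \<open>For the Serre relations, the values E_i K_i^-1 and K_i F_i are up to sign and powers of
  q the generators twisted by K's, so \<open>qserre_twist\<close> applies once
  \<open>lext_anti_qserre\<close> has reversed the products.\<close>

lemma rel_ideal_antipode: "p \<in> rel_ideal D \<Longrightarrow> free_antihom antipode_gen p \<in> rel_ideal D"
proof -
  let ?f = "free_antihom (antipode_gen :: 'i qgen \<Rightarrow> 'i falg)"
  let ?K = "\<lambda>i. gen (QK i) :: 'i falg" and ?L = "\<lambda>i. gen (QKi i) :: 'i falg"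
  let ?E = "\<lambda>i. gen (QE i) :: 'i falg" and ?F = "\<lambda>i. gen (QF i) :: 'i falg"
  note d = two_sidedD[OF two_sided_rel_ideal[of D]]
  note H = two_sided_rel_ideal[of D]
  have "rel_ideal D \<subseteq> {p. ?f p \<in> rel_ideal D}"
  proof (rule two_sided_rels)
    show "two_sided {p. ?f p \<in> rel_ideal D}"
      unfolding two_sided_def by (auto simp: antihom_simps d)
  next
    fix i j
    show "?K i * ?L i - 1 \<in> {p. ?f p \<in> rel_ideal D}" "?L i * ?K i - 1 \<in> {p. ?f p \<in> rel_ideal D}"
      "?K i * ?K j - ?K j * ?K i \<in> {p. ?f p \<in> rel_ideal D}"
      using K_rels by (auto simp: antihom_simps ueq_def)
    have "?E j * (?L j * ?L i) \<triangleq> ?E j * (?L i * ?L j)" by (intro ueq_mult ueq_refl K_rels)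
    also have "?E j * (?L i * ?L j) = const (bq D i j) * (const (inverse (bq D i j)) * ?E j * ?L i) * ?L j"
      using b0[of i j] by (simp add: cst.sm_simps)
    also have "\<dots> \<triangleq> const (bq D i j) * (?L i * ?E j) * ?L j"
      by (intro ueq_mult ueq_refl ueq_sym[OF K_rels(8)])
    finally have "- (?E j * (?L j * ?L i) - const (bq D i j) * (?L i * ?E j) * ?L j) \<in> rel_ideal D"
      unfolding ueq_def by (rule d)
    moreover have "?f (?K i * ?E j - const (bq D i j) * ?E j * ?K i)
      = - (?E j * (?L j * ?L i) - const (bq D i j) * (?L i * ?E j) * ?L j)"
      by (simp add: antihom_simps) (simp add: const_comm cst.sm_simps)
    ultimately show "?K i * ?E j - const (bq D i j) * ?E j * ?K i \<in> {p. ?f p \<in> rel_ideal D}"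
      by (simp only: mem_Collect_eq)
    have "?L i * ?K j * ?F j \<triangleq> ?K j * ?L i * ?F j" by (intro ueq_mult ueq_refl K_rels)
    also have "\<dots> = ?K j * (?L i * ?F j)" by (simp add: mult.assoc)
    also have "\<dots> \<triangleq> ?K j * (const (bq D i j) * ?F j * ?L i)" by (intro ueq_mult ueq_refl K_rels)
    finally have "const (inverse (bq D i j)) * (?L i * ?K j * ?F j) \<triangleq>
        const (inverse (bq D i j)) * (?K j * (const (bq D i j) * ?F j * ?L i))"
      by (rule ueq_mult[OF ueq_refl])
    also have "\<dots> = ?K j * ?F j * ?L i" using b0[of i j] by (simp add: cst.sm_simps)
    finally have "const (inverse (bq D i j)) * (?L i * ?K j * ?F j) - ?K j * ?F j * ?L i \<in> rel_ideal D"
      by (simp add: ueq_def)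
    moreover have "?f (?K i * ?F j - const (inverse (bq D i j)) * ?F j * ?K i)
      = const (inverse (bq D i j)) * (?L i * ?K j * ?F j) - ?K j * ?F j * ?L i"
      by (simp add: antihom_simps) (simp add: const_comm cst.sm_simps)
    ultimately show "?K i * ?F j - const (inverse (bq D i j)) * ?F j * ?K i \<in> {p. ?f p \<in> rel_ideal D}"
      by (simp only: mem_Collect_eq)
    have "?E i * ?L i * (?K j * ?F j) = ?E i * (?L i * ?K j) * ?F j" by (simp add: mult.assoc)
    also have "\<dots> \<triangleq> ?E i * (?K j * ?L i) * ?F j" by (intro ueq_mult ueq_refl K_rels)
    also have "\<dots> = ?E i * ?K j * (?L i * ?F j)" by (simp add: mult.assoc)
    also have "\<dots> \<triangleq> ?E i * ?K j * (const (bq D i j) * ?F j * ?L i)" by (intro ueq_mult ueq_refl K_rels)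
    also have "\<dots> = const (bq D j i) * ?E i * ?K j * (?F j * ?L i)" by (simp add: cst.sm_simps b_sym[of i j])
    also have "\<dots> \<triangleq> ?K j * ?E i * (?F j * ?L i)" by (intro ueq_mult ueq_refl ueq_sym[OF K_rels(6)])
    finally have 1: "?E i * ?L i * (?K j * ?F j) \<triangleq> ?K j * ?E i * (?F j * ?L i)" .
    have "?K j * ?F j * (?E i * ?L i) - ?E i * ?L i * (?K j * ?F j)
      \<triangleq> ?K j * ?F j * (?E i * ?L i) - ?K j * ?E i * (?F j * ?L i)"
      by (intro ueq_diff ueq_refl 1)
    also have "\<dots> = - 1 * (?K j * (?E i * ?F j - ?F j * ?E i) * ?L i)" by (simp add: algebra_simps)
    also have "\<dots> \<triangleq> - 1 * (?K j * (if i = j then const (aq i) * (?K i - ?L i) else 0) * ?L i)"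
      by (intro ueq_mult ueq_refl K_rels)
    also have "\<dots> = (if i = j then const (aq i) * ((?K i * ?L i) * ?L i * 1 - ?K i * (?K i * ?L i)) + 0 else 0)
      + (if i = j then const (aq i) * (?K i * ?L i * ?L i - ?K i * ?L i * ?L i) else 0)"
      by (simp add: cst.sm_simps algebra_simps)
    also have "\<dots> \<triangleq> (if i = j then const (aq i) * (1 * ?L i * 1 - ?K i * 1) + 0 else 0)
      + (if i = j then const (aq i) * (?K i * ?L i * ?L i - ?K i * ?L i * ?L i) else 0)"
      using ueq_mult[OF K_rels(1)[of i] ueq_refl[of "?L i"]] ueq_mult[OF ueq_refl[of "?K i"] K_rels(1)[of i]]
      by (cases "i = j") (auto intro!: ueq_add ueq_diff ueq_mult[OF ueq_refl])
    finally have "?K j * ?F j * (?E i * ?L i) - ?E i * ?L i * (?K j * ?F j)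
       - (if i = j then const (aq i) * (?L i - ?K i) else 0) \<in> rel_ideal D"
      by (simp add: ueq_def cong: if_cong)
    then show "?E i * ?F j - ?F j * ?E i - (if i = j then const (aq i) * (?K i - ?L i) else 0)
       \<in> {p. ?f p \<in> rel_ideal D}"
      by (cases "i = j") (simp_all add: antihom_simps const_comm)
    assume ij: "i \<noteq> j"
    note T = t0[of i] tru[of _ i] bn[OF ij] nq1[OF ij] H
    have fs: "?f (serre D Z i j) = const ((- 1) ^ nq D i j) * cst.qserre (qi D i) (nq D i j) (?f (gen (Z i))) (?f (gen (Z j)))" for Z
      unfolding serre_eq by (rule cst.lext_anti_qserre) (simp_all add: antihom_simps)
    note R = K_rels[unfolded ueq_def]
    have neg: "- x = const (- 1) * x" for x :: "'i falg" by (simp add: cst.sc_minus cst.sc_one)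
    have "cst.qserre (qi D i) (nq D i j) (?E i * ?L i) (?E j * ?L j) \<in> rel_ideal D"
      by (rule cst.qserre_twist[OF T R(8) R(8) _ R(5)])
        (use R(8)[of j i] rels(7)[OF ij] in \<open>simp_all add: b_sym[of j i] serre_eq\<close>)
    then show "serre D QE i j \<in> {p. ?f p \<in> rel_ideal D}"
      by (simp add: fs antihom_simps) (simp only: neg cst.qserre_scale, intro d)
    have "cst.qserre (qi D i) (nq D i j) (?F i * ?K i) (?F j * ?K j) \<in> rel_ideal D"
      by (rule cst.qserre_twist[OF T R(7) R(7) _ R(3)])
        (use R(7)[of j i] rels(8)[OF ij] in \<open>simp_all add: b_sym[of j i] serre_eq\<close>)
    \<comment> \<open>By K_i F_i = q^(-(alpha_i, alpha_i)) F_i K_i, the value -K_i F_i is this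
      multiple of F_i K_i, the form in which the twist is available.\<close>
    then have 2: "cst.qserre (qi D i) (nq D i j) (const (- inverse (bq D i i)) * (?F i * ?K i))
       (const (- inverse (bq D j j)) * (?F j * ?K j)) \<in> rel_ideal D"
      unfolding cst.qserre_scale by (intro d)
    have "- (?K i * ?F i) - const (- inverse (bq D i i)) * (?F i * ?K i) \<in> rel_ideal D" for i
    proof -
      have "- (?K i * ?F i - const (inverse (bq D i i)) * ?F i * ?K i) \<in> rel_ideal D" by (intro d R)
      then show ?thesis by (simp add: cst.sc_minus mult.assoc)
    qed
    from d(2)[OF cst.qserre_cong[OF H this[of i] this[of j], of "qi D i" "nq D i j"] 2]
    have "cst.qserre (qi D i) (nq D i j) (- (?K i * ?F i)) (- (?K j * ?F j)) \<in> rel_ideal D"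
      by simp
    then show "serre D QF i j \<in> {p. ?f p \<in> rel_ideal D}"
      by (simp add: fs antihom_simps d)
  qed
  then show "p \<in> rel_ideal D \<Longrightarrow> ?f p \<in> rel_ideal D" by auto
qed

lemma antipode_ucl: "antipode D (ucl D p) = ucl D (free_antihom antipode_gen p)"
  unfolding antipode_def by (rule the_elem_ucl) (simp_all add: rel_ideal_antipode antihom_simps)

end

subsection \<open>The relation ideal is a Hopf ideal\<close>

text \<open>The tensor p \<otimes> q: the tensor product of two monoid algebras is the monoid
  algebra of the product monoid.\<close>

definition tn :: "('m::monoid_add \<Rightarrow>\<^sub>0 complex) \<Rightarrow> ('n::monoid_add \<Rightarrow>\<^sub>0 complex) \<Rightarrow> ('m \<times> 'n \<Rightarrow>\<^sub>0 complex)" where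
  "tn p q = cst.lext (\<lambda>a. cst.lext (\<lambda>b. Poly_Mapping.single (a, b) 1) q) p"

lemma tn_add: "tn (p + p') q = tn p q + tn p' q" "tn p (q + q') = tn p q + tn p q'"
proof -
  show "tn (p + p') q = tn p q + tn p' q" by (simp add: tn_def cst.lext_add)
  show "tn p (q + q') = tn p q + tn p q'"
    unfolding tn_def cst.lext_add by (simp add: cst.lext_def distrib_left sum.distrib)
qed

lemma tn_const: "tn (const c * p) q = const c * tn p q" "tn p (const c * q) = const c * tn p q"
proof -
  show "tn (const c * p) q = const c * tn p q" by (simp add: tn_def cst.lext_const_mult)
  show "tn p (const c * q) = const c * tn p q"
    unfolding tn_def cst.lext_const_mult
    by (simp add: cst.lext_def sum_distrib_left) (rule sum.cong, simp, rule sum.cong, simp, rule cst.sc_left)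
qed

lemma tn_zero [simp]: "tn 0 q = 0" "tn p 0 = 0"
  using tn_add(1)[of 0 0 q] tn_add(2)[of p 0 0] by simp_all

lemma tn_minus: "tn (- p) q = - tn p q" "tn p (- q) = - tn p q"
  using tn_add(1)[of p "- p" q] tn_add(2)[of p q "- q"]
  by (simp_all add: eq_neg_iff_add_eq_0 add.commute)

lemma tn_diff: "tn (p - p') q = tn p q - tn p' q" "tn p (q - q') = tn p q - tn p q'"
  using tn_add(1)[of p "- p'" q] tn_add(2)[of p q "- q'"] by (simp_all add: tn_minus)

lemma tn_single: "tn (Poly_Mapping.single a c) (Poly_Mapping.single b d) = Poly_Mapping.single (a, b) (c * d)"
  by (simp add: tn_def cst.lext_single const_mult_single)

lemma single_tn: "Poly_Mapping.single w c =
    tn (Poly_Mapping.single (fst w) c) (Poly_Mapping.single (snd w) 1)"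
  by (simp add: tn_single)

lemma tn_mult: "tn p q * tn p' q' = tn (p * p') (q * q')"
proof (induction p rule: pm_induct)
  case (single a c)
  show ?case
  proof (induction q rule: pm_induct)
    case (single b d)
    show ?case
    proof (induction p' rule: pm_induct)
      case (single a' c')
      show ?case
        by (induction q' rule: pm_induct)
          (simp_all add: tn_single mult_single tn_add distrib_left mult_ac plus_prod_def)
    qed (simp_all add: tn_add distrib_left)
  qed (simp_all add: tn_add algebra_simps)
qed (simp_all add: tn_add algebra_simps)

lemma one_tn: "(1 :: 'm::monoid_add \<times> 'n::monoid_add \<Rightarrow>\<^sub>0 complex) = tn 1 1"
  using tn_single[of "0::'m" 1 "0::'n" 1] by (simp add: zero_prod_def[symmetric])

lemma tn_const_one: "tn (const c) 1 = const c" "tn 1 (const c) = const c"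
  using tn_single[of 0 c 0 1] tn_single[of 0 1 0 c] by (simp_all add: const_def zero_prod_def)

lemma coprod_gen_tn:
  "coprod_gen (QK i) = tn (gen (QK i)) (gen (QK i))"
  "coprod_gen (QKi i) = tn (gen (QKi i)) (gen (QKi i))"
  "coprod_gen (QE i) = tn (gen (QE i)) (gen (QK i)) + tn 1 (gen (QE i))"
  "coprod_gen (QF i) = tn (gen (QF i)) 1 + tn (gen (QKi i)) (gen (QF i))"
proof -
  have o: "1 = Poly_Mapping.single 0 (1::complex)" by simp
  show "coprod_gen (QK i) = tn (gen (QK i)) (gen (QK i))"
    "coprod_gen (QKi i) = tn (gen (QKi i)) (gen (QKi i))"
    "coprod_gen (QE i) = tn (gen (QE i)) (gen (QK i)) + tn 1 (gen (QE i))"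
    "coprod_gen (QF i) = tn (gen (QF i)) 1 + tn (gen (QKi i)) (gen (QF i))"
    unfolding gen_def o tn_single by simp_all
qed

declare coprod_gen.simps [simp del]

definition lin_functional :: "('m::monoid_add \<Rightarrow>\<^sub>0 complex) set \<Rightarrow> (('m \<Rightarrow>\<^sub>0 complex) \<Rightarrow> complex) \<Rightarrow> bool" where
  "lin_functional H f \<longleftrightarrow> (\<forall>p q. f (p + q) = f p + f q) \<and> (\<forall>c p. f (const c * p) = c * f p) \<and> (\<forall>p\<in>H. f p = 0)"

text \<open>The map id \<otimes> f on the tensor product.\<close>

definition slice :: "(('n::monoid_add \<Rightarrow>\<^sub>0 complex) \<Rightarrow> complex) \<Rightarrow> ('m::monoid_add \<times> 'n \<Rightarrow>\<^sub>0 complex) \<Rightarrow> ('m \<Rightarrow>\<^sub>0 complex)" where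
  "slice f = cst.lext (\<lambda>(a, b). const (f (Poly_Mapping.single b 1)) * Poly_Mapping.single a 1)"

lemma slice_simps: "slice f (P + Q) = slice f P + slice f Q" "slice f (P - Q) = slice f P - slice f Q"
  "slice f 0 = 0" "slice f (const c * P) = const c * slice f P" "slice f (- P) = - slice f P"
  by (simp_all add: slice_def cst.lext_add cst.lext_diff cst.lext_const_mult cst.lext_minus)

lemma slice_tn:
  assumes f: "lin_functional H f"
  shows "slice f (tn p q) = const (f q) * p"
proof (induction p rule: pm_induct)
  case (single a c)
  have f0: "f 0 = 0" using f by (metis lin_functional_def add_cancel_right_left)
  show ?case
  proof (induction q rule: pm_induct)
    case zero
    then show ?case by (simp add: f0 slice_simps)
  next
    case (single b d)
    have "f (Poly_Mapping.single b d) = d * f (Poly_Mapping.single b 1)"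
      using f by (subst single_conv_const) (simp add: lin_functional_def)
    then show ?case by (simp add: tn_single slice_def cst.lext_single const_mult_single mult_ac)
  next
    case (add p q)
    then show ?case using f by (simp add: tn_add slice_simps lin_functional_def cst.sc_add distrib_right)
  qed
qed (simp_all add: slice_simps tn_add distrib_left)

text \<open>For an ideal H of A this is H \<otimes> A + A \<otimes> H, described by functionals:
  applying any functional of A/H to the second factor must give an element of H. In this form no
  decomposition of the tensor has to be exhibited.\<close>

definition hopf :: "('m::monoid_add \<Rightarrow>\<^sub>0 complex) set \<Rightarrow> ('m \<times> 'm \<Rightarrow>\<^sub>0 complex) set" where
  "hopf H = {P. \<forall>f. lin_functional H f \<longrightarrow> slice f P \<in> H}"

text \<open>When P is multiplied by a pure tensor a \<otimes> b, the slice releases a as an outer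
  factor, and b goes into the functional, which becomes q -> f(b q) or q -> f(q b). The new
  functional still vanishes on H.\<close>

lemma two_sided_hopf:
  assumes H: "two_sided H"
  shows "two_sided (hopf H)"
proof -
  note d = two_sidedD[OF H]
  have fl: "lin_functional H (\<lambda>q. f (r * q))" "lin_functional H (\<lambda>q. f (q * r))"
    if "lin_functional H f" for f r
    using that d by (auto simp: lin_functional_def distrib_left distrib_right cst.sc_left mult.assoc)
  have sl: "slice f (tn a b * P) = a * slice (\<lambda>q. f (b * q)) P"
    "slice f (P * tn a b) = slice (\<lambda>q. f (q * b)) P * a" if f: "lin_functional H f" for f a b P
  proof -
    show "slice f (tn a b * P) = a * slice (\<lambda>q. f (b * q)) P"
    proof (induction P rule: pm_induct)
      case (single w c)
      show ?case unfolding single_tn by (simp add: tn_mult slice_tn[OF f] slice_tn[OF fl(1)[OF f]] cst.sm_simps)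
    qed (simp_all add: slice_simps distrib_left)
    show "slice f (P * tn a b) = slice (\<lambda>q. f (q * b)) P * a"
    proof (induction P rule: pm_induct)
      case (single w c)
      show ?case unfolding single_tn by (simp add: tn_mult slice_tn[OF f] slice_tn[OF fl(2)[OF f]] cst.sm_simps)
    qed (simp_all add: slice_simps distrib_right)
  qed
  have m: "Q * P \<in> hopf H \<and> P * Q \<in> hopf H" if P: "P \<in> hopf H" for P Q
  proof (induction Q rule: pm_induct)
    case (single w c)
    obtain a b where w: "w = (a, b)" by (cases w)
    have "Poly_Mapping.single w c = tn (Poly_Mapping.single a c) (Poly_Mapping.single b 1)" by (simp add: w tn_single)
    then show ?case using P fl by (auto simp: hopf_def sl intro: d)
  qed (use P d in \<open>auto simp: hopf_def distrib_left distrib_right slice_simps\<close>)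
  show ?thesis unfolding two_sided_def using m d by (auto simp: hopf_def slice_simps)
qed

lemma tn_hopf:
  assumes H: "two_sided H"
  shows "p \<in> H \<Longrightarrow> tn p q \<in> hopf H" "q \<in> H \<Longrightarrow> tn p q \<in> hopf H"
  using two_sidedD[OF H] by (auto simp: hopf_def slice_tn lin_functional_def)

context qdatum
begin

text \<open>The coproduct of each quadratic relation is a combination of tensors with a relation in
  one factor. For the Serre relations, the two summands of each coproduct q-commute, which is the
  situation of \<open>qserre_skew_primitive\<close>.\<close>

lemma rel_ideal_coprod: "p \<in> rel_ideal D \<Longrightarrow> free_hom coprod_gen p \<in> hopf (rel_ideal D)"
proof -
  let ?f = "free_hom (coprod_gen :: 'i qgen \<Rightarrow> _)"
  let ?K = "\<lambda>i. gen (QK i) :: 'i falg" and ?L = "\<lambda>i. gen (QKi i) :: 'i falg"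
  let ?E = "\<lambda>i. gen (QE i) :: 'i falg" and ?F = "\<lambda>i. gen (QF i) :: 'i falg"
  let ?I = "rel_ideal D"
  note d = two_sidedD[OF two_sided_rel_ideal[of D]]
  note H = two_sided_hopf[OF two_sided_rel_ideal[of D]]
  note dh = two_sidedD[OF H]
  have feq: "f x = f y" if "lin_functional ?I f" "x \<triangleq> y" for f x y
  proof -
    have "f (x - y + y) = f (x - y) + f y" using that(1) unfolding lin_functional_def by blast
    then show ?thesis using that by (simp add: lin_functional_def ueq_def)
  qed
  have flin: "f (const c * x) = c * f x" "f (x + y) = f x + f y" "f (x - y) = f x - f y" "f 0 = 0"
    if "lin_functional ?I f" for f c x y
  proof -
    have a: "f (const c * x) = c * f x" "f (x + y) = f x + f y" for c x y
      using that by (simp_all add: lin_functional_def)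
    show "f (const c * x) = c * f x" "f (x + y) = f x + f y" by (rule a)+
    show "f 0 = 0" using a(1)[of 0 0] by simp
    show "f (x - y) = f x - f y" using a(2)[of "x - y" y] by simp
  qed
  have "?I \<subseteq> {p. ?f p \<in> hopf ?I}"
  proof (rule two_sided_rels)
    show "two_sided {p. ?f p \<in> hopf ?I}"
      unfolding two_sided_def by (auto simp: eta_hom_simps dh)
  next
    fix i j
    show "?K i * ?L i - 1 \<in> {p. ?f p \<in> hopf ?I}"
    proof -
      have "tn (?K i * ?L i - 1) (?K i * ?L i) + tn 1 (?K i * ?L i - 1) \<in> hopf ?I"
        by (intro dh(2) tn_hopf[OF two_sided_rel_ideal] rels)
      then show ?thesis by (simp add: eta_hom_simps coprod_gen_tn tn_mult tn_diff one_tn)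
    qed
    show "?L i * ?K i - 1 \<in> {p. ?f p \<in> hopf ?I}"
    proof -
      have "tn (?L i * ?K i - 1) (?L i * ?K i) + tn 1 (?L i * ?K i - 1) \<in> hopf ?I"
        by (intro dh(2) tn_hopf[OF two_sided_rel_ideal] rels)
      then show ?thesis by (simp add: eta_hom_simps coprod_gen_tn tn_mult tn_diff one_tn)
    qed
    show "?K i * ?K j - ?K j * ?K i \<in> {p. ?f p \<in> hopf ?I}"
    proof -
      have "tn (?K i * ?K j - ?K j * ?K i) (?K i * ?K j) + tn (?K j * ?K i) (?K i * ?K j - ?K j * ?K i) \<in> hopf ?I"
        by (intro dh(2) tn_hopf[OF two_sided_rel_ideal] rels)
      then show ?thesis by (simp add: eta_hom_simps coprod_gen_tn tn_mult tn_diff)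
    qed
    show "?K i * ?E j - const (bq D i j) * ?E j * ?K i \<in> {p. ?f p \<in> hopf ?I}"
    proof -
      have "tn (?K i * ?E j - const (bq D i j) * ?E j * ?K i) (?K i * ?K j)
        + const (bq D i j) * tn (?E j * ?K i) (?K i * ?K j - ?K j * ?K i)
        + tn (?K i) (?K i * ?E j - const (bq D i j) * ?E j * ?K i) \<in> hopf ?I"
        by (intro dh(2) dh(3) tn_hopf[OF two_sided_rel_ideal] rels)
      then show ?thesis
        by (simp add: eta_hom_simps coprod_gen_tn tn_mult tn_diff distrib_left distrib_right mult.assoc tn_const right_diff_distrib)
          (simp add: algebra_simps)
    qed
    show "?K i * ?F j - const (inverse (bq D i j)) * ?F j * ?K i \<in> {p. ?f p \<in> hopf ?I}"
    proof -
      have "tn (?K i * ?F j - const (inverse (bq D i j)) * ?F j * ?K i) (?K i)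
        + tn (?K i * ?L j) (?K i * ?F j - const (inverse (bq D i j)) * ?F j * ?K i)
        + const (inverse (bq D i j)) * tn (?K i * ?L j - ?L j * ?K i) (?F j * ?K i) \<in> hopf ?I"
        by (intro dh(2) dh(3) tn_hopf[OF two_sided_rel_ideal] rels)
          (use K_rels(4)[of j i] ueq_sym in \<open>auto simp: ueq_def\<close>)
      then show ?thesis
        by (simp add: eta_hom_simps coprod_gen_tn tn_mult tn_diff distrib_left distrib_right mult.assoc tn_const right_diff_distrib)
          (simp add: algebra_simps)
    qed
    define \<delta> where "\<delta> = (if i = j then aq i else 0)"
    have R6: "?E i * ?F j - ?F j * ?E i - const \<delta> * (?K i - ?L i) \<in> ?I"
      using rels(6)[of i j] by (cases "i = j") (simp_all add: \<delta>_def)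
    \<comment> \<open>The last two tensors compare the mixed terms E_i K_j^-1 \<otimes> K_i F_j and
      K_j^-1 E_i \<otimes> F_j K_i: the powers of q from the two factors cancel.\<close>
    have "tn (?E i * ?F j - ?F j * ?E i - const \<delta> * (?K i - ?L i)) (?K i)
      + tn (?L j) (?E i * ?F j - ?F j * ?E i - const \<delta> * (?K i - ?L i))
      - const (bq D j i) * tn (?L j * ?E i - const (inverse (bq D j i)) * ?E i * ?L j) (?K i * ?F j)
      + const (bq D j i) * tn (?L j * ?E i) (?K i * ?F j - const (inverse (bq D i j)) * ?F j * ?K i) \<in> hopf ?I"
      by (intro dh(2) dh(6) dh(3) tn_hopf[OF two_sided_rel_ideal] R6 rels)
        (use K_rels(8) in \<open>auto simp: ueq_def\<close>)
    then have "?f (?E i * ?F j - ?F j * ?E i - const \<delta> * (?K i - ?L i)) \<in> hopf ?I"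
      using b0[of j i] b_sym[of i j]
      by (cases "i = j")
        (simp_all add: \<delta>_def eta_hom_simps coprod_gen_tn tn_mult tn_diff distrib_left distrib_right
          mult.assoc tn_const right_diff_distrib cst.sc_merge cst.sc_one, simp_all add: algebra_simps)
    then show "?E i * ?F j - ?F j * ?E i - (if i = j then const (aq i) * (?K i - ?L i) else 0) \<in> {p. ?f p \<in> hopf ?I}"
      by (cases "i = j") (simp_all add: \<delta>_def)
    assume ij: "i \<noteq> j"
    note T = t0[of i] tru[of _ i] bn[OF ij] nq1[OF ij] H
    have fs: "?f (serre D Z i j) = cst.qserre (qi D i) (nq D i j) (coprod_gen (Z i)) (coprod_gen (Z j))" for Z
      by (simp add: serre_eq free_hom_eq_ahom cst.ahom_qserre cst.ahom_gen)
    have g: "g \<in> hopf ?I" if "f = g" "f \<in> hopf ?I" for f g using that by simp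
    have hm: "cst.qserre t n (tn x 1) (tn y 1) \<in> hopf ?I" "cst.qserre t n (tn 1 x) (tn 1 y) \<in> hopf ?I"
      if S: "cst.qserre t n x y \<in> ?I" for t n x y
    proof -
      have e: "tn p (1 :: 'i falg) = cst.ahom (\<lambda>a. tn (gen a) 1) p" for p :: "'i falg"
        by (intro cst.ahom_unique[of "\<lambda>p. tn p 1"]) (simp_all add: tn_add tn_mult one_tn gen_def tn_const_one)
      have "cst.qserre t n (tn x 1) (tn y (1 :: 'i falg)) = tn (cst.qserre t n x y) 1"
        using cst.ahom_qserre[of "\<lambda>a. tn (gen a) (1 :: 'i falg)" t n x y]
        unfolding e[of x, symmetric] e[of y, symmetric] e[of "cst.qserre t n x y", symmetric] by (rule sym)
      then show "cst.qserre t n (tn x 1) (tn y 1) \<in> hopf ?I"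
        using tn_hopf(1)[OF two_sided_rel_ideal S] by simp
      have e': "tn (1 :: 'i falg) p = cst.ahom (\<lambda>a. tn 1 (gen a)) p" for p :: "'i falg"
        by (intro cst.ahom_unique[of "\<lambda>p. tn 1 p"]) (simp_all add: tn_add tn_mult one_tn gen_def tn_const_one)
      have "cst.qserre t n (tn (1 :: 'i falg) x) (tn 1 y) = tn 1 (cst.qserre t n x y)"
        using cst.ahom_qserre[of "\<lambda>a. tn (1 :: 'i falg) (gen a)" t n x y]
        unfolding e'[of x, symmetric] e'[of y, symmetric] e'[of "cst.qserre t n x y", symmetric] by (rule sym)
      then show "cst.qserre t n (tn 1 x) (tn 1 y) \<in> hopf ?I"
        using tn_hopf(2)[OF two_sided_rel_ideal S] by simp
    qed
    have R9: "?L k * ?F l - const (bq D k l) * ?F l * ?L k \<in> ?I" for k l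
      using K_rels(9) by (simp add: ueq_def)
    have LL: "?L j * ?L i - ?L i * ?L j \<in> ?I" using K_rels(5) by (simp add: ueq_def)
    note S = rels(7)[OF ij, unfolded serre_eq] rels(8)[OF ij, unfolded serre_eq]
    let ?n = "nq D i j" and ?t = "qi D i"
    show "serre D QF i j \<in> {p. ?f p \<in> hopf ?I}"
    proof -
      have "cst.qserre ?t ?n (tn (?F i) 1 + tn (?L i) (?F i)) (tn (?F j) 1 + tn (?L j) (?F j))
        - (cst.qserre ?t ?n (tn (?F i) 1) (tn (?F j) 1) + cst.qserre ?t ?n (tn (?L i) (?F i)) (tn (?L j) (?F j))) \<in> hopf ?I"
      proof (rule cst.qserre_skew_primitive[OF T])
        show "tn (?L i) (?F i) * tn (?F i) 1 - const (?t\<^sup>2) * tn (?F i) 1 * tn (?L i) (?F i) \<in> hopf ?I"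
          by (rule g[OF _ tn_hopf(1)[OF two_sided_rel_ideal R9[of i i], of "?F i"]])
            (simp add: tn_diff tn_const tn_mult mult.assoc bii)
        show "tn (?L i) (?F i) * tn (?F j) 1 - const (bq D i j) * tn (?F j) 1 * tn (?L i) (?F i) \<in> hopf ?I"
          by (rule g[OF _ tn_hopf(1)[OF two_sided_rel_ideal R9[of i j], of "?F i"]])
            (simp add: tn_diff tn_const tn_mult mult.assoc)
        show "tn (?L j) (?F j) * tn (?F i) 1 - const (bq D i j) * tn (?F i) 1 * tn (?L j) (?F j) \<in> hopf ?I"
          by (rule g[OF _ tn_hopf(1)[OF two_sided_rel_ideal R9[of j i], of "?F j"]])
            (simp add: tn_diff tn_const tn_mult mult.assoc b_sym[of j i])
      qed
      \<comment> \<open>K_i^-1 \<otimes> F_i is 1 \<otimes> F_i twisted by K_i^-1 \<otimes> 1, and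
        the twist commutes with all 1 \<otimes> F_j; hence c = d = 1.\<close>
      moreover have "cst.qserre ?t ?n (tn 1 (?F i) * tn (?L i) 1) (tn 1 (?F j) * tn (?L j) 1) \<in> hopf ?I"
        by (rule cst.qserre_twist[OF T, where c = 1 and d = 1])
          (use hm(2)[OF S(2)] tn_hopf(1)[OF two_sided_rel_ideal LL, of 1] in
            \<open>simp_all add: tn_mult cst.sc_one dh(1) tn_diff\<close>)
      ultimately show ?thesis using hm(1)[OF S(2)] dh(2)
        by (simp add: fs coprod_gen_tn tn_mult) (metis diff_add_cancel)
    qed
    show "serre D QE i j \<in> {p. ?f p \<in> hopf ?I}"
    proof -
      have "cst.qserre ?t ?n (tn 1 (?E i) + tn (?E i) (?K i)) (tn 1 (?E j) + tn (?E j) (?K j))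
        - (cst.qserre ?t ?n (tn 1 (?E i)) (tn 1 (?E j)) + cst.qserre ?t ?n (tn (?E i) (?K i)) (tn (?E j) (?K j))) \<in> hopf ?I"
      proof (rule cst.qserre_skew_primitive[OF T])
        show "tn (?E i) (?K i) * tn 1 (?E i) - const (?t\<^sup>2) * tn 1 (?E i) * tn (?E i) (?K i) \<in> hopf ?I"
          by (rule g[OF _ tn_hopf(2)[OF two_sided_rel_ideal rels(4)[of i i], of "?E i"]])
            (simp add: tn_diff tn_const tn_mult mult.assoc bii)
        show "tn (?E i) (?K i) * tn 1 (?E j) - const (bq D i j) * tn 1 (?E j) * tn (?E i) (?K i) \<in> hopf ?I"
          by (rule g[OF _ tn_hopf(2)[OF two_sided_rel_ideal rels(4)[of i j], of "?E i"]])
            (simp add: tn_diff tn_const tn_mult mult.assoc)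
        show "tn (?E j) (?K j) * tn 1 (?E i) - const (bq D i j) * tn 1 (?E i) * tn (?E j) (?K j) \<in> hopf ?I"
          by (rule g[OF _ tn_hopf(2)[OF two_sided_rel_ideal rels(4)[of j i], of "?E j"]])
            (simp add: tn_diff tn_const tn_mult mult.assoc b_sym[of j i])
      qed
      moreover have "cst.qserre ?t ?n (tn (?E i) 1 * tn 1 (?K i)) (tn (?E j) 1 * tn 1 (?K j)) \<in> hopf ?I"
        by (rule cst.qserre_twist[OF T, where c = 1 and d = 1])
          (use hm(1)[OF S(1)] tn_hopf(2)[OF two_sided_rel_ideal rels(3)[of j i], of 1] in
            \<open>simp_all add: tn_mult cst.sc_one dh(1) tn_diff\<close>)
      ultimately show ?thesis using hm(2)[OF S(1)] dh(2)
        by (simp add: fs coprod_gen_tn tn_mult add.commute) (metis diff_add_cancel)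
    qed
  qed
  then show "p \<in> ?I \<Longrightarrow> ?f p \<in> hopf ?I" by auto
qed

end

subsection \<open>Tensor products\<close>

lemma vector_space_pm: "vector_space (\<lambda>c (p :: 'm::monoid_add \<Rightarrow>\<^sub>0 complex). const c * p)"
  by standard (simp_all add: distrib_left distrib_right cst.sc_add cst.sc_merge cst.sc_one)

text \<open>E is a basis of the span of B modulo I, chosen inside B, and the \<open>fs e\<close> are
  its coordinate functionals.\<close>

lemma dual_family:
  fixes I :: "('m::monoid_add \<Rightarrow>\<^sub>0 complex) set"
  assumes I: "two_sided I" and B: "finite B"
  shows "\<exists>E fs. E \<subseteq> B \<and> (\<forall>e\<in>E. lin_functional I (fs e)) \<and>
    (\<forall>b\<in>B. b - (\<Sum>e\<in>E. const (fs e b) * e) \<in> I)"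
proof -
  interpret vs: vector_space "\<lambda>c (p :: 'm \<Rightarrow>\<^sub>0 complex). const c * p" by (rule vector_space_pm)
  note d = two_sidedD[OF I]
  have sub: "vs.subspace I" using d by (auto simp: vs.subspace_def)
  obtain C where C: "C \<subseteq> I" "vs.independent C" "vs.span C = I"
    using vs.maximal_independent_subset[of I] sub vs.span_minimal[OF _ sub] by (metis subset_antisym)
  obtain T where T: "C \<subseteq> T" "T \<subseteq> C \<union> B" "vs.independent T" "C \<union> B \<subseteq> vs.span T"
    using vs.maximal_independent_subset_extend[of C "C \<union> B"] C(2) by blast
  define E where "E = T - C"
  \<comment> \<open>Extending to a basis X of the whole space makes the coordinates at E functionals
    that are defined everywhere; they vanish on I, which is spanned by C.\<close>
  define X where "X = vs.extend_basis T"
  have X: "vs.independent X" "T \<subseteq> X" "vs.span X = UNIV"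
    unfolding X_def using T(3) vs.independent_extend_basis vs.extend_basis_superset vs.span_extend_basis by auto
  define f where "f e p = vs.representation X p e" for e p
  have uX: "p \<in> vs.span X" for p using X by simp
  have fl: "lin_functional I (f e)" if "e \<in> E" for e
  proof -
    have "f e p = 0" if "p \<in> I" for p
    proof -
      have "vs.representation X p = vs.representation C p"
        by (rule vs.representation_extend[OF X(1)]) (use C T X that in auto)
      then show ?thesis unfolding f_def using vs.representation_ne_zero[of C p e] \<open>e \<in> E\<close> by (auto simp: E_def)
    qed
    then show ?thesis
      unfolding lin_functional_def f_def using vs.representation_add[OF X(1) uX uX] vs.representation_scale[OF X(1) uX] by auto
  qed
  have fE: "finite E" using B T(2) by (auto simp: E_def intro: finite_subset)
  have "b - (\<Sum>e\<in>E. const (f e b) * e) \<in> I" if "b \<in> B" for b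
  proof -
    have bT: "b \<in> vs.span T" using T that by auto
    let ?r = "vs.representation T b"
    have rX: "vs.representation X b = ?r" by (rule vs.representation_extend[OF X(1) bT X(2)])
    have fin: "finite {v. ?r v \<noteq> 0}" by (rule vs.finite_representation)
    have sT: "{v. ?r v \<noteq> 0} \<subseteq> T" using vs.representation_ne_zero[of T b] by auto
    have "b = (\<Sum>v | ?r v \<noteq> 0. const (?r v) * v)" using vs.sum_nonzero_representation_eq[OF T(3) bT] by simp
    also have "{v. ?r v \<noteq> 0} = ({v. ?r v \<noteq> 0} \<inter> C) \<union> ({v. ?r v \<noteq> 0} \<inter> E)" using sT by (auto simp: E_def)
    also have "(\<Sum>v\<in>\<dots>. const (?r v) * v) = (\<Sum>v\<in>{v. ?r v \<noteq> 0} \<inter> C. const (?r v) * v) + (\<Sum>v\<in>{v. ?r v \<noteq> 0} \<inter> E. const (?r v) * v)"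
      by (rule sum.union_disjoint) (use fin in \<open>auto simp: E_def\<close>)
    also have "(\<Sum>v\<in>{v. ?r v \<noteq> 0} \<inter> E. const (?r v) * v) = (\<Sum>e\<in>E. const (f e b) * e)"
      unfolding f_def rX by (rule sum.mono_neutral_cong_left) (use fE in auto)
    finally have "b - (\<Sum>e\<in>E. const (f e b) * e) = (\<Sum>v\<in>{v. ?r v \<noteq> 0} \<inter> C. const (?r v) * v)"
      by (simp add: algebra_simps)
    also have "\<dots> \<in> I" unfolding C(3)[symmetric]
      by (intro vs.span_sum vs.span_scale vs.span_base) auto
    finally show ?thesis .
  qed
  moreover have "E \<subseteq> B" using T(2) by (auto simp: E_def)
  ultimately show ?thesis using fl by blast
qed

text \<open>The balanced tensor product is formed twice: M \<otimes> N over the scalars, and U_q(g)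
  \<otimes> T over the Levi part.\<close>

locale tensor_setup = A: abelian_group A + B: abelian_group B
  for A :: "('a, 'x) ring_scheme" and B :: "('b, 'y) ring_scheme" +
  fixes Rs :: "'r set" and ra :: "'a \<Rightarrow> 'r \<Rightarrow> 'a" and la :: "'r \<Rightarrow> 'b \<Rightarrow> 'b"
  assumes ra_closed: "a \<in> carrier A \<Longrightarrow> r \<in> Rs \<Longrightarrow> ra a r \<in> carrier A"
    and la_closed: "b \<in> carrier B \<Longrightarrow> r \<in> Rs \<Longrightarrow> la r b \<in> carrier B"
begin

abbreviation "S \<equiv> carrier A \<times> carrier B"
abbreviation "G \<equiv> free_Abelian_group S"
definition "K = tensor_ker A B Rs ra la"
definition "cl z = tensor_cl A B K z"
definition "pure a b = cl (frag_of (a, b))"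

definition "gens = {frag_of (a \<oplus>\<^bsub>A\<^esub> a', b) - frag_of (a, b) - frag_of (a', b) | a a' b.
         a \<in> carrier A \<and> a' \<in> carrier A \<and> b \<in> carrier B} \<union>
      {frag_of (a, b \<oplus>\<^bsub>B\<^esub> b') - frag_of (a, b) - frag_of (a, b') | a b b'.
         a \<in> carrier A \<and> b \<in> carrier B \<and> b' \<in> carrier B} \<union>
      {frag_of (ra a r, b) - frag_of (a, la r b) | a r b.
         a \<in> carrier A \<and> r \<in> Rs \<and> b \<in> carrier B}"

lemma K_gens: "K = generate G gens"
  by (simp add: K_def tensor_ker_def gens_def)

lemma G_closed: "frag_of (a, b) \<in> carrier G \<longleftrightarrow> a \<in> carrier A \<and> b \<in> carrier B"
  "x \<in> carrier G \<Longrightarrow> y \<in> carrier G \<Longrightarrow> x + y \<in> carrier G"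
  "x \<in> carrier G \<Longrightarrow> y \<in> carrier G \<Longrightarrow> x - y \<in> carrier G"
  "x \<in> carrier G \<Longrightarrow> - x \<in> carrier G" "0 \<in> carrier G"
  using keys_add[of x y] keys_diff[of x y] by auto

lemma gens_in: "gens \<subseteq> carrier G"
  unfolding gens_def
  by (auto simp del: carrier_free_Abelian_group_iff simp: ra_closed la_closed G_closed(1)
      intro!: G_closed(3))

lemma K_sub: "subgroup K G"
  unfolding K_gens by (rule group.generate_is_subgroup[OF group_free_Abelian_group gens_in])

lemma K_closed: "0 \<in> K" "x \<in> K \<Longrightarrow> y \<in> K \<Longrightarrow> x + y \<in> K" "x \<in> K \<Longrightarrow> - x \<in> K"
  "x \<in> K \<Longrightarrow> y \<in> K \<Longrightarrow> x - y \<in> K" "x \<in> K \<Longrightarrow> x \<in> carrier G"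
proof -
  show s: "x \<in> K \<Longrightarrow> x \<in> carrier G" for x using subgroup.subset[OF K_sub] by blast
  show "0 \<in> K" using subgroup.one_closed[OF K_sub] by simp
  show a: "x \<in> K \<Longrightarrow> y \<in> K \<Longrightarrow> x + y \<in> K" for x y using subgroup.m_closed[OF K_sub, of x y] by simp
  show m: "x \<in> K \<Longrightarrow> - x \<in> K" for x using subgroup.m_inv_closed[OF K_sub, of x] s[of x] by simp
  show "x \<in> K \<Longrightarrow> y \<in> K \<Longrightarrow> x - y \<in> K" using a[of x "- y"] m[of y] by simp
qed

lemma K_sum: "(\<And>k. k \<in> J \<Longrightarrow> f k \<in> K) \<Longrightarrow> sum f J \<in> K"
  by (induction J rule: infinite_finite_induct) (auto intro: K_closed)

lemma K_rel:
  "a \<in> carrier A \<Longrightarrow> a' \<in> carrier A \<Longrightarrow> b \<in> carrier B \<Longrightarrow>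
    frag_of (a \<oplus>\<^bsub>A\<^esub> a', b) - (frag_of (a, b) + frag_of (a', b)) \<in> K"
  "a \<in> carrier A \<Longrightarrow> b \<in> carrier B \<Longrightarrow> b' \<in> carrier B \<Longrightarrow>
    frag_of (a, b \<oplus>\<^bsub>B\<^esub> b') - (frag_of (a, b) + frag_of (a, b')) \<in> K"
  "a \<in> carrier A \<Longrightarrow> r \<in> Rs \<Longrightarrow> b \<in> carrier B \<Longrightarrow> frag_of (ra a r, b) - frag_of (a, la r b) \<in> K"
  unfolding K_gens diff_diff_eq[symmetric] gens_def
  by (rule generate.incl, rule UnI1, rule UnI1, blast, rule generate.incl, rule UnI1, rule UnI2, blast,
      rule generate.incl, rule UnI2, blast)

lemma K_zero: "b \<in> carrier B \<Longrightarrow> frag_of (\<zero>\<^bsub>A\<^esub>, b) \<in> K" "a \<in> carrier A \<Longrightarrow> frag_of (a, \<zero>\<^bsub>B\<^esub>) \<in> K"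
  using K_closed(3)[OF K_rel(1)[of "\<zero>\<^bsub>A\<^esub>" "\<zero>\<^bsub>A\<^esub>" b]] K_closed(3)[OF K_rel(2)[of a "\<zero>\<^bsub>B\<^esub>" "\<zero>\<^bsub>B\<^esub>"]]
  by simp_all

lemma cl_alt: "cl z = {k + z | k. k \<in> K}"
  by (auto simp: cl_def tensor_cl_def r_coset_def)

lemma cl_mem: "z' \<in> cl z \<longleftrightarrow> z' - z \<in> K"
  by (auto simp: cl_alt) (metis diff_add_cancel)

lemma cl_self: "z \<in> cl z"
  by (simp add: cl_mem K_closed)

lemma cl_eq: "cl z = cl z' \<longleftrightarrow> z - z' \<in> K"
proof
  assume "cl z = cl z'" then show "z - z' \<in> K" using cl_self cl_mem by metis
next
  assume a: "z - z' \<in> K"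
  have "x - z \<in> K \<longleftrightarrow> x - z' \<in> K" for x
    using K_closed(2)[OF _ a, of "x - z"] K_closed(4)[OF _ a, of "x - z'"] by auto
  then show "cl z = cl z'" by (auto simp: cl_mem)
qed

lemma normal_K: "K \<lhd> G"
  using comm_group.subgroup_imp_normal[OF abelian_free_Abelian_group K_sub] .

context
  fixes act :: "'s \<Rightarrow> ('a \<times> 'b \<Rightarrow>\<^sub>0 int) set \<Rightarrow> ('a \<times> 'b \<Rightarrow>\<^sub>0 int) set"
begin

abbreviation "TM \<equiv> tensor_module A B K act"

lemma TM_carrier: "carrier TM = cl ` carrier G"
  by (auto simp: tensor_module_def Let_def FactGroup_def RCOSETS_def cl_def tensor_cl_def)

lemma TM_add: "z \<in> carrier G \<Longrightarrow> z' \<in> carrier G \<Longrightarrow> cl z \<oplus>\<^bsub>TM\<^esub> cl z' = cl (z + z')"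
  using normal.rcos_sum[OF normal_K, of z z']
  by (simp add: tensor_module_def Let_def FactGroup_def cl_def tensor_cl_def del: carrier_free_Abelian_group_iff)

lemma TM_zero: "\<zero>\<^bsub>TM\<^esub> = cl 0"
  by (auto simp: tensor_module_def Let_def FactGroup_def cl_alt)

lemma TM_smult: "u \<odot>\<^bsub>TM\<^esub> Z = act u Z"
  by (simp add: tensor_module_def Let_def)

lemma TM_abelian: "abelian_group TM"
proof (rule abelian_groupI)
  fix x y z assume "x \<in> carrier TM" "y \<in> carrier TM" "z \<in> carrier TM"
  then obtain a b c where o: "x = cl a" "y = cl b" "z = cl c" "a \<in> carrier G" "b \<in> carrier G" "c \<in> carrier G"
    by (auto simp: TM_carrier)
  note s = TM_add G_closed(2,5) TM_zero
  show "x \<oplus>\<^bsub>TM\<^esub> y \<in> carrier TM" using o s by (auto simp: TM_carrier simp del: carrier_free_Abelian_group_iff)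
  show "x \<oplus>\<^bsub>TM\<^esub> y \<oplus>\<^bsub>TM\<^esub> z = x \<oplus>\<^bsub>TM\<^esub> (y \<oplus>\<^bsub>TM\<^esub> z)"
    using o s by (simp add: add.assoc del: carrier_free_Abelian_group_iff)
  show "x \<oplus>\<^bsub>TM\<^esub> y = y \<oplus>\<^bsub>TM\<^esub> x" using o s by (simp add: add.commute del: carrier_free_Abelian_group_iff)
  show "\<zero>\<^bsub>TM\<^esub> \<oplus>\<^bsub>TM\<^esub> x = x" using o s by (simp del: carrier_free_Abelian_group_iff)
  have "cl (- a) \<oplus>\<^bsub>TM\<^esub> x = \<zero>\<^bsub>TM\<^esub>" "cl (- a) \<in> carrier TM"
    using o s G_closed(4)[of a] by (simp_all add: TM_carrier del: carrier_free_Abelian_group_iff)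
  then show "\<exists>y\<in>carrier TM. y \<oplus>\<^bsub>TM\<^esub> x = \<zero>\<^bsub>TM\<^esub>" by blast
qed (auto simp: TM_carrier TM_zero)

lemma pure_closed: "a \<in> carrier A \<Longrightarrow> b \<in> carrier B \<Longrightarrow> pure a b \<in> carrier TM"
  by (auto simp: pure_def TM_carrier)

lemma pure_add_left: "a \<in> carrier A \<Longrightarrow> a' \<in> carrier A \<Longrightarrow> b \<in> carrier B \<Longrightarrow>
    pure (a \<oplus>\<^bsub>A\<^esub> a') b = pure a b \<oplus>\<^bsub>TM\<^esub> pure a' b"
  unfolding pure_def by (subst TM_add) (auto simp: cl_eq K_rel)

lemma pure_add_right: "a \<in> carrier A \<Longrightarrow> b \<in> carrier B \<Longrightarrow> b' \<in> carrier B \<Longrightarrow>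
    pure a (b \<oplus>\<^bsub>B\<^esub> b') = pure a b \<oplus>\<^bsub>TM\<^esub> pure a b'"
  unfolding pure_def by (subst TM_add) (auto simp: cl_eq K_rel)

lemma pure_zero: "b \<in> carrier B \<Longrightarrow> pure \<zero>\<^bsub>A\<^esub> b = \<zero>\<^bsub>TM\<^esub>" "a \<in> carrier A \<Longrightarrow> pure a \<zero>\<^bsub>B\<^esub> = \<zero>\<^bsub>TM\<^esub>"
  by (simp_all add: pure_def TM_zero cl_eq K_zero)

lemma TM_induct [consumes 1, case_names pure add]:
  assumes "T \<in> carrier TM"
    and p: "\<And>a b. a \<in> carrier A \<Longrightarrow> b \<in> carrier B \<Longrightarrow> P (pure a b)"
    and a: "\<And>X Y. X \<in> carrier TM \<Longrightarrow> Y \<in> carrier TM \<Longrightarrow> P X \<Longrightarrow> P Y \<Longrightarrow> P (X \<oplus>\<^bsub>TM\<^esub> Y)"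
  shows "P T"
proof -
  interpret TM: abelian_group TM by (rule TM_abelian)
  have z0: "P (cl 0)" using p[OF A.zero_closed B.zero_closed] by (simp add: pure_zero TM_zero)
  have neg: "cl (- frag_of (a, b)) = pure (\<ominus>\<^bsub>A\<^esub> a) b" if "a \<in> carrier A" "b \<in> carrier B" for a b
  proof -
    have "frag_of (a \<oplus>\<^bsub>A\<^esub> \<ominus>\<^bsub>A\<^esub> a, b) - (frag_of (a, b) + frag_of (\<ominus>\<^bsub>A\<^esub> a, b)) \<in> K"
      using that by (intro K_rel) auto
    then have "frag_of (\<zero>\<^bsub>A\<^esub>, b) - (frag_of (a, b) + frag_of (\<ominus>\<^bsub>A\<^esub> a, b)) \<in> K"
      using that by (simp add: A.r_neg)
    from K_closed(4)[OF this K_zero(1)[OF that(2)]]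
    show ?thesis by (simp add: pure_def cl_eq algebra_simps)
  qed
  \<comment> \<open>Both signs are carried along, since the induction for free abelian groups steps
    through differences.\<close>
  have "P (cl z) \<and> P (cl (- z))" if "Poly_Mapping.keys z \<subseteq> S" for z
  proof (rule free_Abelian_group_induct[OF that])
    show "P (cl 0) \<and> P (cl (- 0))" using z0 by simp
  next
    fix x y assume k: "Poly_Mapping.keys x \<subseteq> S" "Poly_Mapping.keys y \<subseteq> S"
      and P: "P (cl x) \<and> P (cl (- x))" "P (cl y) \<and> P (cl (- y))"
    have c: "x \<in> carrier G" "y \<in> carrier G" "- x \<in> carrier G" "- y \<in> carrier G" using k by auto
    then have ct: "cl x \<in> carrier TM" "cl y \<in> carrier TM" "cl (- x) \<in> carrier TM" "cl (- y) \<in> carrier TM"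
      unfolding TM_carrier by blast+
    have "cl (x - y) = cl x \<oplus>\<^bsub>TM\<^esub> cl (- y)" "cl (- (x - y)) = cl (- x) \<oplus>\<^bsub>TM\<^esub> cl y"
      using TM_add[OF c(1,4)] TM_add[OF c(3,2)] by simp_all
    then show "P (cl (x - y)) \<and> P (cl (- (x - y)))" using a ct P by metis
  next
    fix ab assume "ab \<in> S"
    then show "P (cl (frag_of ab)) \<and> P (cl (- frag_of ab))"
      using p neg by (cases ab) (auto simp: pure_def[symmetric])
  qed
  then show ?thesis using assms(1) by (auto simp: TM_carrier)
qed

end

text \<open>The criterion by which an action given on pure tensors descends to the tensor
  product.\<close>

lemma frag_extend_K:
  assumes K': "0 \<in> K'" "\<And>x y. x \<in> K' \<Longrightarrow> y \<in> K' \<Longrightarrow> x + y \<in> K'" "\<And>x. x \<in> K' \<Longrightarrow> - x \<in> K'"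
    and l: "\<And>a a' b. a \<in> carrier A \<Longrightarrow> a' \<in> carrier A \<Longrightarrow> b \<in> carrier B \<Longrightarrow>
      F (a \<oplus>\<^bsub>A\<^esub> a', b) - (F (a, b) + F (a', b)) \<in> K'"
    and r: "\<And>a b b'. a \<in> carrier A \<Longrightarrow> b \<in> carrier B \<Longrightarrow> b' \<in> carrier B \<Longrightarrow>
      F (a, b \<oplus>\<^bsub>B\<^esub> b') - (F (a, b) + F (a, b')) \<in> K'"
    and m: "\<And>a r b. a \<in> carrier A \<Longrightarrow> r \<in> Rs \<Longrightarrow> b \<in> carrier B \<Longrightarrow> F (ra a r, b) - F (a, la r b) \<in> K'"
    and x: "x \<in> K"
  shows "frag_extend F x \<in> K'"
proof -
  have g: "frag_extend F h \<in> K'" if "h \<in> gens" for h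
    using that unfolding gens_def
    by (auto simp: frag_extend_diff l[unfolded diff_diff_eq[symmetric]] r[unfolded diff_diff_eq[symmetric]] m)
  show ?thesis using x unfolding K_gens
  proof (induction rule: generate.induct)
    case (inv h)
    have "h \<in> carrier G" using inv gens_in by blast
    then show ?case using K'(3)[OF g[OF inv]] by (simp add: frag_extend_minus)
  qed (simp_all add: K' g frag_extend_add)
qed

end

subsection \<open>Modules over the Levi part\<close>

text \<open>M is a module over \<open>Ul\<close> only, so the laws of its action are available only
  for classes that have a representative in these letters.\<close>

definition levi :: "('g, 'i) qflag \<Rightarrow> 'i falg \<Rightarrow> bool" where
  "levi D p \<longleftrightarrow> (\<forall>w\<in>Poly_Mapping.keys p. set (letters w) \<subseteq> levi_letters D)"

definition levi2 :: "('g, 'i) qflag \<Rightarrow> ('i qgen word \<times> 'i qgen word \<Rightarrow>\<^sub>0 complex) \<Rightarrow> bool" where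
  "levi2 D P \<longleftrightarrow> (\<forall>k\<in>Poly_Mapping.keys P. set (letters (fst k)) \<subseteq> levi_letters D \<and> set (letters (snd k)) \<subseteq> levi_letters D)"

lemma letters_zero [simp]: "letters 0 = []"
  by (simp add: zero_word_def)

lemma keys_single_sub: "Poly_Mapping.keys (Poly_Mapping.single w c) \<subseteq> {w}"
  by (cases "c = 0") auto

lemma levi_simps [simp]: "levi D 0" "levi D 1" "levi D (const c)" "a \<in> levi_letters D \<Longrightarrow> levi D (gen a)"
  using keys_single_sub[of "0::'i qgen word" c]
  by (auto simp: levi_def const_def gen_def zero_word_def)

lemma levi_add [simp]: "levi D p \<Longrightarrow> levi D q \<Longrightarrow> levi D (p + q)"
  using keys_add[of p q] by (auto simp: levi_def)

lemma levi_minus [simp]: "levi D p \<Longrightarrow> levi D (- p)"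
  by (auto simp: levi_def in_keys_iff)

lemma levi_diff [simp]: "levi D p \<Longrightarrow> levi D q \<Longrightarrow> levi D (p - q)"
  using levi_add[of D p "- q"] by simp

lemma levi_mult [simp]: "levi D p \<Longrightarrow> levi D q \<Longrightarrow> levi D (p * q)"
  using keys_mult[of p q] by (fastforce simp: levi_def plus_word_def)

lemma levi_sum: "(\<And>k. k \<in> J \<Longrightarrow> levi D (f k)) \<Longrightarrow> levi D (sum f J)"
  by (induction J rule: infinite_finite_induct) auto

lemma levi_single: "set (letters w) \<subseteq> levi_letters D \<Longrightarrow> levi D (Poly_Mapping.single w c)"
  using keys_single_sub[of w c] by (auto simp: levi_def)

lemma levi2_add: "levi2 D p \<Longrightarrow> levi2 D q \<Longrightarrow> levi2 D (p + q)"
  using keys_add[of p q] by (auto simp: levi2_def)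

lemma levi2_minus: "levi2 D p \<Longrightarrow> levi2 D (- p)"
  by (auto simp: levi2_def in_keys_iff)

lemma levi2_mult: "levi2 D p \<Longrightarrow> levi2 D q \<Longrightarrow> levi2 D (p * q)"
  using keys_mult[of p q] unfolding levi2_def by (fastforce simp: plus_word_def)

lemma levi2_single: "set (letters a) \<subseteq> levi_letters D \<Longrightarrow> set (letters b) \<subseteq> levi_letters D \<Longrightarrow>
    levi2 D (Poly_Mapping.single (a, b) c)"
  using keys_single_sub[of "(a, b)" c] by (auto simp: levi2_def)

lemma levi2_coprod: assumes "levi D p" shows "levi2 D (free_hom coprod_gen p)"
proof -
  have o: "levi2 D 1" using levi2_single[of 0 D 0 1] by (simp add: zero_prod_def[symmetric])
  have g: "levi2 D (coprod_gen a)" if "a \<in> levi_letters D" for a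
    using that by (cases a) (auto simp: levi_letters_def coprod_gen.simps zero_word_def intro!: levi2_add levi2_single)
  have c: "levi2 D (const c)" for c
    using levi2_single[of 0 D 0 c] by (simp add: const_def zero_word_def zero_prod_def)
  have w: "levi2 D (prod_list (map coprod_gen l))" if "set l \<subseteq> levi_letters D" for l
    using that by (induction l) (auto simp: o intro: levi2_mult g)
  have "levi2 D (\<Sum>w\<in>J. const (Poly_Mapping.lookup p w) * prod_list (map coprod_gen (letters w)))"
    if "J \<subseteq> Poly_Mapping.keys p" for J
    using that
  proof (induction J rule: infinite_finite_induct)
    case (insert x F)
    then show ?case using assms by (auto simp: levi_def intro!: levi2_add levi2_mult c w)
  qed (auto simp: levi2_def)
  then show ?thesis unfolding free_hom_def by blast
qed

lemma levi_antipode: assumes "levi D p" shows "levi D (free_antihom antipode_gen p)"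
proof -
  have g: "levi D (antipode_gen a)" if "a \<in> levi_letters D" for a
    using that by (cases a) (auto simp: levi_letters_def)
  have w: "levi D (prod_list (rev (map antipode_gen l)))" if "set l \<subseteq> levi_letters D" for l
    using that by (induction l) (auto simp: g)
  have "set (letters k) \<subseteq> levi_letters D" if "k \<in> Poly_Mapping.keys p" for k
    using assms that by (auto simp: levi_def)
  then show ?thesis unfolding free_antihom_def
    by (intro levi_sum levi_mult w) auto
qed

lemma Ul_simps: "monoid.mult (Ul D) = monoid.mult (Uq D)" "ring.add (Ul D) = ring.add (Uq D)"
    "monoid.one (Ul D) = monoid.one (Uq D)" "ring.zero (Ul D) = ring.zero (Uq D)"
  by (simp_all add: Ul_def)

lemma Ul_carrier: "carrier (Ul D) = {ucl D p | p. levi D p}"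
proof -
  let ?H = "(\<lambda>a. ucl D (gen a)) ` levi_letters D \<union> range (scal D)"
  have c: "carrier (Ul D) = generate_ring (Uq D) ?H" by (simp add: Ul_def)
  have 1: "\<exists>p. levi D p \<and> u = ucl D p" if "u \<in> generate_ring (Uq D) ?H" for u
    using that
  proof (induction rule: generate_ring.induct)
    case one
    then show ?case using ucl_one levi_simps(2) by metis
  next
    case (incl h)
    then show ?case unfolding scal_def using levi_simps(3,4) by blast
  next
    case (a_inv h)
    then show ?case using ucl_minus levi_minus by metis
  next
    case (eng_add h1 h2)
    then show ?case using ucl_add levi_add by metis
  next
    case (eng_mult h1 h2)
    then show ?case using ucl_mult levi_mult by metis
  qed
  have w: "ucl D (Poly_Mapping.single (Word l) 1) \<in> generate_ring (Uq D) ?H" if "set l \<subseteq> levi_letters D" for l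
    using that
  proof (induction l)
    case Nil
    then show ?case using generate_ring.one[of "Uq D" ?H]
      by (simp add: zero_word_def[symmetric] ucl_one)
  next
    case (Cons a l)
    have "Poly_Mapping.single (Word (a # l)) (1::complex) = gen a * Poly_Mapping.single (Word l) 1"
      by (simp add: gen_def mult_single plus_word_def)
    moreover have "ucl D (gen a) \<in> generate_ring (Uq D) ?H"
      by (rule generate_ring.incl) (use Cons in auto)
    ultimately show ?case using Cons by (simp add: ucl_mult generate_ring.eng_mult)
  qed
  have "ucl D p \<in> generate_ring (Uq D) ?H" if "levi D p" for p
  proof -
    have "ucl D (\<Sum>w\<in>J. Poly_Mapping.single w (Poly_Mapping.lookup p w)) \<in> generate_ring (Uq D) ?H"
      if "J \<subseteq> Poly_Mapping.keys p" for J
      using that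
    proof (induction J rule: infinite_finite_induct)
      case (insert x F)
      have "Poly_Mapping.single x (Poly_Mapping.lookup p x) = const (Poly_Mapping.lookup p x) * Poly_Mapping.single (Word (letters x)) 1"
        by (simp add: const_mult_single)
      moreover have "set (letters x) \<subseteq> levi_letters D" using insert \<open>levi D p\<close> by (auto simp: levi_def)
      moreover have "scal D (Poly_Mapping.lookup p x) \<in> generate_ring (Uq D) ?H"
        by (rule generate_ring.incl) simp
      ultimately show ?case using insert w[of "letters x"]
        by (simp add: ucl_add ucl_mult scal_def[symmetric] generate_ring.eng_mult generate_ring.eng_add)
    qed (use ring.zero_in_generate[OF Uq_ring] in \<open>auto simp: ucl_zero\<close>)
    from this[of "Poly_Mapping.keys p"] show ?thesis using pm_expand[of p] by simp
  qed
  then show ?thesis using 1 c by auto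
qed

lemma Ul_sub: "carrier (Ul D) \<subseteq> carrier (Uq D)"
  by (auto simp: Ul_carrier)

locale levi_mod = qdatum D for D :: "('g::ab_group_add, 'i::finite) qflag" +
  fixes M :: "('i uq, 'm) module"
  assumes left_mod: "left_module (Ul D) M"
begin

sublocale M: abelian_group M
  using left_mod by (simp add: left_module_def)

definition mact :: "'i falg \<Rightarrow> 'm \<Rightarrow> 'm" where "mact p x = ucl D p \<odot>\<^bsub>M\<^esub> x"

lemma mact_closed [simp]: "levi D p \<Longrightarrow> x \<in> carrier M \<Longrightarrow> mact p x \<in> carrier M"
  using left_mod by (auto simp: left_module_def Ul_carrier mact_def)

lemma mact_simps:
  "levi D p \<Longrightarrow> levi D q \<Longrightarrow> x \<in> carrier M \<Longrightarrow> mact (p + q) x = mact p x \<oplus>\<^bsub>M\<^esub> mact q x"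
  "levi D p \<Longrightarrow> levi D q \<Longrightarrow> x \<in> carrier M \<Longrightarrow> mact (p * q) x = mact p (mact q x)"
  "levi D p \<Longrightarrow> x \<in> carrier M \<Longrightarrow> y \<in> carrier M \<Longrightarrow> mact p (x \<oplus>\<^bsub>M\<^esub> y) = mact p x \<oplus>\<^bsub>M\<^esub> mact p y"
  "x \<in> carrier M \<Longrightarrow> mact 1 x = x"
proof -
  have c: "levi D p \<Longrightarrow> ucl D p \<in> carrier (Ul D)" for p by (auto simp: Ul_carrier)
  note l = left_mod[unfolded left_module_def Ul_simps]
  show "levi D p \<Longrightarrow> levi D q \<Longrightarrow> x \<in> carrier M \<Longrightarrow> mact (p + q) x = mact p x \<oplus>\<^bsub>M\<^esub> mact q x"
    "levi D p \<Longrightarrow> levi D q \<Longrightarrow> x \<in> carrier M \<Longrightarrow> mact (p * q) x = mact p (mact q x)"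
    unfolding mact_def ucl_add ucl_mult using l c by blast+
  show "levi D p \<Longrightarrow> x \<in> carrier M \<Longrightarrow> y \<in> carrier M \<Longrightarrow> mact p (x \<oplus>\<^bsub>M\<^esub> y) = mact p x \<oplus>\<^bsub>M\<^esub> mact p y"
    unfolding mact_def using l c by blast
  show "x \<in> carrier M \<Longrightarrow> mact 1 x = x" unfolding mact_def ucl_one using l by blast
qed

lemma mact_cong: "p - q \<in> rel_ideal D \<Longrightarrow> mact p x = mact q x"
  by (simp add: mact_def ucl_eq[symmetric])

lemma mact_zero: "x \<in> carrier M \<Longrightarrow> mact 0 x = \<zero>\<^bsub>M\<^esub>" "levi D p \<Longrightarrow> mact p \<zero>\<^bsub>M\<^esub> = \<zero>\<^bsub>M\<^esub>"
proof -
  show "mact 0 x = \<zero>\<^bsub>M\<^esub>" if x: "x \<in> carrier M"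
    using mact_simps(1)[of 0 0 x] x M.add.l_cancel_one[of "mact 0 x" "mact 0 x"] by simp
  show "mact p \<zero>\<^bsub>M\<^esub> = \<zero>\<^bsub>M\<^esub>" if x: "levi D p"
    using mact_simps(3)[of p "\<zero>\<^bsub>M\<^esub>" "\<zero>\<^bsub>M\<^esub>"] x M.add.l_cancel_one[of "mact p \<zero>\<^bsub>M\<^esub>" "mact p \<zero>\<^bsub>M\<^esub>"] by simp
qed

lemma mact_const_comm: "levi D p \<Longrightarrow> x \<in> carrier M \<Longrightarrow> mact p (mact (const c) x) = mact (const c) (mact p x)"
  using mact_simps(2)[of p "const c" x] mact_simps(2)[of "const c" p x] by (simp add: const_comm)

lemma mact_scal: "levi D p \<Longrightarrow> x \<in> carrier M \<Longrightarrow> mact p (scal D c \<odot>\<^bsub>M\<^esub> x) = scal D c \<odot>\<^bsub>M\<^esub> mact p x"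
  using mact_const_comm[of p x c] by (simp add: mact_def scal_def)

lemma scal_act: "scal D c \<odot>\<^bsub>M\<^esub> x = mact (const c) x"
  by (simp add: mact_def scal_def)

end

lemma (in levi_mod) dual_levi_mod: "levi_mod D (dual_module D M)"
proof
  let ?N = "dual_module D M" and ?S = "free_antihom antipode_gen :: 'i falg \<Rightarrow> 'i falg"
  have car: "f \<in> carrier ?N \<longleftrightarrow> f \<in> extensional (carrier M) \<and>
      (\<forall>x\<in>carrier M. \<forall>y\<in>carrier M. f (x \<oplus>\<^bsub>M\<^esub> y) = f x + f y) \<and>
      (\<forall>c. \<forall>x\<in>carrier M. f (mact (const c) x) = c * f x)" for f
    by (simp add: dual_module_def scal_act)
  have add: "f \<oplus>\<^bsub>?N\<^esub> g = (\<lambda>x\<in>carrier M. f x + g x)" for f g by (simp add: dual_module_def)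
  have zero: "\<zero>\<^bsub>?N\<^esub> = (\<lambda>x\<in>carrier M. 0)" by (simp add: dual_module_def)
  have sm: "ucl D p \<odot>\<^bsub>?N\<^esub> f = (\<lambda>x\<in>carrier M. f (mact (?S p) x))" for p f
    by (simp add: dual_module_def antipode_ucl mact_def)
  have ag: "abelian_group ?N"
  proof (rule abelian_groupI)
    fix f assume f: "f \<in> carrier ?N"
    show "\<zero>\<^bsub>?N\<^esub> \<oplus>\<^bsub>?N\<^esub> f = f" using f by (auto simp: car add zero extensional_def)
    show "\<exists>g\<in>carrier ?N. g \<oplus>\<^bsub>?N\<^esub> f = \<zero>\<^bsub>?N\<^esub>"
      by (rule bexI[of _ "\<lambda>x\<in>carrier M. - f x"]) (use f in \<open>auto simp: car add zero\<close>)
  qed (auto simp: car add zero algebra_simps intro!: restrict_ext)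
  show "left_module (Ul D) ?N"
    unfolding left_module_def Ul_carrier Ul_simps
  proof (intro conjI ballI ag)
    fix a f assume "a \<in> {ucl D p | p. levi D p}" and f: "f \<in> carrier ?N"
    then obtain p where p: "a = ucl D p" "levi D p" by auto
    have Sp: "levi D (?S p)" by (rule levi_antipode[OF p(2)])
    show "a \<odot>\<^bsub>?N\<^esub> f \<in> carrier ?N"
      using f Sp by (auto simp: p car sm mact_simps(3)[OF Sp] mact_const_comm)
    fix g assume g: "g \<in> carrier ?N"
    show "a \<odot>\<^bsub>?N\<^esub> (f \<oplus>\<^bsub>?N\<^esub> g) = a \<odot>\<^bsub>?N\<^esub> f \<oplus>\<^bsub>?N\<^esub> a \<odot>\<^bsub>?N\<^esub> g"
      using Sp by (auto simp: p sm add intro!: restrict_ext)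
  next
    fix a b f assume "a \<in> {ucl D p | p. levi D p}" "b \<in> {ucl D p | p. levi D p}" and f: "f \<in> carrier ?N"
    then obtain p q where p: "a = ucl D p" "levi D p" "b = ucl D q" "levi D q" by auto
    have Sp: "levi D (?S p)" "levi D (?S q)" by (rule levi_antipode, rule p)+
    show "(a \<oplus>\<^bsub>Uq D\<^esub> b) \<odot>\<^bsub>?N\<^esub> f = (a \<odot>\<^bsub>?N\<^esub> f) \<oplus>\<^bsub>?N\<^esub> (b \<odot>\<^bsub>?N\<^esub> f)"
      using Sp f by (auto simp: p sm add ucl_add[symmetric] antihom_simps mact_simps car intro!: restrict_ext)
    show "(a \<otimes>\<^bsub>Uq D\<^esub> b) \<odot>\<^bsub>?N\<^esub> f = a \<odot>\<^bsub>?N\<^esub> (b \<odot>\<^bsub>?N\<^esub> f)"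
      using Sp f by (auto simp: p sm ucl_mult[symmetric] antihom_simps mact_simps car intro!: restrict_ext)
  next
    fix f assume f: "f \<in> carrier ?N"
    show "\<one>\<^bsub>Uq D\<^esub> \<odot>\<^bsub>?N\<^esub> f = f"
      using f by (auto simp: ucl_one[symmetric] sm antihom_simps mact_simps car extensional_def)
  qed
qed

subsection \<open>The tensor product of two Levi modules\<close>

locale levi_pair = M: levi_mod D M + N: levi_mod D N
  for D :: "('g::ab_group_add, 'i::finite) qflag" and M :: "('i uq, 'm) module" and N :: "('i uq, 'n) module"
begin

sublocale ct: tensor_setup M N "UNIV :: complex set" "\<lambda>x c. scal D c \<odot>\<^bsub>M\<^esub> x" "\<lambda>c y. scal D c \<odot>\<^bsub>N\<^esub> y"
  by standard (simp_all add: M.scal_act N.scal_act)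

definition fr :: "'i falg \<Rightarrow> 'i falg \<Rightarrow> 'm \<Rightarrow> 'n \<Rightarrow> ('m \<times> 'n \<Rightarrow>\<^sub>0 int)" where
  "fr p q x y = frag_of (M.mact p x, N.mact q y)"

text \<open>The inner sum of \<open>ctens_act\<close> with an arbitrary P in place of a coproduct,
  which allows P to be decomposed.\<close>

definition AF :: "('i qgen word \<times> 'i qgen word \<Rightarrow>\<^sub>0 complex) \<Rightarrow> 'm \<times> 'n \<Rightarrow> ('m \<times> 'n \<Rightarrow>\<^sub>0 int)" where
  "AF P xy = (\<Sum>(a, b)\<in>Poly_Mapping.keys P.
     fr (Poly_Mapping.single a (Poly_Mapping.lookup P (a, b))) (Poly_Mapping.single b 1) (fst xy) (snd xy))"

context
  fixes x y assumes x: "x \<in> carrier M" and y: "y \<in> carrier N"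
begin

lemma fr_add: "levi D p \<Longrightarrow> levi D p' \<Longrightarrow> levi D q \<Longrightarrow> fr (p + p') q x y - (fr p q x y + fr p' q x y) \<in> ct.K"
  "levi D p \<Longrightarrow> levi D q \<Longrightarrow> levi D q' \<Longrightarrow> fr p (q + q') x y - (fr p q x y + fr p q' x y) \<in> ct.K"
  unfolding fr_def using ct.K_rel(1,2) x y
  by (simp_all add: M.mact_simps N.mact_simps x y)

lemma fr_bal: "levi D p \<Longrightarrow> levi D q \<Longrightarrow> fr (const c * p) q x y - fr p (const c * q) x y \<in> ct.K"
  unfolding fr_def using ct.K_rel(3)[of "M.mact p x" c "N.mact q y"] x y
  by (simp add: M.mact_simps N.mact_simps x y M.scal_act N.scal_act)

lemma fr_zero: "levi D q \<Longrightarrow> fr 0 q x y \<in> ct.K" "levi D p \<Longrightarrow> fr p 0 x y \<in> ct.K"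
  unfolding fr_def using x y by (simp_all add: M.mact_zero N.mact_zero ct.K_zero)

lemma fr_sum: "finite J \<Longrightarrow> (\<And>k. k \<in> J \<Longrightarrow> levi D (f k)) \<Longrightarrow> levi D q \<Longrightarrow> fr (sum f J) q x y - (\<Sum>k\<in>J. fr (f k) q x y) \<in> ct.K"
  "finite J \<Longrightarrow> (\<And>k. k \<in> J \<Longrightarrow> levi D (f k)) \<Longrightarrow> levi D p \<Longrightarrow> fr p (sum f J) x y - (\<Sum>k\<in>J. fr p (f k) x y) \<in> ct.K"
proof -
  show "finite J \<Longrightarrow> (\<And>k. k \<in> J \<Longrightarrow> levi D (f k)) \<Longrightarrow> levi D q \<Longrightarrow> fr (sum f J) q x y - (\<Sum>k\<in>J. fr (f k) q x y) \<in> ct.K"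
  proof (induction J rule: finite_induct)
    case (insert k F)
    have "fr (f k + sum f F) q x y - (fr (f k) q x y + fr (sum f F) q x y) +
      (fr (sum f F) q x y - (\<Sum>k\<in>F. fr (f k) q x y)) \<in> ct.K"
      using insert by (intro ct.K_closed(2) fr_add) (auto intro: levi_sum)
    then show ?case using insert by (simp add: algebra_simps)
  qed (simp add: fr_zero)
  show "finite J \<Longrightarrow> (\<And>k. k \<in> J \<Longrightarrow> levi D (f k)) \<Longrightarrow> levi D p \<Longrightarrow> fr p (sum f J) x y - (\<Sum>k\<in>J. fr p (f k) x y) \<in> ct.K"
  proof (induction J rule: finite_induct)
    case (insert k F)
    have "fr p (f k + sum f F) x y - (fr p (f k) x y + fr p (sum f F) x y) +
      (fr p (sum f F) x y - (\<Sum>k\<in>F. fr p (f k) x y)) \<in> ct.K"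
      using insert by (intro ct.K_closed(2) fr_add) (auto intro: levi_sum)
    then show ?case using insert by (simp add: algebra_simps)
  qed (simp add: fr_zero)
qed

definition bs :: "('i qgen word \<times> 'i qgen word \<Rightarrow>\<^sub>0 complex) \<Rightarrow> 'i qgen word \<times> 'i qgen word \<Rightarrow> ('m \<times> 'n \<Rightarrow>\<^sub>0 int)" where
  "bs P k = fr (Poly_Mapping.single (fst k) (Poly_Mapping.lookup P k)) (Poly_Mapping.single (snd k) 1) x y"

lemma AF_alt: "AF P (x, y) = (\<Sum>k\<in>Poly_Mapping.keys P. bs P k)"
  by (simp add: AF_def bs_def case_prod_beta)

definition lev2 :: "'i qgen word \<times> 'i qgen word \<Rightarrow> bool" where
  "lev2 k \<longleftrightarrow> set (letters (fst k)) \<subseteq> levi_letters D \<and> set (letters (snd k)) \<subseteq> levi_letters D"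

lemma AF_superset:
  assumes "finite J" "Poly_Mapping.keys P \<subseteq> J" "\<And>k. k \<in> J \<Longrightarrow> lev2 k"
  shows "(\<Sum>k\<in>J. bs P k) - AF P (x, y) \<in> ct.K"
proof -
  have "(\<Sum>k\<in>J. bs P k) - AF P (x, y) = (\<Sum>k\<in>J - Poly_Mapping.keys P. bs P k)"
    unfolding AF_alt using sum.subset_diff[OF assms(2,1), of "bs P"] by simp
  also have "\<dots> \<in> ct.K"
    by (rule ct.K_sum) (use assms(3) in \<open>auto simp: bs_def in_keys_iff lev2_def intro!: fr_zero levi_single\<close>)
  finally show ?thesis .
qed

lemma AF_add:
  assumes "levi2 D P" "levi2 D Q"
  shows "AF (P + Q) (x, y) - (AF P (x, y) + AF Q (x, y)) \<in> ct.K"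
proof -
  let ?J = "Poly_Mapping.keys P \<union> Poly_Mapping.keys Q"
  have l: "lev2 k" if "k \<in> ?J" for k using that assms by (auto simp: levi2_def lev2_def)
  have s: "(\<Sum>k\<in>?J. bs R k) - AF R (x, y) \<in> ct.K" if "R = P \<or> R = Q \<or> R = P + Q" for R
    by (rule AF_superset) (use that l keys_add[of P Q] in auto)
  have "(\<Sum>k\<in>?J. bs (P + Q) k - (bs P k + bs Q k)) \<in> ct.K"
    by (rule ct.K_sum) (use l in \<open>auto simp: bs_def lookup_add single_add lev2_def intro!: fr_add levi_single\<close>)
  then have "(\<Sum>k\<in>?J. bs (P + Q) k) - ((\<Sum>k\<in>?J. bs P k) + (\<Sum>k\<in>?J. bs Q k)) \<in> ct.K"
    by (simp add: sum_subtractf sum.distrib)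
  then have "(\<Sum>k\<in>?J. bs (P + Q) k) - ((\<Sum>k\<in>?J. bs P k) + (\<Sum>k\<in>?J. bs Q k))
     - ((\<Sum>k\<in>?J. bs (P + Q) k) - AF (P + Q) (x, y)) + ((\<Sum>k\<in>?J. bs P k) - AF P (x, y)) + ((\<Sum>k\<in>?J. bs Q k) - AF Q (x, y)) \<in> ct.K"
    by (intro ct.K_closed(2)[OF ct.K_closed(2)[OF ct.K_closed(4)]] s) auto
  then show ?thesis by (simp add: algebra_simps)
qed

text \<open>The second factors of P are expanded in a family E that is a basis modulo the relations.
  The coefficient of e in E is then the slice of P at the coordinate functional of e, an element of
  the relation ideal, and acts by zero on M.\<close>

lemma AF_hopf:
  assumes P: "levi2 D P" and h: "P \<in> hopf (rel_ideal D)"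
  shows "AF P (x, y) \<in> ct.K"
proof -
  \<comment> \<open>Taking E among the second factors of P keeps all words in the Levi letters,
    where the module laws of N apply.\<close>
  define B where "B = (\<lambda>k. Poly_Mapping.single (snd k) (1::complex)) ` Poly_Mapping.keys P"
  obtain E fs where E: "E \<subseteq> B" "\<And>e. e \<in> E \<Longrightarrow> lin_functional (rel_ideal D) (fs e)"
      "\<And>b. b \<in> B \<Longrightarrow> b - (\<Sum>e\<in>E. const (fs e b) * e) \<in> rel_ideal D"
  proof -
    have fB: "finite B" by (simp add: B_def)
    from dual_family[OF two_sided_rel_ideal[of D] fB] that show thesis by (elim exE conjE) blast
  qed
  have fE: "finite E" using E(1) by (rule finite_subset) (simp add: B_def)
  have lP: "lev2 k" if "k \<in> Poly_Mapping.keys P" for k using that P by (auto simp: levi2_def lev2_def)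
  have lE: "levi D e" if "e \<in> E" for e
  proof -
    from that E(1) obtain k where "k \<in> Poly_Mapping.keys P" "e = Poly_Mapping.single (snd k) 1"
      by (auto simp: B_def)
    then show ?thesis using lP[of k] by (auto simp: lev2_def intro!: levi_single)
  qed
  let ?b = "\<lambda>k. Poly_Mapping.single (snd k) (1::complex)"
  let ?a = "\<lambda>k. Poly_Mapping.single (fst k) (Poly_Mapping.lookup P k)"
  have la: "levi D (?a k)" if "k \<in> Poly_Mapping.keys P" for k using lP[OF that] by (auto simp: lev2_def intro!: levi_single)
  let ?g = "\<lambda>e k. fr (const (fs e (?b k)) * ?a k) e x y"
  have 1: "bs P k - (\<Sum>e\<in>E. ?g e k) \<in> ct.K" if k: "k \<in> Poly_Mapping.keys P" for k
  proof -
    have "?b k - (\<Sum>e\<in>E. const (fs e (?b k)) * e) \<in> rel_ideal D" by (rule E(3)) (use k in \<open>auto simp: B_def\<close>)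
    then have "bs P k = fr (?a k) (\<Sum>e\<in>E. const (fs e (?b k)) * e) x y"
      by (simp add: bs_def fr_def N.mact_cong)
    moreover have "fr (?a k) (\<Sum>e\<in>E. const (fs e (?b k)) * e) x y - (\<Sum>e\<in>E. fr (?a k) (const (fs e (?b k)) * e) x y) \<in> ct.K"
      by (rule fr_sum) (use fE lE la[OF k] in auto)
    ultimately have f1: "bs P k - (\<Sum>e\<in>E. fr (?a k) (const (fs e (?b k)) * e) x y) \<in> ct.K" by simp
    have f2: "(\<Sum>e\<in>E. ?g e k - fr (?a k) (const (fs e (?b k)) * e) x y) \<in> ct.K"
      by (rule ct.K_sum) (use lE la[OF k] in \<open>auto intro!: fr_bal\<close>)
    from ct.K_closed(4)[OF f1 f2]
    show ?thesis by (simp add: sum_subtractf)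
  qed
  have 2: "(\<Sum>k\<in>Poly_Mapping.keys P. ?g e k) \<in> ct.K" if e: "e \<in> E" for e
  proof -
    have "slice (fs e) P = (\<Sum>k\<in>Poly_Mapping.keys P. const (fs e (?b k)) * ?a k)"
      unfolding slice_def cst.lext_def
      by (rule sum.cong) (auto simp: const_mult_single mult.commute)
    moreover have "slice (fs e) P \<in> rel_ideal D" using h E(2)[OF e] by (simp add: hopf_def)
    ultimately have "fr (\<Sum>k\<in>Poly_Mapping.keys P. const (fs e (?b k)) * ?a k) e x y = fr 0 e x y"
      by (simp add: fr_def M.mact_cong[of _ 0])
    then have "fr (\<Sum>k\<in>Poly_Mapping.keys P. const (fs e (?b k)) * ?a k) e x y \<in> ct.K"
      using fr_zero(1)[OF lE[OF e]] by simp
    moreover have "fr (\<Sum>k\<in>Poly_Mapping.keys P. const (fs e (?b k)) * ?a k) e x y - (\<Sum>k\<in>Poly_Mapping.keys P. ?g e k) \<in> ct.K"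
      by (rule fr_sum) (use la lE[OF e] in auto)
    ultimately show ?thesis using ct.K_closed(4) by fastforce
  qed
  have "(\<Sum>k\<in>Poly_Mapping.keys P. bs P k - (\<Sum>e\<in>E. ?g e k)) + (\<Sum>e\<in>E. \<Sum>k\<in>Poly_Mapping.keys P. ?g e k) \<in> ct.K"
    by (intro ct.K_closed(2) ct.K_sum 1 2)
  then show ?thesis unfolding AF_alt sum_subtractf
    by (subst (asm) (2) sum.swap) simp
qed

end

lemma AF_linear:
  assumes "levi2 D P"
  shows "a \<in> carrier M \<Longrightarrow> a' \<in> carrier M \<Longrightarrow> b \<in> carrier N \<Longrightarrow> AF P (a \<oplus>\<^bsub>M\<^esub> a', b) - (AF P (a, b) + AF P (a', b)) \<in> ct.K"
    "a \<in> carrier M \<Longrightarrow> b \<in> carrier N \<Longrightarrow> b' \<in> carrier N \<Longrightarrow> AF P (a, b \<oplus>\<^bsub>N\<^esub> b') - (AF P (a, b) + AF P (a, b')) \<in> ct.K"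
    "a \<in> carrier M \<Longrightarrow> b \<in> carrier N \<Longrightarrow> AF P (scal D c \<odot>\<^bsub>M\<^esub> a, b) - AF P (a, scal D c \<odot>\<^bsub>N\<^esub> b) \<in> ct.K"
proof -
  define f where "f k x y = fr (Poly_Mapping.single (fst k) (Poly_Mapping.lookup P k)) (Poly_Mapping.single (snd k) 1) x y" for k x y
  have AFf: "AF P (x, y) = (\<Sum>k\<in>Poly_Mapping.keys P. f k x y)" for x y
    by (simp add: AF_def f_def case_prod_beta)
  have l: "levi D (Poly_Mapping.single (fst k) c)" "levi D (Poly_Mapping.single (snd k) c)"
    if "k \<in> Poly_Mapping.keys P" for k c
    using that assms by (auto simp: levi2_def intro!: levi_single)
  show "a \<in> carrier M \<Longrightarrow> a' \<in> carrier M \<Longrightarrow> b \<in> carrier N \<Longrightarrow> AF P (a \<oplus>\<^bsub>M\<^esub> a', b) - (AF P (a, b) + AF P (a', b)) \<in> ct.K"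
    unfolding AFf sum.distrib[symmetric] sum_subtractf[symmetric]
    by (rule ct.K_sum) (simp add: f_def fr_def M.mact_simps l ct.K_rel)
  show "a \<in> carrier M \<Longrightarrow> b \<in> carrier N \<Longrightarrow> b' \<in> carrier N \<Longrightarrow> AF P (a, b \<oplus>\<^bsub>N\<^esub> b') - (AF P (a, b) + AF P (a, b')) \<in> ct.K"
    unfolding AFf sum.distrib[symmetric] sum_subtractf[symmetric]
    by (rule ct.K_sum) (simp add: f_def fr_def N.mact_simps l ct.K_rel)
  show "a \<in> carrier M \<Longrightarrow> b \<in> carrier N \<Longrightarrow> AF P (scal D c \<odot>\<^bsub>M\<^esub> a, b) - AF P (a, scal D c \<odot>\<^bsub>N\<^esub> b) \<in> ct.K"
    unfolding AFf sum_subtractf[symmetric]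
    by (rule ct.K_sum) (simp add: f_def fr_def M.mact_scal N.mact_scal l ct.K_rel)
qed

abbreviation "\<Delta> \<equiv> free_hom (coprod_gen :: 'i qgen \<Rightarrow> _)"

lemma AF_closed: "levi2 D P \<Longrightarrow> x \<in> carrier M \<Longrightarrow> y \<in> carrier N \<Longrightarrow> AF P (x, y) \<in> carrier ct.G"
  unfolding AF_def
  by (rule sum_closed_free_Abelian_group)
    (auto simp: fr_def levi2_def levi_single simp del: carrier_free_Abelian_group_iff simp: ct.G_closed)

lemma fe_closed:
  assumes "levi D p" "z \<in> carrier ct.G"
  shows "frag_extend (AF (\<Delta> p)) z \<in> carrier ct.G"
proof -
  have "Poly_Mapping.keys (AF (\<Delta> p) xy) \<subseteq> ct.S" if "xy \<in> Poly_Mapping.keys z" for xy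
  proof -
    have "xy \<in> ct.S" using assms(2) that by auto
    then show ?thesis using AF_closed[OF levi2_coprod[OF assms(1)], of "fst xy" "snd xy"] by auto
  qed
  then show ?thesis unfolding carrier_free_Abelian_group_iff
    using keys_frag_extend[of "AF (\<Delta> p)" z] by blast
qed

text \<open>\<open>ctens_act\<close> involves two choices. Independence of z follows from
  bilinearity, and independence of the representative of u from the fact that coproducts of
  relations lie in \<open>hopf\<close>.\<close>

lemma ctens_act_cl:
  assumes p: "levi D p" and z: "z \<in> carrier ct.G"
  shows "ctens_act D M N (ucl D p) (ct.cl z) = ct.cl (frag_extend (AF (\<Delta> p)) z)"
proof -
  have ck: "ctens_ker D M N = ct.K" by (simp add: ctens_ker_def ct.K_def)
  have AFe: "(\<lambda>(x, y). \<Sum>(a, b)\<in>Poly_Mapping.keys P.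
           frag_of (ucl D (Poly_Mapping.single a (Poly_Mapping.lookup P (a, b))) \<odot>\<^bsub>M\<^esub> x,
                    ucl D (Poly_Mapping.single b 1) \<odot>\<^bsub>N\<^esub> y)) = AF P" for P
    by (auto simp: AF_def fr_def M.mact_def N.mact_def fun_eq_iff)
  have "{tensor_cl M N (ctens_ker D M N) (frag_extend (AF (\<Delta> p')) z') | p' z'.
      p' \<in> ucl D p \<and> (\<forall>w\<in>Poly_Mapping.keys p'. set (letters w) \<subseteq> levi_letters D) \<and> z' \<in> ct.cl z}
    = {ct.cl (frag_extend (AF (\<Delta> p)) z)}" (is "?L = _")
  proof -
    have "tensor_cl M N (ctens_ker D M N) (frag_extend (AF (\<Delta> p')) z') = ct.cl (frag_extend (AF (\<Delta> p)) z)"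
      if a: "p' \<in> ucl D p" "levi D p'" "z' \<in> ct.cl z" for p' z'
    proof -
      have "z' - z \<in> ct.K" using a by (simp add: ct.cl_mem)
      then have 1: "frag_extend (AF (\<Delta> p')) (z' - z) \<in> ct.K"
        by (rule ct.frag_extend_K[OF ct.K_closed(1-3), rotated -1])
          (use AF_linear[OF levi2_coprod[OF a(2)]] in auto)
      have 2: "AF (\<Delta> p') (x, y) - AF (\<Delta> p) (x, y) \<in> ct.K" if xy: "x \<in> carrier M" "y \<in> carrier N" for x y
      proof -
        have "p' - p \<in> rel_ideal D" using a by (simp add: ucl_iff)
        then have "AF (\<Delta> (p' - p)) (x, y) \<in> ct.K"
          using xy a p by (intro AF_hopf M.rel_ideal_coprod levi2_coprod) auto
        moreover have "AF (\<Delta> (p' - p) + \<Delta> p) (x, y) - (AF (\<Delta> (p' - p)) (x, y) + AF (\<Delta> p) (x, y)) \<in> ct.K"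
          using xy a p by (intro AF_add levi2_coprod) auto
        ultimately have "AF (\<Delta> (p' - p) + \<Delta> p) (x, y) - (AF (\<Delta> (p' - p)) (x, y) + AF (\<Delta> p) (x, y)) + AF (\<Delta> (p' - p)) (x, y) \<in> ct.K"
          by (intro ct.K_closed(2))
        then show ?thesis by (simp add: eta_hom_simps[symmetric] algebra_simps)
      qed
      have 3: "frag_extend (AF (\<Delta> p')) z - frag_extend (AF (\<Delta> p)) z \<in> ct.K"
      proof (rule free_Abelian_group_induct[of z ct.S])
        show "Poly_Mapping.keys z \<subseteq> ct.S" using z by simp
        show "frag_extend (AF (\<Delta> p')) (u - v) - frag_extend (AF (\<Delta> p)) (u - v) \<in> ct.K"
          if "frag_extend (AF (\<Delta> p')) u - frag_extend (AF (\<Delta> p)) u \<in> ct.K"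
            "frag_extend (AF (\<Delta> p')) v - frag_extend (AF (\<Delta> p)) v \<in> ct.K" for u v
          using ct.K_closed(4)[OF that] by (simp add: frag_extend_diff algebra_simps)
      qed (auto simp: ct.K_closed 2)
      have "frag_extend (AF (\<Delta> p')) z' - frag_extend (AF (\<Delta> p)) z \<in> ct.K"
        using ct.K_closed(2)[OF 1 3] by (simp add: frag_extend_diff)
      then show ?thesis by (simp add: ck ct.cl_def[symmetric] ct.cl_eq)
    qed
    moreover have "tensor_cl M N (ctens_ker D M N) (frag_extend (AF (\<Delta> p)) z) \<in> ?L"
      using ucl_self[of p D] p ct.cl_self[of z] unfolding levi_def by blast
    ultimately show ?thesis unfolding levi_def by blast
  qed
  then show ?thesis unfolding ctens_act_def AFe by simp
qed

definition "T = ctens D M N"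

lemma T_alt: "T = tensor_module M N ct.K (ctens_act D M N)"
  by (simp add: T_def ctens_def ctens_ker_def ct.K_def)

lemmas T_carrier = ct.TM_carrier[of "ctens_act D M N", folded T_alt]
  and T_add = ct.TM_add[of _ _ "ctens_act D M N", folded T_alt]
  and T_abelian = ct.TM_abelian[of "ctens_act D M N", folded T_alt]
  and T_smult = ct.TM_smult[where act = "ctens_act D M N", folded T_alt]
  and T_pure_closed = ct.pure_closed[of _ _ "ctens_act D M N", folded T_alt]
  and T_induct = ct.TM_induct[of _ "ctens_act D M N", folded T_alt]
  and T_pure_add = ct.pure_add_left[where act = "ctens_act D M N", folded T_alt] ct.pure_add_right[where act = "ctens_act D M N", folded T_alt]

lemma T_smult_cl:
  "levi D p \<Longrightarrow> z \<in> carrier ct.G \<Longrightarrow> ucl D p \<odot>\<^bsub>T\<^esub> ct.cl z = ct.cl (frag_extend (AF (\<Delta> p)) z)"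
  by (simp add: T_smult ctens_act_cl)

lemma T_smult_closed: "levi D p \<Longrightarrow> t \<in> carrier T \<Longrightarrow> ucl D p \<odot>\<^bsub>T\<^esub> t \<in> carrier T"
  unfolding T_carrier using fe_closed T_smult_cl by fastforce

lemma T_smult_pure: "levi D p \<Longrightarrow> x \<in> carrier M \<Longrightarrow> y \<in> carrier N \<Longrightarrow> ucl D p \<odot>\<^bsub>T\<^esub> ct.pure x y = ct.cl (AF (\<Delta> p) (x, y))"
  unfolding ct.pure_def by (subst T_smult_cl) auto

lemma AF_single: "AF (Poly_Mapping.single (a, b) 1) (x, y) = frag_of (M.mact (Poly_Mapping.single a 1) x, N.mact (Poly_Mapping.single b 1) y)"
  by (simp add: AF_def fr_def)

lemma T_gen_pure:
  assumes x: "x \<in> carrier M" and y: "y \<in> carrier N"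
  shows "ucl D (gen (QK i)) \<odot>\<^bsub>T\<^esub> ct.pure x y = ct.pure (M.mact (gen (QK i)) x) (N.mact (gen (QK i)) y)"
    "ucl D (gen (QKi i)) \<odot>\<^bsub>T\<^esub> ct.pure x y = ct.pure (M.mact (gen (QKi i)) x) (N.mact (gen (QKi i)) y)"
    "i \<in> sub D \<Longrightarrow> ucl D (gen (QE i)) \<odot>\<^bsub>T\<^esub> ct.pure x y =
      ct.pure (M.mact (gen (QE i)) x) (N.mact (gen (QK i)) y) \<oplus>\<^bsub>T\<^esub> ct.pure x (N.mact (gen (QE i)) y)"
    "i \<in> sub D \<Longrightarrow> ucl D (gen (QF i)) \<odot>\<^bsub>T\<^esub> ct.pure x y =
      ct.pure (M.mact (gen (QF i)) x) y \<oplus>\<^bsub>T\<^esub> ct.pure (M.mact (gen (QKi i)) x) (N.mact (gen (QF i)) y)"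
    "scal D c \<odot>\<^bsub>T\<^esub> ct.pure x y = ct.pure (M.mact (const c) x) y"
proof -
  have L: "QK i \<in> levi_letters D" "QKi i \<in> levi_letters D" "i \<in> sub D \<Longrightarrow> QE i \<in> levi_letters D" "i \<in> sub D \<Longrightarrow> QF i \<in> levi_letters D" for i
    by (auto simp: levi_letters_def)
  have o: "M.mact (Poly_Mapping.single 0 1) x = x" "N.mact (Poly_Mapping.single 0 1) y = y"
    using M.mact_simps(4)[of x] N.mact_simps(4)[of y] x y by simp_all
  show "ucl D (gen (QK i)) \<odot>\<^bsub>T\<^esub> ct.pure x y = ct.pure (M.mact (gen (QK i)) x) (N.mact (gen (QK i)) y)"
    "ucl D (gen (QKi i)) \<odot>\<^bsub>T\<^esub> ct.pure x y = ct.pure (M.mact (gen (QKi i)) x) (N.mact (gen (QKi i)) y)"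
    using x y by (simp_all add: T_smult_pure L eta_hom_simps coprod_gen.simps AF_single gen_def[symmetric], simp_all add: ct.pure_def)
  have add: "ct.cl (AF (Poly_Mapping.single (a, b) 1 + Poly_Mapping.single (a', b') 1) (x, y)) =
      ct.pure (M.mact (Poly_Mapping.single a 1) x) (N.mact (Poly_Mapping.single b 1) y) \<oplus>\<^bsub>T\<^esub>
      ct.pure (M.mact (Poly_Mapping.single a' 1) x) (N.mact (Poly_Mapping.single b' 1) y)"
    if "set (letters a) \<subseteq> levi_letters D" "set (letters b) \<subseteq> levi_letters D" "set (letters a') \<subseteq> levi_letters D" "set (letters b') \<subseteq> levi_letters D"
    for a b a' b'
  proof -
    have c: "frag_of (M.mact (Poly_Mapping.single a 1) x, N.mact (Poly_Mapping.single b 1) y) \<in> carrier ct.G"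
      "frag_of (M.mact (Poly_Mapping.single a' 1) x, N.mact (Poly_Mapping.single b' 1) y) \<in> carrier ct.G"
      unfolding ct.G_closed using that x y by (simp_all add: levi_single)
    show ?thesis unfolding ct.pure_def T_add[OF c]
      by (unfold ct.cl_eq AF_single[symmetric], rule AF_add) (use that x y in \<open>simp_all add: levi2_single\<close>)
  qed
  show "ucl D (gen (QE i)) \<odot>\<^bsub>T\<^esub> ct.pure x y =
      ct.pure (M.mact (gen (QE i)) x) (N.mact (gen (QK i)) y) \<oplus>\<^bsub>T\<^esub> ct.pure x (N.mact (gen (QE i)) y)" if i: "i \<in> sub D"
    using x y add[of "Word [QE i]" "Word [QK i]" 0 "Word [QE i]"] i
    by (simp add: T_smult_pure L eta_hom_simps coprod_gen.simps gen_def[symmetric] o M.mact_simps N.mact_simps)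
  show "ucl D (gen (QF i)) \<odot>\<^bsub>T\<^esub> ct.pure x y =
      ct.pure (M.mact (gen (QF i)) x) y \<oplus>\<^bsub>T\<^esub> ct.pure (M.mact (gen (QKi i)) x) (N.mact (gen (QF i)) y)" if i: "i \<in> sub D"
    using x y add[of "Word [QF i]" 0 "Word [QKi i]" "Word [QF i]"] i
    by (simp add: T_smult_pure L eta_hom_simps coprod_gen.simps gen_def[symmetric] o M.mact_simps N.mact_simps)
  have "AF (const c) (x, y) - frag_of (M.mact (const c) x, y) \<in> ct.K"
  proof (cases "c = 0")
    case True
    then show ?thesis using x y ct.K_closed(3)[OF ct.K_zero(1)[of y]] by (simp add: AF_def const_def M.mact_zero)
  next
    case False
    then show ?thesis using o ct.K_closed(1)
      by (simp add: AF_def const_def fr_def zero_prod_def)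
  qed
  then show "scal D c \<odot>\<^bsub>T\<^esub> ct.pure x y = ct.pure (M.mact (const c) x) y"
    using x y T_smult_pure[of "const c" x y, folded scal_def] by (simp add: eta_hom_simps ct.pure_def ct.cl_eq)
qed

end

subsection \<open>Cyclicity of Levi modules and of their duals\<close>

text \<open>Separation of a point from a subspace in finite dimension, eliminating one coordinate at
  a time. Closure of P is required only for values on B, which suits functionals on a module that
  are evaluated on a spanning set.\<close>

lemma separating_functional:
  fixes P :: "('b \<Rightarrow> complex) set"
  assumes "finite B" and "\<And>f g. f \<in> P \<Longrightarrow> g \<in> P \<Longrightarrow> \<exists>h\<in>P. \<forall>b\<in>B. h b = f b + g b"
    and "\<And>f c. f \<in> P \<Longrightarrow> \<exists>h\<in>P. \<forall>b\<in>B. h b = c * f b" and "P \<noteq> {}"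
    and "\<And>g. g \<in> P \<Longrightarrow> \<exists>b\<in>B. g b \<noteq> f0 b"
  shows "\<exists>c. (\<forall>g\<in>P. (\<Sum>b\<in>B. c b * g b) = 0) \<and> (\<Sum>b\<in>B. c b * f0 b) \<noteq> (0::complex)"
  using assms
proof (induction B arbitrary: P f0 rule: finite_induct)
  case empty
  then show ?case by auto
next
  case (insert a B)
  show ?case
  proof (cases "\<forall>g\<in>P. g a = 0")
    case True
    show ?thesis
    proof (cases "f0 a = 0")
      case False
      have "(\<Sum>b\<in>insert a B. (if b = a then 1 else 0) * g b) = g a" for g :: "'b \<Rightarrow> complex"
        using insert.hyps by (auto intro!: sum.neutral)
      then show ?thesis
        by (intro exI[of _ "\<lambda>b. if b = a then 1 else 0"]) (use True False in auto)
    next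
      case f0: True
      have "\<exists>c. (\<forall>g\<in>P. (\<Sum>b\<in>B. c b * g b) = 0) \<and> (\<Sum>b\<in>B. c b * f0 b) \<noteq> 0"
      proof (rule insert.IH)
        show "\<exists>b\<in>B. g b \<noteq> f0 b" if "g \<in> P" for g using insert.prems(4)[OF that] True f0 that by auto
        show "\<exists>h\<in>P. \<forall>b\<in>B. h b = f b + g b" if "f \<in> P" "g \<in> P" for f g
          using insert.prems(1)[OF that] by auto
        show "\<exists>h\<in>P. \<forall>b\<in>B. h b = c * f b" if "f \<in> P" for f c
          using insert.prems(2)[OF that, of c] by auto
      qed (rule insert.prems(3))
      then obtain c where "\<forall>g\<in>P. (\<Sum>b\<in>B. c b * g b) = 0" "(\<Sum>b\<in>B. c b * f0 b) \<noteq> 0" by blast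
      then show ?thesis using True f0 insert.hyps by (intro exI[of _ c]) simp
    qed
  next
    case False
    then obtain g0 where g0: "g0 \<in> P" "g0 a \<noteq> 0" by auto
    obtain g1 where g1: "g1 \<in> P" "\<forall>b\<in>insert a B. g1 b = inverse (g0 a) * g0 b"
      using insert.prems(2)[OF g0(1)] by blast
    have g1a: "g1 a = 1" using g1 g0 by simp
    define P0 where "P0 = {g \<in> P. g a = 0}"
    define f1 where "f1 b = f0 b - f0 a * g1 b" for b
    have comb: "\<exists>h\<in>P. \<forall>b\<in>insert a B. h b = g b + c * g' b" if gg: "g \<in> P" "g' \<in> P" for g g' c
    proof -
      obtain h where h: "h \<in> P" "\<forall>b\<in>insert a B. h b = c * g' b" using insert.prems(2)[OF gg(2)] by blast
      obtain k where "k \<in> P" "\<forall>b\<in>insert a B. k b = g b + h b" using insert.prems(1)[OF gg(1) h(1)] by blast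
      then show ?thesis using h(2) by auto
    qed
    have "\<exists>c. (\<forall>g\<in>P0. (\<Sum>b\<in>B. c b * g b) = 0) \<and> (\<Sum>b\<in>B. c b * f1 b) \<noteq> 0"
    proof (rule insert.IH)
      show "P0 \<noteq> {}" using comb[OF g1(1) g1(1), of "- 1"] by (auto simp: P0_def)
      show "\<exists>h\<in>P0. \<forall>b\<in>B. h b = f b + g b" if "f \<in> P0" "g \<in> P0" for f g
        using insert.prems(1)[of f g] that by (auto simp: P0_def)
      show "\<exists>h\<in>P0. \<forall>b\<in>B. h b = c * f b" if "f \<in> P0" for f c
        using insert.prems(2)[of f c] that by (auto simp: P0_def)
      show "\<exists>b\<in>B. g b \<noteq> f1 b" if g: "g \<in> P0" for g
      proof (rule ccontr)
        assume a: "\<not> ?thesis"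
        obtain h where h: "h \<in> P" "\<forall>b\<in>insert a B. h b = g b + f0 a * g1 b"
          using comb[of g g1 "f0 a"] g g1 by (auto simp: P0_def)
        have "h b = f0 b" if "b \<in> insert a B" for b
          using h(2) that a g g1a by (cases "b = a") (auto simp: P0_def f1_def)
        then show False using insert.prems(4)[OF h(1)] by auto
      qed
    qed
    then obtain c where c: "\<forall>g\<in>P0. (\<Sum>b\<in>B. c b * g b) = 0" "(\<Sum>b\<in>B. c b * f1 b) \<noteq> 0" by blast
    \<comment> \<open>The value at a is chosen such that the combination d annihilates g1.\<close>
    define d where "d = c(a := - (\<Sum>b\<in>B. c b * g1 b))"
    have d: "(\<Sum>b\<in>insert a B. d b * f b) = (\<Sum>b\<in>B. c b * (f b - f a * g1 b))" for f
    proof -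
      have "(\<Sum>b\<in>insert a B. d b * f b) = - (\<Sum>b\<in>B. c b * g1 b) * f a + (\<Sum>b\<in>B. c b * f b)"
        using insert.hyps by (auto simp: d_def intro!: sum.cong)
      then show ?thesis by (simp add: right_diff_distrib sum_subtractf sum_distrib_left sum_distrib_right algebra_simps)
    qed
    have "(\<Sum>b\<in>insert a B. d b * g b) = 0" if g: "g \<in> P" for g
    proof -
      obtain h where h: "h \<in> P" "\<forall>b\<in>insert a B. h b = g b + (- g a) * g1 b" using comb[OF g g1(1)] by blast
      then have "h \<in> P0" using g1a by (auto simp: P0_def)
      then have "(\<Sum>b\<in>B. c b * h b) = 0" using c by auto
      moreover have "(\<Sum>b\<in>B. c b * h b) = (\<Sum>b\<in>B. c b * (g b - g a * g1 b))"
        by (rule sum.cong) (use h in auto)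
      ultimately show ?thesis unfolding d by simp
    qed
    moreover have "(\<Sum>b\<in>insert a B. d b * f0 b) \<noteq> 0" unfolding d using c(2) by (simp add: f1_def)
    ultimately show ?thesis by blast
  qed
qed

context levi_mod
begin

lemma levi_closed:
  assumes X: "X \<subseteq> carrier M" "\<zero>\<^bsub>M\<^esub> \<in> X" and add: "\<And>x y. x \<in> X \<Longrightarrow> y \<in> X \<Longrightarrow> x \<oplus>\<^bsub>M\<^esub> y \<in> X"
    and con: "\<And>c x. x \<in> X \<Longrightarrow> mact (const c) x \<in> X"
    and ltr: "\<And>a x. a \<in> levi_letters D \<Longrightarrow> x \<in> X \<Longrightarrow> mact (gen a) x \<in> X"
    and p: "levi D p" and x: "x \<in> X"
  shows "mact p x \<in> X"
proof -
  have w: "mact (Poly_Mapping.single (Word l) 1) x \<in> X" if "set l \<subseteq> levi_letters D" for l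
    using that
  proof (induction l)
    case Nil
    then show ?case using x X mact_simps(4)[of x] by (auto simp: zero_word_def[symmetric])
  next
    case (Cons a l)
    have "Poly_Mapping.single (Word (a # l)) (1::complex) = gen a * Poly_Mapping.single (Word l) 1"
      by (simp add: gen_def mult_single plus_word_def)
    then show ?case using Cons x X(1) ltr by (auto simp: mact_simps levi_single)
  qed
  have "mact (\<Sum>w\<in>J. Poly_Mapping.single w (Poly_Mapping.lookup p w)) x \<in> X"
    if "J \<subseteq> Poly_Mapping.keys p" "finite J" for J
    using that(2,1)
  proof (induction J rule: finite_induct)
    case empty
    then show ?case using x X mact_zero(1)[of x] by auto
  next
    case (insert w F)
    have l: "set (letters w) \<subseteq> levi_letters D" if "w \<in> Poly_Mapping.keys p" for w using p that by (auto simp: levi_def)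
    have "mact (Poly_Mapping.single w (Poly_Mapping.lookup p w)) x = mact (const (Poly_Mapping.lookup p w)) (mact (Poly_Mapping.single (Word (letters w)) 1) x)"
      using x X(1) l[of w] insert.prems mact_simps(2)[of "const (Poly_Mapping.lookup p w)" "Poly_Mapping.single w 1" x]
      by (auto simp: const_mult_single levi_single)
    then have a: "mact (Poly_Mapping.single w (Poly_Mapping.lookup p w)) x \<in> X"
      using w[OF l[of w]] insert.prems con by auto
    have b: "mact (\<Sum>w\<in>F. Poly_Mapping.single w (Poly_Mapping.lookup p w)) x \<in> X" using insert by auto
    have "mact (Poly_Mapping.single w (Poly_Mapping.lookup p w) + (\<Sum>w\<in>F. Poly_Mapping.single w (Poly_Mapping.lookup p w))) x
      = mact (Poly_Mapping.single w (Poly_Mapping.lookup p w)) x \<oplus>\<^bsub>M\<^esub> mact (\<Sum>w\<in>F. Poly_Mapping.single w (Poly_Mapping.lookup p w)) x"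
      by (rule mact_simps(1)) (use x X(1) l insert.prems in \<open>auto intro!: levi_single levi_sum\<close>)
    then show ?case using add[OF a b] insert.hyps by simp
  qed
  from this[of "Poly_Mapping.keys p"] show ?thesis using pm_expand[of p] by simp
qed

text \<open>With L smaller than the set of all Levi letters this is a priori only a subspace.
  Closure under the remaining letters shows that lowering, or raising, letters alone generate the
  module.\<close>

inductive_set cyc :: "'i qgen set \<Rightarrow> 'm \<Rightarrow> 'm set" for L v where
  cyc_base: "v \<in> cyc L v"
| cyc_add: "x \<in> cyc L v \<Longrightarrow> y \<in> cyc L v \<Longrightarrow> x \<oplus>\<^bsub>M\<^esub> y \<in> cyc L v"
| cyc_const: "x \<in> cyc L v \<Longrightarrow> mact (const c) x \<in> cyc L v"
| cyc_gen: "a \<in> L \<Longrightarrow> x \<in> cyc L v \<Longrightarrow> mact (gen a) x \<in> cyc L v"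

definition "KL = (range QK \<union> range QKi :: 'i qgen set)"
definition "LF = QF ` sub D \<union> KL"
definition "LE = QE ` sub D \<union> KL"

lemma letters_LFE: "LF \<subseteq> levi_letters D" "LE \<subseteq> levi_letters D"
    "levi_letters D = LF \<union> QE ` sub D" "levi_letters D = LE \<union> QF ` sub D"
  by (auto simp: LF_def LE_def KL_def levi_letters_def)

lemma cyc_carrier: "L \<subseteq> levi_letters D \<Longrightarrow> v \<in> carrier M \<Longrightarrow> x \<in> cyc L v \<Longrightarrow> x \<in> carrier M"
  by (rotate_tac 2, induction rule: cyc.induct) auto

lemma cyc_zero: "L \<subseteq> levi_letters D \<Longrightarrow> v \<in> carrier M \<Longrightarrow> \<zero>\<^bsub>M\<^esub> \<in> cyc L v"
  using cyc_const[OF cyc_base, of 0 v L] mact_zero(1)[of v] by simp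

lemma mact_ueq: "p \<triangleq> q \<Longrightarrow> mact p x = mact q x"
  by (rule mact_cong) (simp add: ueq_def)

lemma gens_levi [simp]: "levi D (gen (QK j))" "levi D (gen (QKi j))"
    "j \<in> sub D \<Longrightarrow> levi D (gen (QE j))" "j \<in> sub D \<Longrightarrow> levi D (gen (QF j))"
  by (auto simp: levi_letters_def)

lemma K_act: assumes x: "x \<in> carrier M"
  shows "mact (gen (QK j)) (mact (gen (QKi j)) x) = x" "mact (gen (QKi j)) (mact (gen (QK j)) x) = x"
  using mact_ueq[OF K_rels(1), of j x] mact_ueq[OF K_rels(2), of j x] x by (simp_all add: mact_simps)

text \<open>E_i is moved past the letters until it reaches v; the commutator with F_i leaves only
  K_i and K_i^-1, which belong to \<open>LF\<close>.\<close>

lemma cyc_lower: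
  assumes v: "v \<in> carrier M" and i: "i \<in> sub D"
    and Ev: "mact (gen (QE i)) v = \<zero>\<^bsub>M\<^esub>"
    and x: "x \<in> cyc LF v"
  shows "mact (gen (QE i)) x \<in> cyc LF v"
  using x
proof (induction rule: cyc.induct)
  case cyc_base
  then show ?case using Ev cyc_zero[OF letters_LFE(1) v] by simp
next
  case (cyc_add x y)
  then show ?case using cyc_carrier[OF letters_LFE(1) v] i by (simp add: mact_simps cyc.cyc_add)
next
  case (cyc_const x c)
  then show ?case using cyc_carrier[OF letters_LFE(1) v] i by (simp add: mact_const_comm cyc.cyc_const)
next
  case (cyc_gen a x)
  have xc: "x \<in> carrier M" by (rule cyc_carrier[OF letters_LFE(1) v cyc_gen(2)])
  have a: "mact (gen (QE i) * gen a) x = mact (gen (QE i)) (mact (gen a) x)"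
    using xc i cyc_gen(1) letters_LFE(1) by (subst mact_simps) auto
  have in_LF: "QK j \<in> LF" "QKi j \<in> LF" for j by (auto simp: LF_def KL_def)
  consider j where "a = QK j" | j where "a = QKi j" | j where "a = QF j" "j \<in> sub D"
    using cyc_gen(1) by (auto simp: LF_def KL_def)
  then show ?case
  proof cases
    case 1
    have "gen (QE i) * gen (QK j) \<triangleq> const (inverse (bq D j i)) * (gen (QK j) * gen (QE i))"
      using ueq_mult[OF ueq_refl[of "const (inverse (bq D j i))"] ueq_sym[OF K_rels(6)[of j i]]] b0[of j i]
      by (simp add: cst.sm_simps)
    from mact_ueq[OF this, of x] show ?thesis
      unfolding a[unfolded 1] 1 using cyc_gen(3) xc i in_LF by (simp add: mact_simps cyc.cyc_gen cyc.cyc_const)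
  next
    case 2
    have "gen (QE i) * gen (QKi j) \<triangleq> const (bq D j i) * (gen (QKi j) * gen (QE i))"
      using ueq_mult[OF ueq_refl[of "const (bq D j i)"] ueq_sym[OF K_rels(8)[of j i]]] b0[of j i]
      by (simp add: cst.sm_simps)
    from mact_ueq[OF this, of x] show ?thesis
      unfolding a[unfolded 2] 2 using cyc_gen(3) xc i in_LF by (simp add: mact_simps cyc.cyc_gen cyc.cyc_const)
  next
    case 3
    have F: "QF j \<in> LF" using 3 by (auto simp: LF_def)
    have "gen (QE i) * gen (QF j) \<triangleq> gen (QF j) * gen (QE i) +
      (if i = j then const (aq i) * gen (QK i) + const (- aq i) * gen (QKi i) else 0)"
      using ueq_add[OF K_rels(10)[of i j] ueq_refl[of "gen (QF j) * gen (QE i)"]]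
      by (simp add: algebra_simps cst.sc_minus split: if_splits)
    from mact_ueq[OF this, of x] show ?thesis
      unfolding a[unfolded 3] 3(1) using cyc_gen(2,3) xc i in_LF F 3(2)
      by (cases "i = j") (simp_all add: mact_simps cyc.cyc_gen cyc.cyc_const cyc.cyc_add)
  qed
qed

lemma cyc_raise:
  assumes v: "v \<in> carrier M" and i: "i \<in> sub D"
    and Fv: "mact (gen (QF i)) v = \<zero>\<^bsub>M\<^esub>"
    and x: "x \<in> cyc LE v"
  shows "mact (gen (QF i)) x \<in> cyc LE v"
  using x
proof (induction rule: cyc.induct)
  case cyc_base
  then show ?case using Fv cyc_zero[OF letters_LFE(2) v] by simp
next
  case (cyc_add x y)
  then show ?case using cyc_carrier[OF letters_LFE(2) v] i by (simp add: mact_simps cyc.cyc_add)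
next
  case (cyc_const x c)
  then show ?case using cyc_carrier[OF letters_LFE(2) v] i by (simp add: mact_const_comm cyc.cyc_const)
next
  case (cyc_gen a x)
  have xc: "x \<in> carrier M" by (rule cyc_carrier[OF letters_LFE(2) v cyc_gen(2)])
  have a: "mact (gen (QF i) * gen a) x = mact (gen (QF i)) (mact (gen a) x)"
    using xc i cyc_gen(1) letters_LFE(2) by (subst mact_simps) auto
  have in_LE: "QK j \<in> LE" "QKi j \<in> LE" for j by (auto simp: LE_def KL_def)
  consider j where "a = QK j" | j where "a = QKi j" | j where "a = QE j" "j \<in> sub D"
    using cyc_gen(1) by (auto simp: LE_def KL_def)
  then show ?case
  proof cases
    case 1
    have "gen (QF i) * gen (QK j) \<triangleq> const (bq D j i) * (gen (QK j) * gen (QF i))"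
      using ueq_mult[OF ueq_refl[of "const (bq D j i)"] ueq_sym[OF K_rels(7)[of j i]]] b0[of j i]
      by (simp add: cst.sm_simps)
    from mact_ueq[OF this, of x] show ?thesis
      unfolding a[unfolded 1] 1 using cyc_gen(3) xc i in_LE by (simp add: mact_simps cyc.cyc_gen cyc.cyc_const)
  next
    case 2
    have "gen (QF i) * gen (QKi j) \<triangleq> const (inverse (bq D j i)) * (gen (QKi j) * gen (QF i))"
      using ueq_mult[OF ueq_refl[of "const (inverse (bq D j i))"] ueq_sym[OF K_rels(9)[of j i]]] b0[of j i]
      by (simp add: cst.sm_simps)
    from mact_ueq[OF this, of x] show ?thesis
      unfolding a[unfolded 2] 2 using cyc_gen(3) xc i in_LE by (simp add: mact_simps cyc.cyc_gen cyc.cyc_const)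
  next
    case 3
    have E: "QE j \<in> LE" using 3 by (auto simp: LE_def)
    have "gen (QF i) * gen (QE j) \<triangleq> gen (QE j) * gen (QF i) -
      (if j = i then const (aq j) * (gen (QK j) - gen (QKi j)) else 0)"
      using ueq_diff[OF ueq_refl[of "gen (QE j) * gen (QF i)"] K_rels(10)[of j i]] by simp
    also have "\<dots> = gen (QE j) * gen (QF i) +
      (if j = i then const (- aq j) * gen (QK j) + const (aq j) * gen (QKi j) else 0)"
      by (simp add: algebra_simps cst.sc_minus)
    finally have "gen (QF i) * gen (QE j) \<triangleq> gen (QE j) * gen (QF i) +
      (if j = i then const (- aq j) * gen (QK j) + const (aq j) * gen (QKi j) else 0)" .
    from mact_ueq[OF this, of x] show ?thesis
      unfolding a[unfolded 3] 3(1) using cyc_gen(2,3) xc i in_LE E 3(2)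
      by (cases "j = i") (simp_all add: mact_simps cyc.cyc_gen cyc.cyc_const cyc.cyc_add)
  qed
qed

lemma submodule_of_closed:
  assumes X: "X \<subseteq> carrier M" "\<zero>\<^bsub>M\<^esub> \<in> X" and add: "\<And>x y. x \<in> X \<Longrightarrow> y \<in> X \<Longrightarrow> x \<oplus>\<^bsub>M\<^esub> y \<in> X"
    and con: "\<And>c x. x \<in> X \<Longrightarrow> mact (const c) x \<in> X"
    and ltr: "\<And>a x. a \<in> levi_letters D \<Longrightarrow> x \<in> X \<Longrightarrow> mact (gen a) x \<in> X"
  shows "submodule X (Ul D) M"
proof -
  have inv: "\<ominus>\<^bsub>M\<^esub> x = mact (const (- 1)) x" if x: "x \<in> carrier M" for x
  proof (rule M.minus_equality)
    show "mact (const (- 1)) x \<oplus>\<^bsub>M\<^esub> x = \<zero>\<^bsub>M\<^esub>"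
      using mact_simps(1)[of "const (- 1)" 1 x] x mact_zero(1)[OF x] by (simp add: cst.sc_minus cst.sc_one mact_simps)
  qed (use x in auto)
  have "subgroup X (add_monoid M)"
  proof (rule group.subgroupI[OF M.a_group])
    show "inv\<^bsub>add_monoid M\<^esub> x \<in> X" if "x \<in> X" for x
      using inv[of x] con[OF that, of "- 1"] X(1) that by (auto simp: a_inv_def)
  qed (use X add in auto)
  then show ?thesis
    by (rule submodule.intro) (unfold_locales, use levi_closed[OF assms] in \<open>auto simp: Ul_carrier mact_def\<close>)
qed

text \<open>By \<open>cyc_lower\<close> the span of the lowering words is a submodule; it contains v
  and so is not zero.\<close>

lemma cyc_all:
  assumes simple: "simple_module (Ul D) M" and v: "v \<in> carrier M" "v \<noteq> \<zero>\<^bsub>M\<^esub>"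
    and Ev: "\<And>i. i \<in> sub D \<Longrightarrow> mact (gen (QE i)) v = \<zero>\<^bsub>M\<^esub>"
  shows "cyc LF v = carrier M"
proof -
  have "submodule (cyc LF v) (Ul D) M"
  proof (rule submodule_of_closed)
    show "mact (gen a) x \<in> cyc LF v" if "a \<in> levi_letters D" "x \<in> cyc LF v" for a x
      using that cyc_lower[OF v(1) _ Ev] unfolding letters_LFE(3) by (auto intro: cyc_gen)
  qed (use cyc_carrier[OF letters_LFE(1) v(1)] cyc_zero[OF letters_LFE(1) v(1)] in \<open>auto intro: cyc.intros\<close>)
  then show ?thesis using simple v cyc_base[of v LF] unfolding simple_module_def by blast
qed

end

context levi_mod
begin

abbreviation "N \<equiv> dual_module D M"

interpretation dm: levi_mod D N
  by (rule dual_levi_mod)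

lemma dual_car: "f \<in> carrier N \<longleftrightarrow> f \<in> extensional (carrier M) \<and>
      (\<forall>x\<in>carrier M. \<forall>y\<in>carrier M. f (x \<oplus>\<^bsub>M\<^esub> y) = f x + f y) \<and>
      (\<forall>c. \<forall>x\<in>carrier M. f (mact (const c) x) = c * f x)"
  by (simp add: dual_module_def scal_act)

lemma dual_add: "x \<in> carrier M \<Longrightarrow> (f \<oplus>\<^bsub>N\<^esub> g) x = f x + g x"
  by (simp add: dual_module_def)

lemma dual_zero: "\<zero>\<^bsub>N\<^esub> = (\<lambda>x\<in>carrier M. 0)"
  by (simp add: dual_module_def)

lemma dual_mact: "x \<in> carrier M \<Longrightarrow> dm.mact p f x = f (mact (free_antihom antipode_gen p) x)"
  unfolding dm.mact_def by (simp add: dual_module_def antipode_ucl mact_def)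

lemma dual_lin: assumes "f \<in> carrier N" shows "f \<zero>\<^bsub>M\<^esub> = 0"
  "x \<in> carrier M \<Longrightarrow> y \<in> carrier M \<Longrightarrow> f (x \<oplus>\<^bsub>M\<^esub> y) = f x + f y"
  "x \<in> carrier M \<Longrightarrow> f (mact (const c) x) = c * f x"
proof -
  show a: "x \<in> carrier M \<Longrightarrow> y \<in> carrier M \<Longrightarrow> f (x \<oplus>\<^bsub>M\<^esub> y) = f x + f y" for x y
    using assms by (simp add: dual_car)
  show "x \<in> carrier M \<Longrightarrow> f (mact (const c) x) = c * f x" using assms by (simp add: dual_car)
  show "f \<zero>\<^bsub>M\<^esub> = 0" using a[of "\<zero>\<^bsub>M\<^esub>" "\<zero>\<^bsub>M\<^esub>"] by simp
qed

lemma dual_ext: "f \<in> carrier N \<Longrightarrow> g \<in> carrier N \<Longrightarrow> (\<And>x. x \<in> carrier M \<Longrightarrow> f x = g x) \<Longrightarrow> f = g"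
  by (rule extensionalityI[of _ "carrier M"]) (auto simp: dual_car)

lemma dual_finsum:
  assumes f: "f \<in> carrier N" and B: "finite B" "B \<subseteq> carrier M"
  shows "f (finsum M (\<lambda>b. scal D (c b) \<odot>\<^bsub>M\<^esub> b) B) = (\<Sum>b\<in>B. c b * f b)"
  using B
proof (induction B rule: finite_induct)
  case empty
  then show ?case by (simp add: dual_lin(1)[OF f])
next
  case (insert a B)
  then have "(\<lambda>b. scal D (c b) \<odot>\<^bsub>M\<^esub> b) \<in> B \<rightarrow> carrier M" "scal D (c a) \<odot>\<^bsub>M\<^esub> a \<in> carrier M"
    by (auto simp: scal_act)
  then show ?case using insert by (simp add: dual_lin[OF f] M.finsum_closed) (simp add: scal_act dual_lin[OF f])
qed

text \<open>Simplicity is given for M rather than for its dual. The space C generated by \<xi> has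
  an annihilator M0 in M, which is a proper submodule and hence zero; in finite dimension, a space
  of functionals with zero annihilator is the whole dual.\<close>

lemma dual_cyc_all:
  assumes simple: "simple_module (Ul D) M" and fd: "fin_dim D M"
    and xi: "\<xi> \<in> carrier N" "\<xi> \<noteq> \<zero>\<^bsub>N\<^esub>"
    and F: "\<And>i. i \<in> sub D \<Longrightarrow> dm.mact (gen (QF i)) \<xi> = \<zero>\<^bsub>N\<^esub>"
  shows "dm.cyc dm.LE \<xi> = carrier N"
proof -
  define C where "C = dm.cyc dm.LE \<xi>"
  have Cc: "C \<subseteq> carrier N" using dm.cyc_carrier[OF dm.letters_LFE(2) xi(1)] by (auto simp: C_def)
  have Cl: "dm.mact (gen a) f \<in> C" if "a \<in> levi_letters D" "f \<in> C" for a f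
    using that dm.cyc_raise[OF xi(1) _ F] unfolding dm.letters_LFE(4) C_def by (auto intro: dm.cyc_gen)
  define M0 where "M0 = {x \<in> carrier M. \<forall>f\<in>C. f x = 0}"
  have M0D: "x \<in> carrier M" "f \<in> C \<Longrightarrow> f x = 0" if "x \<in> M0" for x f using that by (auto simp: M0_def)
  \<comment> \<open>The antipode sends E_j to -E_j K_j^-1, so stability of M0 under the K's is
    needed first to strip off the K factor.\<close>
  have K0: "mact (gen (QK j)) x \<in> M0" "mact (gen (QKi j)) x \<in> M0" if x: "x \<in> M0" for x j
  proof -
    have "f (mact (gen (QK j)) x) = 0" "f (mact (gen (QKi j)) x) = 0" if f: "f \<in> C" for f
      using M0D(2)[OF x Cl[OF _ f], of "QKi j"] M0D(2)[OF x Cl[OF _ f], of "QK j"] M0D(1)[OF x]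
      by (simp_all add: dual_mact antihom_simps levi_letters_def)
    then show "mact (gen (QK j)) x \<in> M0" "mact (gen (QKi j)) x \<in> M0" using M0D(1)[OF x] by (auto simp: M0_def)
  qed
  have neg: "f (mact (- p) x) = - f (mact p x)" if "f \<in> C" "levi D p" "x \<in> carrier M" for f p x
  proof -
    have "mact (- p) x = mact (const (- 1)) (mact p x)"
      using that mact_simps(2)[of "const (- 1)" p x] by (simp add: cst.sc_minus cst.sc_one)
    then show ?thesis using that Cc dual_lin(3)[of f "mact p x" "- 1"] by auto
  qed
  have "submodule M0 (Ul D) M"
  proof (rule submodule_of_closed)
    show "\<zero>\<^bsub>M\<^esub> \<in> M0" using Cc dual_lin(1) by (auto simp: M0_def)
    show "x \<oplus>\<^bsub>M\<^esub> y \<in> M0" if "x \<in> M0" "y \<in> M0" for x y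
      using that by (auto simp: M0_def dual_lin(2)[OF subsetD[OF Cc]])
    show "mact (const c) x \<in> M0" if "x \<in> M0" for c x
      using that by (auto simp: M0_def dual_lin(3)[OF subsetD[OF Cc]])
    show "mact (gen a) x \<in> M0" if al: "a \<in> levi_letters D" and x: "x \<in> M0" for a x
    proof -
      have xc: "x \<in> carrier M" using M0D[OF x] by simp
      consider j where "a = QK j" | j where "a = QKi j" | j where "a = QE j" "j \<in> sub D" | j where "a = QF j" "j \<in> sub D"
        using al by (auto simp: levi_letters_def)
      then show ?thesis
      proof cases
        case 3
        have "f (mact (gen (QE j)) x) = 0" if f: "f \<in> C" for f
        proof -
          have "dm.mact (gen (QE j)) f (mact (gen (QK j)) x) = 0"
            using K0(1)[OF x] Cl[OF al f] 3 by (auto dest: M0D(2))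
          then have "f (mact (- (gen (QE j) * gen (QKi j))) (mact (gen (QK j)) x)) = 0"
            using xc by (simp add: dual_mact antihom_simps)
          then have "f (mact (gen (QE j) * gen (QKi j)) (mact (gen (QK j)) x)) = 0"
            using neg[OF f, of "gen (QE j) * gen (QKi j)"] xc 3 by simp
          then show ?thesis using xc 3 K_act by (simp add: mact_simps)
        qed
        then show ?thesis using xc 3 by (auto simp: M0_def)
      next
        case 4
        have "f (mact (gen (QF j)) x) = 0" if f: "f \<in> C" for f
        proof -
          \<comment> \<open>The antipode of F_j is -K_j F_j; acting on f with K_j beforehand cancels
            this K_j.\<close>
          define g where "g = dm.mact (gen (QK j)) f"
          have g: "g \<in> C" unfolding g_def by (rule Cl[OF _ f]) (simp add: levi_letters_def)
          have "dm.mact (gen (QF j)) g x = 0"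
            using x Cl[OF al g] 4 by (auto dest: M0D(2))
          then have "g (mact (- (gen (QK j) * gen (QF j))) x) = 0"
            using xc by (simp add: dual_mact antihom_simps)
          then have "g (mact (gen (QK j) * gen (QF j)) x) = 0"
            using neg[OF g, of "gen (QK j) * gen (QF j)"] xc 4 by simp
          then show ?thesis unfolding g_def using xc 4 K_act by (simp add: mact_simps dual_mact antihom_simps)
        qed
        then show ?thesis using xc 4 by (auto simp: M0_def)
      qed (use K0[OF x] in auto)
    qed
  qed (auto simp: M0_def)
  moreover have "M0 \<noteq> carrier M"
  proof
    assume "M0 = carrier M"
    then have "\<xi> x = 0" if "x \<in> carrier M" for x
      using that dm.cyc_base[of \<xi> dm.LE] by (auto simp: M0_def C_def)
    then have "\<xi> = \<zero>\<^bsub>N\<^esub>" using xi(1) dm.M.zero_closed by (intro dual_ext) (auto simp: dual_zero)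
    then show False using xi by simp
  qed
  ultimately have M00: "M0 = {\<zero>\<^bsub>M\<^esub>}" using simple unfolding simple_module_def by blast
  obtain B where B: "finite B" "B \<subseteq> carrier M" "\<forall>x\<in>carrier M. \<exists>c. x = finsum M (\<lambda>b. scal D (c b) \<odot>\<^bsub>M\<^esub> b) B"
    using fd by (auto simp: fin_dim_def)
  have "f0 \<in> C" if f0: "f0 \<in> carrier N" for f0
  proof (rule ccontr)
    assume n: "f0 \<notin> C"
    have "\<exists>c. (\<forall>g\<in>C. (\<Sum>b\<in>B. c b * g b) = 0) \<and> (\<Sum>b\<in>B. c b * f0 b) \<noteq> 0"
    proof (rule separating_functional[OF B(1)])
      show "\<exists>h\<in>C. \<forall>b\<in>B. h b = f b + g b" if "f \<in> C" "g \<in> C" for f g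
        using that B(2) dm.cyc_add[of f dm.LE \<xi> g]
        by (intro bexI[of _ "f \<oplus>\<^bsub>N\<^esub> g"]) (auto simp: C_def dual_add)
      show "\<exists>h\<in>C. \<forall>b\<in>B. h b = c * f b" if "f \<in> C" for f c
      proof (intro bexI[of _ "dm.mact (const c) f"] ballI)
        show "dm.mact (const c) f \<in> C" using that dm.cyc_const[of f dm.LE \<xi> c] by (simp add: C_def)
        fix b assume "b \<in> B"
        then have "b \<in> carrier M" using B(2) by auto
        then show "dm.mact (const c) f b = c * f b"
          using dual_lin(3)[OF subsetD[OF Cc that], of b c] by (simp add: dual_mact antihom_simps)
      qed
      show "C \<noteq> {}" using dm.cyc_base[of \<xi> dm.LE] by (auto simp: C_def)
      show "\<exists>b\<in>B. g b \<noteq> f0 b" if g: "g \<in> C" for g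
      proof (rule ccontr)
        assume a: "\<not> ?thesis"
        have "g = f0"
        proof (rule dual_ext)
          show gN: "g \<in> carrier N" using g Cc by auto
          fix x assume "x \<in> carrier M"
          then obtain c where "x = finsum M (\<lambda>b. scal D (c b) \<odot>\<^bsub>M\<^esub> b) B" using B(3) by blast
          then show "g x = f0 x" using dual_finsum[OF gN B(1,2), of c] dual_finsum[OF f0 B(1,2), of c] a by simp
        qed (rule f0)
        then show False using g n by simp
      qed
    qed
    then obtain c where c: "\<forall>g\<in>C. (\<Sum>b\<in>B. c b * g b) = 0" "(\<Sum>b\<in>B. c b * f0 b) \<noteq> 0" by blast
    \<comment> \<open>By the choice of c this vector is killed by C but not by f0, against M0 =
      0.\<close>
    define x where "x = finsum M (\<lambda>b. scal D (c b) \<odot>\<^bsub>M\<^esub> b) B"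
    have "x \<in> carrier M" unfolding x_def using B(2) by (intro M.finsum_closed) (auto simp: scal_act)
    moreover have "g x = 0" if "g \<in> C" for g
      unfolding x_def using c(1) that by (subst dual_finsum[OF subsetD[OF Cc that] B(1,2)]) auto
    ultimately have "x \<in> M0" by (simp add: M0_def)
    then have "x = \<zero>\<^bsub>M\<^esub>" using M00 by simp
    then show False using c(2) dual_finsum[OF f0 B(1,2), of c] dual_lin(1)[OF f0] by (simp add: x_def)
  qed
  then show ?thesis using Cc by (auto simp: C_def)
qed

end

subsection \<open>Induced modules\<close>

context levi_pair
begin

interpretation UU: ring "Uq D" by (rule Uq_ring)
interpretation TT: abelian_group T by (rule T_abelian)

sublocale iw: tensor_setup "Uq D" T "carrier (Ul D)" "\<lambda>u r. u \<otimes>\<^bsub>Uq D\<^esub> r" "\<lambda>r t. r \<odot>\<^bsub>T\<^esub> t"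
proof unfold_locales
  fix a r assume "a \<in> carrier (Uq D)" "r \<in> carrier (Ul D)"
  then show "a \<otimes>\<^bsub>Uq D\<^esub> r \<in> carrier (Uq D)" using Ul_sub[of D] by auto
next
  fix b r assume "b \<in> carrier T" "r \<in> carrier (Ul D)"
  then show "r \<odot>\<^bsub>T\<^esub> b \<in> carrier T" by (auto simp: Ul_carrier T_smult_closed)
qed

definition "W = induced D T"

lemma W_alt: "W = tensor_module (Uq D) T iw.K (induced_act D T)"
  by (simp add: W_def induced_def induced_ker_def iw.K_def)

lemmas W_carrier = iw.TM_carrier[of "induced_act D T", folded W_alt]
  and W_add = iw.TM_add[of _ _ "induced_act D T", folded W_alt]
  and W_zero = iw.TM_zero[of "induced_act D T", folded W_alt]
  and W_abelian = iw.TM_abelian[of "induced_act D T", folded W_alt]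
  and W_smult = iw.TM_smult[where act = "induced_act D T", folded W_alt]
  and W_pure_closed = iw.pure_closed[of _ _ "induced_act D T", folded W_alt]
  and W_induct = iw.TM_induct[of _ "induced_act D T", folded W_alt, consumes 1, case_names pure add]
  and W_pure_add = iw.pure_add_left[where act = "induced_act D T", folded W_alt] iw.pure_add_right[where act = "induced_act D T", folded W_alt]
  and W_pure_zero = iw.pure_zero[where act = "induced_act D T", folded W_alt]

interpretation WW: abelian_group W by (rule W_abelian)

abbreviation "um u \<equiv> (\<lambda>(a, t). frag_of (u \<otimes>\<^bsub>Uq D\<^esub> a, t))"

lemma W_smult_cl:
  assumes u: "u \<in> carrier (Uq D)" and z: "z \<in> carrier iw.G"
  shows "u \<odot>\<^bsub>W\<^esub> iw.cl z = iw.cl (frag_extend (um u) z)"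
proof -
  have ck: "induced_ker D T = iw.K" by (simp add: induced_ker_def iw.K_def)
  have "the_elem ((\<lambda>z. tensor_cl (Uq D) T (induced_ker D T) (frag_extend (um u) z)) ` iw.cl z) = iw.cl (frag_extend (um u) z)"
  proof (rule the_elem_image_eq)
    fix z' assume "z' \<in> iw.cl z"
    then have "z' - z \<in> iw.K" by (simp add: iw.cl_mem)
    then have "frag_extend (um u) (z' - z) \<in> iw.K"
    proof (rule iw.frag_extend_K[OF iw.K_closed(1-3), rotated -1])
      fix a a' b assume "a \<in> carrier (Uq D)" "a' \<in> carrier (Uq D)" "b \<in> carrier T"
      then show "um u (a \<oplus>\<^bsub>Uq D\<^esub> a', b) - (um u (a, b) + um u (a', b)) \<in> iw.K"
        using u iw.K_rel(1) by (simp add: UU.r_distr)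
    next
      fix a b b' assume "a \<in> carrier (Uq D)" "b \<in> carrier T" "b' \<in> carrier T"
      then show "um u (a, b \<oplus>\<^bsub>T\<^esub> b') - (um u (a, b) + um u (a, b')) \<in> iw.K"
        using u iw.K_rel(2) by simp
    next
      fix a r b assume a: "a \<in> carrier (Uq D)" "r \<in> carrier (Ul D)" "b \<in> carrier T"
      then have "r \<in> carrier (Uq D)" using Ul_sub[of D] by auto
      then show "um u (a \<otimes>\<^bsub>Uq D\<^esub> r, b) - um u (a, r \<odot>\<^bsub>T\<^esub> b) \<in> iw.K"
        using u a iw.K_rel(3)[of "u \<otimes>\<^bsub>Uq D\<^esub> a" r b] by (simp add: UU.m_assoc)
    qed
    then show "tensor_cl (Uq D) T (induced_ker D T) (frag_extend (um u) z') = iw.cl (frag_extend (um u) z)"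
      by (simp add: ck iw.cl_def[symmetric] iw.cl_eq frag_extend_diff)
  qed (use iw.cl_self in blast)
  then show ?thesis by (simp add: W_smult induced_act_def)
qed

lemma um_closed: "u \<in> carrier (Uq D) \<Longrightarrow> z \<in> carrier iw.G \<Longrightarrow> frag_extend (um u) z \<in> carrier iw.G"
  unfolding carrier_free_Abelian_group_iff
  using keys_frag_extend[of "um u" z] by (fastforce simp: keys_frag_of split: prod.splits)

lemma W_smult_pure: "u \<in> carrier (Uq D) \<Longrightarrow> a \<in> carrier (Uq D) \<Longrightarrow> t \<in> carrier T \<Longrightarrow>
    u \<odot>\<^bsub>W\<^esub> iw.pure a t = iw.pure (u \<otimes>\<^bsub>Uq D\<^esub> a) t"
  unfolding iw.pure_def by (subst W_smult_cl) auto

lemma W_smult_closed: "u \<in> carrier (Uq D) \<Longrightarrow> X \<in> carrier W \<Longrightarrow> u \<odot>\<^bsub>W\<^esub> X \<in> carrier W"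
  unfolding W_carrier using um_closed W_smult_cl by fastforce

lemma W_smult_add: "u \<in> carrier (Uq D) \<Longrightarrow> X \<in> carrier W \<Longrightarrow> Y \<in> carrier W \<Longrightarrow>
    u \<odot>\<^bsub>W\<^esub> (X \<oplus>\<^bsub>W\<^esub> Y) = u \<odot>\<^bsub>W\<^esub> X \<oplus>\<^bsub>W\<^esub> u \<odot>\<^bsub>W\<^esub> Y"
  unfolding W_carrier
  using um_closed W_smult_cl W_add iw.G_closed(2)
  by (auto simp: frag_extend_add simp del: carrier_free_Abelian_group_iff)

lemma W_add_smult:
  assumes u: "u \<in> carrier (Uq D)" "u' \<in> carrier (Uq D)" and X: "X \<in> carrier W"
  shows "(u \<oplus>\<^bsub>Uq D\<^esub> u') \<odot>\<^bsub>W\<^esub> X = u \<odot>\<^bsub>W\<^esub> X \<oplus>\<^bsub>W\<^esub> u' \<odot>\<^bsub>W\<^esub> X"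
  using X
proof (induction X rule: W_induct)
  case (pure a t)
  then show ?case using u by (simp add: W_smult_pure UU.l_distr W_pure_add)
next
  case (add X Y)
  then show ?case using u W_smult_closed by (simp add: W_smult_add WW.a_ac)
qed

lemma W_zero_smult: "X \<in> carrier W \<Longrightarrow> \<zero>\<^bsub>Uq D\<^esub> \<odot>\<^bsub>W\<^esub> X = \<zero>\<^bsub>W\<^esub>"
proof (induction X rule: W_induct)
  case (pure a t)
  then show ?case by (simp add: W_smult_pure W_pure_zero)
qed (simp add: W_smult_add)

lemma pure_balance: "u \<in> carrier (Uq D) \<Longrightarrow> levi D p \<Longrightarrow> t \<in> carrier T \<Longrightarrow>
    iw.pure u (ucl D p \<odot>\<^bsub>T\<^esub> t) = iw.pure (u \<otimes>\<^bsub>Uq D\<^esub> ucl D p) t"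
proof -
  assume a: "u \<in> carrier (Uq D)" "levi D p" "t \<in> carrier T"
  then have "ucl D p \<in> carrier (Ul D)" by (auto simp: Ul_carrier)
  from iw.K_closed(3)[OF iw.K_rel(3)[OF a(1) this a(3)]] show ?thesis
    unfolding iw.pure_def iw.cl_eq by simp
qed

end

locale cyclic_pair = levi_pair D M N
  for D :: "('g::ab_group_add, 'i::finite) qflag" and M :: "('i uq, 'm) module" and N :: "('i uq, 'n) module" +
  fixes v \<xi> cv cx
  assumes v: "v \<in> carrier M" and xi: "\<xi> \<in> carrier N"
    and Ev: "\<And>i. i \<in> sub D \<Longrightarrow> M.mact (gen (QE i)) v = \<zero>\<^bsub>M\<^esub>"
    and Kv: "\<And>j. M.mact (gen (QK j)) v = M.mact (const (cv j)) v" and cv0: "\<And>j. cv j \<noteq> 0"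
    and Kx: "\<And>j. N.mact (gen (QK j)) \<xi> = N.mact (const (cx j)) \<xi>"
    and Mcyc: "M.cyc M.LF v = carrier M" and Ncyc: "N.cyc N.LE \<xi> = carrier N"
begin

interpretation UU: ring "Uq D" by (rule Uq_ring)
interpretation TT: abelian_group T by (rule T_abelian)
interpretation WW: abelian_group W by (rule W_abelian)

definition "we u = iw.pure u (ct.pure v \<xi>)"

lemma vx: "ct.pure v \<xi> \<in> carrier T"
  using v xi by (rule T_pure_closed)

lemma we_closed: "u \<in> carrier (Uq D) \<Longrightarrow> we u \<in> carrier W"
  unfolding we_def by (rule W_pure_closed[OF _ vx])

lemma we_add: "u \<in> carrier (Uq D) \<Longrightarrow> u' \<in> carrier (Uq D) \<Longrightarrow> we (u \<oplus>\<^bsub>Uq D\<^esub> u') = we u \<oplus>\<^bsub>W\<^esub> we u'"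
  unfolding we_def using vx by (simp add: W_pure_add)

lemma we_zero: "we \<zero>\<^bsub>Uq D\<^esub> = \<zero>\<^bsub>W\<^esub>"
  unfolding we_def using vx by (simp add: W_pure_zero)

text \<open>Stable under the Levi part, because u \<otimes> p t = u p \<otimes> t. If it is all of
  T, then every element of W has the form \<open>we u\<close>.\<close>

definition "T0 = {t \<in> carrier T. \<forall>u\<in>carrier (Uq D). \<exists>u'\<in>carrier (Uq D). iw.pure u t = we u'}"

lemma T0_add: "s \<in> T0 \<Longrightarrow> t \<in> T0 \<Longrightarrow> s \<oplus>\<^bsub>T\<^esub> t \<in> T0"
  unfolding T0_def
proof (elim CollectE conjE, intro CollectI conjI ballI)
  fix u assume s: "s \<in> carrier T" "\<forall>u\<in>carrier (Uq D). \<exists>u'\<in>carrier (Uq D). iw.pure u s = we u'"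
    and t: "t \<in> carrier T" "\<forall>u\<in>carrier (Uq D). \<exists>u'\<in>carrier (Uq D). iw.pure u t = we u'"
    and u: "u \<in> carrier (Uq D)"
  obtain a b where "a \<in> carrier (Uq D)" "iw.pure u s = we a" "b \<in> carrier (Uq D)" "iw.pure u t = we b"
    using s(2) t(2) u by blast
  then show "\<exists>u'\<in>carrier (Uq D). iw.pure u (s \<oplus>\<^bsub>T\<^esub> t) = we u'"
    using s(1) t(1) u by (intro bexI[of _ "a \<oplus>\<^bsub>Uq D\<^esub> b"]) (simp_all add: W_pure_add we_add)
qed (rule iw.B.a_closed)

lemma T0_act: "levi D p \<Longrightarrow> t \<in> T0 \<Longrightarrow> ucl D p \<odot>\<^bsub>T\<^esub> t \<in> T0"
  unfolding T0_def by (auto simp: T_smult_closed pure_balance)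

lemma T0_scal: "t \<in> T0 \<Longrightarrow> scal D c \<odot>\<^bsub>T\<^esub> t \<in> T0"
  unfolding scal_def by (rule T0_act) simp_all

lemma T0_base: "ct.pure v \<xi> \<in> T0"
  unfolding T0_def we_def using vx by auto

lemma pure_const_right: "x \<in> carrier M \<Longrightarrow> y \<in> carrier N \<Longrightarrow> ct.pure x (N.mact (const c) y) = ct.pure (M.mact (const c) x) y"
  unfolding ct.pure_def using ct.K_closed(3)[OF ct.K_rel(3)[of x c y]]
  by (simp add: ct.cl_eq) (simp add: M.mact_def N.mact_def scal_def)

text \<open>As E_j v = 0, the coproduct gives E_j (v \<otimes> y) = v \<otimes> E_j y, and K_j acts
  on v by a nonzero scalar. So raising words applied to v \<otimes> \<xi> reach all v \<otimes>
  y.\<close>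

lemma T0_v: assumes "y \<in> carrier N" shows "ct.pure v y \<in> T0"
  using assms unfolding Ncyc[symmetric]
proof (induction rule: N.cyc.induct)
  case cyc_base
  then show ?case by (rule T0_base)
next
  case (cyc_add x y)
  then have "x \<in> carrier N" "y \<in> carrier N" unfolding Ncyc by auto
  then show ?case using v cyc_add by (simp add: T_pure_add T0_add)
next
  case (cyc_const y c)
  then have "y \<in> carrier N" unfolding Ncyc by auto
  then show ?case using v cyc_const T0_scal[of "ct.pure v y" c] by (simp add: pure_const_right T_gen_pure)
next
  case (cyc_gen a y)
  then have y: "y \<in> carrier N" unfolding Ncyc by auto
  have inv: "M.mact (const (inverse (cv j))) (M.mact (const (cv j)) x) = x" "M.mact (const (cv j)) (M.mact (const (inverse (cv j))) x) = x"
    if "x \<in> carrier M" for j x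
    using that cv0[of j] M.mact_simps(2)[of "const (inverse (cv j))" "const (cv j)" x]
      M.mact_simps(2)[of "const (cv j)" "const (inverse (cv j))" x]
    by (simp_all add: cst.sc_mult[symmetric] cst.sc_one M.mact_simps)
  have Kiv: "M.mact (gen (QKi j)) v = M.mact (const (inverse (cv j))) v" for j
  proof -
    have "M.mact (gen (QKi j)) v = M.mact (gen (QKi j)) (M.mact (const (inverse (cv j))) (M.mact (gen (QK j)) v))"
      by (simp add: Kv inv v)
    also have "\<dots> = M.mact (const (inverse (cv j))) (M.mact (gen (QKi j)) (M.mact (gen (QK j)) v))"
      using v by (simp add: M.mact_const_comm)
    finally show ?thesis using v M.K_act by simp
  qed
  consider j where "a = QK j" | j where "a = QKi j" | j where "a = QE j" "j \<in> sub D"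
    using cyc_gen(1) by (auto simp: N.LE_def N.KL_def)
  then show ?case
  proof cases
    case 1
    have "scal D (inverse (cv j)) \<odot>\<^bsub>T\<^esub> (ucl D (gen (QK j)) \<odot>\<^bsub>T\<^esub> ct.pure v y) \<in> T0"
      by (intro T0_scal T0_act cyc_gen) simp
    then show ?thesis using v y by (simp add: T_gen_pure Kv inv 1)
  next
    case 2
    have "scal D (cv j) \<odot>\<^bsub>T\<^esub> (ucl D (gen (QKi j)) \<odot>\<^bsub>T\<^esub> ct.pure v y) \<in> T0"
      by (intro T0_scal T0_act cyc_gen) simp
    then show ?thesis using v y by (simp add: T_gen_pure Kiv inv 2)
  next
    case 3
    have "ucl D (gen (QE j)) \<odot>\<^bsub>T\<^esub> ct.pure v y \<in> T0"
      by (intro T0_act cyc_gen) (simp add: 3)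
    then show ?thesis using v y 3 T_pure_closed[of v "N.mact (gen (QE j)) y"]
        ct.pure_zero(1)[of "N.mact (gen (QK j)) y" "ctens_act D M N", folded T_alt]
      by (simp add: T_gen_pure Ev)
  qed
qed

text \<open>In F_j (x \<otimes> y) = F_j x \<otimes> y + K_j^-1 x \<otimes> F_j y the left side and
  the last summand are in \<open>T0\<close>, because the induction hypothesis on x is for all y;
  hence so is F_j x \<otimes> y.\<close>

lemma T0_pure: assumes "x \<in> carrier M" shows "\<forall>y\<in>carrier N. ct.pure x y \<in> T0"
  using assms unfolding Mcyc[symmetric]
proof (induction rule: M.cyc.induct)
  case cyc_base
  then show ?case using T0_v by blast
next
  case (cyc_add x x')
  then have "x \<in> carrier M" "x' \<in> carrier M" unfolding Mcyc by auto
  then show ?case using cyc_add by (simp add: T_pure_add T0_add)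
next
  case (cyc_const x c)
  then have x: "x \<in> carrier M" unfolding Mcyc by auto
  show ?case
  proof
    fix y assume y: "y \<in> carrier N"
    then have "scal D c \<odot>\<^bsub>T\<^esub> ct.pure x y \<in> T0" using cyc_const T0_scal by blast
    then show "ct.pure (M.mact (const c) x) y \<in> T0" using x y by (simp add: T_gen_pure)
  qed
next
  case (cyc_gen a x)
  then have x: "x \<in> carrier M" unfolding Mcyc by auto
  have K1: "ct.pure (M.mact (gen (QK j)) x) y \<in> T0" if y: "y \<in> carrier N" for y j
  proof -
    have "ucl D (gen (QK j)) \<odot>\<^bsub>T\<^esub> ct.pure x (N.mact (gen (QKi j)) y) \<in> T0"
      using cyc_gen(3) y by (intro T0_act) auto
    then show ?thesis using x y by (simp add: T_gen_pure N.K_act)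
  qed
  have K2: "ct.pure (M.mact (gen (QKi j)) x) y \<in> T0" if y: "y \<in> carrier N" for y j
  proof -
    have "ucl D (gen (QKi j)) \<odot>\<^bsub>T\<^esub> ct.pure x (N.mact (gen (QK j)) y) \<in> T0"
      using cyc_gen(3) y by (intro T0_act) auto
    then show ?thesis using x y by (simp add: T_gen_pure N.K_act)
  qed
  consider j where "a = QK j" | j where "a = QKi j" | j where "a = QF j" "j \<in> sub D"
    using cyc_gen(1) by (auto simp: M.LF_def M.KL_def)
  then show ?case
  proof cases
    case 3
    show ?thesis
    proof
      fix y assume y: "y \<in> carrier N"
      define X where "X = ct.pure (M.mact (gen (QF j)) x) y"
      define x' where "x' = M.mact (gen (QKi j)) x"
      define y' where "y' = N.mact (gen (QF j)) y"
      have c: "x' \<in> carrier M" "y' \<in> carrier N" "X \<in> carrier T"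
        using x y 3 by (auto simp: x'_def y'_def X_def T_pure_closed)
      have Z: "ct.pure x' y' \<in> T0" unfolding x'_def by (rule K2[OF c(2)])
      have a: "ucl D (gen (QF j)) \<odot>\<^bsub>T\<^esub> ct.pure x y \<in> T0"
        using cyc_gen(3) y 3 by (intro T0_act) auto
      have e: "ucl D (gen (QF j)) \<odot>\<^bsub>T\<^esub> ct.pure x y = X \<oplus>\<^bsub>T\<^esub> ct.pure x' y'"
        using x y 3 by (simp add: T_gen_pure X_def x'_def y'_def)
      have n: "ct.pure x' y' \<oplus>\<^bsub>T\<^esub> scal D (- 1) \<odot>\<^bsub>T\<^esub> ct.pure x' y' = \<zero>\<^bsub>T\<^esub>"
      proof -
        have "x' \<oplus>\<^bsub>M\<^esub> M.mact (const (- 1)) x' = M.mact (1 + const (- 1)) x'"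
          using c M.mact_simps(1)[of 1 "const (- 1)" x'] by (simp add: M.mact_simps)
        also have "\<dots> = \<zero>\<^bsub>M\<^esub>" using c M.mact_zero(1) by (simp add: cst.sc_minus cst.sc_one)
        finally show ?thesis using c ct.pure_zero(1)[of y' "ctens_act D M N", folded T_alt]
          by (simp add: T_gen_pure T_pure_add(1)[symmetric])
      qed
      have "(X \<oplus>\<^bsub>T\<^esub> ct.pure x' y') \<oplus>\<^bsub>T\<^esub> scal D (- 1) \<odot>\<^bsub>T\<^esub> ct.pure x' y' \<in> T0"
        using T0_add[OF a T0_scal[OF Z]] e by simp
      moreover have "scal D (- 1) \<odot>\<^bsub>T\<^esub> ct.pure x' y' \<in> carrier T" using T0_scal[OF Z] by (simp add: T0_def)
      ultimately have "X \<in> T0" using c n T_pure_closed[OF c(1,2)] by (simp add: iw.B.a_assoc)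
      then show "ct.pure (M.mact (gen a) x) y \<in> T0" by (simp add: X_def 3)
    qed
  qed (use K1 K2 in auto)
qed

lemma T0_all: "t \<in> carrier T \<Longrightarrow> t \<in> T0"
  by (erule T_induct) (auto simp: T0_pure T0_add)

lemma W_cyclic: "X \<in> carrier W \<Longrightarrow> \<exists>u\<in>carrier (Uq D). X = we u"
proof (induction X rule: W_induct)
  case (pure a t)
  then show ?case using T0_all[of t] by (auto simp: T0_def)
next
  case (add X Y)
  then show ?case using we_add by (metis iw.A.a_closed)
qed

text \<open>The annihilator of the generator of W, phrased without the action on W: quantifying over
  the left factor a makes it a left ideal by construction.\<close>

definition "LL = {p. \<forall>a. we (ucl D (a * p)) = \<zero>\<^bsub>W\<^esub>}"

lemma LL_props:
  "x \<in> LL \<Longrightarrow> y \<in> LL \<Longrightarrow> x + y \<in> LL" "x \<in> LL \<Longrightarrow> a * x \<in> LL" "rel_ideal D \<subseteq> LL"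
  "gen (QK j) - const (cv j * cx j) \<in> LL"
proof -
  show "x \<in> LL \<Longrightarrow> y \<in> LL \<Longrightarrow> x + y \<in> LL" by (simp add: LL_def distrib_left ucl_add we_add)
  show "x \<in> LL \<Longrightarrow> a * x \<in> LL" by (simp add: LL_def mult.assoc[symmetric])
  show "rel_ideal D \<subseteq> LL"
  proof
    fix x assume "x \<in> rel_ideal D"
    then have "ucl D (a * x) = \<zero>\<^bsub>Uq D\<^esub>" for a
      unfolding ucl_eq_zero by (rule two_sidedD(3)[OF two_sided_rel_ideal])
    then show "x \<in> LL" by (simp only: LL_def we_zero mem_Collect_eq) simp
  qed
  have "we (ucl D (a * gen (QK j))) = we (ucl D (a * const (cv j * cx j)))" for a
  proof -
    have "ucl D (gen (QK j)) \<odot>\<^bsub>T\<^esub> ct.pure v \<xi> = ucl D (const (cv j * cx j)) \<odot>\<^bsub>T\<^esub> ct.pure v \<xi>"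
    proof -
      have "ucl D (gen (QK j)) \<odot>\<^bsub>T\<^esub> ct.pure v \<xi> = ct.pure (M.mact (const (cv j)) v) (N.mact (const (cx j)) \<xi>)"
        using v xi by (simp add: T_gen_pure Kv Kx)
      also have "\<dots> = ct.pure (M.mact (const (cx j * cv j)) v) \<xi>"
        using v xi M.mact_simps(2)[of "const (cx j)" "const (cv j)" v]
        by (simp add: pure_const_right cst.sc_mult)
      finally show ?thesis using v xi T_gen_pure(5)[OF v xi, unfolded scal_def[symmetric]]
        by (simp add: scal_def[symmetric] mult.commute)
    qed
    then show ?thesis unfolding ucl_mult we_def
      using vx by (simp add: pure_balance[symmetric])
  qed
  then have "we (ucl D (a * gen (QK j))) \<oplus>\<^bsub>W\<^esub> we (ucl D (a * (- const (cv j * cx j)))) = \<zero>\<^bsub>W\<^esub>" for a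
    by (simp add: we_add[symmetric] ucl_add[symmetric] we_zero ucl_zero)
  then show "gen (QK j) - const (cv j * cx j) \<in> LL"
    by (simp add: LL_def right_diff_distrib we_add[symmetric] ucl_add[symmetric])
qed

end

subsection \<open>Root strings of a simple Lie algebra\<close>

locale lie_setup =
  fixes D :: "('g::ab_group_add, 'i::finite) qflag"
  assumes simple: "simple_lie_algebra (sc D) (br D)"
    and cartan: "cartan_subalgebra (sc D) (br D) (csa D)"
    and sroots: "simple_roots D"
    and nform: "normalized_form D"
begin

abbreviation "scl \<equiv> sc D"
abbreviation "brk \<equiv> br D"
abbreviation "H \<equiv> csa D"
abbreviation "RS \<equiv> root_space D"
abbreviation "\<alpha> \<equiv> simp_root D"

lemma vs: "vector_space scl"
  using simple by (simp add: simple_lie_algebra_def lie_algebra_def)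

sublocale V: vector_space scl
  by (rule vs)

lemma br_simps:
  "brk (x + y) z = brk x z + brk y z" "brk x (y + z) = brk x y + brk x z"
  "brk (scl c x) y = scl c (brk x y)" "brk x (scl c y) = scl c (brk x y)" "brk x x = 0"
  using simple by (simp_all add: simple_lie_algebra_def lie_algebra_def)

lemma br_zero [simp]: "brk 0 x = 0" "brk x 0 = 0"
  using br_simps(1)[of 0 0 x] br_simps(2)[of x 0 0] by simp_all

lemma br_minus: "brk (- x) y = - brk x y" "brk x (- y) = - brk x y"
  using br_simps(1)[of x "- x" y] br_simps(2)[of x y "- y"]
  by (simp_all add: eq_neg_iff_add_eq_0 add.commute)

lemma br_diff: "brk (x - y) z = brk x z - brk y z" "brk x (y - z) = brk x y - brk x z"
  using br_simps(1)[of x "- y" z] br_simps(2)[of x y "- z"] by (simp_all add: br_minus)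

lemma br_anti: "brk x y = - brk y x"
proof -
  have "brk (x + y) (x + y) = brk x y + brk y x" unfolding br_simps(1,2) by (simp add: br_simps(5))
  then show ?thesis unfolding br_simps(5) by (simp add: eq_neg_iff_add_eq_0)
qed

lemma jacobi: "brk x (brk y z) = brk (brk x y) z + brk y (brk x z)"
proof -
  have "brk x (brk y z) + brk y (brk z x) + brk z (brk x y) = 0"
    using simple by (simp add: simple_lie_algebra_def lie_algebra_def)
  moreover have "brk y (brk z x) = - brk y (brk x z)" using br_anti[of z x] by (simp add: br_minus)
  moreover have "brk z (brk x y) = - brk (brk x y) z" by (rule br_anti)
  ultimately show ?thesis by (simp add: algebra_simps)
qed

lemma br_sum: "brk x (sum f J) = (\<Sum>k\<in>J. brk x (f k))"
  by (induction J rule: infinite_finite_induct) (simp_all add: br_simps)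

lemma H_props: "V.subspace H" "x \<in> H \<Longrightarrow> y \<in> H \<Longrightarrow> brk x y = 0"
  "(\<And>y. y \<in> H \<Longrightarrow> brk y x = 0) \<Longrightarrow> x \<in> H"
  "y \<in> H \<Longrightarrow> V.span {x. \<exists>c. brk y x = scl c x} = UNIV"
  using cartan unfolding cartan_subalgebra_def by blast+

section \<open>Traces and the Killing form\<close>

definition lie_basis :: "'g set" where "lie_basis = V.extend_basis {}"

lemma lie_basis: "V.independent lie_basis" "V.span lie_basis = UNIV" "finite lie_basis"
proof -
  have i: "V.independent {}" by (rule V.independent_empty)
  show 1: "V.independent lie_basis" "V.span lie_basis = UNIV"
    unfolding lie_basis_def using V.independent_extend_basis[OF i] V.span_extend_basis[OF i] by auto
  obtain B where "finite B" "V.span B = UNIV" using simple by (auto simp: simple_lie_algebra_def)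
  then show "finite lie_basis" using V.independent_span_bound[of B lie_basis] 1 by auto
qed

definition coord :: "'g \<Rightarrow> 'g \<Rightarrow> complex" where "coord x b = V.representation lie_basis x b"

lemma coord_add: "coord (x + y) b = coord x b + coord y b" and coord_scale: "coord (scl c x) b = c * coord x b"
  unfolding coord_def using V.representation_add[OF lie_basis(1)] V.representation_scale[OF lie_basis(1)] lie_basis(2) by auto

lemma coord_sum: "coord (sum f J) b = (\<Sum>k\<in>J. coord (f k) b)"
  using coord_scale[of 0 0 b] by (induction J rule: infinite_finite_induct) (simp_all add: coord_add)

lemma coord_expand: "x = (\<Sum>b\<in>lie_basis. scl (coord x b) b)"
  unfolding coord_def using V.sum_representation_eq[OF lie_basis(1), of x lie_basis] lie_basis by auto

definition lin :: "('g \<Rightarrow> 'g) \<Rightarrow> bool" where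
  "lin f \<longleftrightarrow> (\<forall>x y. f (x + y) = f x + f y) \<and> (\<forall>c x. f (scl c x) = scl c (f x))"

lemma lin_sum: "lin f \<Longrightarrow> f (\<Sum>b\<in>J. scl (c b) (g b)) = (\<Sum>b\<in>J. scl (c b) (f (g b)))"
proof -
  assume f: "lin f"
  have z: "f 0 = 0" using f unfolding lin_def by (metis V.scale_zero_left)
  show ?thesis using f by (induction J rule: infinite_finite_induct) (simp_all add: z lin_def)
qed

lemma lin_br: "lin (brk x)"
  by (simp add: lin_def br_simps)

lemma lin_comp: "lin f \<Longrightarrow> lin g \<Longrightarrow> lin (\<lambda>x. f (g x))"
  by (simp add: lin_def)

abbreviation "tr \<equiv> lin_trace scl"

lemma tr_alt: "tr f = (\<Sum>b\<in>lie_basis. coord (f b) b)"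
  by (simp add: lin_trace_def Let_def lie_basis_def coord_def)

lemma tr_comm: assumes "lin f" "lin g" shows "tr (\<lambda>x. f (g x)) = tr (\<lambda>x. g (f x))"
proof -
  have m: "coord (f (g b)) b = (\<Sum>c\<in>lie_basis. coord (g b) c * coord (f c) b)" if "lin f" for f g b
    using lin_sum[OF that, of "coord (g b)" "\<lambda>x. x" lie_basis] coord_expand[of "g b"] by (simp add: coord_sum coord_scale)
  have "tr (\<lambda>x. f (g x)) = (\<Sum>b\<in>lie_basis. \<Sum>c\<in>lie_basis. coord (g b) c * coord (f c) b)" by (simp add: tr_alt m[OF assms(1)])
  also have "\<dots> = (\<Sum>c\<in>lie_basis. \<Sum>b\<in>lie_basis. coord (g b) c * coord (f c) b)" by (rule sum.swap)
  also have "\<dots> = tr (\<lambda>x. g (f x))" by (simp add: tr_alt m[OF assms(2)] mult.commute)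
  finally show ?thesis .
qed

lemma tr_add: "tr (\<lambda>x. f x + g x) = tr f + tr g"
  by (simp add: tr_alt coord_add sum.distrib)

lemma tr_scale: "tr (\<lambda>x. scl c (f x)) = c * tr f"
  by (simp add: tr_alt coord_scale sum_distrib_left)

abbreviation "\<kappa> \<equiv> killing scl brk"

lemma kil: "\<kappa> x y = tr (\<lambda>z. brk x (brk y z))"
  by (simp add: killing_def)

lemma kil_sym: "\<kappa> x y = \<kappa> y x"
  unfolding kil by (rule tr_comm) (rule lin_br)+

lemma kil_add: "\<kappa> (x + y) z = \<kappa> x z + \<kappa> y z" "\<kappa> z (x + y) = \<kappa> z x + \<kappa> z y"
  by (simp_all add: kil br_simps tr_add)

lemma kil_scale: "\<kappa> (scl c x) z = c * \<kappa> x z" "\<kappa> z (scl c x) = c * \<kappa> z x"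
  by (simp_all add: kil br_simps tr_scale)

lemma kil_zero [simp]: "\<kappa> 0 z = 0" "\<kappa> z 0 = 0"
  using kil_scale(1)[of 0 0 z] kil_scale(2)[of z 0 0] by simp_all

lemma kil_minus: "\<kappa> (- x) z = - \<kappa> x z" "\<kappa> z (- x) = - \<kappa> z x"
  using kil_add(1)[of x "- x" z] kil_add(2)[of z x "- x"] by (simp_all add: eq_neg_iff_add_eq_0 add.commute)

lemma kil_inv: "\<kappa> (brk x y) z = \<kappa> x (brk y z)"
proof -
  have 1: "brk (brk x y) w = brk x (brk y w) + scl (- 1) (brk y (brk x w))" for x y w
    using jacobi[of x y w] by simp
  have "\<kappa> (brk x y) z = tr (\<lambda>w. brk x (brk y (brk z w))) + (- 1) * tr (\<lambda>w. brk y (brk x (brk z w)))"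
    unfolding kil 1 tr_add tr_scale ..
  also have "tr (\<lambda>w. brk y (brk x (brk z w))) = tr (\<lambda>w. brk x (brk z (brk y w)))"
    by (rule tr_comm[OF lin_br lin_comp[OF lin_br lin_br]])
  also have "tr (\<lambda>w. brk x (brk y (brk z w))) + (- 1) * tr (\<lambda>w. brk x (brk z (brk y w))) = \<kappa> x (brk y z)"
    unfolding kil 1 br_simps(2,4) tr_add tr_scale ..
  finally show ?thesis .
qed

section \<open>Simultaneous eigenspaces and the root decomposition\<close>

lemma eigen_indep:
  assumes f: "lin f" and "finite \<Lambda>" "\<And>l. l \<in> \<Lambda> \<Longrightarrow> f (z l) = scl l (z l)" "(\<Sum>l\<in>\<Lambda>. z l) = 0" "l \<in> \<Lambda>"
  shows "z l = 0"
  using assms(2-)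
proof (induction \<Lambda> arbitrary: z l rule: finite_induct)
  case (insert a L)
  have "f (\<Sum>l\<in>insert a L. z l) = (\<Sum>l\<in>insert a L. scl l (z l))"
    using lin_sum[OF f, of "\<lambda>_. 1" z "insert a L"] insert.prems(1) by simp
  moreover have "f 0 = 0" using f unfolding lin_def by (metis V.scale_zero_left)
  ultimately have "(\<Sum>l\<in>insert a L. scl l (z l)) - scl a (\<Sum>l\<in>insert a L. z l) = 0"
    using insert.prems(2) by simp
  then have "(\<Sum>l\<in>L. scl (l - a) (z l)) = 0"
    using insert.hyps by (simp add: V.scale_sum_right V.scale_left_diff_distrib sum_subtractf V.scale_right_distrib)
  from insert.IH[of "\<lambda>l. scl (l - a) (z l)", OF _ this] have z: "scl (l - a) (z l) = 0" if "l \<in> L" for l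
    using f insert.prems(1) that by (simp add: lin_def mult.commute)
  have zL: "z l = 0" if "l \<in> L" for l using z[OF that] that insert.hyps by auto
  then have "z a = 0" using insert.prems(2) insert.hyps by simp
  then show ?case using zL insert.prems(3) by auto
qed simp

lemma eigen_decomp:
  assumes f: "lin f" and x: "x \<in> V.span {z. \<exists>c. f z = scl c z}"
  shows "\<exists>\<Lambda> z. finite \<Lambda> \<and> (\<forall>l\<in>\<Lambda>. f (z l) = scl l (z l)) \<and> x = (\<Sum>l\<in>\<Lambda>. z l)"
  using x
proof (induction rule: V.span_induct_alt)
  case base
  show ?case by (rule exI[of _ "{}"]) simp
next
  case (step c x y)
  obtain d where d: "f x = scl d x" using step by auto
  obtain L z where L: "finite L" "\<forall>l\<in>L. f (z l) = scl l (z l)" "y = (\<Sum>l\<in>L. z l)" using step by auto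
  define z' where "z' = (\<lambda>l. (if l \<in> L then z l else 0) + (if l = d then scl c x else 0))"
  have f0: "f 0 = 0" using f unfolding lin_def by (metis V.scale_zero_left)
  have fx: "f (scl c x) = scl d (scl c x)" using f d by (simp add: lin_def mult.commute)
  have "f (z' l) = scl l (z' l)" for l
    using L(2) fx f f0 by (auto simp: z'_def lin_def V.scale_right_distrib)
  moreover have "(\<Sum>l\<in>insert d L. z' l) = scl c x + y"
  proof -
    have "(\<Sum>l\<in>insert d L. z' l) = (\<Sum>l\<in>insert d L. if l \<in> L then z l else 0) + (\<Sum>l\<in>insert d L. if l = d then scl c x else 0)"
      unfolding z'_def by (rule sum.distrib)
    also have "(\<Sum>l\<in>insert d L. if l \<in> L then z l else 0) = (\<Sum>l\<in>L. z l)"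
      by (rule sum.mono_neutral_cong_right) (use L in auto)
    also have "(\<Sum>l\<in>insert d L. if l = d then scl c x else 0) = scl c x"
      using L(1) by (simp add: sum.delta)
    finally show ?thesis by (simp add: L(3) add.commute)
  qed
  ultimately show ?case using L(1) by (intro exI[of _ "insert d L"] exI[of _ z']) auto
qed

text \<open>Each element of H is diagonalizable on its own. Splitting a joint eigenvector of Y into
  eigenvectors of y keeps the pieces joint eigenvectors: the commuting operators preserve the
  eigenspaces of y, and components for different eigenvalues are independent.\<close>

lemma joint_eigen:
  assumes "finite Y" "Y \<subseteq> H"
  shows "V.span {x. \<forall>y\<in>Y. \<exists>c. brk y x = scl c x} = UNIV"
  using assms
proof (induction Y rule: finite_induct)
  case empty
  show ?case by simp
next
  case (insert y Y)
  let ?E = "\<lambda>Y. {x. \<forall>y\<in>Y. \<exists>c. brk y x = scl c x}"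
  have "?E Y \<subseteq> V.span (?E (insert y Y))"
  proof
    fix x assume "x \<in> ?E Y"
    then obtain c where c: "\<And>y'. y' \<in> Y \<Longrightarrow> brk y' x = scl (c y') x" by (auto simp: bchoice_iff)
    obtain L z where L: "finite L" "\<forall>l\<in>L. brk y (z l) = scl l (z l)" "x = (\<Sum>l\<in>L. z l)"
      using eigen_decomp[OF lin_br, of x y] H_props(4)[of y] insert.prems by auto
    have "brk y' (z l) - scl (c y') (z l) = 0" if y': "y' \<in> Y" and l: "l \<in> L" for y' l
    proof (rule eigen_indep[OF lin_br[of y] L(1) _ _ l, where z = "\<lambda>l. brk y' (z l) - scl (c y') (z l)"])
      fix l assume l: "l \<in> L"
      have "brk y (brk y' (z l)) = brk y' (brk y (z l))"
        using jacobi[of y y' "z l"] H_props(2)[of y y'] insert.prems y' by auto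
      then show "brk y (brk y' (z l) - scl (c y') (z l)) = scl l (brk y' (z l) - scl (c y') (z l))"
        using L(2) l by (simp add: br_simps br_diff V.scale_right_diff_distrib mult.commute)
    next
      show "(\<Sum>l\<in>L. brk y' (z l) - scl (c y') (z l)) = 0"
        using c[OF y'] L(3) by (simp add: sum_subtractf br_sum[symmetric] V.scale_sum_right[symmetric])
    qed
    then have "z l \<in> ?E (insert y Y)" if "l \<in> L" for l using L(2) that by auto
    then show "x \<in> V.span (?E (insert y Y))" unfolding L(3) by (intro V.span_sum V.span_base)
  qed
  then have "V.span (?E Y) \<subseteq> V.span (?E (insert y Y))" by (rule V.span_minimal) simp
  then show ?case using insert by auto
qed

abbreviation "R \<equiv> roots D"
abbreviation "hs \<equiv> hstar D"

lemma RS_iff: "x \<in> RS \<mu> \<longleftrightarrow> (\<forall>y\<in>H. brk y x = scl (\<mu> y) x)"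
  by (simp add: root_space_def)

lemma RS_zero: "RS (\<lambda>_. 0) = H"
  using H_props(2,3) by (auto simp: RS_iff)

lemma RS_sub: "0 \<in> RS \<mu>" "x \<in> RS \<mu> \<Longrightarrow> y \<in> RS \<mu> \<Longrightarrow> x + y \<in> RS \<mu>" "x \<in> RS \<mu> \<Longrightarrow> scl c x \<in> RS \<mu>"
  by (simp_all add: RS_iff br_simps V.scale_right_distrib mult.commute)

lemma RS_br: "x \<in> RS \<mu> \<Longrightarrow> y \<in> RS \<nu> \<Longrightarrow> brk x y \<in> RS (\<lambda>h. \<mu> h + \<nu> h)"
proof -
  assume "x \<in> RS \<mu>" "y \<in> RS \<nu>"
  then have "brk h (brk x y) = scl (\<mu> h + \<nu> h) (brk x y)" if "h \<in> H" for h
    using that jacobi[of h x y] by (simp add: RS_iff br_simps V.scale_left_distrib)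
  then show ?thesis by (simp add: RS_iff)
qed

lemma hs_iff: "\<mu> \<in> hs \<longleftrightarrow> (\<forall>x\<in>H. \<forall>y\<in>H. \<mu> (x + y) = \<mu> x + \<mu> y) \<and>
     (\<forall>c. \<forall>x\<in>H. \<mu> (scl c x) = c * \<mu> x) \<and> (\<forall>x. x \<notin> H \<longrightarrow> \<mu> x = 0)"
  by (simp add: hstar_def)

lemma hs_lin: "\<mu> \<in> hs \<Longrightarrow> \<nu> \<in> hs \<Longrightarrow> (\<lambda>x. \<mu> x + \<nu> x) \<in> hs" "\<mu> \<in> hs \<Longrightarrow> (\<lambda>x. c * \<mu> x) \<in> hs"
  "\<mu> \<in> hs \<Longrightarrow> (\<lambda>x. - \<mu> x) \<in> hs" "\<mu> \<in> hs \<Longrightarrow> \<nu> \<in> hs \<Longrightarrow> (\<lambda>x. \<mu> x - \<nu> x) \<in> hs" "(\<lambda>_. 0) \<in> hs"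
  by (simp_all add: hs_iff algebra_simps)

lemma hs_ext: "\<mu> \<in> hs \<Longrightarrow> \<nu> \<in> hs \<Longrightarrow> (\<And>h. h \<in> H \<Longrightarrow> \<mu> h = \<nu> h) \<Longrightarrow> \<mu> = \<nu>"
  unfolding hs_iff fun_eq_iff by metis

lemma R_iff: "\<beta> \<in> R \<longleftrightarrow> \<beta> \<in> hs \<and> \<beta> \<noteq> (\<lambda>_. 0) \<and> (\<exists>x\<in>RS \<beta>. x \<noteq> 0)"
  using RS_sub(1) by (auto simp: roots_def)

text \<open>A joint eigenvector of a basis of H is one for all of H; its eigenvalues depend linearly
  on the element of H and form a weight, which is zero or a root.\<close>

lemma weight_decomp: "V.span (\<Union>\<mu>\<in>insert (\<lambda>_. 0) R. RS \<mu>) = UNIV"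
proof -
  obtain Y where Y: "Y \<subseteq> H" "V.independent Y" "V.span Y = H"
    using V.maximal_independent_subset[of H] V.span_minimal[OF _ H_props(1)] by (metis subset_antisym)
  have fY: "finite Y" using V.independent_span_bound[OF lie_basis(3) Y(2)] lie_basis(2) by auto
  have "{x. \<forall>y\<in>Y. \<exists>c. brk y x = scl c x} \<subseteq> (\<Union>\<mu>\<in>insert (\<lambda>_. 0) R. RS \<mu>)"
  proof
    fix x assume x: "x \<in> {x. \<forall>y\<in>Y. \<exists>c. brk y x = scl c x}"
    show "x \<in> (\<Union>\<mu>\<in>insert (\<lambda>_. 0) R. RS \<mu>)"
    proof (cases "x = 0")
      case True then show ?thesis using RS_sub(1) by auto
    next
      case False
      have "\<exists>c. brk y x = scl c x" if "y \<in> V.span Y" for y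
        using that
      proof (induction rule: V.span_induct_alt)
        case base show ?case by (rule exI[of _ 0]) simp
      next
        case (step a y w)
        then obtain d where d: "brk w x = scl d x" by blast
        obtain c where "brk y x = scl c x" using x step(1) by blast
        with d show ?case by (intro exI[of _ "a * c + d"]) (simp add: br_simps V.scale_left_distrib)
      qed
      then obtain c where c: "\<And>y. y \<in> H \<Longrightarrow> brk y x = scl (c y) x" unfolding Y(3) by metis
      \<comment> \<open>Zero off H, as in the encoding of \<open>hstar\<close>.\<close>
      define \<mu> where "\<mu> = (\<lambda>y. if y \<in> H then c y else 0)"
      have cl: "y + w \<in> H" "scl a y \<in> H" if "y \<in> H" "w \<in> H" for y w a
        using that H_props(1) by (auto simp: V.subspace_def)
      have "\<mu> \<in> hs" unfolding hs_iff
      proof (intro conjI ballI allI impI)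
        fix y w assume yw: "y \<in> H" "w \<in> H"
        have "scl (c (y + w)) x = scl (c y + c w) x"
          using c[of "y + w"] c[of y] c[of w] yw cl by (simp add: br_simps V.scale_left_distrib)
        then show "\<mu> (y + w) = \<mu> y + \<mu> w" using False yw cl by (simp add: \<mu>_def)
      next
        fix a y assume y: "y \<in> H"
        have "scl (c (scl a y)) x = scl (a * c y) x"
          unfolding c[OF cl(2)[OF y y], symmetric] br_simps(3) c[OF y] by simp
        then have "c (scl a y) = a * c y" using False by simp
        then show "\<mu> (scl a y) = a * \<mu> y" using y cl(2)[OF y y] by (simp add: \<mu>_def)
      qed (simp add: \<mu>_def)
      moreover have "x \<in> RS \<mu>" using c by (simp add: RS_iff \<mu>_def)
      ultimately have "\<mu> \<in> insert (\<lambda>_. 0) R" using False by (auto simp: R_iff)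
      then show ?thesis using \<open>x \<in> RS \<mu>\<close> by blast
    qed
  qed
  then have "V.span {x. \<forall>y\<in>Y. \<exists>c. brk y x = scl c x} \<subseteq> V.span (\<Union>\<mu>\<in>insert (\<lambda>_. 0) R. RS \<mu>)"
    by (rule V.span_mono)
  then show ?thesis using joint_eigen[OF fY Y(1)] by auto
qed

lemma weight_indep:
  assumes "finite F" "F \<subseteq> hs" "\<And>\<mu>. \<mu> \<in> F \<Longrightarrow> x \<mu> \<in> RS \<mu>" "(\<Sum>\<mu>\<in>F. x \<mu>) = 0" "\<mu> \<in> F"
  shows "x \<mu> = 0"
  using assms
proof (induction F arbitrary: x \<mu> rule: finite_induct)
  case (insert \<gamma> F)
  have xF: "x \<mu> = 0" if m: "\<mu> \<in> F" for \<mu>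
  proof -
    have "\<mu> \<noteq> \<gamma>" using m insert.hyps by auto
    then obtain h where h: "h \<in> H" "\<mu> h \<noteq> \<gamma> h" using hs_ext[of \<mu> \<gamma>] insert.prems(1) m by auto
    have "0 = brk h (\<Sum>\<mu>\<in>insert \<gamma> F. x \<mu>) - scl (\<gamma> h) (\<Sum>\<mu>\<in>insert \<gamma> F. x \<mu>)" using insert.prems(3) by simp
    also have "brk h (\<Sum>\<mu>\<in>insert \<gamma> F. x \<mu>) = (\<Sum>\<mu>\<in>insert \<gamma> F. scl (\<mu> h) (x \<mu>))"
      unfolding br_sum by (rule sum.cong) (use insert.prems(2) h in \<open>auto simp: RS_iff\<close>)
    also have "(\<Sum>\<mu>\<in>insert \<gamma> F. scl (\<mu> h) (x \<mu>)) - scl (\<gamma> h) (\<Sum>\<mu>\<in>insert \<gamma> F. x \<mu>) = (\<Sum>\<mu>\<in>F. scl (\<mu> h - \<gamma> h) (x \<mu>))"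
      using insert.hyps by (simp add: V.scale_sum_right V.scale_left_diff_distrib sum_subtractf V.scale_right_distrib)
    finally have "(\<Sum>\<mu>\<in>F. scl (\<mu> h - \<gamma> h) (x \<mu>)) = 0" by simp
    from insert.IH[of "\<lambda>\<mu>. scl (\<mu> h - \<gamma> h) (x \<mu>)", OF _ _ this m] have "scl (\<mu> h - \<gamma> h) (x \<mu>) = 0"
      using insert.prems by (auto intro: RS_sub)
    then show ?thesis using h by simp
  qed
  then have "x \<gamma> = 0" using insert.prems(3) insert.hyps by simp
  then show ?case using xF insert.prems(4) by auto
qed simp

text \<open>Nonzero vectors of different weights are linearly independent, so their number is at
  most the dimension.\<close>

lemma finite_weights:
  assumes "\<And>\<mu>. \<mu> \<in> X \<Longrightarrow> \<mu> \<in> hs \<and> (\<exists>x\<in>RS \<mu>. x \<noteq> 0)"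
  shows "finite X"
proof (rule finite_if_finite_subsets_card_bdd[THEN conjunct1])
  fix F assume F: "F \<subseteq> X" "finite F"
  obtain x where x: "\<And>\<mu>. \<mu> \<in> F \<Longrightarrow> x \<mu> \<in> RS \<mu> \<and> x \<mu> \<noteq> 0" using assms F by (metis subsetD)
  have inj: "inj_on x F"
  proof (rule inj_onI)
    fix \<mu> \<nu> assume a: "\<mu> \<in> F" "\<nu> \<in> F" "x \<mu> = x \<nu>"
    show "\<mu> = \<nu>"
    proof (rule hs_ext)
      fix h assume "h \<in> H"
      then have "scl (\<mu> h) (x \<mu>) = scl (\<nu> h) (x \<mu>)" using x[OF a(1)] x[OF a(2)] a(3) by (auto simp: RS_iff)
      then show "\<mu> h = \<nu> h" using x[OF a(1)] by simp
    qed (use assms F a in auto)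
  qed
  have "V.independent (x ` F)"
  proof (rule V.independent_if_scalars_zero)
    fix f y assume s: "(\<Sum>y\<in>x ` F. scl (f y) y) = 0" and "y \<in> x ` F"
    then obtain \<mu> where m: "\<mu> \<in> F" "y = x \<mu>" by auto
    have "(\<Sum>\<mu>\<in>F. scl (f (x \<mu>)) (x \<mu>)) = 0" using s by (simp add: sum.reindex[OF inj])
    from weight_indep[OF F(2) _ _ this m(1)] have "scl (f (x \<mu>)) (x \<mu>) = 0"
      using x assms F by (auto intro: RS_sub)
    then show "f y = 0" using x m by auto
  qed (use F in auto)
  then have "card (x ` F) \<le> card lie_basis" using V.independent_span_bound[OF lie_basis(3)] lie_basis(2) by auto
  then show "card F \<le> card lie_basis" using card_image[OF inj] by simp
qed

lemma finite_R: "finite R"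
  by (rule finite_weights) (auto simp: R_iff)

section \<open>Nondegeneracy of the Killing form and dual root vectors\<close>

lemma ideal_trivial: "V.subspace N \<Longrightarrow> (\<And>x y. y \<in> N \<Longrightarrow> brk x y \<in> N) \<Longrightarrow> N = {0} \<or> N = UNIV"
  using simple unfolding simple_lie_algebra_def by blast

text \<open>Fixes a witness of \<open>normalized_form\<close>: the scaling factor \<open>kk\<close>
  and the vectors \<open>t \<mu>\<close> that represent functionals through the Killing
  form.\<close>

definition kt :: "real \<times> ('g wt \<Rightarrow> 'g)" where
  "kt = (SOME (k, u). k > 0 \<and>
        (\<forall>\<mu>\<in>hs. u \<mu> \<in> H \<and> (\<forall>x\<in>H. \<kappa> (u \<mu>) x = \<mu> x)) \<and>
        (\<forall>\<mu>\<in>hs. \<forall>\<nu>\<in>hs. frm D \<mu> \<nu> = complex_of_real k * \<kappa> (u \<mu>) (u \<nu>)))"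

abbreviation "kk \<equiv> fst kt"
abbreviation "t \<equiv> snd kt"

lemma t_props: "kk > 0" "\<mu> \<in> hs \<Longrightarrow> t \<mu> \<in> H" "\<mu> \<in> hs \<Longrightarrow> x \<in> H \<Longrightarrow> \<kappa> (t \<mu>) x = \<mu> x"
  "\<mu> \<in> hs \<Longrightarrow> \<nu> \<in> hs \<Longrightarrow> frm D \<mu> \<nu> = complex_of_real kk * \<mu> (t \<nu>)"
proof -
  have "\<exists>p. case p of (k, u) \<Rightarrow> k > 0 \<and>
        (\<forall>\<mu>\<in>hs. u \<mu> \<in> H \<and> (\<forall>x\<in>H. \<kappa> (u \<mu>) x = \<mu> x)) \<and>
        (\<forall>\<mu>\<in>hs. \<forall>\<nu>\<in>hs. frm D \<mu> \<nu> = complex_of_real k * \<kappa> (u \<mu>) (u \<nu>))"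
    using nform unfolding normalized_form_def by auto
  from someI_ex[OF this] have a: "kk > 0 \<and>
        (\<forall>\<mu>\<in>hs. t \<mu> \<in> H \<and> (\<forall>x\<in>H. \<kappa> (t \<mu>) x = \<mu> x)) \<and>
        (\<forall>\<mu>\<in>hs. \<forall>\<nu>\<in>hs. frm D \<mu> \<nu> = complex_of_real kk * \<kappa> (t \<mu>) (t \<nu>))"
    unfolding kt_def[symmetric] by (simp add: case_prod_beta)
  then show "kk > 0" "\<mu> \<in> hs \<Longrightarrow> t \<mu> \<in> H" "\<mu> \<in> hs \<Longrightarrow> x \<in> H \<Longrightarrow> \<kappa> (t \<mu>) x = \<mu> x"
    "\<mu> \<in> hs \<Longrightarrow> \<nu> \<in> hs \<Longrightarrow> frm D \<mu> \<nu> = complex_of_real kk * \<mu> (t \<nu>)"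
    by auto
qed

lemma simple_R: "\<alpha> i \<in> R"
  using sroots unfolding simple_roots_def by blast

text \<open>The Killing form is nondegenerate because its radical is an ideal and, by the normalization
  of the form on the dual of the Cartan subalgebra, it does not vanish identically.\<close>

lemma kil_nondeg: assumes "\<And>y. \<kappa> x y = 0" shows "x = 0"
proof -
  define N where "N = {x. \<forall>y. \<kappa> x y = 0}"
  have "N = {0} \<or> N = UNIV"
  proof (rule ideal_trivial)
    show "V.subspace N" by (auto simp: V.subspace_def N_def kil_add kil_scale)
    show "brk x y \<in> N" if "y \<in> N" for x y
    proof -
      have "\<kappa> (brk x y) z = - \<kappa> y (brk x z)" for z
        using br_anti[of x y] by (simp add: kil_minus kil_inv)
      then show ?thesis using that by (simp add: N_def)
    qed
  qed
  moreover have "N \<noteq> UNIV"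
  proof
    assume N: "N = UNIV"
    have a: "\<alpha> undefined \<in> hs" "\<alpha> undefined \<noteq> (\<lambda>_. 0)" using simple_R R_iff by auto
    then obtain h where "h \<in> H" "\<alpha> undefined h \<noteq> 0" using hs_ext[OF a(1) hs_lin(5)] by auto
    moreover have "t (\<alpha> undefined) \<in> N" using N by simp
    then have "\<kappa> (t (\<alpha> undefined)) h = 0" by (simp add: N_def)
    ultimately show False using t_props(3)[OF a(1), of h] by simp
  qed
  ultimately show ?thesis using assms by (auto simp: N_def)
qed

lemma kil_orth: "x \<in> RS \<mu> \<Longrightarrow> y \<in> RS \<nu> \<Longrightarrow> h \<in> H \<Longrightarrow> \<mu> h + \<nu> h \<noteq> 0 \<Longrightarrow> \<kappa> x y = 0"
proof -
  assume a: "x \<in> RS \<mu>" "y \<in> RS \<nu>" "h \<in> H" "\<mu> h + \<nu> h \<noteq> 0"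
  have "\<mu> h * \<kappa> x y = \<kappa> (brk h x) y" using a by (simp add: RS_iff kil_scale)
  also have "\<dots> = - \<kappa> x (brk h y)" using br_anti[of h x] by (simp add: kil_minus kil_inv)
  also have "\<dots> = - (\<nu> h * \<kappa> x y)" using a by (simp add: RS_iff kil_scale)
  finally have "(\<mu> h + \<nu> h) * \<kappa> x y = 0" by (simp add: algebra_simps)
  then show ?thesis using a by simp
qed

lemma span_zero: assumes "\<And>\<mu> y. \<mu> \<in> insert (\<lambda>_. 0) R \<Longrightarrow> y \<in> RS \<mu> \<Longrightarrow> \<kappa> x y = 0" shows "x = 0"
proof (rule kil_nondeg)
  fix y
  have "y \<in> V.span (\<Union>\<mu>\<in>insert (\<lambda>_. 0) R. RS \<mu>)" using weight_decomp by simp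
  then show "\<kappa> x y = 0"
    by (induction rule: V.span_induct_alt) (use assms in \<open>auto simp: kil_add kil_scale\<close>)
qed

text \<open>The root spaces of roots are orthogonal to H, so a vector of H that is orthogonal to H
  is orthogonal to everything.\<close>

lemma H_nondeg: assumes "x \<in> H" "\<And>y. y \<in> H \<Longrightarrow> \<kappa> x y = 0" shows "x = 0"
proof (rule span_zero)
  fix \<mu> y assume m: "\<mu> \<in> insert (\<lambda>_. 0) R" and y: "y \<in> RS \<mu>"
  show "\<kappa> x y = 0"
  proof (cases "\<mu> = (\<lambda>_. 0)")
    case True then show ?thesis using assms y RS_zero by auto
  next
    case False
    then have "\<mu> \<in> hs" using m R_iff by auto
    then obtain h where "h \<in> H" "\<mu> h \<noteq> 0" using False hs_ext[OF _ hs_lin(5), of \<mu>] by auto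
    then show ?thesis using kil_orth[of x "\<lambda>_. 0" y \<mu> h] assms(1) y RS_zero by auto
  qed
qed

text \<open>The Killing form pairs \<open>RS \<beta>\<close> nontrivially only with the weight
  -\<beta>, and e is not in its radical.\<close>

lemma dual_vector:
  assumes b: "\<beta> \<in> R" and e: "e \<in> RS \<beta>" "e \<noteq> 0"
  obtains f where "f \<in> RS (\<lambda>x. - \<beta> x)" "\<kappa> e f = 1"
proof -
  have "\<exists>\<mu>\<in>insert (\<lambda>_. 0) R. \<exists>y\<in>RS \<mu>. \<kappa> e y \<noteq> 0" using span_zero[of e] e by blast
  then obtain \<mu> y where m: "\<mu> \<in> hs" "y \<in> RS \<mu>" "\<kappa> e y \<noteq> 0" using R_iff hs_lin(5) by auto
  have "\<mu> h = - \<beta> h" if "h \<in> H" for h using kil_orth[OF e(1) m(2) that] m(3) by (auto simp: add_eq_0_iff)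
  then have "y \<in> RS (\<lambda>x. - \<beta> x)" using m(2) by (simp add: RS_iff)
  then show thesis using that[of "scl (inverse (\<kappa> e y)) y"] m(3) by (simp add: RS_sub kil_scale)
qed

text \<open>Both sides lie in H and, by invariance, pair in the same way with H, where the Killing
  form is nondegenerate.\<close>

lemma br_dual:
  assumes b: "\<beta> \<in> hs" and e: "e \<in> RS \<beta>" and f: "f \<in> RS (\<lambda>x. - \<beta> x)"
  shows "brk e f = scl (\<kappa> e f) (t \<beta>)"
proof -
  have "brk e f \<in> H" using RS_br[OF e f] RS_zero by simp
  moreover have "scl (- \<kappa> e f) (t \<beta>) \<in> H" by (rule V.subspace_scale[OF H_props(1) t_props(2)[OF b]])
  ultimately have "brk e f + scl (- \<kappa> e f) (t \<beta>) \<in> H" by (rule V.subspace_add[OF H_props(1)])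
  moreover have "\<kappa> (brk e f + scl (- \<kappa> e f) (t \<beta>)) h = 0" if h: "h \<in> H" for h
  proof -
    have "\<kappa> (brk e f) h = \<beta> h * \<kappa> e f"
      using f h br_anti[of f h] by (simp add: kil_inv kil_minus kil_scale RS_iff)
    then show ?thesis using t_props(3)[OF b h] kil_add(1)[of "brk e f" "scl (- \<kappa> e f) (t \<beta>)" h]
        kil_scale(1)[of "- \<kappa> e f" "t \<beta>" h] by simp
  qed
  ultimately have "brk e f + scl (- \<kappa> e f) (t \<beta>) = 0" by (rule H_nondeg)
  then show ?thesis by simp
qed

lemma neg_R: "\<beta> \<in> R \<Longrightarrow> (\<lambda>x. - \<beta> x) \<in> R"
proof -
  assume b: "\<beta> \<in> R"
  obtain e where e: "e \<in> RS \<beta>" "e \<noteq> 0" using b R_iff by auto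
  obtain f where f: "f \<in> RS (\<lambda>x. - \<beta> x)" "\<kappa> e f = 1" by (rule dual_vector[OF b e])
  have "f \<noteq> 0" using f(2) by auto
  moreover have "(\<lambda>x. - \<beta> x) \<noteq> (\<lambda>_. 0)" using b R_iff by (auto simp: fun_eq_iff)
  ultimately show ?thesis using f b hs_lin(3) by (auto simp: R_iff)
qed

section \<open>Root strings from sl2-triples\<close>

abbreviation ladder :: "'g \<Rightarrow> nat \<Rightarrow> 'g \<Rightarrow> 'g" where "ladder f m \<equiv> (brk f ^^ m)"

lemma ladder_RS: "f \<in> RS \<beta> \<Longrightarrow> y \<in> RS \<mu> \<Longrightarrow> ladder f m y \<in> RS (\<lambda>x. \<mu> x + of_nat m * \<beta> x)"
proof (induction m)
  case (Suc m)
  have "brk f (ladder f m y) \<in> RS (\<lambda>x. \<beta> x + (\<mu> x + of_nat m * \<beta> x))"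
    using RS_br[OF Suc.prems(1) Suc.IH[OF Suc.prems]] .
  then show ?case by (simp add: algebra_simps)
qed simp

text \<open>The weights \<mu> + m \<beta> are pairwise distinct, and only finitely many of them can
  have nonzero vectors.\<close>

lemma ladder_nilpotent:
  assumes b: "\<beta> \<in> R" and f: "f \<in> RS \<beta>" and y: "y \<in> RS \<mu>" "\<mu> \<in> hs" "y \<noteq> 0"
  obtains m where "ladder f m y \<noteq> 0" "ladder f (Suc m) y = 0"
proof -
  have bh: "\<beta> \<in> hs" "\<beta> \<noteq> (\<lambda>_. 0)" using b R_iff by auto
  then obtain h where h: "h \<in> H" "\<beta> h \<noteq> 0" using hs_ext[OF bh(1) hs_lin(5)] by auto
  let ?w = "\<lambda>m x. \<mu> x + of_nat m * \<beta> x"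
  have inj: "inj ?w"
  proof (rule injI)
    fix m n :: nat assume "?w m = ?w n"
    from fun_cong[OF this, of h] show "m = n" using h by simp
  qed
  have "\<exists>m. ladder f m y = 0"
  proof (rule ccontr)
    assume n: "\<not> ?thesis"
    have "finite (range ?w)"
    proof (rule finite_weights)
      fix \<nu> assume "\<nu> \<in> range ?w"
      then obtain m where m: "\<nu> = ?w m" by auto
      show "\<nu> \<in> hs \<and> (\<exists>x\<in>RS \<nu>. x \<noteq> 0)"
        unfolding m using hs_lin(1)[OF y(2) hs_lin(2)[OF bh(1)]] ladder_RS[OF f y(1), of m] n by auto
    qed
    then show False using finite_imageD[OF _ inj] by auto
  qed
  then obtain m0 where m0: "ladder f m0 y = 0" "\<And>k. k < m0 \<Longrightarrow> ladder f k y \<noteq> 0"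
    using exists_least_iff[of "\<lambda>m. ladder f m y = 0"] by auto
  then obtain m where "m0 = Suc m" using y(3) by (cases m0) auto
  then show thesis using that[of m] m0 by auto
qed

text \<open>The usual sl2 computation, but for an arbitrary h = [e, f] in H without the
  normalization \<beta>(h) = 2: it is needed with h = t \<beta> before \<beta>(t \<beta>) is known
  to be nonzero.\<close>

lemma ladder_formula:
  assumes f: "f \<in> RS (\<lambda>x. - \<beta> x)" and h: "brk e f = h" "h \<in> H"
    and y: "y \<in> RS \<mu>" "brk e y = 0"
  shows "brk e (ladder f (Suc m) y) = scl (of_nat (Suc m) * \<mu> h - of_nat (m * Suc m) / 2 * \<beta> h) (ladder f m y)"
proof (induction m)
  case 0
  have "brk e (brk f y) = brk h y" using jacobi[of e f y] h y by simp
  then show ?case using y h by (simp add: RS_iff)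
next
  case (Suc m)
  have w: "brk h (ladder f (Suc m) y) = scl (\<mu> h - of_nat (Suc m) * \<beta> h) (ladder f (Suc m) y)"
    using ladder_RS[OF f y(1), of "Suc m"] h(2) by (simp add: RS_iff)
  have "brk e (ladder f (Suc (Suc m)) y) = brk h (ladder f (Suc m) y) + brk f (brk e (ladder f (Suc m) y))"
    using jacobi[of e f "ladder f (Suc m) y"] h(1) by simp
  also have "brk f (brk e (ladder f (Suc m) y)) = scl (of_nat (Suc m) * \<mu> h - of_nat (m * Suc m) / 2 * \<beta> h) (ladder f (Suc m) y)"
    unfolding Suc by (simp add: br_simps)
  finally show ?case unfolding w V.scale_left_distrib[symmetric]
    by (simp add: field_simps)
qed

text \<open>If \<beta>(t \<beta>) = 0, then \<open>ladder_formula\<close> loses its quadratic term,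
  and the end of an f-string forces its top weight to vanish at t \<beta>. So all roots vanish there
  and t \<beta> is central, hence zero in a simple algebra, and then \<beta> = 0.\<close>

lemma length_nonzero:
  assumes b: "\<beta> \<in> R" shows "\<beta> (t \<beta>) \<noteq> 0"
proof
  assume z: "\<beta> (t \<beta>) = 0"
  have bh: "\<beta> \<in> hs" "\<beta> \<noteq> (\<lambda>_. 0)" using b R_iff by auto
  obtain e where e: "e \<in> RS \<beta>" "e \<noteq> 0" using b R_iff by auto
  obtain f where f: "f \<in> RS (\<lambda>x. - \<beta> x)" "\<kappa> e f = 1" by (rule dual_vector[OF b e])
  have ef: "brk e f = t \<beta>" using br_dual[OF bh(1) e(1) f(1)] f(2) by simp
  have tH: "t \<beta> \<in> H" by (rule t_props(2)[OF bh(1)])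
  have g0: "\<gamma> (t \<beta>) = 0" if g: "\<gamma> \<in> R" for \<gamma>
  proof -
    obtain x where x: "x \<in> RS \<gamma>" "x \<noteq> 0" "\<gamma> \<in> hs" using g R_iff by auto
    obtain p where p: "ladder e p x \<noteq> 0" "ladder e (Suc p) x = 0" by (rule ladder_nilpotent[OF b e(1) x(1,3,2)])
    define y where "y = ladder e p x"
    define \<mu> where "\<mu> = (\<lambda>x. \<gamma> x + of_nat p * \<beta> x)"
    have y: "y \<in> RS \<mu>" "brk e y = 0" "y \<noteq> 0" "\<mu> \<in> hs"
      using ladder_RS[OF e(1) x(1), of p] p hs_lin(1)[OF x(3) hs_lin(2)[OF bh(1)]] by (auto simp: y_def \<mu>_def)
    obtain m where m: "ladder f m y \<noteq> 0" "ladder f (Suc m) y = 0"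
      by (rule ladder_nilpotent[OF neg_R[OF b] f(1) y(1,4,3)])
    have "scl (of_nat (Suc m) * \<mu> (t \<beta>)) (ladder f m y) = 0"
      using ladder_formula[OF f(1) ef tH y(1,2), of m] m(2) z by simp
    then have "\<mu> (t \<beta>) = 0" using m(1) by (simp del: of_nat_Suc)
    then show ?thesis using z by (simp add: \<mu>_def)
  qed
  have cen: "brk (t \<beta>) x = 0" for x
  proof -
    have "x \<in> V.span (\<Union>\<mu>\<in>insert (\<lambda>_. 0) R. RS \<mu>)" using weight_decomp by simp
    then show ?thesis
      by (induction rule: V.span_induct_alt) (use g0 tH in \<open>auto simp: br_simps RS_iff\<close>)
  qed
  define N where "N = {x. \<forall>y. brk x y = 0}"
  have "N = {0} \<or> N = UNIV"
  proof (rule ideal_trivial)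
    show "V.subspace N" by (auto simp: V.subspace_def N_def br_simps)
    show "brk x y \<in> N" if "y \<in> N" for x y
      using that br_anti[of x y] by (simp add: N_def)
  qed
  moreover have "N \<noteq> UNIV" using simple by (auto simp: N_def simple_lie_algebra_def)
  ultimately have "t \<beta> = 0" using cen by (auto simp: N_def)
  then have "\<beta> h = 0" if "h \<in> H" for h using t_props(3)[OF bh(1) that] by simp
  then show False using bh hs_ext[OF bh(1) hs_lin(5)] by auto
qed

definition cor :: "'g wt \<Rightarrow> 'g" where "cor \<beta> = scl (2 / \<beta> (t \<beta>)) (t \<beta>)"

lemma cor_H: "\<beta> \<in> R \<Longrightarrow> cor \<beta> \<in> H"
  unfolding cor_def using t_props(2)[of \<beta>] R_iff[of \<beta>] H_props(1) by (auto simp: V.subspace_def)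

lemma pairing: "\<mu> \<in> hs \<Longrightarrow> \<beta> \<in> R \<Longrightarrow> coroot_pairing D \<mu> \<beta> = \<mu> (cor \<beta>)"
  using t_props(1,2,4) length_nonzero[of \<beta>] R_iff[of \<beta>] by (auto simp: coroot_pairing_def cor_def hs_iff)

lemma cor_two: "\<beta> \<in> R \<Longrightarrow> \<beta> (cor \<beta>) = 2"
  using length_nonzero[of \<beta>] t_props(2)[of \<beta>] R_iff[of \<beta>] by (auto simp: cor_def hs_iff)

lemma sl2: assumes b: "\<beta> \<in> R"
  obtains e f where "e \<in> RS \<beta>" "e \<noteq> 0" "f \<in> RS (\<lambda>x. - \<beta> x)" "brk e f = cor \<beta>"
proof -
  have bh: "\<beta> \<in> hs" using b R_iff by auto
  obtain e where e: "e \<in> RS \<beta>" "e \<noteq> 0" using b R_iff by auto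
  obtain f where f: "f \<in> RS (\<lambda>x. - \<beta> x)" "\<kappa> e f = 1" by (rule dual_vector[OF b e])
  have "brk e (scl (2 / \<beta> (t \<beta>)) f) = cor \<beta>" using br_dual[OF bh e(1) f(1)] f(2) by (simp add: br_simps cor_def)
  then show thesis using that[of e "scl (2 / \<beta> (t \<beta>)) f"] e RS_sub(3)[OF f(1)] by simp
qed

text \<open>The last nonzero vector f^m y of the string forces (m+1) (\<mu>(cor \<beta>) - m) =
  0.\<close>

lemma highest_weight:
  assumes b: "\<beta> \<in> R" and f: "f \<in> RS (\<lambda>x. - \<beta> x)" and ef: "brk e f = cor \<beta>"
    and y: "y \<in> RS \<mu>" "\<mu> \<in> hs" "y \<noteq> 0" "brk e y = 0"
  shows "\<exists>m. \<mu> (cor \<beta>) = of_nat m \<and> (\<forall>j\<le>m. ladder f j y \<noteq> 0) \<and>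
    (\<forall>j. brk e (ladder f (Suc j) y) = scl (of_nat (Suc j) * (of_nat m - of_nat j)) (ladder f j y))"
proof -
  obtain m where m: "ladder f m y \<noteq> 0" "ladder f (Suc m) y = 0"
    by (rule ladder_nilpotent[OF neg_R[OF b] f y(1,2,3)])
  have F: "brk e (ladder f (Suc j) y) = scl (of_nat (Suc j) * (\<mu> (cor \<beta>) - of_nat j)) (ladder f j y)" for j
  proof -
    have "of_nat (Suc j) * \<mu> (cor \<beta>) - of_nat (j * Suc j) / 2 * \<beta> (cor \<beta>) = of_nat (Suc j) * (\<mu> (cor \<beta>) - of_nat j)"
      using cor_two[OF b] by (simp add: algebra_simps)
    then show ?thesis using ladder_formula[OF f ef cor_H[OF b] y(1,4), of j] by simp
  qed
  have mm: "\<mu> (cor \<beta>) = of_nat m" using F[of m] m by (simp del: of_nat_Suc)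
  have "ladder f j y \<noteq> 0" if "j \<le> m" for j
  proof
    assume "ladder f j y = 0"
    then have "ladder f (j + k) y = 0" for k
      by (induction k) simp_all
    from this[of "m - j"] show False using that m(1) by simp
  qed
  then show ?thesis using F mm by auto
qed

text \<open>A vector of weight \<gamma> is raised by e as far as possible, which takes p steps, and
  the highest weight vector so obtained is lowered m times by f. The existence of these vectors
  suffices for integrality and for reflections.\<close>

lemma root_string:
  assumes b: "\<beta> \<in> R" and g: "\<gamma> \<in> R"
  obtains p m :: nat where "\<gamma> (cor \<beta>) = of_nat m - 2 * of_nat p"
    "\<And>j. j \<le> m \<Longrightarrow> \<exists>x\<in>RS (\<lambda>x. \<gamma> x + (of_nat p - of_nat j) * \<beta> x). x \<noteq> 0"
proof -
  have bh: "\<beta> \<in> hs" using b R_iff by auto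
  obtain e f where e: "e \<in> RS \<beta>" "e \<noteq> 0" and f: "f \<in> RS (\<lambda>x. - \<beta> x)" and ef: "brk e f = cor \<beta>"
    by (rule sl2[OF b])
  obtain x where x: "x \<in> RS \<gamma>" "x \<noteq> 0" "\<gamma> \<in> hs" using g R_iff by auto
  obtain p where p: "ladder e p x \<noteq> 0" "ladder e (Suc p) x = 0" by (rule ladder_nilpotent[OF b e(1) x(1,3,2)])
  define y where "y = ladder e p x"
  define \<mu> where "\<mu> = (\<lambda>x. \<gamma> x + of_nat p * \<beta> x)"
  have y: "y \<in> RS \<mu>" "brk e y = 0" "y \<noteq> 0" "\<mu> \<in> hs"
    using ladder_RS[OF e(1) x(1), of p] p hs_lin(1)[OF x(3) hs_lin(2)[OF bh]] by (auto simp: y_def \<mu>_def)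
  obtain m where m: "\<mu> (cor \<beta>) = of_nat m" "\<And>j. j \<le> m \<Longrightarrow> ladder f j y \<noteq> 0"
    "\<And>j. brk e (ladder f (Suc j) y) = scl (of_nat (Suc j) * (of_nat m - of_nat j)) (ladder f j y)"
    using highest_weight[OF b f ef y(1,4,3,2)] by blast
  show thesis
  proof (rule that)
    show "\<gamma> (cor \<beta>) = of_nat m - 2 * of_nat p" using m(1) cor_two[OF b] by (simp add: \<mu>_def algebra_simps)
    fix j assume "j \<le> m"
    moreover have "ladder f j y \<in> RS (\<lambda>x. \<gamma> x + (of_nat p - of_nat j) * \<beta> x)"
      using ladder_RS[OF f y(1), of j] by (simp add: \<mu>_def algebra_simps)
    ultimately show "\<exists>x\<in>RS (\<lambda>x. \<gamma> x + (of_nat p - of_nat j) * \<beta> x). x \<noteq> 0" using m(2) by blast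
  qed
qed

lemma cor_int: "\<beta> \<in> R \<Longrightarrow> \<gamma> \<in> R \<Longrightarrow> \<gamma> (cor \<beta>) \<in> \<int>"
  by (erule (1) root_string[of \<beta> \<gamma>]) simp

lemma cor_neg: "\<beta> \<in> R \<Longrightarrow> \<gamma> \<in> R \<Longrightarrow> \<gamma> (cor (\<lambda>x. - \<beta> x)) = - \<gamma> (cor \<beta>)"
proof -
  assume b: "\<beta> \<in> R" and g: "\<gamma> \<in> R"
  have h: "\<beta> \<in> hs" "\<gamma> \<in> hs" "(\<lambda>x. - \<beta> x) \<in> hs" using b g neg_R[OF b] R_iff by auto
  have s: "\<beta> (t \<gamma>) = \<gamma> (t \<beta>)" if "\<beta> \<in> hs" "\<gamma> \<in> hs" for \<beta> \<gamma>
    using t_props(3)[OF that(1) t_props(2)[OF that(2)]] t_props(3)[OF that(2) t_props(2)[OF that(1)]] kil_sym[of "t \<beta>" "t \<gamma>"] by simp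
  have "\<gamma> (t (\<lambda>x. - \<beta> x)) = - \<gamma> (t \<beta>)" "\<beta> (t (\<lambda>x. - \<beta> x)) = - \<beta> (t \<beta>)"
    using s[OF h(2,3)] s[OF h(1,3)] s[OF h(1,2)] by auto
  then show ?thesis using h t_props(2)[OF h(1)] t_props(2)[OF h(3)] by (auto simp: cor_def hs_iff)
qed

text \<open>The reflected root stands at position j = m - p of the string. This index makes sense
  for p \<le> m, which holds if \<gamma>(cor \<beta>) = m - 2p \<ge> 0; otherwise -\<beta> is used,
  which gives the same reflection.\<close>

lemma reflect_R:
  assumes b: "\<beta> \<in> R" and g: "\<gamma> \<in> R"
  shows "(\<lambda>x. \<gamma> x - \<gamma> (cor \<beta>) * \<beta> x) \<in> R"
proof -
  have main: "(\<lambda>x. \<gamma> x - \<gamma> (cor \<beta>) * \<beta> x) \<in> R" if b: "\<beta> \<in> R" and r: "Re (\<gamma> (cor \<beta>)) \<ge> 0" for \<beta>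
  proof -
    obtain p m :: nat where pm: "\<gamma> (cor \<beta>) = of_nat m - 2 * of_nat p"
      "\<And>j. j \<le> m \<Longrightarrow> \<exists>x\<in>RS (\<lambda>x. \<gamma> x + (of_nat p - of_nat j) * \<beta> x). x \<noteq> 0"
      using root_string[OF b g] by metis
    have "Re (\<gamma> (cor \<beta>)) = real m - 2 * real p" unfolding pm(1) by simp
    then have mp: "2 * p \<le> m" using r by linarith
    then have "of_nat p - of_nat (m - p) = - (\<gamma> (cor \<beta>))" by (simp add: pm(1) of_nat_diff)
    then have "\<exists>x\<in>RS (\<lambda>x. \<gamma> x - \<gamma> (cor \<beta>) * \<beta> x). x \<noteq> 0" using pm(2)[of "m - p"] by simp
    moreover have "(\<lambda>x. \<gamma> x - \<gamma> (cor \<beta>) * \<beta> x) \<in> hs" using b g R_iff hs_lin(2,4) by auto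
    moreover have "(\<lambda>x. \<gamma> x - \<gamma> (cor \<beta>) * \<beta> x) \<noteq> (\<lambda>_. 0)"
    proof
      assume z: "(\<lambda>x. \<gamma> x - \<gamma> (cor \<beta>) * \<beta> x) = (\<lambda>_. 0)"
      from fun_cong[OF z, of "cor \<beta>"] have "\<gamma> (cor \<beta>) = 0" using cor_two[OF b] by simp
      then show False using z g R_iff by auto
    qed
    ultimately show ?thesis by (simp add: R_iff)
  qed
  show ?thesis
  proof (cases "Re (\<gamma> (cor \<beta>)) \<ge> 0")
    case True then show ?thesis by (rule main[OF b])
  next
    case False
    then show ?thesis using main[OF neg_R[OF b]] cor_neg[OF b g] by simp
  qed
qed

text \<open>For the largest multiple n \<beta> with n \<ge> 2 that is a root, e kills the vectors x
  of weight n \<beta>. Let w = f^(n-1) x, of weight \<beta>. Then [e, [f, w]] is a multiple of e,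
  since [f, w] is a multiple of t \<beta>; by the string formula it is also a nonzero multiple of w.
  So w is proportional to e and [e, w] = 0, which the string formula excludes.\<close>

lemma multiple_not_root:
  assumes b: "\<beta> \<in> R" and k: "k \<ge> 2"
  shows "(\<lambda>x. of_nat k * \<beta> x) \<notin> R"
proof
  assume kR: "(\<lambda>x. of_nat k * \<beta> x) \<in> R"
  have bh: "\<beta> \<in> hs" "\<beta> \<noteq> (\<lambda>_. 0)" using b R_iff by auto
  obtain h where h: "h \<in> H" "\<beta> h \<noteq> 0" using hs_ext[OF bh(1) hs_lin(5)] bh by auto
  define S where "S = {k. k \<ge> 2 \<and> (\<lambda>x. of_nat k * \<beta> x) \<in> R}"
  have inj: "inj_on (\<lambda>k x. of_nat k * \<beta> x) S"
  proof (rule inj_onI)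
    fix m n :: nat assume "(\<lambda>x. of_nat m * \<beta> x) = (\<lambda>x. of_nat n * \<beta> x)"
    from fun_cong[OF this, of h] show "m = n" using h by simp
  qed
  have "finite S" by (rule finite_imageD[OF finite_subset[OF _ finite_R] inj]) (auto simp: S_def)
  define n where "n = Max S"
  have "k \<in> S" using k kR by (simp add: S_def)
  then have nS: "n \<in> S" and nmax: "\<And>l. l \<in> S \<Longrightarrow> l \<le> n" using Max_in[OF \<open>finite S\<close>] Max_ge[OF \<open>finite S\<close>] unfolding n_def by blast+
  have n2: "n \<ge> 2" and nR: "(\<lambda>x. of_nat n * \<beta> x) \<in> R" using nS by (auto simp: S_def)
  obtain e f where e: "e \<in> RS \<beta>" "e \<noteq> 0" and f: "f \<in> RS (\<lambda>x. - \<beta> x)" and ef: "brk e f = cor \<beta>"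
    by (rule sl2[OF b])
  obtain x where x: "x \<in> RS (\<lambda>x. of_nat n * \<beta> x)" "x \<noteq> 0" using nR R_iff by auto
  have ex: "brk e x = 0"
  proof (rule ccontr)
    assume "brk e x \<noteq> 0"
    moreover have "brk e x \<in> RS (\<lambda>x. of_nat (Suc n) * \<beta> x)" using RS_br[OF e(1) x(1)] by (simp add: algebra_simps)
    moreover have "(\<lambda>x. of_nat (Suc n) * \<beta> x) \<noteq> (\<lambda>_. 0)" using h by (auto simp: fun_eq_iff simp del: of_nat_Suc)
    ultimately have "Suc n \<in> S" using n2 hs_lin(2)[OF bh(1)] by (auto simp: S_def R_iff)
    then show False using nmax[of "Suc n"] by simp
  qed
  obtain m where m: "of_nat n * \<beta> (cor \<beta>) = of_nat m" "\<And>j. j \<le> m \<Longrightarrow> ladder f j x \<noteq> 0"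
    "\<And>j. brk e (ladder f (Suc j) x) = scl (of_nat (Suc j) * (of_nat m - of_nat j)) (ladder f j x)"
    using highest_weight[OF b f ef x(1) hs_lin(2)[OF bh(1)] x(2) ex] by blast
  have mn: "m = 2 * n"
  proof -
    have "of_nat m = (of_nat (2 * n) :: complex)" using m(1) cor_two[OF b] by (simp add: mult.commute)
    then show ?thesis by (simp only: of_nat_eq_iff)
  qed
  obtain l where l: "n = Suc (Suc l)" using n2 by (metis add_2_eq_Suc le_Suc_ex)
  define w where "w = ladder f (Suc l) x"
  have w: "w \<in> RS \<beta>" using ladder_RS[OF f x(1), of "Suc l"] by (simp add: w_def l algebra_simps)
  have "brk f w = scl (- \<kappa> w f) (t \<beta>)"
    using br_dual[OF bh(1) w f] br_anti[of f w] by simp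
  then have "brk e (brk f w) = scl (\<kappa> w f * \<beta> (t \<beta>)) e"
    using br_anti[of e "t \<beta>"] e(1) t_props(2)[OF bh(1)] by (simp add: br_simps br_minus RS_iff)
  moreover have "brk e (brk f w) = scl (of_nat (Suc (Suc l)) * (of_nat m - of_nat (Suc l))) w"
    using m(3)[of "Suc l"] by (simp add: w_def)
  moreover define c where "c = of_nat (Suc (Suc l)) * (of_nat m - of_nat (Suc l) :: complex)"
  moreover have c0: "c \<noteq> 0"
  proof -
    have "of_nat m - of_nat (Suc l) = (of_nat (l + 3) :: complex)" using mn l by simp
    then show ?thesis unfolding c_def by (simp only: mult_eq_0_iff of_nat_eq_0_iff) simp
  qed
  ultimately have "scl c w = scl (\<kappa> w f * \<beta> (t \<beta>)) e" by simp
  then have "brk e (scl c w) = 0" by (simp add: br_simps)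
  then have "brk e w = 0" using c0 by (simp add: br_simps)
  moreover have "brk e w = scl (of_nat (Suc l) * (of_nat m - of_nat l)) (ladder f l x)"
    using m(3)[of l] by (simp add: w_def)
  moreover have "of_nat (Suc l) * (of_nat m - of_nat l) \<noteq> (0::complex)"
  proof -
    have "of_nat m - of_nat l = (of_nat (l + 4) :: complex)" using mn l by simp
    then show ?thesis by (simp only: mult_eq_0_iff of_nat_eq_0_iff) simp
  qed
  moreover have "ladder f l x \<noteq> 0" using m(2)[of l] mn l by simp
  ultimately show False by simp
qed

end

subsection \<open>Weyl group and the half sum of positive roots\<close>

context lie_setup
begin

abbreviation "rc \<equiv> root_comb D"
abbreviation "cp \<equiv> coroot_pairing D"
abbreviation "P \<equiv> pos_roots D"
abbreviation "\<rho> \<equiv> half_sum D"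

lemma t_sym: "\<mu> \<in> hs \<Longrightarrow> \<nu> \<in> hs \<Longrightarrow> \<mu> (t \<nu>) = \<nu> (t \<mu>)"
  using t_props(3)[OF _ t_props(2), of \<mu> \<nu>] t_props(3)[OF _ t_props(2), of \<nu> \<mu>] kil_sym[of "t \<mu>" "t \<nu>"] by simp

lemma R_hs: "\<beta> \<in> R \<Longrightarrow> \<beta> \<in> hs"
  by (simp add: R_iff)

lemma frm_sym: "\<mu> \<in> hs \<Longrightarrow> \<nu> \<in> hs \<Longrightarrow> frm D \<mu> \<nu> = frm D \<nu> \<mu>"
  by (simp add: t_props(4) t_sym)

lemma hs_comb: "\<mu> \<in> hs \<Longrightarrow> \<nu> \<in> hs \<Longrightarrow> (\<lambda>x. \<mu> x + c * \<nu> x) \<in> hs"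
  using hs_lin(1)[OF _ hs_lin(2)] .

lemma frm_left: "\<mu> \<in> hs \<Longrightarrow> \<nu> \<in> hs \<Longrightarrow> \<gamma> \<in> hs \<Longrightarrow> frm D (\<lambda>x. \<mu> x + c * \<nu> x) \<gamma> = frm D \<mu> \<gamma> + c * frm D \<nu> \<gamma>"
  using hs_comb[of \<mu> \<nu> c] by (simp add: t_props(4) algebra_simps)

lemma frm_right: "\<mu> \<in> hs \<Longrightarrow> \<nu> \<in> hs \<Longrightarrow> \<gamma> \<in> hs \<Longrightarrow> frm D \<gamma> (\<lambda>x. \<mu> x + c * \<nu> x) = frm D \<gamma> \<mu> + c * frm D \<gamma> \<nu>"
  using frm_left[of \<mu> \<nu> \<gamma> c] frm_sym hs_comb[of \<mu> \<nu> c] by simp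

lemma frm_nz: "\<beta> \<in> R \<Longrightarrow> frm D \<beta> \<beta> \<noteq> 0"
  using t_props(1) length_nonzero[of \<beta>] R_hs[of \<beta>] by (simp add: t_props(4))

lemma cp_left: "\<mu> \<in> hs \<Longrightarrow> \<nu> \<in> hs \<Longrightarrow> \<beta> \<in> R \<Longrightarrow> cp (\<lambda>x. \<mu> x + c * \<nu> x) \<beta> = cp \<mu> \<beta> + c * cp \<nu> \<beta>"
  using hs_comb[of \<mu> \<nu> c] by (simp add: pairing)

lemma hs_sum: "(\<And>j. j \<in> J \<Longrightarrow> f j \<in> hs) \<Longrightarrow> (\<lambda>x. \<Sum>j\<in>J. c j * f j x) \<in> hs"
proof (induction J rule: infinite_finite_induct)
  case (insert a J)
  then show ?case using hs_comb[of "\<lambda>x. \<Sum>j\<in>J. c j * f j x" "f a" "c a"] by (simp add: add.commute)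
qed (simp_all add: hs_lin)

lemma rc_hs: "rc c \<in> hs"
  unfolding root_comb_def using hs_sum[of UNIV \<alpha> c] simple_R R_hs by auto

lemma rc_inj: "rc c = rc d \<Longrightarrow> c = d"
  using sroots rc_hs[of c] unfolding simple_roots_def by metis

lemma rc_simple: "rc (\<lambda>j. if j = i then c else 0) = (\<lambda>x. c * \<alpha> i x)"
  by (simp add: root_comb_def fun_eq_iff if_distrib if_distribR sum.delta cong: if_cong)

lemma rc_sum: "(\<lambda>x. \<Sum>j\<in>J. rc (c j) x) = rc (\<lambda>i. \<Sum>j\<in>J. c j i)"
  unfolding root_comb_def fun_eq_iff by (simp add: sum_distrib_right) (subst sum.swap, simp)

lemma rc_scale: "(\<lambda>x. a * rc c x) = rc (\<lambda>i. a * c i)"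
  by (simp add: root_comb_def sum_distrib_left mult.assoc)

lemma rc_uminus: "(\<lambda>x. - rc c x) = rc (\<lambda>i. - c i)"
  by (simp add: root_comb_def sum_negf)

lemma P_iff: "\<beta> \<in> P \<longleftrightarrow> \<beta> \<in> R \<and> (\<exists>c::'i \<Rightarrow> nat. \<beta> = rc (\<lambda>i. of_nat (c i)))"
  by (simp add: pos_roots_def)

lemma P_R: "\<beta> \<in> P \<Longrightarrow> \<beta> \<in> R"
  by (simp add: P_iff)

lemma finite_P: "finite P"
  using finite_R P_R by (metis finite_subset subsetI)

lemma P_cases: assumes "\<beta> \<in> R" shows "\<beta> \<in> P \<or> (\<lambda>x. - \<beta> x) \<in> P"
proof (cases "\<beta> \<in> P")
  case False
  then have "\<beta> \<in> neg_roots D" using assms sroots by (auto simp: simple_roots_def)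
  then obtain c :: "'i \<Rightarrow> nat" where "\<beta> = rc (\<lambda>i. - of_nat (c i))" by (auto simp: neg_roots_def)
  then have "(\<lambda>x. - \<beta> x) = rc (\<lambda>i. of_nat (c i))" by (simp add: rc_uminus)
  then show ?thesis using neg_R[OF assms] by (auto simp: P_iff)
qed simp

lemma P_not_neg: assumes "\<beta> \<in> P" shows "(\<lambda>x. - \<beta> x) \<notin> P"
proof
  assume "(\<lambda>x. - \<beta> x) \<in> P"
  then obtain c d :: "'i \<Rightarrow> nat" where c: "\<beta> = rc (\<lambda>i. of_nat (c i))" and d: "(\<lambda>x. - \<beta> x) = rc (\<lambda>i. of_nat (d i))"
    using assms by (auto simp: P_iff)
  then have "rc (\<lambda>i. - of_nat (c i)) = rc (\<lambda>i. of_nat (d i))" by (simp add: rc_uminus)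
  from rc_inj[OF this] have "- complex_of_nat (c i) = of_nat (d i)" for i by (rule fun_cong)
  then have "c i = 0" for i
    by (metis add_eq_0_iff add_is_0 of_nat_0_eq_iff of_nat_add)
  then have "\<beta> = (\<lambda>_. 0)" using c by (simp add: root_comb_def)
  then show False using assms R_iff P_R by auto
qed

lemma alpha_P: "\<alpha> i \<in> P"
  unfolding P_iff using simple_R rc_simple[of i 1]
  by (auto intro!: exI[of _ "\<lambda>j. if j = i then 1 else 0"] simp: if_distrib cong: if_cong)

text \<open>What is needed of a Weyl group element. These properties hold for reflections, which are
  their own inverses, and are stable under composition, so they pass to all of
  \<open>weyl\<close>.\<close>

definition root_isometry :: "'g wgt \<Rightarrow> bool" where
  "root_isometry w \<longleftrightarrow> w \<in> Bij hs \<and> (\<forall>\<mu>\<in>hs. \<forall>\<nu>\<in>hs. \<forall>c. w (\<lambda>x. \<mu> x + c * \<nu> x) = (\<lambda>x. w \<mu> x + c * w \<nu> x)) \<and>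
     (\<forall>\<mu>\<in>hs. \<forall>\<nu>\<in>hs. frm D (w \<mu>) (w \<nu>) = frm D \<mu> \<nu>) \<and> (\<forall>\<beta>\<in>R. w \<beta> \<in> R)"

abbreviation "rfl \<equiv> reflection D"
abbreviation "BG \<equiv> BijGroup hs"

lemma root_isometryD: assumes "root_isometry w" shows "w \<in> Bij hs" "\<mu> \<in> hs \<Longrightarrow> w \<mu> \<in> hs"
  "\<mu> \<in> hs \<Longrightarrow> \<nu> \<in> hs \<Longrightarrow> w (\<lambda>x. \<mu> x + c * \<nu> x) = (\<lambda>x. w \<mu> x + c * w \<nu> x)"
  "\<mu> \<in> hs \<Longrightarrow> \<nu> \<in> hs \<Longrightarrow> frm D (w \<mu>) (w \<nu>) = frm D \<mu> \<nu>" "\<beta> \<in> R \<Longrightarrow> w \<beta> \<in> R" "inj_on w hs"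
  using assms by (auto simp: root_isometry_def Bij_def bij_betw_def)

lemma refl_val: "\<mu> \<in> hs \<Longrightarrow> rfl \<beta> \<mu> = (\<lambda>x. \<mu> x - cp \<mu> \<beta> * \<beta> x)"
  by (simp add: reflection_def)

lemma refl_hs: "\<beta> \<in> R \<Longrightarrow> \<mu> \<in> hs \<Longrightarrow> rfl \<beta> \<mu> \<in> hs"
  using hs_comb[of \<mu> \<beta> "- cp \<mu> \<beta>"] R_hs by (simp add: refl_val)

lemma cp_self: "\<beta> \<in> R \<Longrightarrow> cp \<beta> \<beta> = 2"
  by (simp add: pairing R_hs cor_two)

lemma refl_refl: "\<beta> \<in> R \<Longrightarrow> \<mu> \<in> hs \<Longrightarrow> rfl \<beta> (rfl \<beta> \<mu>) = \<mu>"
proof -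
  assume b: "\<beta> \<in> R" "\<mu> \<in> hs"
  have "cp (rfl \<beta> \<mu>) \<beta> = - cp \<mu> \<beta>"
    using cp_left[OF b(2) R_hs[OF b(1)] b(1), of "- cp \<mu> \<beta>"] cp_self[OF b(1)] by (simp add: refl_val[OF b(2)])
  then show ?thesis unfolding refl_val[OF refl_hs[OF b]] by (simp add: refl_val[OF b(2)])
qed

lemma root_isometry_refl: assumes b: "\<beta> \<in> R" shows "root_isometry (rfl \<beta>)"
  unfolding root_isometry_def
proof (intro conjI ballI allI)
  note bh = R_hs[OF b]
  have "bij_betw (rfl \<beta>) hs hs"
    by (rule bij_betw_byWitness[where f' = "rfl \<beta>"]) (use refl_hs[OF b] refl_refl[OF b] in auto)
  then show "rfl \<beta> \<in> Bij hs" by (simp add: Bij_def reflection_def)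
  fix \<mu> assume m: "\<mu> \<in> hs"
  fix \<nu> assume n: "\<nu> \<in> hs"
  show "rfl \<beta> (\<lambda>x. \<mu> x + c * \<nu> x) = (\<lambda>x. rfl \<beta> \<mu> x + c * rfl \<beta> \<nu> x)" for c
    by (simp add: refl_val m n hs_comb cp_left b algebra_simps)
  have "frm D (rfl \<beta> \<mu>) (rfl \<beta> \<nu>) = frm D (\<lambda>x. \<mu> x + - cp \<mu> \<beta> * \<beta> x) (\<lambda>x. \<nu> x + - cp \<nu> \<beta> * \<beta> x)"
    by (simp add: refl_val m n)
  also have "\<dots> = frm D \<mu> \<nu> - cp \<nu> \<beta> * frm D \<mu> \<beta> - cp \<mu> \<beta> * (frm D \<beta> \<nu> - cp \<nu> \<beta> * frm D \<beta> \<beta>)"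
    using frm_left[OF m bh hs_comb[OF n bh], of "- cp \<mu> \<beta>" "- cp \<nu> \<beta>"] frm_right[OF n bh m, of "- cp \<nu> \<beta>"]
      frm_right[OF n bh bh, of "- cp \<nu> \<beta>"] by simp
  also have "\<dots> = frm D \<mu> \<nu>"
    using frm_nz[OF b] frm_sym[OF bh n] by (simp add: coroot_pairing_def field_simps)
  finally show "frm D (rfl \<beta> \<mu>) (rfl \<beta> \<nu>) = frm D \<mu> \<nu>" .
next
  fix \<gamma> assume "\<gamma> \<in> R"
  then show "rfl \<beta> \<gamma> \<in> R" using reflect_R[OF b] by (simp add: refl_val R_hs pairing b)
qed

lemma BG_mult: "f \<in> Bij hs \<Longrightarrow> g \<in> Bij hs \<Longrightarrow> f \<otimes>\<^bsub>BG\<^esub> g = compose hs f g"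
  by (simp add: BijGroup_def)

lemma root_isometry_compose: assumes "root_isometry f" "root_isometry g" shows "root_isometry (f \<otimes>\<^bsub>BG\<^esub> g)"
proof -
  have "compose hs f g \<mu> = f (g \<mu>)" if "\<mu> \<in> hs" for \<mu> using that by (simp add: compose_def)
  then show ?thesis
    unfolding root_isometry_def BG_mult[OF root_isometryD(1)[OF assms(1)] root_isometryD(1)[OF assms(2)]]
    using root_isometryD[OF assms(1)] root_isometryD[OF assms(2)] by (auto simp: compose_Bij hs_comb R_hs)
qed

lemma weyl_root_isometry: assumes "w \<in> weyl D" shows "root_isometry w"
proof -
  interpret G: group BG by (rule group_BijGroup)
  have rinv: "inv\<^bsub>BG\<^esub> (rfl \<beta>) = rfl \<beta>" if b: "\<beta> \<in> R" for \<beta>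
  proof (rule G.inv_equality)
    note g = root_isometryD(1)[OF root_isometry_refl[OF b]]
    show "rfl \<beta> \<in> carrier BG" "rfl \<beta> \<in> carrier BG" using g by (simp_all add: BijGroup_def)
    show "rfl \<beta> \<otimes>\<^bsub>BG\<^esub> rfl \<beta> = \<one>\<^bsub>BG\<^esub>"
      unfolding BG_mult[OF g g] using refl_refl[OF b] by (auto simp: BijGroup_def compose_def restrict_def fun_eq_iff)
  qed
  show ?thesis using assms unfolding weyl_def
  proof (induction rule: generate.induct)
    case one
    show ?case using id_Bij[of hs] by (auto simp: root_isometry_def BijGroup_def hs_comb R_hs restrict_def)
  next
    case (incl h)
    then show ?case using root_isometry_refl by auto
  next
    case (inv h)
    then show ?case using root_isometry_refl rinv by auto
  next
    case (eng h1 h2)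
    then show ?case by (simp add: root_isometry_compose)
  qed
qed

lemma root_isometry_neg: assumes "root_isometry w" "\<mu> \<in> hs" shows "w (\<lambda>x. - \<mu> x) = (\<lambda>x. - w \<mu> x)"
proof -
  \<comment> \<open>Linearity is available in the form \<mu> + c \<nu>; here \<nu> = \<mu> and c =
    -2.\<close>
  have "w (\<lambda>x. \<mu> x + (- 2) * \<mu> x) = (\<lambda>x. w \<mu> x + (- 2) * w \<mu> x)" by (rule root_isometryD(3)[OF assms(1,2,2)])
  then show ?thesis by simp
qed

lemma root_isometry_zero: assumes "root_isometry w" shows "w (\<lambda>_. 0) = (\<lambda>_. 0)"
  using root_isometryD(3)[OF assms hs_lin(5) hs_lin(5), of "- 1"] by simp

lemma root_isometry_sum: assumes "root_isometry w" "\<And>j. j \<in> J \<Longrightarrow> f j \<in> hs"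
  shows "w (\<lambda>x. \<Sum>j\<in>J. c j * f j x) = (\<lambda>x. \<Sum>j\<in>J. c j * w (f j) x)"
  using assms(2)
proof (induction J rule: infinite_finite_induct)
  case (insert a J)
  then show ?case using root_isometryD(3)[OF assms(1) hs_sum[of J f c], of "f a" "c a"] by (simp add: add.commute)
qed (simp_all add: root_isometry_zero[OF assms(1)])

lemma root_isometry_R: assumes "root_isometry w" shows "w ` R = R"
  by (rule endo_inj_surj[OF finite_R]) (use root_isometryD[OF assms] R_hs in \<open>auto intro: inj_on_subset\<close>)

section \<open>The half sum of the positive roots and the weights w.0\<close>

lemma rho_alt: "\<rho> = (\<lambda>x. \<Sum>\<beta>\<in>P. (1/2) * \<beta> x)"
  by (simp add: half_sum_def sum_divide_distrib)

lemma rho_hs: "\<rho> \<in> hs"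
  unfolding rho_alt by (rule hs_sum) (use P_R R_hs in auto)

text \<open>The positive roots made negative by the inverse of w, written without that
  inverse.\<close>

definition "inversions w = {\<gamma> \<in> P. (\<lambda>x. - \<gamma> x) \<in> w ` P}"

lemma image_P_dichotomy: assumes w: "root_isometry w" and g: "\<gamma> \<in> R" shows "\<gamma> \<in> w ` P \<longleftrightarrow> (\<lambda>x. - \<gamma> x) \<notin> w ` P"
proof -
  obtain \<beta> where b: "\<beta> \<in> R" "\<gamma> = w \<beta>" using g root_isometry_R[OF w] by auto
  have i: "w \<delta> \<in> w ` P \<longleftrightarrow> \<delta> \<in> P" if "\<delta> \<in> R" for \<delta>
    using that root_isometryD(6)[OF w] P_R R_hs by (auto simp: inj_on_def)
  have "(\<lambda>x. - \<gamma> x) = w (\<lambda>x. - \<beta> x)" using root_isometry_neg[OF w] b R_hs by simp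
  then show ?thesis using i[OF b(1)] i[OF neg_R[OF b(1)]] b P_cases[OF b(1)] P_not_neg[of \<beta>] by auto
qed

text \<open>The image of the positive roots under w contains exactly one of \<gamma> and -\<gamma>
  for each root \<gamma>. So w \<rho> arises from \<rho> by flipping the sign of each inversion,
  which occurs with coefficient 1/2.\<close>

lemma rho_image: assumes w: "root_isometry w" shows "w \<rho> = (\<lambda>x. \<rho> x - (\<Sum>\<gamma>\<in>inversions w. \<gamma> x))"
proof
  fix x
  define A where "A = w ` P"
  have inj: "inj_on w P" using root_isometryD(6)[OF w] P_R R_hs by (auto intro: inj_on_subset)
  have AR: "A \<subseteq> R" using root_isometryD(5)[OF w] P_R by (auto simp: A_def)
  have fA: "finite A" using finite_P by (simp add: A_def)
  have "w \<rho> x = (\<Sum>\<beta>\<in>P. (1/2) * w \<beta> x)"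
    unfolding rho_alt using root_isometry_sum[OF w, of P "\<lambda>\<beta>. \<beta>" "\<lambda>_. 1/2"] P_R R_hs by auto
  also have "\<dots> = (\<Sum>\<gamma>\<in>A. (1/2) * \<gamma> x)" unfolding A_def by (simp add: sum.reindex[OF inj])
  also have "\<dots> = (\<Sum>\<gamma>\<in>A \<inter> P. (1/2) * \<gamma> x) + (\<Sum>\<gamma>\<in>A - P. (1/2) * \<gamma> x)"
    by (rule sum.Int_Diff[OF fA])
  also have "(\<Sum>\<gamma>\<in>A - P. (1/2) * \<gamma> x) = (\<Sum>\<gamma>\<in>P - A. (1/2) * - \<gamma> x)"
  proof (rule sum.reindex_bij_witness[where i = "\<lambda>\<gamma> x. - \<gamma> x" and j = "\<lambda>\<gamma> x. - \<gamma> x"])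
    fix \<gamma> assume g: "\<gamma> \<in> A - P"
    then show "(\<lambda>x. - \<gamma> x) \<in> P - A" using P_cases[of \<gamma>] AR image_P_dichotomy[OF w, of \<gamma>] by (auto simp: A_def)
  next
    fix \<gamma> assume g: "\<gamma> \<in> P - A"
    then show "(\<lambda>x. - \<gamma> x) \<in> A - P" using P_not_neg[of \<gamma>] P_R image_P_dichotomy[OF w, of \<gamma>] by (auto simp: A_def)
  qed auto
  also have "P - A = inversions w"
    using image_P_dichotomy[OF w] P_R by (auto simp: A_def inversions_def)
  also have "(\<Sum>\<gamma>\<in>A \<inter> P. (1/2) * \<gamma> x) = \<rho> x - (\<Sum>\<gamma>\<in>P - A. (1/2) * \<gamma> x)"
    unfolding rho_alt using sum.Int_Diff[OF finite_P, of "\<lambda>\<gamma>. (1/2) * \<gamma> x" A] by (simp add: Int_commute)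
  also have "P - A = inversions w"
    using image_P_dichotomy[OF w] P_R by (auto simp: A_def inversions_def)
  finally show "w \<rho> x = \<rho> x - (\<Sum>\<gamma>\<in>inversions w. \<gamma> x)"
    by (simp add: sum_negf sum_divide_distrib[symmetric])
qed

lemma dot0_val: "root_isometry w \<Longrightarrow> dot0 D w = (\<lambda>x. - (\<Sum>\<gamma>\<in>inversions w. \<gamma> x))"
  unfolding dot_def using rho_image by simp

lemma alpha_pairing: "\<beta> \<in> R \<Longrightarrow> cp \<beta> (\<alpha> i) \<in> \<int>"
  using cor_int[OF simple_R] by (simp add: pairing R_hs simple_R)

lemma wl_iff: "\<mu> \<in> weight_lattice D \<longleftrightarrow> \<mu> \<in> hs \<and> (\<forall>i. cp \<mu> (\<alpha> i) \<in> \<int>)"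
  by (simp add: weight_lattice_def)

lemma alpha_wl: "\<alpha> i \<in> weight_lattice D"
  using alpha_pairing simple_R R_hs by (simp add: wl_iff)

lemma inv_P: "\<gamma> \<in> inversions w \<Longrightarrow> \<gamma> \<in> P"
  by (simp add: inversions_def)

lemma cp_sum: "(\<And>j. j \<in> J \<Longrightarrow> f j \<in> hs) \<Longrightarrow> \<beta> \<in> R \<Longrightarrow> cp (\<lambda>x. \<Sum>j\<in>J. c j * f j x) \<beta> = (\<Sum>j\<in>J. c j * cp (f j) \<beta>)"
  using hs_sum[of J f c] by (simp add: pairing)

lemma dot0_wl: assumes "root_isometry w" shows "dot0 D w \<in> weight_lattice D"
proof -
  have e: "dot0 D w = (\<lambda>x. \<Sum>\<gamma>\<in>inversions w. (- 1) * \<gamma> x)" using dot0_val[OF assms] by (simp add: sum_negf)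
  have h: "\<gamma> \<in> hs" "\<gamma> \<in> R" if "\<gamma> \<in> inversions w" for \<gamma> using that inv_P P_R R_hs by auto
  have "cp (\<lambda>x. \<Sum>\<gamma>\<in>inversions w. (- 1) * \<gamma> x) (\<alpha> i) = (\<Sum>\<gamma>\<in>inversions w. (- 1) * cp \<gamma> (\<alpha> i))" for i
    by (rule cp_sum[OF h(1) simple_R])
  then show ?thesis unfolding wl_iff e
    using hs_sum[of "inversions w" "\<lambda>\<gamma>. \<gamma>" "\<lambda>_. - 1"] h alpha_pairing by (auto intro!: Ints_sum)
qed

text \<open>The second claim is \<open>rho_image\<close> compared with the definition of the
  reflection. As \<beta> is itself an inversion of its reflection, a simple root occurring in
  \<beta> has at least as large a coefficient in the sum of the inversions; the quotient of the two
  coefficients is the pairing.\<close>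

lemma rho_pairing:
  assumes b: "\<beta> \<in> P" shows "\<exists>r::real. r \<ge> 1 \<and> cp \<rho> \<beta> = complex_of_real r"
    "(\<lambda>x. cp \<rho> \<beta> * \<beta> x) = (\<lambda>x. \<Sum>\<gamma>\<in>inversions (rfl \<beta>). \<gamma> x)"
proof -
  note bR = P_R[OF b]
  show e: "(\<lambda>x. cp \<rho> \<beta> * \<beta> x) = (\<lambda>x. \<Sum>\<gamma>\<in>inversions (rfl \<beta>). \<gamma> x)"
    using rho_image[OF root_isometry_refl[OF bR]] by (simp add: refl_val rho_hs fun_eq_iff)
  have "\<forall>\<gamma>\<in>P. \<exists>c::'i \<Rightarrow> nat. \<gamma> = rc (\<lambda>i. of_nat (c i))" by (simp add: P_iff)
  then obtain cf :: "'g wt \<Rightarrow> 'i \<Rightarrow> nat" where cf: "\<And>\<gamma>. \<gamma> \<in> P \<Longrightarrow> \<gamma> = rc (\<lambda>i. of_nat (cf \<gamma> i))" by metis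
  let ?B = "inversions (rfl \<beta>)"
  have "(\<lambda>x. \<Sum>\<gamma>\<in>?B. \<gamma> x) = (\<lambda>x. \<Sum>\<gamma>\<in>?B. rc (\<lambda>i. of_nat (cf \<gamma> i)) x)"
    by (intro ext sum.cong refl fun_cong[OF cf] inv_P)
  also have "\<dots> = rc (\<lambda>i. of_nat (\<Sum>\<gamma>\<in>?B. cf \<gamma> i))" by (simp add: rc_sum)
  finally have "(\<lambda>x. cp \<rho> \<beta> * rc (\<lambda>i. of_nat (cf \<beta> i)) x) = rc (\<lambda>i. of_nat (\<Sum>\<gamma>\<in>?B. cf \<gamma> i))"
    using e cf[OF b] by metis
  from rc_inj[OF this[unfolded rc_scale]] have c: "cp \<rho> \<beta> * of_nat (cf \<beta> i) = of_nat (\<Sum>\<gamma>\<in>?B. cf \<gamma> i)" for i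
    by (rule fun_cong)
  have "rfl \<beta> \<beta> = (\<lambda>x. - \<beta> x)" using cp_self[OF bR] R_hs[OF bR] by (simp add: refl_val)
  then have bB: "\<beta> \<in> ?B" using b by (auto simp: inversions_def intro: image_eqI[of _ _ \<beta>])
  have fB: "finite ?B" using finite_P by (simp add: inversions_def)
  obtain i where i: "cf \<beta> i \<noteq> 0"
  proof (rule ccontr)
    assume "\<not> thesis"
    then have "cf \<beta> i = 0" for i using that by blast
    then have "\<beta> = (\<lambda>_. 0)" using cf[OF b] by (simp add: root_comb_def)
    then show False using bR R_iff by auto
  qed
  have le: "cf \<beta> i \<le> (\<Sum>\<gamma>\<in>?B. cf \<gamma> i)" by (rule member_le_sum[OF bB _ fB]) simp
  have "cp \<rho> \<beta> = complex_of_real (real (\<Sum>\<gamma>\<in>?B. cf \<gamma> i) / real (cf \<beta> i))"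
    using c[of i] i by (simp add: field_simps del: of_nat_sum)
  moreover have "real (\<Sum>\<gamma>\<in>?B. cf \<gamma> i) / real (cf \<beta> i) \<ge> 1" using le i by (simp add: field_simps del: of_nat_sum)
  ultimately show "\<exists>r::real. r \<ge> 1 \<and> cp \<rho> \<beta> = complex_of_real r" by blast
qed

text \<open>If \<gamma> and \<delta> are positive and -\<gamma> is the reflection of \<delta>, then
  \<gamma> + \<delta> is a multiple of the simple root. So \<gamma> is one too, and
  \<open>multiple_not_root\<close> leaves only the simple root itself.\<close>

lemma inversions_simple: "inversions (rfl (\<alpha> i)) = {\<alpha> i}"
proof
  have "rfl (\<alpha> i) (\<alpha> i) = (\<lambda>x. - \<alpha> i x)" using cp_self[OF simple_R] R_hs[OF simple_R] by (simp add: refl_val)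
  then show "{\<alpha> i} \<subseteq> inversions (rfl (\<alpha> i))" using alpha_P by (auto simp: inversions_def intro: image_eqI[of _ _ "\<alpha> i"])
  show "inversions (rfl (\<alpha> i)) \<subseteq> {\<alpha> i}"
  proof
    fix \<gamma> assume "\<gamma> \<in> inversions (rfl (\<alpha> i))"
    then obtain \<delta> where g: "\<gamma> \<in> P" "\<delta> \<in> P" "(\<lambda>x. - \<gamma> x) = rfl (\<alpha> i) \<delta>" by (auto simp: inversions_def)
    obtain c d :: "'i \<Rightarrow> nat" where c: "\<gamma> = rc (\<lambda>i. of_nat (c i))" and d: "\<delta> = rc (\<lambda>i. of_nat (d i))"
      using g by (auto simp: P_iff)
    define k where "k = cp \<delta> (\<alpha> i)"
    have "(\<lambda>x. - \<gamma> x) = (\<lambda>x. \<delta> x - k * \<alpha> i x)" using g(3) refl_val[OF R_hs[OF P_R[OF g(2)]]] by (simp add: k_def)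
    then have "(\<lambda>x. \<gamma> x + \<delta> x) = (\<lambda>x. k * \<alpha> i x)" by (simp add: fun_eq_iff algebra_simps)
    moreover have "(\<lambda>x. \<gamma> x + \<delta> x) = rc (\<lambda>i. of_nat (c i + d i))"
      by (simp add: c d root_comb_def algebra_simps sum.distrib)
    ultimately have "rc (\<lambda>i. of_nat (c i + d i)) = rc (\<lambda>j. if j = i then k else 0)" by (simp add: rc_simple)
    from rc_inj[OF this] have "of_nat (c j + d j) = (if j = i then k else 0)" for j by (rule fun_cong)
    from this have "c j = 0" if "j \<noteq> i" for j using that by (metis add_is_0 of_nat_0_eq_iff)
    then have "(\<lambda>i. of_nat (c i)) = (\<lambda>j. if j = i then of_nat (c i) else (0::complex))" by auto
    then have ci: "\<gamma> = (\<lambda>x. of_nat (c i) * \<alpha> i x)" using c rc_simple[of i "of_nat (c i)"] by simp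
    have "c i \<noteq> 0"
    proof
      assume "c i = 0"
      then have "\<gamma> = (\<lambda>_. 0)" using ci by simp
      then show False using P_R[OF g(1)] by (simp add: R_iff)
    qed
    moreover have "\<not> c i \<ge> 2" using multiple_not_root[OF simple_R, of "c i" i] ci P_R[OF g(1)] by auto
    ultimately have "c i = 1" by simp
    then show "\<gamma> \<in> {\<alpha> i}" using ci by simp
  qed
qed

lemma rho_simple: "cp \<rho> (\<alpha> i) = 1"
proof -
  have e: "(\<lambda>x. cp \<rho> (\<alpha> i) * \<alpha> i x) = \<alpha> i" using rho_pairing(2)[OF alpha_P] inversions_simple by simp
  obtain x where "\<alpha> i x \<noteq> 0" using simple_R[of i] R_iff by auto
  then show ?thesis using fun_cong[OF e, of x] by simp
qed

lemma frm_wl: "\<mu> \<in> weight_lattice D \<Longrightarrow> \<nu> \<in> weight_lattice D \<Longrightarrow> frm D \<mu> \<nu> \<in> \<int>"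
  using nform by (simp add: normalized_form_def)

text \<open>Integrality of the form is applied to \<rho> and alpha_i: \<rho> is a weight because it
  pairs to 1 with every simple coroot, and for the same reason (\<rho>, alpha_i) = (alpha_i,
  alpha_i)/2.\<close>

lemma half_length: "frm D (\<alpha> i) (\<alpha> i) / 2 \<in> \<int>"
proof -
  have "\<rho> \<in> weight_lattice D" by (simp add: wl_iff rho_hs rho_simple)
  then have "frm D \<rho> (\<alpha> i) \<in> \<int>" using frm_wl alpha_wl by simp
  moreover have "frm D \<rho> (\<alpha> i) = frm D (\<alpha> i) (\<alpha> i) / 2"
    using rho_simple[of i] frm_nz[OF simple_R, of i] by (simp add: coroot_pairing_def field_simps)
  ultimately show ?thesis by simp
qed

text \<open>Membership in \<open>min_reps\<close> gives alpha_i = w \<beta> with \<beta> positive.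
  The pairing of w.0 with the coroot of alpha_i is then the pairing of \<rho> with the coroot of
  \<beta>, minus 1: an integer by \<open>dot0_wl\<close>, and nonnegative by
  \<open>rho_pairing\<close>.\<close>

lemma dot0_dominant: assumes "w \<in> min_reps D" shows "dot0 D w \<in> dominant_wrt_sub D"
proof -
  have w: "root_isometry w" and s: "sub_lattice D \<inter> P \<subseteq> w ` P" using assms weyl_root_isometry by (auto simp: min_reps_def)
  have "cp (dot0 D w) (\<alpha> i) \<in> \<nat>" if i: "i \<in> sub D" for i
  proof -
    have "\<alpha> i \<in> sub_lattice D"
      unfolding sub_lattice_def using i rc_simple[of i 1]
      by (auto intro!: exI[of _ "\<lambda>j. if j = i then 1 else 0"] simp: if_distrib cong: if_cong)
    then obtain \<beta> where b: "\<beta> \<in> P" "\<alpha> i = w \<beta>" using s alpha_P by auto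
    note bh = R_hs[OF P_R[OF b(1)]]
    have "cp (w \<rho>) (\<alpha> i) = cp \<rho> \<beta>"
      unfolding b(2) coroot_pairing_def using root_isometryD(4)[OF w] rho_hs bh by simp
    moreover have "dot0 D w = (\<lambda>x. w \<rho> x + (- 1) * \<rho> x)" by (simp add: dot_def)
    ultimately have e: "cp (dot0 D w) (\<alpha> i) = cp \<rho> \<beta> - 1"
      using cp_left[OF root_isometryD(2)[OF w rho_hs] rho_hs simple_R, of "- 1" i] rho_simple by simp
    obtain r :: real where r: "r \<ge> 1" "cp \<rho> \<beta> = complex_of_real r" using rho_pairing(1)[OF b(1)] by blast
    have "cp (dot0 D w) (\<alpha> i) \<in> \<int>" using dot0_wl[OF w] by (simp add: wl_iff)
    then obtain z :: int where z: "cp (dot0 D w) (\<alpha> i) = of_int z" by (auto elim: Ints_cases)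
    then have "complex_of_real (of_int z) = complex_of_real (r - 1)" using e r by simp
    then have "of_int z = r - 1" by (simp only: of_real_eq_iff)
    then have "z \<ge> 0" using r by linarith
    then have "complex_of_int z = of_nat (nat z)" by simp
    then show ?thesis using z by (metis of_nat_in_Nats)
  qed
  then show ?thesis using dot0_wl[OF w] by (simp add: dominant_wrt_sub_def)
qed

text \<open>alpha_j - alpha_i has coefficients of both signs and so is no root; hence a root vector
  for alpha_j is a highest weight vector for the sl2-triple of -alpha_i.\<close>

lemma cartan_offdiag: assumes ij: "i \<noteq> j" shows "Re (cp (\<alpha> j) (\<alpha> i)) \<le> 0"
proof -
  define \<beta> where "\<beta> = (\<lambda>x. - \<alpha> i x)"
  have b: "\<beta> \<in> R" unfolding \<beta>_def by (rule neg_R[OF simple_R])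
  obtain e f where e: "e \<in> RS \<beta>" "e \<noteq> 0" and f: "f \<in> RS (\<lambda>x. - \<beta> x)" and ef: "brk e f = cor \<beta>"
    by (rule sl2[OF b])
  obtain y where y: "y \<in> RS (\<alpha> j)" "y \<noteq> 0" using simple_R[of j] R_iff by auto
  have nw: "(\<lambda>x. \<alpha> j x - \<alpha> i x) \<notin> R"
  proof
    have e: "(\<lambda>x. \<alpha> j x - \<alpha> i x) = rc (\<lambda>k. if k = j then 1 else if k = i then - 1 else 0)"
    proof
      fix x
      have "(\<Sum>k\<in>UNIV. (if k = j then 1 else if k = i then - 1 else 0) * \<alpha> k x)
        = (\<Sum>k\<in>UNIV. (if k = j then \<alpha> j x else 0) - (if k = i then \<alpha> i x else 0))"
        by (rule sum.cong) (use ij in auto)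
      also have "\<dots> = \<alpha> j x - \<alpha> i x" by (simp add: sum_subtractf)
      finally show "\<alpha> j x - \<alpha> i x = rc (\<lambda>k. if k = j then 1 else if k = i then - 1 else 0) x"
        by (simp add: root_comb_def)
    qed
    assume "(\<lambda>x. \<alpha> j x - \<alpha> i x) \<in> R"
    then consider c :: "'i \<Rightarrow> nat" where "(\<lambda>x. \<alpha> j x - \<alpha> i x) = rc (\<lambda>k. of_nat (c k))"
      | c :: "'i \<Rightarrow> nat" where "(\<lambda>x. \<alpha> j x - \<alpha> i x) = rc (\<lambda>k. - of_nat (c k))"
      using sroots unfolding simple_roots_def pos_roots_def neg_roots_def by blast
    then show False
    proof cases
      case 1
      from fun_cong[OF rc_inj[OF this[unfolded e]], of i] ij have "- 1 = complex_of_nat (c i)" by simp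
      from arg_cong[OF this, of Re] show False by simp
    next
      case 2
      from fun_cong[OF rc_inj[OF this[unfolded e]], of j] ij have "1 = - complex_of_nat (c j)" by simp
      from arg_cong[OF this, of Re] show False by simp
    qed
  qed
  have ey: "brk e y = 0"
  proof (rule ccontr)
    assume n: "brk e y \<noteq> 0"
    have "brk e y \<in> RS (\<lambda>x. \<alpha> j x - \<alpha> i x)" using RS_br[OF e(1) y(1)] by (simp add: \<beta>_def)
    moreover have "(\<lambda>x. \<alpha> j x - \<alpha> i x) \<in> hs" using simple_R R_hs hs_lin(4) by blast
    moreover have "(\<lambda>x. \<alpha> j x - \<alpha> i x) \<noteq> (\<lambda>_. 0)"
    proof
      assume "(\<lambda>x. \<alpha> j x - \<alpha> i x) = (\<lambda>_. 0)"
      then have "\<alpha> j = \<alpha> i" by (simp add: fun_eq_iff)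
      then have "rc (\<lambda>k. if k = j then 1 else 0) = rc (\<lambda>k. if k = i then 1 else 0)" by (simp add: rc_simple)
      from fun_cong[OF rc_inj[OF this], of j] ij show False by simp
    qed
    ultimately show False using nw n by (auto simp: R_iff)
  qed
  obtain m where "\<alpha> j (cor \<beta>) = of_nat m"
    using highest_weight[OF b f ef y(1) R_hs[OF simple_R] y(2) ey] by blast
  then have "- \<alpha> j (cor (\<alpha> i)) = of_nat m" using cor_neg[OF simple_R simple_R, of j i] by (simp add: \<beta>_def)
  from arg_cong[OF this, of Re] show ?thesis by (simp add: pairing R_hs simple_R)
qed

lemma qdatum_lie:
  assumes "qpar D \<noteq> 0" "\<forall>k>0. qpar D ^ k \<noteq> 1"
  shows "qdatum D"
  by unfold_locales
    (use assms frm_wl alpha_wl frm_sym half_length frm_nz alpha_pairing cartan_offdiag simple_R R_hs in auto)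

text \<open>\<open>finsum\<close> is a genuine sum only over finite sets. The elements w with w ->
  w' are among the products of w' with reflections in positive roots.\<close>

lemma arrow_finite: "finite {w. arrow D w w'}"
  by (rule finite_subset[of _ "(\<lambda>\<beta>. rfl \<beta> \<otimes>\<^bsub>BG\<^esub> w') ` P"]) (use finite_P in \<open>auto simp: arrow_def\<close>)

end

subsection \<open>Singular vectors of Verma modules\<close>

lemma left_idealI:
  assumes "ring R" "J \<subseteq> carrier R" "J \<noteq> {}" "\<And>x y. x \<in> J \<Longrightarrow> y \<in> J \<Longrightarrow> x \<oplus>\<^bsub>R\<^esub> y \<in> J"
    "\<And>a x. a \<in> carrier R \<Longrightarrow> x \<in> J \<Longrightarrow> a \<otimes>\<^bsub>R\<^esub> x \<in> J"
  shows "left_ideal J R"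
proof -
  interpret R: ring R by (rule assms(1))
  have "\<ominus>\<^bsub>R\<^esub> x \<in> J" if "x \<in> J" for x
    using assms(5)[of "\<ominus>\<^bsub>R\<^esub> \<one>\<^bsub>R\<^esub>" x] that assms(2) by (simp add: R.l_minus subsetD)
  then have "subgroup J (add_monoid R)"
    using assms(2,3,4) by (intro group.subgroupI[OF R.add.is_group]) (auto simp: a_inv_def)
  then show ?thesis using assms(5) by (simp add: left_ideal_def additive_subgroup_def)
qed

lemma left_ideal_verma: "left_ideal (verma_ideal D \<mu>) (Uq D)"
proof -
  interpret U: ring "Uq D" by (rule Uq_ring)
  let ?X = "{J. left_ideal J (Uq D) \<and> (\<forall>i. ucl D (gen (QE i)) \<in> J) \<and>
     (\<forall>j. ucl D (gen (QK j) - const (qpow D (frm D \<mu> (simp_root D j)))) \<in> J)}"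
  have v: "verma_ideal D \<mu> = \<Inter>?X" by (simp add: verma_ideal_def)
  have c: "carrier (Uq D) \<in> ?X" by (auto intro!: left_idealI Uq_ring)
  have s: "J \<subseteq> carrier (Uq D)" "\<zero>\<^bsub>Uq D\<^esub> \<in> J" "x \<in> J \<Longrightarrow> y \<in> J \<Longrightarrow> x \<oplus>\<^bsub>Uq D\<^esub> y \<in> J"
    "a \<in> carrier (Uq D) \<Longrightarrow> x \<in> J \<Longrightarrow> a \<otimes>\<^bsub>Uq D\<^esub> x \<in> J" if "J \<in> ?X" for J x y a
    using that additive_subgroup.a_subset[of J "Uq D"] additive_subgroup.zero_closed[of J "Uq D"]
      additive_subgroup.a_closed[of J "Uq D" x y]
    by (auto simp: left_ideal_def)
  show ?thesis unfolding v
  proof (rule left_idealI[OF Uq_ring])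
    show "\<Inter>?X \<subseteq> carrier (Uq D)" using c by blast
    show "\<Inter>?X \<noteq> {}" using s(2) by blast
    show "x \<oplus>\<^bsub>Uq D\<^esub> y \<in> \<Inter>?X" if "x \<in> \<Inter>?X" "y \<in> \<Inter>?X" for x y using that s(3) by blast
    show "a \<otimes>\<^bsub>Uq D\<^esub> x \<in> \<Inter>?X" if "a \<in> carrier (Uq D)" "x \<in> \<Inter>?X" for a x using that s(4) by blast
  qed
qed

lemma verma_facts:
  fixes D :: "('g, 'i) qflag"
  assumes a: "a \<in> carrier (Uq D)"
  shows "verma_ideal D \<mu> +>\<^bsub>Uq D\<^esub> a \<in> carrier (verma D \<mu>)"
    "u \<in> carrier (Uq D) \<Longrightarrow> u \<odot>\<^bsub>verma D \<mu>\<^esub> (verma_ideal D \<mu> +>\<^bsub>Uq D\<^esub> a) = verma_ideal D \<mu> +>\<^bsub>Uq D\<^esub> (u \<otimes>\<^bsub>Uq D\<^esub> a)"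
    "verma_ideal D \<mu> +>\<^bsub>Uq D\<^esub> a = verma_ideal D \<mu> \<longleftrightarrow> a \<in> verma_ideal D \<mu>"
proof -
  interpret U: ring "Uq D" by (rule Uq_ring)
  define J where "J = verma_ideal D \<mu>"
  have J: "left_ideal J (Uq D)" unfolding J_def by (rule left_ideal_verma)
  then have s: "subgroup J (add_monoid (Uq D))" by (simp add: left_ideal_def additive_subgroup_def)
  interpret J: additive_subgroup J "Uq D" using J by (simp add: left_ideal_def)
  interpret JA: abelian_subgroup J "Uq D"
    by (rule abelian_subgroupI3) unfold_locales
  show "verma_ideal D \<mu> +>\<^bsub>Uq D\<^esub> a \<in> carrier (verma D \<mu>)"
    using U.a_rcosetsI[OF J.a_subset a] by (simp add: verma_def Let_def J_def)
  show "verma_ideal D \<mu> +>\<^bsub>Uq D\<^esub> a = verma_ideal D \<mu> \<longleftrightarrow> a \<in> verma_ideal D \<mu>"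
    unfolding J_def[symmetric] using U.a_coset_join1[OF _ a s] U.a_coset_join2[OF a s] by blast
  assume u: "u \<in> carrier (Uq D)"
  have "the_elem ((\<lambda>a. J +>\<^bsub>Uq D\<^esub> (u \<otimes>\<^bsub>Uq D\<^esub> a)) ` (J +>\<^bsub>Uq D\<^esub> a)) = J +>\<^bsub>Uq D\<^esub> (u \<otimes>\<^bsub>Uq D\<^esub> a)"
  proof (rule the_elem_image_eq)
    fix b assume "b \<in> J +>\<^bsub>Uq D\<^esub> a"
    then obtain x where x: "x \<in> J" "b = x \<oplus>\<^bsub>Uq D\<^esub> a" by (auto simp: a_r_coset_def r_coset_def)
    have ux: "u \<otimes>\<^bsub>Uq D\<^esub> x \<in> J" using J u x by (simp add: left_ideal_def)
    have "u \<otimes>\<^bsub>Uq D\<^esub> b = u \<otimes>\<^bsub>Uq D\<^esub> x \<oplus>\<^bsub>Uq D\<^esub> u \<otimes>\<^bsub>Uq D\<^esub> a"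
      using x u a J.a_subset by (auto simp: U.r_distr)
    then have "u \<otimes>\<^bsub>Uq D\<^esub> b \<in> J +>\<^bsub>Uq D\<^esub> (u \<otimes>\<^bsub>Uq D\<^esub> a)"
      using ux by (auto simp: a_r_coset_def r_coset_def)
    from U.a_repr_independence[OF this _ s] u a
    show "J +>\<^bsub>Uq D\<^esub> (u \<otimes>\<^bsub>Uq D\<^esub> b) = J +>\<^bsub>Uq D\<^esub> (u \<otimes>\<^bsub>Uq D\<^esub> a)" by simp
  next
    show "J +>\<^bsub>Uq D\<^esub> a \<noteq> {}" using JA.a_rcos_self[OF a] by blast
  qed
  then show "u \<odot>\<^bsub>verma D \<mu>\<^esub> (verma_ideal D \<mu> +>\<^bsub>Uq D\<^esub> a) = verma_ideal D \<mu> +>\<^bsub>Uq D\<^esub> (u \<otimes>\<^bsub>Uq D\<^esub> a)"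
    by (simp add: verma_def Let_def J_def)
qed

text \<open>E_k kills the generator of the Verma module of w.0, hence also its image in the one of
  weight 0. This is the image of y0 v under the embedding belonging to w', whose injectivity gives
  E_k y0 v = 0.\<close>

lemma embedding_singular:
  assumes emb: "verma_embeddings D \<iota>" and el: "embedding_elements D \<iota> y0" and ar: "arrow D w w'"
  shows "ucl D (gen (QE k)) \<otimes>\<^bsub>Uq D\<^esub> y0 w w' \<in> verma_ideal D (dot0 D w')"
proof -
  interpret U: ring "Uq D" by (rule Uq_ring)
  define \<mu> where "\<mu> = dot0 D w"
  define \<nu> where "\<nu> = dot0 D w'"
  let ?I = "\<lambda>\<mu>. verma_ideal D \<mu>"
  let ?v = "\<lambda>\<mu> a. ?I \<mu> +>\<^bsub>Uq D\<^esub> a"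
  let ?E = "ucl D (gen (QE k))"
  have W: "w \<in> weyl D" "w' \<in> weyl D" using ar by (auto simp: arrow_def)
  have y: "y0 w w' \<in> Un_minus D" and e: "\<iota> w (verma_vec D \<mu>) = \<iota> w' (y0 w w' \<odot>\<^bsub>verma D \<nu>\<^esub> verma_vec D \<nu>)"
    using el ar by (auto simp: embedding_elements_def \<mu>_def \<nu>_def)
  have yc: "y0 w w' \<in> carrier (Uq D)"
    by (rule U.generate_ring_in_carrier[OF _ y[unfolded Un_minus_def]]) (auto simp: scal_def)
  have E: "?E \<in> ?I \<mu>" by (auto simp: verma_ideal_def)
  have hom: "\<iota> w (a \<odot>\<^bsub>verma D (dot0 D w)\<^esub> x) = a \<odot>\<^bsub>verma D (\<lambda>_. 0)\<^esub> \<iota> w x"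
    if "w \<in> weyl D" "a \<in> carrier (Uq D)" "x \<in> carrier (verma D (dot0 D w))" for a x w
    using emb that unfolding verma_embeddings_def lmod_hom_def by blast
  have vec: "verma_vec D \<gamma> = ?v \<gamma> \<one>\<^bsub>Uq D\<^esub>" for \<gamma> by (simp add: verma_vec_def)
  have zero: "\<zero>\<^bsub>Uq D\<^esub> \<in> ?I \<gamma>" for \<gamma>
    using left_ideal_verma[of D \<gamma>] by (auto simp: left_ideal_def additive_subgroup.zero_closed)
  \<comment> \<open>Being zero is written as the action of the zero of the algebra, a form that
    module homomorphisms transport at once.\<close>
  have "?E \<odot>\<^bsub>verma D \<mu>\<^esub> verma_vec D \<mu> = \<zero>\<^bsub>Uq D\<^esub> \<odot>\<^bsub>verma D \<mu>\<^esub> verma_vec D \<mu>"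
    unfolding vec using E zero verma_facts(3)[of ?E D \<mu>] verma_facts(3)[of "\<zero>\<^bsub>Uq D\<^esub>" D \<mu>]
    by (simp add: verma_facts(2))
  from arg_cong[OF this, of "\<iota> w"]
  have "?E \<odot>\<^bsub>verma D (\<lambda>_. 0)\<^esub> \<iota> w (verma_vec D \<mu>) = \<zero>\<^bsub>Uq D\<^esub> \<odot>\<^bsub>verma D (\<lambda>_. 0)\<^esub> \<iota> w (verma_vec D \<mu>)"
    using hom[OF W(1), of _ "verma_vec D \<mu>", folded \<mu>_def] verma_facts(1)[of "\<one>\<^bsub>Uq D\<^esub>" D \<mu>] by (simp add: vec)
  moreover have yv: "y0 w w' \<odot>\<^bsub>verma D \<nu>\<^esub> verma_vec D \<nu> = ?v \<nu> (y0 w w')"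
    using verma_facts(2)[OF U.one_closed yc, of \<nu>] yc by (simp add: vec)
  ultimately have "\<iota> w' (?E \<odot>\<^bsub>verma D \<nu>\<^esub> ?v \<nu> (y0 w w')) = \<iota> w' (\<zero>\<^bsub>Uq D\<^esub> \<odot>\<^bsub>verma D \<nu>\<^esub> ?v \<nu> (y0 w w'))"
    using hom[OF W(2), of _ "?v \<nu> (y0 w w')", folded \<nu>_def] verma_facts(1)[OF yc, of \<nu>] by (simp add: e)
  then have eq: "\<iota> w' (?v \<nu> (?E \<otimes>\<^bsub>Uq D\<^esub> y0 w w')) = \<iota> w' (?v \<nu> \<zero>\<^bsub>Uq D\<^esub>)"
    using yc by (simp add: verma_facts(2))
  have inj: "inj_on (\<iota> w') (carrier (verma D \<nu>))"
    using emb W(2) by (simp add: verma_embeddings_def \<nu>_def)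
  have "?v \<nu> (?E \<otimes>\<^bsub>Uq D\<^esub> y0 w w') = ?v \<nu> \<zero>\<^bsub>Uq D\<^esub>"
    by (rule inj_onD[OF inj eq verma_facts(1)[OF U.m_closed[OF ucl_closed yc]] verma_facts(1)[OF U.zero_closed]])
  also have "\<dots> = ?I \<nu>" using verma_facts(3)[of "\<zero>\<^bsub>Uq D\<^esub>" D \<nu>] zero by simp
  finally show ?thesis using verma_facts(3)[of "?E \<otimes>\<^bsub>Uq D\<^esub> y0 w w'" D \<nu>] yc by (simp add: \<nu>_def)
qed

context qdatum
begin

abbreviation "wchar \<mu> \<equiv> (\<lambda>j. qpow D (frm D \<mu> (simp_root D j)))"

lemma wchar0: "wchar \<mu> j \<noteq> 0"
  using q0 by (simp add: qpow_def)

text \<open>Modulo \<open>serre_ideal\<close>, the vector 1 of the free module satisfies the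
  defining relations of a highest weight vector, so whatever kills the generator of the Verma module
  kills it too.\<close>

lemma verma_ideal_vrep:
  assumes "ucl D p \<in> verma_ideal D \<mu>" shows "app (vrep (wchar \<mu>) p) 1 \<in> serre_ideal"
proof -
  define \<chi> where "\<chi> = wchar \<mu>"
  have c0: "\<And>j. \<chi> j \<noteq> 0" using wchar0 by (simp add: \<chi>_def)
  define L where "L = {p. app (vrep \<chi> p) 1 \<in> serre_ideal}"
  have L: "p \<in> L \<Longrightarrow> q \<in> L \<Longrightarrow> p + q \<in> L" "p \<in> L \<Longrightarrow> a * p \<in> L" "p \<in> rel_ideal D \<Longrightarrow> p \<in> L" for a p q
    using serre_ideal_vrep[of \<chi>, OF c0] rel_ideal_vrep[of \<chi>, OF c0]
    by (auto simp: L_def vrep_simps app_simps intro: serre_ideal.intros)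
  have m: "(1 :: 'i word \<Rightarrow>\<^sub>0 complex) = mono []" by (simp add: mono_simps)
  have "left_ideal (ucl D ` L) (Uq D)"
  proof (rule left_idealI[OF Uq_ring])
    show "ucl D ` L \<noteq> {}" using L(3) two_sidedD(1)[OF two_sided_rel_ideal[of D]] by blast
    show "x \<oplus>\<^bsub>Uq D\<^esub> y \<in> ucl D ` L" if "x \<in> ucl D ` L" "y \<in> ucl D ` L" for x y
      using that L(1) by (auto simp: ucl_add[symmetric])
    show "a \<otimes>\<^bsub>Uq D\<^esub> x \<in> ucl D ` L" if "a \<in> carrier (Uq D)" "x \<in> ucl D ` L" for a x
      using that L(2) by (auto simp: ucl_mult[symmetric] carrier_Uq)
  qed auto
  moreover have "gen (QE i) \<in> L" for i
    by (simp add: L_def vrep_simps m app_mono serre_ideal.intros)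
  moreover have "gen (QK j) - const (\<chi> j) \<in> L" for j
  proof -
    have "app (LK \<chi> j) 1 = const (\<chi> j)" using app_mono(2)[of \<chi> j "[]"] by (simp add: mono_simps kap_simps)
    then show ?thesis by (simp add: L_def vrep_simps app_simps app_lscal serre_ideal_zero)
  qed
  ultimately have "verma_ideal D \<mu> \<subseteq> ucl D ` L"
    unfolding verma_ideal_def \<chi>_def by (intro Inter_lower) auto
  then obtain q where q: "q \<in> L" "ucl D p = ucl D q" using assms by auto
  \<comment> \<open>L contains the relation ideal, so membership does not depend on the
    representative.\<close>
  then have "(p - q) + q \<in> L" using L(1,3) by (metis ucl_eq)
  then show ?thesis by (simp add: L_def \<chi>_def)
qed

lemma Un_minus_liftF: assumes "u \<in> Un_minus D" shows "\<exists>a. u = ucl D (liftF a)"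
  using assms unfolding Un_minus_def
proof (induction rule: generate_ring.induct)
  case one
  then show ?case using lift_simps(2) by (metis ucl_one)
next
  case (incl h)
  then consider i where "h = ucl D (gen (QF i))" | c where "h = scal D c" by blast
  then show ?case
  proof cases
    case 1
    then show ?thesis using lift_simps(6) by metis
  next
    case 2
    then show ?thesis unfolding scal_def using lift_simps(5) by metis
  qed
next
  case (a_inv h)
  then obtain a where "h = ucl D (liftF a)" by blast
  moreover have "liftF (const (- 1) * a) = - liftF a"
    unfolding lift_simps by (simp add: cst.sc_minus cst.sc_one)
  ultimately have "\<ominus>\<^bsub>Uq D\<^esub> h = ucl D (liftF (const (- 1) * a))" by (simp only: ucl_minus)
  then show ?case by blast
next
  case (eng_add h1 h2)
  then show ?case using lift_simps(3) by (metis ucl_add)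
next
  case (eng_mult h1 h2)
  then show ?case using lift_simps(4) by (metis ucl_mult)
qed

text \<open>The sign is absorbed into the polynomial a, which is read once in the F_i, giving y, and
  once in the E_i, giving x.\<close>

lemma embedding_elements_singular:
  assumes "verma_embeddings D \<iota>" "embedding_elements D \<iota> y0" "arrow D w w'"
  shows "\<exists>a. singular (wchar (dot0 D w')) a \<and> y_elt D s y0 w w' = ucl D (liftF a) \<and> x_elt D s y0 w w' = ucl D (liftE a)"
proof -
  let ?\<chi> = "wchar (dot0 D w')"
  have "y0 w w' \<in> Un_minus D" using assms(2,3) by (simp add: embedding_elements_def)
  then obtain b where b: "y0 w w' = ucl D (liftF b)" using Un_minus_liftF by blast
  have "app (LD ?\<chi> k) b \<in> serre_ideal" for k
    using verma_ideal_vrep[of "gen (QE k) * liftF b"] embedding_singular[OF assms, of k]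
    by (simp add: b ucl_mult vrep_simps vrep_liftF app_simps app_lmul)
  then have "singular ?\<chi> (const c * b)" for c
    by (simp add: singular_def app_const serre_ideal_const)
  moreover have "y_elt D s y0 w w' = ucl D (liftF (const (of_int (s w w')) * b))"
    by (simp add: y_elt_def b scal_def ucl_mult lift_simps)
  ultimately show ?thesis by (auto simp: x_elt_def eta_liftF)
qed

end

subsection \<open>Anticommutation\<close>

lemma (in abelian_monoid) finsum_swap:
  assumes "finite A" "finite B" "\<And>a b. a \<in> A \<Longrightarrow> b \<in> B \<Longrightarrow> f a b \<in> carrier G"
  shows "(\<Oplus>a\<in>A. \<Oplus>b\<in>B. f a b) = (\<Oplus>b\<in>B. \<Oplus>a\<in>A. f a b)"
  using assms(1,3)
proof (induction A rule: finite_induct)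
  case empty
  then show ?case by simp
next
  case (insert x A)
  have "(\<Oplus>b\<in>B. \<Oplus>a\<in>insert x A. f a b) = (\<Oplus>b\<in>B. f x b \<oplus> (\<Oplus>a\<in>A. f a b))"
    by (rule finsum_cong') (use insert in \<open>auto intro!: finsum_closed finsum_insert\<close>)
  also have "\<dots> = (\<Oplus>b\<in>B. f x b) \<oplus> (\<Oplus>b\<in>B. \<Oplus>a\<in>A. f a b)"
    by (rule finsum_addf) (use insert in \<open>auto intro!: finsum_closed\<close>)
  also have "\<dots> = (\<Oplus>a\<in>insert x A. \<Oplus>b\<in>B. f a b)"
    using insert by (subst finsum_insert) (auto intro!: finsum_closed)
  finally show ?case ..
qed

lemma additive_finsum:
  assumes "abelian_group G" "abelian_group H" "f \<in> carrier G \<rightarrow> carrier H"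
    and "\<And>x y. x \<in> carrier G \<Longrightarrow> y \<in> carrier G \<Longrightarrow> f (x \<oplus>\<^bsub>G\<^esub> y) = f x \<oplus>\<^bsub>H\<^esub> f y"
    and "finite A" "\<And>a. a \<in> A \<Longrightarrow> g a \<in> carrier G"
  shows "f (\<Oplus>\<^bsub>G\<^esub>a\<in>A. g a) = (\<Oplus>\<^bsub>H\<^esub>a\<in>A. f (g a))"
proof -
  interpret G: abelian_group G by (rule assms(1))
  interpret H: abelian_group H by (rule assms(2))
  have z: "f \<zero>\<^bsub>G\<^esub> = \<zero>\<^bsub>H\<^esub>"
    using assms(4)[of "\<zero>\<^bsub>G\<^esub>" "\<zero>\<^bsub>G\<^esub>"] assms(3) H.add.l_cancel_one[of "f \<zero>\<^bsub>G\<^esub>" "f \<zero>\<^bsub>G\<^esub>"] by (auto simp: Pi_iff)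
  show ?thesis using assms(5,6)
  proof (induction A rule: finite_induct)
    case (insert a A)
    then have "g \<in> A \<rightarrow> carrier G" "(\<lambda>a. f (g a)) \<in> A \<rightarrow> carrier H" "f (g a) \<in> carrier H"
      using assms(3) by auto
    then show ?case using insert assms(4) by simp
  qed (simp add: z)
qed

context cyclic_pair
begin

interpretation UU: ring "Uq D" by (rule Uq_ring)

text \<open>The annihilator of the generator of W takes the place of the left ideal in
  \<open>qcore\<close>.\<close>

lemma we_commute:
  assumes "\<And>j. \<psi> j \<noteq> 0" "\<And>j. cx j = inverse (\<psi> j)"
    and "M.singular cv y" "M.singular \<psi> x" "u \<in> carrier (Uq D)"
  shows "we (u \<otimes>\<^bsub>Uq D\<^esub> ucl D (M.liftF y) \<otimes>\<^bsub>Uq D\<^esub> ucl D (M.liftE x))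
    = we (u \<otimes>\<^bsub>Uq D\<^esub> ucl D (M.liftE x) \<otimes>\<^bsub>Uq D\<^esub> ucl D (M.liftF y))"
proof -
  interpret WW: abelian_group W by (rule W_abelian)
  interpret Q: qcore D LL cv \<psi>
    by unfold_locales (use cv0 assms LL_props in auto)
  obtain a where a: "u = ucl D a" using assms(5) by (auto simp: carrier_Uq)
  let ?y = "M.liftF y" and ?x = "M.liftE x"
  have "?y * ?x - ?x * ?y \<in> LL" by (rule Q.singular_commute[OF assms(3,4)])
  then have "we (ucl D (a * (?y * ?x - ?x * ?y))) = \<zero>\<^bsub>W\<^esub>" by (simp add: LL_def)
  then have "we (ucl D (a * ?x * ?y)) = we (ucl D (a * (?y * ?x - ?x * ?y) + a * ?x * ?y))"
    by (simp only: ucl_add) (simp add: we_add we_closed)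
  also have "a * (?y * ?x - ?x * ?y) + a * ?x * ?y = a * ?y * ?x" by (simp add: algebra_simps)
  finally show ?thesis by (simp add: a ucl_mult)
qed

end

locale bgg_data = lie_setup D
  for D :: "('g::ab_group_add, 'i::finite) qflag" +
  fixes M :: "'g wt \<Rightarrow> ('i uq, 'm) module"
    and v :: "'g wt \<Rightarrow> 'm"
    and \<xi> :: "'g wt \<Rightarrow> 'm \<Rightarrow> complex"
    and \<iota> :: "'g wgt \<Rightarrow> 'i uq set \<Rightarrow> 'i uq set"
    and y0 :: "'g wgt \<Rightarrow> 'g wgt \<Rightarrow> 'i uq"
    and s :: "'g wgt \<Rightarrow> 'g wgt \<Rightarrow> int"
    and h h' :: "'g wgt \<Rightarrow> 'g wgt \<Rightarrow> 'g wgt \<Rightarrow> ('i, 'm) wel \<Rightarrow> ('i, 'm) wel"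
  assumes q: "qpar D \<noteq> 0" "\<forall>k>0. qpar D ^ k \<noteq> 1"
    and levi: "\<forall>\<mu>\<in>dominant_wrt_sub D. levi_module D (M \<mu>) \<mu> (v \<mu>)"
    and lowest: "\<forall>\<mu>\<in>dominant_wrt_sub D.
           lowest_weight_vector D (dual_module D (M \<mu>)) (\<lambda>x. - \<mu> x) (\<xi> \<mu>)"
    and emb: "verma_embeddings D \<iota>" "embedding_elements D \<iota> y0"
    and hom1: "h_first D M v \<xi> (y_elt D s y0) h"
    and hom2: "h_second D M v \<xi> (x_elt D s y0) h'"
begin

sublocale Q: qdatum D
  by (rule qdatum_lie[OF q])

abbreviation "MR \<equiv> min_reps D"
abbreviation "WM w1 w2 \<equiv> Wmod D M (dot0 D w1) (dot0 D w2)"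
abbreviation "WE w1 w2 \<equiv> welt D M v \<xi> (dot0 D w1) (dot0 D w2)"

lemma cyclic:
  assumes m: "\<mu> \<in> dominant_wrt_sub D" and n: "\<nu> \<in> dominant_wrt_sub D"
  shows "cyclic_pair D (M \<mu>) (dual_module D (M \<nu>)) (v \<mu>) (\<xi> \<nu>) (Q.wchar \<mu>) (Q.wchar (\<lambda>x. - \<nu> x))"
proof -
  have l: "levi_module D (M \<mu>) \<mu> (v \<mu>)" "levi_module D (M \<nu>) \<nu> (v \<nu>)"
    and low: "lowest_weight_vector D (dual_module D (M \<nu>)) (\<lambda>x. - \<nu> x) (\<xi> \<nu>)"
    using levi lowest m n by auto
  interpret A: levi_mod D "M \<mu>" by unfold_locales (use l in \<open>simp add: levi_module_def simple_module_def\<close>)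
  interpret B: levi_mod D "M \<nu>" by unfold_locales (use l in \<open>simp add: levi_module_def simple_module_def\<close>)
  interpret B': levi_mod D "dual_module D (M \<nu>)" by (rule B.dual_levi_mod)
  have v: "v \<mu> \<in> carrier (M \<mu>)" "v \<mu> \<noteq> \<zero>\<^bsub>M \<mu>\<^esub>"
    "\<And>j. A.mact (gen (QK j)) (v \<mu>) = A.mact (const (Q.wchar \<mu> j)) (v \<mu>)"
    "\<And>i. i \<in> sub D \<Longrightarrow> A.mact (gen (QE i)) (v \<mu>) = \<zero>\<^bsub>M \<mu>\<^esub>"
    using l(1) by (auto simp: levi_module_def highest_weight_vector_def weight_vector_def A.mact_def scal_def)
  have x: "\<xi> \<nu> \<in> carrier (dual_module D (M \<nu>))" "\<xi> \<nu> \<noteq> \<zero>\<^bsub>dual_module D (M \<nu>)\<^esub>"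
    "\<And>j. B'.mact (gen (QK j)) (\<xi> \<nu>) = B'.mact (const (Q.wchar (\<lambda>x. - \<nu> x) j)) (\<xi> \<nu>)"
    "\<And>i. i \<in> sub D \<Longrightarrow> B'.mact (gen (QF i)) (\<xi> \<nu>) = \<zero>\<^bsub>dual_module D (M \<nu>)\<^esub>"
    using low by (auto simp: lowest_weight_vector_def weight_vector_def B'.mact_def scal_def)
  have s: "simple_module (Ul D) (M \<mu>)" "simple_module (Ul D) (M \<nu>)" "fin_dim D (M \<nu>)"
    using l by (auto simp: levi_module_def)
  show ?thesis
    by unfold_locales
      (use v x Q.wchar0 A.cyc_all[OF s(1) v(1,2,4)] B.dual_cyc_all[OF s(2,3) x(1,2,4)] in auto)
qed

lemma hh_commute:
  assumes w: "w1 \<in> MR" "w2 \<in> MR" "w1' \<in> MR" "w2' \<in> MR" and ar: "arrow D w1 w1'" "arrow D w2 w2'"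
    and X: "X \<in> carrier (WM w1 w2)"
  shows "h' w1' w2 w2' (h w1 w1' w2 X) = h w1 w1' w2' (h' w1 w2 w2' X)"
proof -
  interpret U: ring "Uq D" by (rule Uq_ring)
  note dm = dot0_dominant
  interpret C: cyclic_pair D "M (dot0 D w1)" "dual_module D (M (dot0 D w2))" "v (dot0 D w1)" "\<xi> (dot0 D w2)"
    "Q.wchar (dot0 D w1)" "Q.wchar (\<lambda>x. - dot0 D w2 x)"
    by (rule cyclic[OF dm[OF w(1)] dm[OF w(2)]])
  interpret C': cyclic_pair D "M (dot0 D w1')" "dual_module D (M (dot0 D w2'))" "v (dot0 D w1')" "\<xi> (dot0 D w2')"
    "Q.wchar (dot0 D w1')" "Q.wchar (\<lambda>x. - dot0 D w2' x)"
    by (rule cyclic[OF dm[OF w(3)] dm[OF w(4)]])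
  have "X \<in> carrier C.W" using X by (simp add: Wmod_def C.W_def C.T_def)
  from C.W_cyclic[OF this] obtain u where u: "u \<in> carrier (Uq D)" "X = C.we u" by blast
  have Xw: "X = WE w1 w2 u"
    unfolding u(2) welt_def Let_def C.we_def C.iw.pure_def C.iw.cl_def C.iw.K_def C.ct.pure_def C.ct.cl_def C.ct.K_def
      induced_ker_def ctens_ker_def by (simp only: C.T_def)
  have we': "WE w1' w2' u = C'.we u" for u
    unfolding welt_def Let_def C'.we_def C'.iw.pure_def C'.iw.cl_def C'.iw.K_def C'.ct.pure_def C'.ct.cl_def C'.ct.K_def
      induced_ker_def ctens_ker_def by (simp only: C'.T_def)
  obtain y where y: "Q.singular (Q.wchar (dot0 D w1')) y" "y_elt D s y0 w1 w1' = ucl D (Q.liftF y)"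
    using Q.embedding_elements_singular[OF emb ar(1)] by blast
  obtain x where x: "Q.singular (Q.wchar (dot0 D w2')) x" "x_elt D s y0 w2 w2' = ucl D (Q.liftE x)"
    using Q.embedding_elements_singular[OF emb ar(2)] by blast
  have h1: "h w1 w1' w2 (WE w1 w2 u) = WE w1' w2 (u \<otimes>\<^bsub>Uq D\<^esub> y_elt D s y0 w1 w1')"
    if "u \<in> carrier (Uq D)" "w2 \<in> MR" for u w2
    using hom1 w ar that by (simp add: h_first_def)
  have h2: "h' w1 w2 w2' (WE w1 w2 u) = WE w1 w2' (u \<otimes>\<^bsub>Uq D\<^esub> x_elt D s y0 w2 w2')"
    if "u \<in> carrier (Uq D)" "w1 \<in> MR" for u w1
    using hom2 w ar that by (simp add: h_second_def)
  \<comment> \<open>\<xi> has weight -\<nu> with \<nu> = w2'.0, whereas the character \<psi> of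
    \<open>qcore\<close> is that of the mirrored module of highest weight \<nu>.\<close>
  have inv: "Q.wchar (\<lambda>x. - dot0 D w2' x) j = inverse (Q.wchar (dot0 D w2') j)" for j
  proof -
    have wl: "dot0 D w2' \<in> weight_lattice D" using dm[OF w(4)] by (simp add: dominant_wrt_sub_def)
    then have hs2: "dot0 D w2' \<in> hs" by (simp add: wl_iff)
    have "frm D (\<lambda>x. - dot0 D w2' x) (\<alpha> j) = - frm D (dot0 D w2') (\<alpha> j)"
      using frm_left[OF hs2 hs2 R_hs[OF simple_R], of "- 2" j] by simp
    then show ?thesis using qpow_minus[OF frm_wl[OF wl alpha_wl]] by simp
  qed
  have "h' w1' w2 w2' (h w1 w1' w2 X) = C'.we (u \<otimes>\<^bsub>Uq D\<^esub> ucl D (Q.liftF y) \<otimes>\<^bsub>Uq D\<^esub> ucl D (Q.liftE x))"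
    using u(1) w by (simp add: Xw h1 h2 y(2) x(2) we')
  also have "\<dots> = C'.we (u \<otimes>\<^bsub>Uq D\<^esub> ucl D (Q.liftE x) \<otimes>\<^bsub>Uq D\<^esub> ucl D (Q.liftF y))"
    by (rule C'.we_commute[OF Q.wchar0 inv y(1) x(1) u(1)])
  also have "\<dots> = h w1 w1' w2' (h' w1 w2 w2' X)"
    using u(1) w by (simp add: Xw h1 h2 y(2) x(2) we')
  finally show ?thesis .
qed

lemma WM_module:
  assumes w: "w1 \<in> MR" "w2 \<in> MR"
  shows "abelian_group (WM w1 w2)" "X \<in> carrier (WM w1 w2) \<Longrightarrow> scal D c \<odot>\<^bsub>WM w1 w2\<^esub> X \<in> carrier (WM w1 w2)"
    "X \<in> carrier (WM w1 w2) \<Longrightarrow> Y \<in> carrier (WM w1 w2) \<Longrightarrow>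
      scal D c \<odot>\<^bsub>WM w1 w2\<^esub> (X \<oplus>\<^bsub>WM w1 w2\<^esub> Y) = scal D c \<odot>\<^bsub>WM w1 w2\<^esub> X \<oplus>\<^bsub>WM w1 w2\<^esub> scal D c \<odot>\<^bsub>WM w1 w2\<^esub> Y"
    "X \<in> carrier (WM w1 w2) \<Longrightarrow> scal D c \<odot>\<^bsub>WM w1 w2\<^esub> X \<oplus>\<^bsub>WM w1 w2\<^esub> scal D (- c) \<odot>\<^bsub>WM w1 w2\<^esub> X = \<zero>\<^bsub>WM w1 w2\<^esub>"
proof -
  interpret C: cyclic_pair D "M (dot0 D w1)" "dual_module D (M (dot0 D w2))" "v (dot0 D w1)" "\<xi> (dot0 D w2)"
    "Q.wchar (dot0 D w1)" "Q.wchar (\<lambda>x. - dot0 D w2 x)"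
    by (rule cyclic[OF dot0_dominant[OF w(1)] dot0_dominant[OF w(2)]])
  have e: "WM w1 w2 = C.W" by (simp add: Wmod_def C.W_def C.T_def)
  show "abelian_group (WM w1 w2)" unfolding e by (rule C.W_abelian)
  show "X \<in> carrier (WM w1 w2) \<Longrightarrow> scal D c \<odot>\<^bsub>WM w1 w2\<^esub> X \<in> carrier (WM w1 w2)"
    unfolding e scal_def by (rule C.W_smult_closed) simp
  show "X \<in> carrier (WM w1 w2) \<Longrightarrow> Y \<in> carrier (WM w1 w2) \<Longrightarrow>
      scal D c \<odot>\<^bsub>WM w1 w2\<^esub> (X \<oplus>\<^bsub>WM w1 w2\<^esub> Y) = scal D c \<odot>\<^bsub>WM w1 w2\<^esub> X \<oplus>\<^bsub>WM w1 w2\<^esub> scal D c \<odot>\<^bsub>WM w1 w2\<^esub> Y"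
    unfolding e scal_def by (rule C.W_smult_add) simp
  have "scal D c \<oplus>\<^bsub>Uq D\<^esub> scal D (- c) = \<zero>\<^bsub>Uq D\<^esub>"
    by (simp add: scal_def ucl_add[symmetric] ucl_zero cst.sc_minus)
  then show "X \<in> carrier (WM w1 w2) \<Longrightarrow> scal D c \<odot>\<^bsub>WM w1 w2\<^esub> X \<oplus>\<^bsub>WM w1 w2\<^esub> scal D (- c) \<odot>\<^bsub>WM w1 w2\<^esub> X = \<zero>\<^bsub>WM w1 w2\<^esub>"
    unfolding e using C.W_add_smult[of "scal D c" "scal D (- c)" X] C.W_zero_smult[of X] by (simp add: scal_def)
qed

lemma h_hom:
  assumes "w1 \<in> MR" "w1' \<in> MR" "w2 \<in> MR" "arrow D w1 w1'"
  shows "X \<in> carrier (WM w1 w2) \<Longrightarrow> h w1 w1' w2 X \<in> carrier (WM w1' w2)"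
    "X \<in> carrier (WM w1 w2) \<Longrightarrow> Y \<in> carrier (WM w1 w2) \<Longrightarrow>
      h w1 w1' w2 (X \<oplus>\<^bsub>WM w1 w2\<^esub> Y) = h w1 w1' w2 X \<oplus>\<^bsub>WM w1' w2\<^esub> h w1 w1' w2 Y"
    "X \<in> carrier (WM w1 w2) \<Longrightarrow> h w1 w1' w2 (scal D c \<odot>\<^bsub>WM w1 w2\<^esub> X) = scal D c \<odot>\<^bsub>WM w1' w2\<^esub> h w1 w1' w2 X"
proof -
  have "h w1 w1' w2 \<in> lmod_hom (Uq D) (WM w1 w2) (WM w1' w2)"
    using hom1 assms by (simp add: h_first_def)
  then show "X \<in> carrier (WM w1 w2) \<Longrightarrow> h w1 w1' w2 X \<in> carrier (WM w1' w2)"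
    "X \<in> carrier (WM w1 w2) \<Longrightarrow> Y \<in> carrier (WM w1 w2) \<Longrightarrow>
      h w1 w1' w2 (X \<oplus>\<^bsub>WM w1 w2\<^esub> Y) = h w1 w1' w2 X \<oplus>\<^bsub>WM w1' w2\<^esub> h w1 w1' w2 Y"
    "X \<in> carrier (WM w1 w2) \<Longrightarrow> h w1 w1' w2 (scal D c \<odot>\<^bsub>WM w1 w2\<^esub> X) = scal D c \<odot>\<^bsub>WM w1' w2\<^esub> h w1 w1' w2 X"
    by (auto simp: lmod_hom_def scal_def)
qed

lemma h'_hom:
  assumes "w1 \<in> MR" "w2 \<in> MR" "w2' \<in> MR" "arrow D w2 w2'"
  shows "X \<in> carrier (WM w1 w2) \<Longrightarrow> h' w1 w2 w2' X \<in> carrier (WM w1 w2')"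
    "X \<in> carrier (WM w1 w2) \<Longrightarrow> Y \<in> carrier (WM w1 w2) \<Longrightarrow>
      h' w1 w2 w2' (X \<oplus>\<^bsub>WM w1 w2\<^esub> Y) = h' w1 w2 w2' X \<oplus>\<^bsub>WM w1 w2'\<^esub> h' w1 w2 w2' Y"
proof -
  have "h' w1 w2 w2' \<in> lmod_hom (Uq D) (WM w1 w2) (WM w1 w2')"
    using hom2 assms by (simp add: h_second_def)
  then show "X \<in> carrier (WM w1 w2) \<Longrightarrow> h' w1 w2 w2' X \<in> carrier (WM w1 w2')"
    "X \<in> carrier (WM w1 w2) \<Longrightarrow> Y \<in> carrier (WM w1 w2) \<Longrightarrow>
      h' w1 w2 w2' (X \<oplus>\<^bsub>WM w1 w2\<^esub> Y) = h' w1 w2 w2' X \<oplus>\<^bsub>WM w1 w2'\<^esub> h' w1 w2 w2' Y"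
    by (auto simp: lmod_hom_def)
qed

theorem differentials_anticommute:
  assumes n: "n \<ge> 1" and z: "z \<in> carrier (Cmod D M n m)"
  shows "d_second D M h' (n - 1) m (d_first D M h n m z)
      \<oplus>\<^bsub>Cmod D M (n - 1) (m - 1)\<^esub>
    d_first D M h n (m - 1) (d_second D M h' n m z) = \<zero>\<^bsub>Cmod D M (n - 1) (m - 1)\<^esub>"
proof -
  have main: "d_second D M h' (n - 1) m (d_first D M h n m z) (w1', w2')
      \<oplus>\<^bsub>WM w1' w2'\<^esub> d_first D M h n (m - 1) (d_second D M h' n m z) (w1', w2') = \<zero>\<^bsub>WM w1' w2'\<^esub>"
    if k: "(w1', w2') \<in> bidegree D (n - 1) (m - 1)" for w1' w2'
  proof -
    define A where "A = {w1 \<in> MR. weyl_length D w1 = n \<and> arrow D w1 w1'}"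
    define B where "B = {w2 \<in> MR. weyl_length D w2 = m \<and> arrow D w2 w2'}"
    have fin: "finite A" "finite B"
      using arrow_finite[of w1'] arrow_finite[of w2'] by (auto simp: A_def B_def elim: finite_subset[rotated])
    have w': "w1' \<in> MR" "w2' \<in> MR" "weyl_length D w1' = n - 1" "weyl_length D w2' = m - 1"
      using k by (auto simp: bidegree_def)
    have AD: "a \<in> MR" "arrow D a w1'" "weyl_length D a = n" if "a \<in> A" for a using that by (auto simp: A_def)
    have BD: "b \<in> MR" "arrow D b w2'" "weyl_length D b = m" if "b \<in> B" for b using that by (auto simp: B_def)
    have zc: "z (a, b) \<in> carrier (WM a b)" if "a \<in> A" "b \<in> B" for a b
    proof -
      have "(a, b) \<in> bidegree D n m" using AD[OF that(1)] BD[OF that(2)] by (simp add: bidegree_def)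
      then show ?thesis using z by (auto simp: Cmod_def direct_sum_def dest: PiE_mem)
    qed
    interpret W: abelian_group "WM w1' w2'" by (rule WM_module(1)[OF w'(1,2)])
    define F where "F = (\<lambda>a b. h' w1' b w2' (h a w1' b (z (a, b))))"
    have Fc: "F a b \<in> carrier (WM w1' w2')" if "a \<in> A" "b \<in> B" for a b
      unfolding F_def by (rule h'_hom(1)[OF w'(1) BD(1)[OF that(2)] w'(2) BD(2)[OF that(2)]],
          rule h_hom(1)[OF AD(1)[OF that(1)] w'(1) BD(1)[OF that(2)] AD(2)[OF that(1)]], rule zc[OF that])
    \<comment> \<open>Both composites reduce to this double sum up to sign; the second one meets it
      with the sums in the other order.\<close>
    define S where "S = (\<Oplus>\<^bsub>WM w1' w2'\<^esub>b\<in>B. \<Oplus>\<^bsub>WM w1' w2'\<^esub>a\<in>A. F a b)"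
    have Sc: "S \<in> carrier (WM w1' w2')" unfolding S_def by (intro W.finsum_closed) (auto intro!: W.finsum_closed Fc)
    have 1: "d_second D M h' (n - 1) m (d_first D M h n m z) (w1', w2') = scal D ((- 1) ^ (n - 1)) \<odot>\<^bsub>WM w1' w2'\<^esub> S"
    proof -
      have "h' w1' b w2' (d_first D M h n m z (w1', b)) = (\<Oplus>\<^bsub>WM w1' w2'\<^esub>a\<in>A. F a b)" if b: "b \<in> B" for b
      proof -
        have "(w1', b) \<in> bidegree D (n - 1) m" using w' BD[OF b] by (simp add: bidegree_def)
        then have d: "d_first D M h n m z (w1', b) = (\<Oplus>\<^bsub>WM w1' b\<^esub>a\<in>A. h a w1' b (z (a, b)))"
          by (simp add: d_first_def A_def)
        show ?thesis unfolding d F_def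
        proof (rule additive_finsum[OF WM_module(1)[OF w'(1) BD(1)[OF b]] W.abelian_group_axioms, where f = "h' w1' b w2'"])
          note hh = h'_hom[OF w'(1) BD(1)[OF b] w'(2) BD(2)[OF b]]
          show "h' w1' b w2' \<in> carrier (WM w1' b) \<rightarrow> carrier (WM w1' w2')" by (intro funcsetI hh(1))
          show "h a w1' b (z (a, b)) \<in> carrier (WM w1' b)" if "a \<in> A" for a
            by (rule h_hom(1)[OF AD(1)[OF that] w'(1) BD(1)[OF b] AD(2)[OF that] zc[OF that b]])
          show "h' w1' b w2' (x \<oplus>\<^bsub>WM w1' b\<^esub> y) = h' w1' b w2' x \<oplus>\<^bsub>WM w1' w2'\<^esub> h' w1' b w2' y"
            if "x \<in> carrier (WM w1' b)" "y \<in> carrier (WM w1' b)" for x y by (rule hh(2)[OF that])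
        qed (rule fin(1))
      qed
      then have "(\<Oplus>\<^bsub>WM w1' w2'\<^esub>b\<in>B. h' w1' b w2' (d_first D M h n m z (w1', b))) = S"
        unfolding S_def by (intro W.finsum_cong') (auto intro!: W.finsum_closed Fc)
      then show ?thesis using k by (simp add: d_second_def B_def)
    qed
    have 2: "d_first D M h n (m - 1) (d_second D M h' n m z) (w1', w2') = scal D ((- 1) ^ n) \<odot>\<^bsub>WM w1' w2'\<^esub> S"
    proof -
      have e: "h a w1' w2' (d_second D M h' n m z (a, w2')) = scal D ((- 1) ^ n) \<odot>\<^bsub>WM w1' w2'\<^esub> (\<Oplus>\<^bsub>WM w1' w2'\<^esub>b\<in>B. F a b)"
        if a: "a \<in> A" for a
      proof -
        interpret Wa: abelian_group "WM a w2'" by (rule WM_module(1)[OF AD(1)[OF a] w'(2)])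
        let ?T = "\<Oplus>\<^bsub>WM a w2'\<^esub>b\<in>B. h' a b w2' (z (a, b))"
        have hc: "h' a b w2' (z (a, b)) \<in> carrier (WM a w2')" if "b \<in> B" for b
          by (rule h'_hom(1)[OF AD(1)[OF a] BD(1)[OF that] w'(2) BD(2)[OF that] zc[OF a that]])
        have Tc: "?T \<in> carrier (WM a w2')" by (intro Wa.finsum_closed) (use hc in auto)
        have "(a, w2') \<in> bidegree D n (m - 1)" using w' AD[OF a] by (simp add: bidegree_def)
        then have "d_second D M h' n m z (a, w2') = scal D ((- 1) ^ n) \<odot>\<^bsub>WM a w2'\<^esub> ?T"
          by (simp add: d_second_def B_def)
        then have "h a w1' w2' (d_second D M h' n m z (a, w2')) = scal D ((- 1) ^ n) \<odot>\<^bsub>WM w1' w2'\<^esub> h a w1' w2' ?T"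
          using h_hom(3)[OF AD(1)[OF a] w'(1,2) AD(2)[OF a] Tc] by simp
        also have "h a w1' w2' ?T = (\<Oplus>\<^bsub>WM w1' w2'\<^esub>b\<in>B. h a w1' w2' (h' a b w2' (z (a, b))))"
        proof (rule additive_finsum[OF Wa.abelian_group_axioms W.abelian_group_axioms, where f = "h a w1' w2'"])
          note hh = h_hom[OF AD(1)[OF a] w'(1,2) AD(2)[OF a]]
          show "h a w1' w2' \<in> carrier (WM a w2') \<rightarrow> carrier (WM w1' w2')"
            by (intro funcsetI hh(1))
          show "h a w1' w2' (x \<oplus>\<^bsub>WM a w2'\<^esub> y) = h a w1' w2' x \<oplus>\<^bsub>WM w1' w2'\<^esub> h a w1' w2' y"
            if "x \<in> carrier (WM a w2')" "y \<in> carrier (WM a w2')" for x y by (rule hh(2)[OF that])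
          show "h' a b w2' (z (a, b)) \<in> carrier (WM a w2')" if "b \<in> B" for b by (rule hc[OF that])
        qed (rule fin(2))
        also have "\<dots> = (\<Oplus>\<^bsub>WM w1' w2'\<^esub>b\<in>B. F a b)"
        proof (rule W.finsum_cong')
          show "F a \<in> B \<rightarrow> carrier (WM w1' w2')" using Fc a by auto
          show "h a w1' w2' (h' a b w2' (z (a, b))) = F a b" if "b \<in> B" for b
            unfolding F_def by (rule hh_commute[symmetric, OF AD(1)[OF a] BD(1)[OF that] w'(1,2)
                AD(2)[OF a] BD(2)[OF that] zc[OF a that]])
        qed simp
        finally show ?thesis .
      qed
      have c: "(\<Oplus>\<^bsub>WM w1' w2'\<^esub>b\<in>B. F a b) \<in> carrier (WM w1' w2')" if "a \<in> A" for a
        by (intro W.finsum_closed) (use that Fc in auto)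
      have "(\<Oplus>\<^bsub>WM w1' w2'\<^esub>a\<in>A. h a w1' w2' (d_second D M h' n m z (a, w2')))
        = (\<Oplus>\<^bsub>WM w1' w2'\<^esub>a\<in>A. scal D ((- 1) ^ n) \<odot>\<^bsub>WM w1' w2'\<^esub> (\<Oplus>\<^bsub>WM w1' w2'\<^esub>b\<in>B. F a b))"
        by (rule W.finsum_cong') (use e c WM_module(2)[OF w'(1,2)] in auto)
      also have "\<dots> = scal D ((- 1) ^ n) \<odot>\<^bsub>WM w1' w2'\<^esub> (\<Oplus>\<^bsub>WM w1' w2'\<^esub>a\<in>A. \<Oplus>\<^bsub>WM w1' w2'\<^esub>b\<in>B. F a b)"
      proof (rule additive_finsum[symmetric, OF W.abelian_group_axioms W.abelian_group_axioms,
            where f = "\<lambda>X. scal D ((- 1) ^ n) \<odot>\<^bsub>WM w1' w2'\<^esub> X"])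
        show "(\<lambda>X. scal D ((- 1) ^ n) \<odot>\<^bsub>WM w1' w2'\<^esub> X) \<in> carrier (WM w1' w2') \<rightarrow> carrier (WM w1' w2')"
          by (intro funcsetI WM_module(2)[OF w'(1,2)])
        show "scal D ((- 1) ^ n) \<odot>\<^bsub>WM w1' w2'\<^esub> (x \<oplus>\<^bsub>WM w1' w2'\<^esub> y)
            = scal D ((- 1) ^ n) \<odot>\<^bsub>WM w1' w2'\<^esub> x \<oplus>\<^bsub>WM w1' w2'\<^esub> scal D ((- 1) ^ n) \<odot>\<^bsub>WM w1' w2'\<^esub> y"
          if "x \<in> carrier (WM w1' w2')" "y \<in> carrier (WM w1' w2')" for x y by (rule WM_module(3)[OF w'(1,2) that])
        show "(\<Oplus>\<^bsub>WM w1' w2'\<^esub>b\<in>B. F a b) \<in> carrier (WM w1' w2')" if "a \<in> A" for a by (rule c[OF that])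
      qed (rule fin(1))
      also have "(\<Oplus>\<^bsub>WM w1' w2'\<^esub>a\<in>A. \<Oplus>\<^bsub>WM w1' w2'\<^esub>b\<in>B. F a b) = S"
        unfolding S_def by (rule W.finsum_swap[OF fin Fc])
      finally show ?thesis using k by (simp add: d_first_def A_def)
    qed
    \<comment> \<open>Here \<open>n \<ge> 1\<close> matters: for n = 0 the truncated difference n -
      1 would make both signs equal.\<close>
    have "(- 1 :: complex) ^ n = - ((- 1) ^ (n - 1))" using n by (cases n) auto
    then show ?thesis unfolding 1 2 using WM_module(4)[OF w'(1,2) Sc] by simp
  qed
  have "(\<lambda>k\<in>bidegree D (n - 1) (m - 1). d_second D M h' (n - 1) m (d_first D M h n m z) k
      \<oplus>\<^bsub>(case k of (w1, w2) \<Rightarrow> WM w1 w2)\<^esub> d_first D M h n (m - 1) (d_second D M h' n m z) k)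
    = (\<lambda>k\<in>bidegree D (n - 1) (m - 1). \<zero>\<^bsub>(case k of (w1, w2) \<Rightarrow> WM w1 w2)\<^esub>)"
  proof (rule restrict_ext)
    fix k assume k: "k \<in> bidegree D (n - 1) (m - 1)"
    obtain w1 w2 where "k = (w1, w2)" by (cases k)
    then show "d_second D M h' (n - 1) m (d_first D M h n m z) k
      \<oplus>\<^bsub>(case k of (w1, w2) \<Rightarrow> WM w1 w2)\<^esub> d_first D M h n (m - 1) (d_second D M h' n m z) k
      = \<zero>\<^bsub>(case k of (w1, w2) \<Rightarrow> WM w1 w2)\<^esub>" using main k by simp
  qed
  then show ?thesis by (simp add: Cmod_def direct_sum_def)
qed

end

theorem proposition7p13:
  fixes D :: "('g::ab_group_add, 'i::finite) qflag"
    and M :: "'g wt \<Rightarrow> ('i uq, 'm) module"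
    and v :: "'g wt \<Rightarrow> 'm"
    and \<xi> :: "'g wt \<Rightarrow> 'm \<Rightarrow> complex"
    and \<iota> :: "'g wgt \<Rightarrow> 'i uq set \<Rightarrow> 'i uq set"
    and y0 :: "'g wgt \<Rightarrow> 'g wgt \<Rightarrow> 'i uq"
    and s :: "'g wgt \<Rightarrow> 'g wgt \<Rightarrow> int"
    and h h' :: "'g wgt \<Rightarrow> 'g wgt \<Rightarrow> 'g wgt \<Rightarrow> ('i, 'm) wel \<Rightarrow> ('i, 'm) wel"
    and n m :: nat
  assumes "simple_lie_algebra (sc D) (br D)"
    and "cartan_subalgebra (sc D) (br D) (csa D)"
    and "simple_roots D"
    and "normalized_form D"
    and "qpar D \<noteq> 0"
    and "\<forall>k>0. qpar D ^ k \<noteq> 1"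
    and "irreducible_flag D"
    and "\<forall>\<mu>\<in>dominant_wrt_sub D. levi_module D (M \<mu>) \<mu> (v \<mu>)"
    and "\<forall>\<mu>\<in>dominant_wrt_sub D.
           lowest_weight_vector D (dual_module D (M \<mu>)) (\<lambda>x. - \<mu> x) (\<xi> \<mu>)"
    and "verma_embeddings D \<iota>"
    and "embedding_elements D \<iota> y0"
    and "sign_choice D s"
    and "h_first D M v \<xi> (y_elt D s y0) h"
    and "h_second D M v \<xi> (x_elt D s y0) h'"
    and "n \<ge> 1" and "m \<ge> 1"
  shows "\<forall>z\<in>carrier (Cmod D M n m).
    d_second D M h' (n - 1) m (d_first D M h n m z)
      \<oplus>\<^bsub>Cmod D M (n - 1) (m - 1)\<^esub>
    d_first D M h n (m - 1) (d_second D M h' n m z) = \<zero>\<^bsub>Cmod D M (n - 1) (m - 1)\<^esub>"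
proof -
  interpret bgg_data D M v \<xi> \<iota> y0 s h h'
    by unfold_locales (use assms in auto)
  show ?thesis using differentials_anticommute[OF \<open>n \<ge> 1\<close>] by blast
qed

end
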